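(* Consider the branching random walk on $\mathbb{Z}^d$ described in the context, with $\beta^*>0$, and suppose that for some $\alpha\in(0,2)$ and some constant $H_0>0$ $$a(z)\sim\frac{H_0}{|z|^{d+\alpha}},\qquad |z|\to\infty.$$ Then there exist positive functions $C(x,y)$ and $C(x)$ of $x,y\in\mathbb{Z}^d$ such that, for all $x,y\in\mathbb{Z}^d$, as $t\to\infty$, $$m_1(t,x,y)\sim C(x,y)\,u^*(t),\qquad m_1(t,x)\sim C(x)\,v^*(t),$$ where the functions $u^*$ and $v^*$ have the following form: (a) for $\beta^*>\beta_c$: $u^*(t)=e^{\lambda_{\mathcal{E}}t}$, $v^*(t)=e^{\lambda_{\mathcal{E}}t}$; (b) for $\beta^*=\beta_c$: - if $d/\alpha\in(1,2)$: $u^*(t)=t^{d/\alpha-2}e^{-b_0t}$, $v^*(t)=t^{d/\alpha-1}e^{-b_0t}$; - if $d/\alpha=2$: $u^*(t)=(\ln t)^{-1}e^{-b_0t}$, $v^*(t)=t(\ln t)^{-1}e^{-b_0t}$; - if $d/\alpha\in(2,+\infty)$: $u^*(t)=e^{-b_0t}$, $v^*(t)=t\,e^{-b_0t}$; (c) for $\beta^*<\beta_c$, $d/\alpha\in(1,+\infty)$: $u^*(t)=t^{-d/\alpha}e^{-b_0t}$, $v^*(t)=e^{-b_0t}$.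
   Context: **Random walk.** Let $d\in\mathbb{N}$. The underlying continuous-time random walk on $\mathbb{Z}^d$ has transition intensity matrix $A=(a(x,y))_{x,y\in\mathbb{Z}^d}$ with $a(x,y)\ge0$ for $x\ne y$, $a(x,x)<0$, and is regular ($\sum_y a(x,y)=0$), symmetric ($a(x,y)=a(y,x)$), spatially homogeneous ($a(x,y)=a(y-x)$, regarded as a function of one argument), time homogeneous and irreducible (every lattice point can be reached from every other). Its transition probabilities are $p(t,x,y)$; $p(h,x,y)=a(x,y)h+o(h)$ for $x\neq y$ and $p(h,x,x)=1+a(x,x)h+o(h)$ as $h\to0$. The Green's function is $G_\lambda(x,y)=\int_0^\infty e^{-\lambda t}p(t,x,y)\,dt$, $\lambda\ge0$, and $\beta_c:=1/G_0(0,0)$ (with $\beta_c=0$ if $G_0(0,0)=\infty$). $|\cdot|$ is the Euclidean norm. **Branching and absorption.** Let $f(u)=\sum_{n\ge0}b_nu^n$, $0\le u\le1$, with $b_n\ge0$ for $n\ne1$, $b_1<0$, $\sum_nb_n=0$. A particle at $x$ during a short time $dt$ jumps to $y\ne x$ with probability $a(x,y)dt+o(dt)$, dies with probability $b_0dt+o(dt)$ (at every lattice point $x$), and, only if $x=0$, is replaced by $n>1$ particles at $0$ (itself included) with probability $b_ndt+o(dt)$; otherwise it stays unchanged. Particles evolve independently of each other and of the past. Put $\beta^*:=\sum_{n>1}(n-1)b_n$ (finite); throughout $\beta^*>0$. **Moments.** $\mu(t,y)$ is the number of particles at $y\in\mathbb{Z}^d$ at time $t$, and $\mu(t)=\sum_y\mu(t,y)$.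 $\mathsf{E}_x$ is expectation when the process starts at time $0$ with one particle at $x$. $m_n(t,x,y):=\mathsf{E}_x\mu^n(t,y)$, $m_n(t,x):=\mathsf{E}_x\mu^n(t)$. **Evolution operator.** $(\mathcal{A}\varphi)(x)=\sum_ya(x-y)\varphi(y)$, $\Delta_0=\delta_0\delta_0^T$ (so $(\Delta_0\varphi)(x)=\varphi(0)$ if $x=0$ and $0$ otherwise), $\mathcal{E}=\mathcal{A}+\beta^*\Delta_0-b_0I$. When $\beta^*>\beta_c$, $\lambda_0>0$ denotes the unique isolated positive eigenvalue of $\mathcal{A}+\beta^*\Delta_0$ on $l^2(\mathbb{Z}^d)$, i.e. the solution of $\beta^*G_\lambda(0,0)=1$, and $\lambda_{\mathcal{E}}:=\lambda_0-b_0$. The symbol $\sim$ denotes asymptotic equivalence (the ratio tends to $1$). *)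

theory Defs
  imports "HOL-Probability.Probability" "HOL-Library.Landau_Symbols"
begin

unbundle asymp_equiv_syntax

text \<open>The lattice of dimension d is \<^typ>\<open>int ^ 'd\<close>, with d the cardinality of \<^typ>\<open>'d\<close>.\<close>

definition lattice_norm :: "int ^ 'd \<Rightarrow> real" where
  "lattice_norm z = norm (\<chi> i. real_of_int (z $ i) :: real ^ 'd)"

definition at_lattice_infinity :: "(int ^ 'd) filter" where
  "at_lattice_infinity = filtercomap lattice_norm at_top"


section \<open>The underlying random walk\<close>

text \<open>By spatial homogeneity the intensity of the pair (x, y) is \<^term>\<open>a (y - x)\<close>.\<close>

locale walk_intensity =
  fixes a :: "int ^ 'd \<Rightarrow> real"
  assumes nonneg: "z \<noteq> 0 \<Longrightarrow> a z \<ge> 0"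
    and neg_at_zero: "a 0 < 0"
    and regular: "(a has_sum 0) UNIV"
    and symmetric: "a (- z) = a z"
    and irreducible: "(x, y) \<in> {(u, v). u \<noteq> v \<and> a (v - u) > 0}\<^sup>*"

text \<open>\<^term>\<open>p t x\<close> is the law at time t of the walk started at x; only \<^prop>\<open>t \<ge> 0\<close> matters.
  The transition function is determined by its intensities.\<close>

locale walk_transition = walk_intensity a
  for a :: "int ^ 'd \<Rightarrow> real" +
  fixes p :: "real \<Rightarrow> int ^ 'd \<Rightarrow> (int ^ 'd) pmf"
  assumes initial: "p 0 x = return_pmf x"
    and semigroup: "s \<ge> 0 \<Longrightarrow> t \<ge> 0 \<Longrightarrow> p (s + t) x = bind_pmf (p s x) (p t)"
    and jump: "x \<noteq> y \<Longrightarrow> (\<lambda>h. pmf (p h x) y - a (y - x) * h) \<in> o[at_right 0](\<lambda>h. h)"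
    and stay: "(\<lambda>h. pmf (p h x) x - (1 + a 0 * h)) \<in> o[at_right 0](\<lambda>h. h)"

definition green ::
    "(real \<Rightarrow> int ^ 'd \<Rightarrow> (int ^ 'd) pmf) \<Rightarrow> real \<Rightarrow> int ^ 'd \<Rightarrow> int ^ 'd \<Rightarrow> ennreal" where
  "green p lam x y = (\<integral>\<^sup>+ t\<in>{0..}. ennreal (exp (- lam * t) * pmf (p t x) y) \<partial>lborel)"

definition beta_crit :: "(real \<Rightarrow> int ^ 'd \<Rightarrow> (int ^ 'd) pmf) \<Rightarrow> real" where
  "beta_crit p = (if green p 0 0 0 = \<infinity> then 0 else 1 / enn2real (green p 0 0 0))"


section \<open>Branching\<close>

locale offspring_intensity =
  fixes b :: "nat \<Rightarrow> real"
  assumes offspring_nonneg: "n \<noteq> 1 \<Longrightarrow> b n \<ge> 0"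
    and neg_at_one: "b 1 < 0"
    and sum_zero: "b sums 0"
    and finite_mean: "(\<lambda>n. (real n - 1) * b n) summable_on {1<..}"

definition beta_star :: "(nat \<Rightarrow> real) \<Rightarrow> real" where
  "beta_star b = (\<Sum>\<^sub>\<infinity>n\<in>{1<..}. (real n - 1) * b n)"

text \<open>A configuration of particles is a finite multiset of lattice points, and \<^term>\<open>P t \<xi>\<close> is the
  law at time t of the population started from the configuration \<^term>\<open>\<xi>\<close>. The assumption
  \<open>independent\<close> says that the progenies of distinct particles evolve independently, so that the
  small-time behaviour need only be prescribed for a single initial particle. In \<open>stay\<close> the total
  rate of leaving the state is
  \<open>- a 0 + b 0\<close> away from the origin and \<open>- a 0 + b 0 + (\<Sum>n>1. b n) = - a 0 - b 1\<close> at the origin.\<close>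

locale branching_transition = walk_intensity a + offspring_intensity b
  for a :: "int ^ 'd \<Rightarrow> real" and b :: "nat \<Rightarrow> real" +
  fixes P :: "real \<Rightarrow> (int ^ 'd) multiset \<Rightarrow> (int ^ 'd) multiset pmf"
  assumes initial: "P 0 \<xi> = return_pmf \<xi>"
    and semigroup: "s \<ge> 0 \<Longrightarrow> t \<ge> 0 \<Longrightarrow> P (s + t) \<xi> = bind_pmf (P s \<xi>) (P t)"
    and extinct: "t \<ge> 0 \<Longrightarrow> P t {#} = return_pmf {#}"
    and independent: "t \<ge> 0 \<Longrightarrow>
      P t (\<xi> + \<zeta>) = bind_pmf (P t \<xi>) (\<lambda>\<xi>'. map_pmf (\<lambda>\<zeta>'. \<xi>' + \<zeta>') (P t \<zeta>))"
    and jump: "x \<noteq> y \<Longrightarrow>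
      (\<lambda>h. pmf (P h {#x#}) {#y#} - a (y - x) * h) \<in> o[at_right 0](\<lambda>h. h)"
    and death: "(\<lambda>h. pmf (P h {#x#}) {#} - b 0 * h) \<in> o[at_right 0](\<lambda>h. h)"
    and branch: "n > 1 \<Longrightarrow>
      (\<lambda>h. pmf (P h {#0#}) (replicate_mset n 0) - b n * h) \<in> o[at_right 0](\<lambda>h. h)"
    and stay: "x \<noteq> 0 \<Longrightarrow>
      (\<lambda>h. pmf (P h {#x#}) {#x#} - (1 + (a 0 - b 0) * h)) \<in> o[at_right 0](\<lambda>h. h)"
    and stay_origin:
      "(\<lambda>h. pmf (P h {#0#}) {#0#} - (1 + (a 0 + b 1) * h)) \<in> o[at_right 0](\<lambda>h. h)"

text \<open>\<^term>\<open>M x\<close> is the probability measure under which the process starts with one particle at x,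
  and \<^term>\<open>X t\<close> is the configuration at time t. The set F in \<open>markov\<close> is an arbitrary event of the
  past up to time s.\<close>

locale branching_random_walk = branching_transition a b P
  for a :: "int ^ 'd \<Rightarrow> real" and b :: "nat \<Rightarrow> real"
    and P :: "real \<Rightarrow> (int ^ 'd) multiset \<Rightarrow> (int ^ 'd) multiset pmf" +
  fixes M :: "int ^ 'd \<Rightarrow> 'w measure" and X :: "real \<Rightarrow> 'w \<Rightarrow> (int ^ 'd) multiset"
  assumes prob_space: "prob_space (M x)"
    and measurable: "t \<ge> 0 \<Longrightarrow> X t \<in> M x \<rightarrow>\<^sub>M count_space UNIV"
    and start: "AE \<omega> in M x. X 0 \<omega> = {#x#}"
    and markov: "s \<ge> 0 \<Longrightarrow> t \<ge> 0 \<Longrightarrow>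
      F \<in> sigma_sets (space (M x)) {X r -` B \<inter> space (M x) | r B. 0 \<le> r \<and> r \<le> s} \<Longrightarrow>
      measure (M x) {\<omega> \<in> F. X (s + t) \<omega> = \<zeta>} = (LINT \<omega>:F|M x. pmf (P t (X s \<omega>)) \<zeta>)"

definition local_moment ::
    "(int ^ 'd \<Rightarrow> 'w measure) \<Rightarrow> (real \<Rightarrow> 'w \<Rightarrow> (int ^ 'd) multiset)
      \<Rightarrow> nat \<Rightarrow> real \<Rightarrow> int ^ 'd \<Rightarrow> int ^ 'd \<Rightarrow> real" where
  "local_moment M X n t x y = (LINT \<omega>|M x. real (count (X t \<omega>) y) ^ n)"

definition total_moment ::
    "(int ^ 'd \<Rightarrow> 'w measure) \<Rightarrow> (real \<Rightarrow> 'w \<Rightarrow> (int ^ 'd) multiset)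
      \<Rightarrow> nat \<Rightarrow> real \<Rightarrow> int ^ 'd \<Rightarrow> real" where
  "total_moment M X n t x = (LINT \<omega>|M x. real (size (X t \<omega>)) ^ n)"


section \<open>The leading eigenvalue\<close>

definition walk_op :: "(int ^ 'd \<Rightarrow> real) \<Rightarrow> (int ^ 'd \<Rightarrow> real) \<Rightarrow> int ^ 'd \<Rightarrow> real" where
  "walk_op a \<phi> x = (\<Sum>\<^sub>\<infinity>y. a (x - y) * \<phi> y)"

definition delta_op :: "(int ^ 'd \<Rightarrow> real) \<Rightarrow> int ^ 'd \<Rightarrow> real" where
  "delta_op \<phi> x = (if x = 0 then \<phi> 0 else 0)"

definition is_l2_eigenvalue :: "((int ^ 'd \<Rightarrow> real) \<Rightarrow> int ^ 'd \<Rightarrow> real) \<Rightarrow> real \<Rightarrow> bool" where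
  "is_l2_eigenvalue T lam \<longleftrightarrow>
    (\<exists>\<phi>. (\<lambda>x. (\<phi> x)\<^sup>2) summable_on UNIV \<and> \<phi> \<noteq> (\<lambda>x. 0) \<and> (\<forall>x. T \<phi> x = lam * \<phi> x))"

text \<open>Meaningful when \<^term>\<open>beta_star b\<close> exceeds the critical value: the operator then has exactly
  one positive eigenvalue. Real eigenfunctions suffice, since the operator is real.\<close>

definition lambda_zero :: "(int ^ 'd \<Rightarrow> real) \<Rightarrow> (nat \<Rightarrow> real) \<Rightarrow> real" where
  "lambda_zero a b = (THE lam. lam > 0 \<and>
     is_l2_eigenvalue (\<lambda>\<phi> x. walk_op a \<phi> x + beta_star b * delta_op \<phi> x) lam)"

definition lambda_E :: "(int ^ 'd \<Rightarrow> real) \<Rightarrow> (nat \<Rightarrow> real) \<Rightarrow> real" where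
  "lambda_E a b = lambda_zero a b - b 0"

definition first_moments_asymp ::
    "(int ^ 'd \<Rightarrow> 'w measure) \<Rightarrow> (real \<Rightarrow> 'w \<Rightarrow> (int ^ 'd) multiset)
      \<Rightarrow> (int ^ 'd \<Rightarrow> int ^ 'd \<Rightarrow> real) \<Rightarrow> (int ^ 'd \<Rightarrow> real) \<Rightarrow> (real \<Rightarrow> real) \<Rightarrow> (real \<Rightarrow> real) \<Rightarrow> bool"
  where
  "first_moments_asymp M X C c u v \<longleftrightarrow>
    (\<forall>x y. (\<lambda>t. local_moment M X 1 t x y) \<sim>[at_top] (\<lambda>t. C x y * u t)) \<and>
    (\<forall>x. (\<lambda>t. total_moment M X 1 t x) \<sim>[at_top] (\<lambda>t. c x * v t))"

end

theory Submission
 imports Defs "HOL-Real_Asymp.Real_Asymp"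
begin

text \<open>
 Let \<beta> stand for beta_star b, r for d/\<alpha>, and put w(t,x,y) = e^(b0 t) m1(t,x,y). Particles die at the
 same rate b0 everywhere, so the factor e^(b0 t) removes the deaths: w is the kernel of the semigroup
 generated by the bounded symmetric matrix H = A + \<beta> \<delta>0 \<delta>0^T (mean_kernel_semigroup). Finiteness of
 the moments is part of this claim. For 0 \<le> h \<le> 1 the generating functional with weight
 1 - \<epsilon> h per particle solves a nonlinear backward equation; a comparison principle bounds its
 difference quotients in \<epsilon> by e^(\<beta> t), and \<epsilon> \<rightarrow> 0 yields the linear equation (moment_backward).

 The walk enters through the local limit theorem p(t,x,y) ~ \<gamma> t^(-r) with \<gamma> > 0 (heat_asymptotics).
 Its kernel is a Fourier integral of e^(t symb), and \<epsilon>^(-\<alpha>) symb(\<epsilon> \<theta>) is a Riemann sum for the exponent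
 of an isotropic stable law (symb_scaling).

 Walk and mean kernel are linked by Duhamel's formula w = p + \<beta> p * w (duhamel). For \<lambda> \<ge> 0 the potential
 \<psi> = G_\<lambda>(.,0), if finite, satisfies A \<psi> = \<lambda> \<psi> - \<delta>0. With G = \<psi>(0) this becomes
 H \<psi> = \<lambda> \<psi> - (1 - \<beta> G) \<delta>0, so for \<lambda> > 0 the number \<lambda> is an eigenvalue of H on l2 iff \<beta> G = 1. If \<beta> G \<le> 1, then
 v(t) = e^(-\<lambda> t) w(t,0,0) is bounded, because \<psi> is a supersolution; by symmetry of H it is also
 log-convex, hence nonincreasing (tilted_diag_antimono). Monotonicity is what lets
 elementary Tauberian arguments suffice. When \<beta> G = 1, Duhamel's formula with p and w interchanged, applied to \<psi>,
 gives a renewal identity (renewal_identity): the convolution of v with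
 K(t) = \<beta> times the integral of e^(-\<lambda> s) p(s,0,0) over s > t tends to G.

 At and above \<beta>_c the regimes differ in the kernel K only. Above \<beta>_c there is \<lambda> > 0 with \<beta> G = 1 (critical_exists), K
 decays exponentially, and v tends to G divided by the integral of K. At \<beta>_c one has \<lambda> = 0 and
 K(t) ~ c t^(1-r), with finite mean for r > 2 (renewal_finite_mean), a logarithmically diverging one for r = 2
 (renewal_log_mean), and for 1 < r < 2 a regularly varying one, which is resolved by a convolution with
 t^(r-2) and monotone differentiation (renewal_regularly_varying_mean, monotone_density). Below \<beta>_c the formula
 w = p + \<beta> p * w is a defective renewal equation, and v inherits the tail t^(-r) of p (defective_renewal).

 Two applications of Duhamel's formula carry the asymptotics of w(t,0,0) over to w(t,x,y)
 (local_limits). The total mean has time derivative \<beta> w(t,x,0), so its growth follows by l'Hospital's rule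
 (total_limit), or by finiteness of the integral of w below \<beta>_c (subcritical_total).
\<close>

section \<open>Dominated sums and derivatives\<close>

abbreviation tends_at_infinity :: "(real => real) => real => bool" (infix "\<leadsto>" 55) where
 "f \<leadsto> l \<equiv> (f \<longlongrightarrow> l) at_top"

abbreviation pmf_mean :: "'x pmf => ('x => real) => real" where
 "pmf_mean q \<equiv> measure_pmf.expectation q"

lemma summable_mult_bounded:
 fixes f u :: "'x => real"
 assumes f: "(\<lambda>x. \<bar>f x\<bar>) summable_on S" and u: "\<And>x. x \<in> S ==> \<bar>u x\<bar> \<le> B"
 shows "(\<lambda>x. \<bar>f x * u x\<bar>) summable_on S" "(\<lambda>x. f x * u x) summable_on S"
  "\<bar>\<Sum>\<^sub>\<infinity>x\<in>S. f x * u x\<bar> \<le> (\<Sum>\<^sub>\<infinity>x\<in>S. \<bar>f x\<bar>) * B"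
proof -
 have s: "(\<lambda>x. \<bar>f x\<bar> * B) summable_on S"
  by (intro summable_on_cmult_left f)
 have le: "\<bar>f x * u x\<bar> \<le> \<bar>f x\<bar> * B" if "x \<in> S" for x
  using u[OF that] by (simp add: abs_mult mult_left_mono)
 show 1: "(\<lambda>x. \<bar>f x * u x\<bar>) summable_on S"
  by (rule summable_on_comparison_test[OF s]) (use le in auto)
 then have 2: "(\<lambda>x. norm (f x * u x)) summable_on S" by simp
 show "(\<lambda>x. f x * u x) summable_on S" by (rule abs_summable_summable[OF 2])
 have "\<bar>\<Sum>\<^sub>\<infinity>x\<in>S. f x * u x\<bar> \<le> (\<Sum>\<^sub>\<infinity>x\<in>S. \<bar>f x * u x\<bar>)"
  using norm_infsum_bound[OF 2] by simp
 also have "\<dots> \<le> (\<Sum>\<^sub>\<infinity>x\<in>S. \<bar>f x\<bar> * B)"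
  by (rule infsum_mono[OF 1 s]) (use le in auto)
 also have "\<dots> = (\<Sum>\<^sub>\<infinity>x\<in>S. \<bar>f x\<bar>) * B"
  by (rule infsum_cmult_left) (use f in auto)
 finally show "\<bar>\<Sum>\<^sub>\<infinity>x\<in>S. f x * u x\<bar> \<le> (\<Sum>\<^sub>\<infinity>x\<in>S. \<bar>f x\<bar>) * B" .
qed

lemma infsum_linear_diff:
 fixes f u v :: "'x => real"
 assumes "(\<lambda>x. f x * u x) summable_on S" "(\<lambda>x. f x * v x) summable_on S"
 shows "(\<Sum>\<^sub>\<infinity>x\<in>S. f x * (u x - v x)) = (\<Sum>\<^sub>\<infinity>x\<in>S. f x * u x) - (\<Sum>\<^sub>\<infinity>x\<in>S. f x * v x)"
proof -
 have "((\<lambda>x. f x * u x + - (f x * v x)) has_sum (\<Sum>\<^sub>\<infinity>x\<in>S. f x * u x) + - (\<Sum>\<^sub>\<infinity>x\<in>S. f x * v x)) S"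
  using assms by (intro has_sum_add) (auto simp: has_sum_uminus)
 then show ?thesis by (simp add: infsumI algebra_simps)
qed

lemma infsum_single:
 fixes f :: "'x => real"
 assumes "\<And>y. y \<noteq> x ==> f y = 0"
 shows "infsum f UNIV = f x" "f summable_on UNIV"
proof -
 have "(f has_sum f x) {x}" by (simp add: has_sum_finiteI)
 then have "(f has_sum f x) UNIV"
  by (rule has_sum_cong_neutral[THEN iffD1, rotated -1]) (use assms in auto)
 then show "infsum f UNIV = f x" "f summable_on UNIV"
  by (auto simp: infsumI summable_on_def)
qed

lemma tendsto_infsum_dominated:
 fixes f :: "'t => 'x => real"
 assumes lim: "\<And>x. x \<in> S ==> ((\<lambda>t. f t x) \<longlongrightarrow> g x) F"
  and dom: "\<forall>\<^sub>F t in F. \<forall>x\<in>S. \<bar>f t x\<bar> \<le> M x" and M: "M summable_on S"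
 shows "((\<lambda>t. \<Sum>\<^sub>\<infinity>x\<in>S. f t x) \<longlongrightarrow> (\<Sum>\<^sub>\<infinity>x\<in>S. g x)) F"
proof (cases "F = bot")
 case False
 have domg: "\<bar>g x\<bar> \<le> M x" if "x \<in> S" for x
 proof (rule tendsto_upperbound[OF tendsto_rabs[OF lim[OF that]] _ False])
  show "\<forall>\<^sub>F t in F. \<bar>f t x\<bar> \<le> M x" using dom that by (auto elim: eventually_mono)
 qed
 have sg: "g summable_on S"
  by (rule abs_summable_summable, rule summable_on_comparison_test[OF M]) (use domg in auto)
 show ?thesis
 proof (rule tendstoI)
  fix e :: real assume e: "e > 0"
  obtain X where X: "finite X" "X \<subseteq> S" "dist (sum M X) (infsum M S) \<le> e/4"
   using infsum_finite_approximation[OF M, of "e/4"] e by auto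
  have tail: "(\<Sum>\<^sub>\<infinity>x\<in>S-X. M x) \<le> e/4"
  proof -
   have "infsum M (S - X) = infsum M S - sum M X" using infsum_Diff[OF M _ X(2)] X by simp
   also have "\<dots> \<le> \<bar>sum M X - infsum M S\<bar>" by simp
   finally show ?thesis using X(3) by (simp add: dist_real_def)
  qed
  have "((\<lambda>t. \<Sum>x\<in>X. \<bar>f t x - g x\<bar>) \<longlongrightarrow> (\<Sum>x\<in>X. \<bar>g x - g x\<bar>)) F"
   using X by (intro tendsto_intros lim) auto
  then have "\<forall>\<^sub>F t in F. (\<Sum>x\<in>X. \<bar>f t x - g x\<bar>) < e/4"
   by (rule order_tendstoD) (use e in simp)
  with dom show "\<forall>\<^sub>F t in F. dist (\<Sum>\<^sub>\<infinity>x\<in>S. f t x) (\<Sum>\<^sub>\<infinity>x\<in>S. g x) < e"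
  proof eventually_elim
   case (elim t)
   have sf: "f t summable_on S"
    by (rule abs_summable_summable, rule summable_on_comparison_test[OF M]) (use elim in auto)
   have MX: "M summable_on S - X" by (rule summable_on_subset_banach[OF M]) auto
   have sd: "(\<lambda>x. f t x - g x) summable_on S"
    using summable_on_add[OF sf, of "\<lambda>x. - g x"] sg by (simp add: summable_on_uminus)
   have sdX: "(\<lambda>x. f t x - g x) summable_on S - X" by (rule summable_on_subset_banach[OF sd]) auto
   have "(\<Sum>\<^sub>\<infinity>x\<in>S. f t x) - (\<Sum>\<^sub>\<infinity>x\<in>S. g x) = (\<Sum>\<^sub>\<infinity>x\<in>S. f t x - g x)"
    using infsum_linear_diff[of "\<lambda>_. 1" "f t" S g] sf sg by simp
   also have "\<dots> = (\<Sum>x\<in>X. f t x - g x) + (\<Sum>\<^sub>\<infinity>x\<in>S-X. f t x - g x)"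
    using infsum_Diff[OF sd _ X(2)] X by simp
   finally have eq: "(\<Sum>\<^sub>\<infinity>x\<in>S. f t x) - (\<Sum>\<^sub>\<infinity>x\<in>S. g x) = \<dots>" .
   have le: "\<bar>f t x - g x\<bar> \<le> 2 * M x" if "x \<in> S" for x
   proof -
    have "\<bar>f t x\<bar> \<le> M x" using elim that by auto
    with domg[OF that] show ?thesis by linarith
   qed
   have abs: "(\<lambda>x. norm (f t x - g x)) summable_on S - X"
    by (rule summable_on_iff_abs_summable_on_real[THEN iffD1, OF sdX])
   have "\<bar>\<Sum>\<^sub>\<infinity>x\<in>S-X. f t x - g x\<bar> \<le> (\<Sum>\<^sub>\<infinity>x\<in>S-X. \<bar>f t x - g x\<bar>)"
    using norm_infsum_bound[OF abs] by simp
   also have "\<dots> \<le> (\<Sum>\<^sub>\<infinity>x\<in>S-X. 2 * M x)"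
    using abs by (intro infsum_mono summable_on_cmult_right MX) (auto intro: le)
   also have "\<dots> = 2 * (\<Sum>\<^sub>\<infinity>x\<in>S-X. M x)" by (rule infsum_cmult_right) (use MX in auto)
   finally have "\<bar>\<Sum>\<^sub>\<infinity>x\<in>S-X. f t x - g x\<bar> \<le> e/2" using tail by linarith
   moreover have "\<bar>\<Sum>x\<in>X. f t x - g x\<bar> \<le> (\<Sum>x\<in>X. \<bar>f t x - g x\<bar>)" by (rule sum_abs)
   ultimately show ?case using eq elim unfolding dist_real_def by linarith
  qed
 qed
qed simp

lemma continuous_on_infsum_dominated:
 fixes f :: "'t::topological_space => 'x => real"
 assumes "\<And>x. continuous_on T (\<lambda>t. f t x)" and "\<And>t x. t \<in> T ==> \<bar>f t x\<bar> \<le> M x" and "M summable_on UNIV"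
 shows "continuous_on T (\<lambda>t. \<Sum>\<^sub>\<infinity>x. f t x)"
 unfolding continuous_on_def
proof
 fix t assume t: "t \<in> T"
 show "((\<lambda>t. \<Sum>\<^sub>\<infinity>x. f t x) \<longlongrightarrow> (\<Sum>\<^sub>\<infinity>x. f t x)) (at t within T)"
 proof (rule tendsto_infsum_dominated[where M=M])
  show "((\<lambda>t. f t x) \<longlongrightarrow> f t x) (at t within T)" for x
   using assms(1)[of x] t by (auto simp: continuous_on_def)
  show "\<forall>\<^sub>F t in at t within T. \<forall>x\<in>UNIV. \<bar>f t x\<bar> \<le> M x"
   unfolding eventually_at_filter using assms(2) by auto
 qed fact
qed

text \<open>Semigroup and Markov properties express the value at t through the earlier time s, with an
 error depending on t - s alone, and the slope g is taken at s. Continuity of g makes up for the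
 missing estimate with slope at the right end point.\<close>

lemma derivative_from_increments:
 fixes G g \<eta> :: "real => real"
 assumes inc: "\<And>s t. s \<in> S ==> t \<in> S ==> s < t ==> \<bar>G t - G s - (t - s) * g s\<bar> \<le> \<eta> (t - s)"
  and \<eta>: "((\<lambda>h. \<eta> h / h) \<longlongrightarrow> 0) (at_right 0)"
  and g: "continuous_on S g" and x: "x \<in> S"
 shows "(G has_real_derivative g x) (at x within S)"
proof -
 have lim1: "((\<lambda>y. g y - g x) \<longlongrightarrow> g x - g x) (at x within S)"
  using g x by (intro tendsto_intros) (auto simp: continuous_on_def)
 have "filterlim (\<lambda>y. \<bar>y - x\<bar>) (at_right 0) (at x within S)"
  unfolding filterlim_at
 proof
  have "((\<lambda>y. \<bar>y - x\<bar>) \<longlongrightarrow> \<bar>x - x\<bar>) (at x within S)" by (intro tendsto_intros)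
  then show "((\<lambda>y. \<bar>y - x\<bar>) \<longlongrightarrow> 0) (at x within S)" by simp
  show "\<forall>\<^sub>F y in at x within S. \<bar>y - x\<bar> \<in> {0<..} \<and> \<bar>y - x\<bar> \<noteq> 0"
   unfolding eventually_at_filter by auto
 qed
 from filterlim_compose[OF \<eta> this]
 have lim2: "((\<lambda>y. \<eta> \<bar>y - x\<bar> / \<bar>y - x\<bar>) \<longlongrightarrow> 0) (at x within S)" .
 have lim: "((\<lambda>y. \<bar>\<eta> \<bar>y - x\<bar> / \<bar>y - x\<bar>\<bar> + \<bar>g y - g x\<bar>) \<longlongrightarrow> 0) (at x within S)"
  using tendsto_add[OF tendsto_rabs[OF lim2] tendsto_rabs[OF lim1]] by simp
 have "((\<lambda>y. (G y - G x) / (y - x) - g x) \<longlongrightarrow> 0) (at x within S)"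
 proof (rule Lim_null_comparison[OF _ lim])
  have "norm ((G y - G x) / (y - x) - g x) \<le> \<bar>\<eta> \<bar>y - x\<bar> / \<bar>y - x\<bar>\<bar> + \<bar>g y - g x\<bar>"
   if y: "y \<in> S" "y \<noteq> x" for y
  proof (cases "x < y")
   case True
   have "(G y - G x) / (y - x) - g x = (G y - G x - (y - x) * g x) / (y - x)"
    using True by (simp add: field_simps)
   also have "norm \<dots> \<le> \<eta> (y - x) / (y - x)"
    using inc[OF x y(1) True] True by (simp add: divide_right_mono)
   finally have F: "norm ((G y - G x) / (y - x) - g x) \<le> \<eta> (y - x) / (y - x)" .
   have "\<bar>y - x\<bar> = y - x" using True by simp
   then show ?thesis
    using order_trans[OF F add_increasing2[OF abs_ge_zero abs_ge_self]] by (simp only:)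
  next
   case False
   then have yx: "y < x" using y by auto
   have "(G y - G x) / (y - x) - g x = (G x - G y - (x - y) * g y) / (x - y) + (g y - g x)"
    using yx by (simp add: divide_simps) (simp add: algebra_simps)
   also have "norm \<dots> \<le> norm ((G x - G y - (x - y) * g y) / (x - y)) + norm (g y - g x)"
    by (rule norm_triangle_ineq)
   also have "norm ((G x - G y - (x - y) * g y) / (x - y)) \<le> \<eta> (x - y) / (x - y)"
    using inc[OF y(1) x yx] yx by (simp add: divide_right_mono)
   finally have F: "norm ((G y - G x) / (y - x) - g x) \<le> \<eta> (x - y) / (x - y) + norm (g y - g x)" by (simp only: add_right_mono)
   have "\<bar>y - x\<bar> = x - y" using yx by simp
   then show ?thesis
    using order_trans[OF F add_right_mono[OF abs_ge_self]] by (simp only: real_norm_def)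
  qed
  then show "\<forall>\<^sub>F y in at x within S. norm ((G y - G x) / (y - x) - g x) \<le> \<bar>\<eta> \<bar>y - x\<bar> / \<bar>y - x\<bar>\<bar> + \<bar>g y - g x\<bar>"
   unfolding eventually_at_filter by auto
 qed
 then show ?thesis unfolding has_field_derivative_iff by (simp add: LIM_zero_iff)
qed

lemma nondecreasing_from_derivative:
 fixes f :: "real => real"
 assumes "\<And>s. a \<le> s ==> s \<le> b ==> (f has_real_derivative f' s) (at s within {a..b})"
  and "\<And>s. a \<le> s ==> s \<le> b ==> 0 \<le> f' s" and "a \<le> b"
 shows "f a \<le> f b"
proof (cases "a = b")
 case False
 then have "a < b" using assms(3) by simp
 from mvt_simple[OF this, of f "\<lambda>s. (*) (f' s)"] assms(1)
 obtain z where "z \<in> {a<..<b}" "f b - f a = f' z * (b - a)"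
  by (auto simp: has_field_derivative_def)
 then show ?thesis using assms(2)[of z] \<open>a < b\<close> by (smt (verit) greaterThanLessThan_iff zero_le_mult_iff)
qed simp

lemma increment_lower_from_derivative:
 fixes f :: "real => real"
 assumes "\<And>s. a \<le> s ==> s \<le> b ==> (f has_real_derivative f' s) (at s within {a..b})"
  and "\<And>s. a \<le> s ==> s \<le> b ==> D \<le> f' s" and "a \<le> b"
 shows "D * (b - a) \<le> f b - f a"
proof -
 have "f a - D * a \<le> f b - D * b"
 proof (rule nondecreasing_from_derivative[where f="\<lambda>s. f s - D * s" and f'="\<lambda>s. f' s - D" and a=a and b=b])
  show "((\<lambda>s. f s - D * s) has_real_derivative f' s - D) (at s within {a..b})" if "a \<le> s" "s \<le> b" for s
   by (auto intro!: derivative_eq_intros assms(1) that)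
 qed (use assms in auto)
 then show ?thesis by (simp add: algebra_simps)
qed

lemma increment_bound_from_derivative:
 fixes f :: "real => real"
 assumes d: "\<And>s. a \<le> s ==> s \<le> b ==> (f has_real_derivative f' s) (at s within {a..b})"
  and D: "\<And>s. a \<le> s ==> s \<le> b ==> \<bar>f' s\<bar> \<le> D" and "a \<le> b"
 shows "\<bar>f b - f a\<bar> \<le> D * (b - a)"
proof -
 have "- D \<le> f' s" "f' s \<le> D" if "a \<le> s" "s \<le> b" for s using D[OF that] by auto
 note D' = this
 have "- D * (b - a) \<le> f b - f a"
  by (rule increment_lower_from_derivative[OF d]) (use D' assms(3) in auto)
 moreover have "- D * (b - a) \<le> - f b - - f a"
  by (rule increment_lower_from_derivative[of a b "\<lambda>s. - f s" "\<lambda>s. - f' s"])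
   (use D' assms(3) in \<open>auto intro!: derivative_intros d\<close>)
 ultimately show ?thesis by (simp add: abs_le_iff)
qed

lemma eventually_positive: "(\<And>t::real. 0 < t ==> P t) ==> \<forall>\<^sub>F t in at_top. P t"
 using eventually_gt_at_top[of 0] by (rule eventually_mono)

lemma limit_cong_positive:
 fixes f g :: "real => real"
 assumes "f \<leadsto> L" "\<And>t. 0 < t ==> f t = g t"
 shows "g \<leadsto> L"
 by (rule Lim_transform_eventually[OF assms(1) eventually_positive]) (rule assms(2))

lemma integral_from_derivative:
 fixes F f :: "real => real"
 assumes "\<And>t. 0 \<le> t ==> (F has_real_derivative f t) (at t within {0..})" "0 \<le> T"
 shows "(f has_integral (F T - F 0)) {0..T}"
proof (rule fundamental_theorem_of_calculus[OF assms(2)])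
 fix t assume t: "t \<in> {0..T}"
 have "(F has_real_derivative f t) (at t within {0..T})"
  by (rule has_field_derivative_subset[OF assms(1)]) (use t in auto)
 then show "(F has_vector_derivative f t) (at t within {0..T})"
  by (simp add: has_real_derivative_iff_has_vector_derivative)
qed

text \<open>A log-convex function that increases once has growing ratios from then on, hence grows at
 least geometrically along an arithmetic progression and cannot stay bounded.\<close>

lemma log_convex_bounded_antimono:
 fixes v :: "real => real"
 assumes lc: "\<And>s t. 0 \<le> s ==> 0 \<le> t ==> (v (s + t))\<^sup>2 \<le> v (2 * s) * v (2 * t)"
  and v: "\<And>t. 0 \<le> t ==> 0 \<le> v t" "\<And>t. 0 \<le> t ==> v t \<le> B"
  and st: "0 \<le> s" "s \<le> t"
 shows "v t \<le> v s"
proof (rule ccontr)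
 assume "\<not> ?thesis"
 then have less: "v s < v t" by simp
 define h where "h = t - s"
 have h: "0 \<le> h" using st by (simp add: h_def)
 define u where "u n = v (s + real n * h)" for n
 have u0: "0 \<le> u n" "u n \<le> B" for n using v st h by (auto simp: u_def)
 have lcu: "(u (Suc n))\<^sup>2 \<le> u n * u (Suc (Suc n))" for n
 proof -
  have e: "(s + real n * h) / 2 + (s + real (Suc (Suc n)) * h) / 2 = s + real (Suc n) * h"
   by (simp add: field_simps)
  have e': "2 * ((s + real m * h) / 2) = s + real m * h" for m by simp
  have "0 \<le> (s + real m * h) / 2" for m using st h by simp
  from lc[OF this this, of n "Suc (Suc n)"] show ?thesis unfolding e e' u_def .
 qed
 have us: "u 0 < u 1" using less by (simp add: u_def h_def)
 have "0 < u 0"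
 proof (rule ccontr)
  assume "\<not> 0 < u 0"
  then have "u 0 = 0" using u0(1)[of 0] by simp
  then have "(u 1)\<^sup>2 \<le> 0" using lcu[of 0] by simp
  then show False using us u0(1)[of 0] by simp
 qed
 define q where "q = u 1 / u 0"
 have q: "1 < q" using us \<open>0 < u 0\<close> by (simp add: q_def)
 have grow: "0 < u n \<and> q * u n \<le> u (Suc n)" for n
 proof (induction n)
  case 0
  then show ?case using \<open>0 < u 0\<close> by (simp add: q_def)
 next
  case (Suc n)
  have p: "0 < u (Suc n)" using Suc q by (smt (verit) mult_pos_pos)
  have "u n * (q * u (Suc n)) \<le> u (Suc n) * u (Suc n)"
   using mult_right_mono[of "q * u n" "u (Suc n)" "u (Suc n)"] Suc p by (simp add: mult_ac)
  also have "\<dots> \<le> u n * u (Suc (Suc n))" using lcu[of n] by (simp add: power2_eq_square)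
  finally show ?case using Suc p by simp
 qed
 have pow: "q ^ n * u 0 \<le> u n" for n
 proof (induction n)
  case (Suc n)
  have "q ^ Suc n * u 0 \<le> q * u n" using Suc q by simp
  then show ?case using grow[of n] by linarith
 qed simp
 obtain n where n: "B / u 0 < q ^ n" using real_arch_pow[OF q] by blast
 then have "B < q ^ n * u 0" using \<open>0 < u 0\<close> by (simp add: field_simps)
 then show False using pow[of n] u0(2)[of n] by linarith
qed

section \<open>Generators and the comparison principle\<close>

definition gen_op :: "('x => 'x => real) => ('x => real) => 'x => real" where
 "gen_op H u x = (\<Sum>\<^sub>\<infinity>y. H x y * u y)"

locale generator =
 fixes H :: "'x => 'x => real" and C :: real
 assumes offdiag: "x \<noteq> y ==> 0 \<le> H x y"
  and sym: "H x y = H y x"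
  and row_summable: "(\<lambda>y. \<bar>H x y\<bar>) summable_on UNIV"
  and row_bound: "(\<Sum>\<^sub>\<infinity>y. \<bar>H x y\<bar>) \<le> C"
begin

lemma C_nonneg: "0 \<le> C"
 using row_bound infsum_nonneg[of UNIV "\<lambda>y. \<bar>H undefined y\<bar>"] by (meson abs_ge_zero order_trans)

lemma entry_bound: "\<bar>H x y\<bar> \<le> C"
proof -
 have "(\<Sum>z\<in>{y}. \<bar>H x z\<bar>) \<le> (\<Sum>\<^sub>\<infinity>z. \<bar>H x z\<bar>)"
  by (rule finite_sum_le_infsum) (use row_summable in auto)
 then show ?thesis using row_bound[of x] by simp
qed

lemma gen_summable: "(\<And>y. \<bar>u y\<bar> \<le> B) ==> (\<lambda>y. H x y * u y) summable_on UNIV"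
 by (rule summable_mult_bounded(2)[OF row_summable])

lemma gen_bound:
 assumes "\<And>y. \<bar>u y\<bar> \<le> B" shows "\<bar>gen_op H u x\<bar> \<le> C * B"
proof -
 have B: "0 \<le> B" using assms[of undefined] by linarith
 have "\<bar>gen_op H u x\<bar> \<le> (\<Sum>\<^sub>\<infinity>y. \<bar>H x y\<bar>) * B"
  unfolding gen_op_def by (rule summable_mult_bounded(3)[OF row_summable]) (rule assms)
 also have "\<dots> \<le> C * B" using row_bound B by (rule mult_right_mono)
 finally show ?thesis .
qed

lemma gen_diff:
 assumes "\<And>y. \<bar>u y\<bar> \<le> B" "\<And>y. \<bar>v y\<bar> \<le> B'"
 shows "gen_op H (\<lambda>y. u y - v y) x = gen_op H u x - gen_op H v x"
 unfolding gen_op_def using assms by (intro infsum_linear_diff gen_summable) auto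

lemma gen_scale: "gen_op H (\<lambda>y. c * u y) x = c * gen_op H u x"
proof -
 have "(\<lambda>y. H x y * (c * u y)) = (\<lambda>y. c * (H x y * u y))" by (auto simp: algebra_simps)
 then show ?thesis unfolding gen_op_def by (simp add: infsum_cmult_right')
qed

lemma gen_delta: "gen_op H (\<lambda>z. of_bool (z = y)) x = H x y"
 unfolding gen_op_def by (subst infsum_single[where x=y]) auto

lemma gen_continuous:
 assumes "\<And>y. continuous_on T (\<lambda>t. u t y)" "\<And>t y. t \<in> T ==> \<bar>u t y\<bar> \<le> B"
 shows "continuous_on T (\<lambda>t. gen_op H (u t) x)"
 unfolding gen_op_def
proof (rule continuous_on_infsum_dominated)
 show "continuous_on T (\<lambda>t. H x y * u t y)" for y by (intro continuous_intros assms)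
 show "\<bar>H x y * u t y\<bar> \<le> \<bar>H x y\<bar> * B" if "t \<in> T" for t y
  using assms(2)[OF that] by (simp add: abs_mult mult_left_mono)
 show "(\<lambda>y. \<bar>H x y\<bar> * B) summable_on UNIV"
  by (intro summable_on_cmult_left row_summable)
qed

lemma gen_tendsto:
 assumes "\<And>y. ((\<lambda>t. u t y) \<longlongrightarrow> v y) F" "\<forall>\<^sub>F t in F. \<forall>y. \<bar>u t y\<bar> \<le> B"
 shows "((\<lambda>t. gen_op H (u t) x) \<longlongrightarrow> gen_op H v x) F"
 unfolding gen_op_def
proof (rule tendsto_infsum_dominated)
 show "((\<lambda>t. H x y * u t y) \<longlongrightarrow> H x y * v y) F" for y by (intro tendsto_intros assms)
 show "\<forall>\<^sub>F t in F. \<forall>y\<in>UNIV. \<bar>H x y * u t y\<bar> \<le> \<bar>H x y\<bar> * B"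
  using assms(2) by eventually_elim (auto simp: abs_mult intro!: mult_left_mono)
 show "(\<lambda>y. \<bar>H x y\<bar> * B) summable_on UNIV"
  by (intro summable_on_cmult_left row_summable)
qed

text \<open>The matrix C I + H has nonnegative entries and row sums at most 2 C.\<close>

lemma gen_lower_bound:
 assumes B: "\<And>y. \<bar>u y\<bar> \<le> B" and g: "\<And>y. - g \<le> u y" "0 \<le> g"
 shows "- (2 * C * g) \<le> C * u x + gen_op H u x"
proof -
 define W where "W = (\<lambda>y. H x y + C * of_bool (y = x))"
 have W0: "0 \<le> W y" for y
 proof (cases "y = x")
  case True then show ?thesis using entry_bound[of x x] unfolding W_def by (simp add: abs_le_iff)
 next
  case False then show ?thesis using offdiag[of x y] unfolding W_def by simp
 qed
 have d: "((\<lambda>y. C * of_bool (y = x)) has_sum C) UNIV"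
  using infsum_single[of x "\<lambda>y. C * of_bool (y = x)"] by (simp add: has_sum_iff)
 have du: "((\<lambda>y. C * of_bool (y = x) * u y) has_sum C * u x) UNIV"
  using infsum_single[of x "\<lambda>y. C * of_bool (y = x) * u y"] by (simp add: has_sum_iff)
 have sH: "(H x) summable_on UNIV"
  by (rule abs_summable_summable) (simp add: row_summable)
 have sW: "(W has_sum infsum (H x) UNIV + C) UNIV"
  unfolding W_def by (rule has_sum_add[OF has_sum_infsum[OF sH] d])
 have "infsum (H x) UNIV \<le> (\<Sum>\<^sub>\<infinity>y. \<bar>H x y\<bar>)" by (rule infsum_mono[OF sH row_summable]) simp
 then have Wle: "infsum (H x) UNIV + C \<le> 2 * C"
  using row_bound[of x] by linarith
 have "((\<lambda>y. H x y * u y + C * of_bool (y = x) * u y) has_sum gen_op H u x + C * u x) UNIV"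
  unfolding gen_op_def by (rule has_sum_add[OF has_sum_infsum[OF gen_summable[OF B]] du])
 then have Wu: "((\<lambda>y. W y * u y) has_sum gen_op H u x + C * u x) UNIV"
  by (simp add: W_def distrib_right)
 have "((\<lambda>y. W y * - g) has_sum (infsum (H x) UNIV + C) * - g) UNIV"
  by (rule has_sum_cmult_left[OF sW])
 from has_sum_mono[OF this Wu] have "(infsum (H x) UNIV + C) * - g \<le> gen_op H u x + C * u x"
  using mult_left_mono[OF g(1) W0] by blast
 then show ?thesis using mult_right_mono[OF Wle g(2)] by linarith
qed

text \<open>On an infinite state space the infimum over x need not be attained, so there is no first time
 at which u touches 0. Instead a crude lower bound for e^(C t) u is improved by integrating
 gen_lower_bound repeatedly; the n-th bound carries the factor (2 C t)^n / n!, which tends to 0.\<close>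

lemma comparison:
 assumes B: "\<And>t x. 0 \<le> t ==> t \<le> T ==> \<bar>u t x\<bar> \<le> B"
  and d: "\<And>t x. 0 \<le> t ==> t \<le> T ==> ((\<lambda>s. u s x) has_real_derivative u' t x) (at t within {0..})"
  and u': "\<And>t x. 0 \<le> t ==> t \<le> T ==> gen_op H (u t) x \<le> u' t x"
  and u0: "\<And>x. 0 \<le> u 0 x" and t: "0 \<le> t" "t \<le> T"
 shows "0 \<le> u t x"
proof -
 define B' where "B' = exp (C * T) * B"
 have T: "0 \<le> T" using t by simp
 have B0: "0 \<le> B" using B[of 0 undefined] T by (meson abs_ge_zero order_refl order_trans)
 have claim: "- (B' * ((2 * C * t)^n / fact n)) \<le> exp (C * t) * u t x" if "0 \<le> t" "t \<le> T" for n t x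
  using that
 proof (induction n arbitrary: t x)
  case 0
  have "\<bar>exp (C * t) * u t x\<bar> \<le> exp (C * T) * B"
   unfolding abs_mult using 0 B C_nonneg by (intro mult_mono) (auto simp: mult_left_mono)
  then show ?case by (simp add: B'_def)
 next
  case (Suc n)
  define q where "q s = B' * ((2 * C * s)^n / fact n)" for s
  define f where "f s = exp (C * s) * u s x + B' * ((2 * C * s)^Suc n / fact (Suc n))" for s
  have "f 0 \<le> f t"
  proof (rule nondecreasing_from_derivative[where f=f and a=0 and b=t and f'="\<lambda>s. exp (C * s) * (C * u s x + u' s x) + 2 * C * q s"])
   fix s assume s: "0 \<le> s" "s \<le> t"
   have ds: "((\<lambda>s. u s x) has_real_derivative u' s x) (at s within {0..t})"
    using d[of s x] s Suc.prems by (intro has_field_derivative_subset[OF d]) auto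
   have "((\<lambda>s. (2 * C * s)^Suc n) has_real_derivative real (Suc n) * (2 * C) * (2 * C * s)^n) (at s within {0..t})"
    by (rule derivative_eq_intros refl)+ simp
   from DERIV_cmult[OF DERIV_cdivide[OF this, of "fact (Suc n)"], of B']
   have dp: "((\<lambda>s. B' * ((2 * C * s)^Suc n / fact (Suc n))) has_real_derivative 2 * C * q s) (at s within {0..t})"
    by (rule DERIV_cong) (simp add: q_def field_simps del: of_nat_Suc)
   show "(f has_real_derivative (exp (C * s) * (C * u s x + u' s x) + 2 * C * q s)) (at s within {0..t})"
    unfolding f_def
    by (rule derivative_eq_intros ds dp refl)+ (simp add: algebra_simps)
   have "- (2 * C * (exp (- C * s) * q s)) \<le> C * u s x + gen_op H (u s) x"
   proof (rule gen_lower_bound[where B=B])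
    show "\<bar>u s y\<bar> \<le> B" for y using B s Suc.prems by auto
    show "- (exp (- C * s) * q s) \<le> u s y" for y
    proof -
     have "- q s \<le> exp (C * s) * u s y" unfolding q_def using Suc.IH[of s y] s Suc.prems by auto
     then have "exp (- C * s) * (- q s) \<le> exp (- C * s) * (exp (C * s) * u s y)"
      by (intro mult_left_mono) auto
     then show ?thesis by (simp add: mult.assoc[symmetric] exp_add[symmetric])
    qed
    show "0 \<le> exp (- C * s) * q s" unfolding q_def B'_def using s C_nonneg B0 by auto
   qed
   also have "\<dots> \<le> C * u s x + u' s x" using u'[of s x] s Suc.prems by auto
   finally have "exp (C * s) * - (2 * C * (exp (- C * s) * q s)) \<le> exp (C * s) * (C * u s x + u' s x)"
    by (intro mult_left_mono) auto
   moreover have "exp (C * s) * - (2 * C * (exp (- C * s) * q s)) = - (2 * C * q s)"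
    by (simp add: exp_minus field_simps)
   ultimately show "0 \<le> exp (C * s) * (C * u s x + u' s x) + 2 * C * q s" by linarith
  qed (use Suc in auto)
  moreover have "0 \<le> f 0" using u0 by (simp add: f_def)
  ultimately show ?case unfolding f_def by linarith
 qed
 have "(\<lambda>n. (2 * C * t)^n / fact n) \<longlonglongrightarrow> 0"
  using summable_LIMSEQ_zero[OF summable_exp[of "2 * C * t"]] by (simp add: field_simps)
 then have "(\<lambda>n. - (B' * ((2 * C * t)^n / fact n))) \<longlonglongrightarrow> - (B' * 0)"
  by (intro tendsto_intros)
 then have "- (B' * 0) \<le> exp (C * t) * u t x"
  by (rule tendsto_upperbound) (use claim[OF t] in auto)
 then show ?thesis by (simp add: zero_le_mult_iff)
qed

lemma ode_unique:
 assumes u: "\<And>t x. 0 \<le> t ==> t \<le> T ==> \<bar>u t x\<bar> \<le> B"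
   "\<And>t x. 0 \<le> t ==> t \<le> T ==> ((\<lambda>s. u s x) has_real_derivative gen_op H (u t) x) (at t within {0..})"
  and v: "\<And>t x. 0 \<le> t ==> t \<le> T ==> \<bar>v t x\<bar> \<le> B'"
   "\<And>t x. 0 \<le> t ==> t \<le> T ==> ((\<lambda>s. v s x) has_real_derivative gen_op H (v t) x) (at t within {0..})"
  and eq: "\<And>x. u 0 x = v 0 x" and t: "0 \<le> t" "t \<le> T"
 shows "u t x = v t x"
proof -
 have "0 \<le> u t x - v t x"
  if *: "\<And>t x. 0 \<le> t ==> t \<le> T ==> \<bar>u t x\<bar> \<le> B"
   "\<And>t x. 0 \<le> t ==> t \<le> T ==> ((\<lambda>s. u s x) has_real_derivative gen_op H (u t) x) (at t within {0..})"
   "\<And>t x. 0 \<le> t ==> t \<le> T ==> \<bar>v t x\<bar> \<le> B'"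
   "\<And>t x. 0 \<le> t ==> t \<le> T ==> ((\<lambda>s. v s x) has_real_derivative gen_op H (v t) x) (at t within {0..})"
   "\<And>x. u 0 x = v 0 x" for u v :: "real => 'x => real" and B B'
 proof (rule comparison[where u="\<lambda>t x. u t x - v t x" and T=T and B="B + B'"
    and u'="\<lambda>t x. gen_op H (u t) x - gen_op H (v t) x"])
  show "\<bar>u t x - v t x\<bar> \<le> B + B'" if "0 \<le> t" "t \<le> T" for t x
   using *(1,3)[OF that, of x] by linarith
  show "((\<lambda>s. u s x - v s x) has_real_derivative gen_op H (u t) x - gen_op H (v t) x) (at t within {0..})"
   if "0 \<le> t" "t \<le> T" for t x
   by (intro derivative_intros *(2,4) that)
  show "gen_op H (\<lambda>x. u t x - v t x) x \<le> gen_op H (u t) x - gen_op H (v t) x" if "0 \<le> t" "t \<le> T" for t x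
   using gen_diff[of "u t" B "v t" B'] *(1,3) that by simp
 qed (use *(5) t in auto)
 from this[of u B v B'] this[of v B' u B] assms show ?thesis by force
qed

lemma gen_integral:
 fixes u :: "real => 'x => real"
 assumes c: "\<And>y. continuous_on {0..T} (\<lambda>t. u t y)" and B: "\<And>t y. t \<in> {0..T} ==> \<bar>u t y\<bar> \<le> B"
 shows "gen_op H (\<lambda>y. integral {0..T} (\<lambda>t. u t y)) x = integral {0..T} (\<lambda>t. gen_op H (u t) x)"
proof -
 define f where "f X t = (\<Sum>y\<in>X. H x y * u t y)" for X t
 have "uniform_limit {0..T} (\<lambda>X t. \<Sum>y\<in>X. H x y * u t y) (\<lambda>t. \<Sum>\<^sub>\<infinity>y. H x y * u t y) (finite_subsets_at_top UNIV)"
 proof (rule Weierstrass_m_test_general)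
  show "norm (H x y * u t y) \<le> \<bar>H x y\<bar> * B" if "t \<in> {0..T}" for y t
   using B[OF that, of y] by (simp add: abs_mult mult_left_mono)
  show "(\<lambda>y. \<bar>H x y\<bar> * B) summable_on UNIV" by (intro summable_on_cmult_left row_summable)
 qed
 then have ul: "uniform_limit (cbox 0 T) f (\<lambda>t. gen_op H (u t) x) (finite_subsets_at_top UNIV)"
  by (simp only: f_def[abs_def] gen_op_def box_real)
 obtain I J where I: "\<And>X. (f X has_integral I X) (cbox 0 T)" and J: "((\<lambda>t. gen_op H (u t) x) has_integral J) (cbox 0 T)"
  and lim: "(I \<longlongrightarrow> J) (finite_subsets_at_top UNIV)"
  by (rule uniform_limit_integral_cbox[OF ul]) (use c in \<open>auto simp: f_def intro!: continuous_intros\<close>)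
 have I': "I X = (\<Sum>y\<in>X. H x y * integral {0..T} (\<lambda>t. u t y))" for X
 proof -
  have "I X = integral {0..T} (f X)" using integral_unique[OF I[of X]] by simp
  also have "\<dots> = (\<Sum>y\<in>X. H x y * integral {0..T} (\<lambda>t. u t y))"
  proof (cases "finite X")
   case True then show ?thesis unfolding f_def
    by (subst integral_sum) (auto intro!: integrable_continuous_real continuous_intros c)
  next
   case False then show ?thesis by (simp add: f_def[abs_def])
  qed
  finally show ?thesis .
 qed
 have "((\<lambda>y. H x y * integral {0..T} (\<lambda>t. u t y)) has_sum J) UNIV"
  using lim unfolding I'[abs_def] has_sum_def .
 then show ?thesis using integral_unique[OF J] by (simp add: gen_op_def infsumI)
qed

end

section \<open>Symmetric positive kernel semigroups\<close>

definition act :: "(real => 'x => 'x => real) => real => ('x => real) => 'x => real" where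
 "act k t u x = (\<Sum>\<^sub>\<infinity>y. k t x y * u y)"

text \<open>Both the walk and the branching mean kernel are introduced through their backward equation.
 The semigroup property, the forward equation and the symmetry are consequences of uniqueness for
 that equation.\<close>

locale kernel_semigroup = generator H C
 for H :: "'x => 'x => real" and C :: real +
 fixes k :: "real => 'x => 'x => real" and b :: real
 assumes k_nonneg: "0 \<le> t ==> 0 \<le> k t x y"
  and k_summable: "0 \<le> t ==> k t x summable_on UNIV"
  and k_mass: "0 \<le> t ==> (\<Sum>\<^sub>\<infinity>y. k t x y) \<le> exp (b * t)"
  and growth_nonneg: "0 \<le> b"
  and k_initial: "k 0 x y = of_bool (x = y)"
  and k_backward: "(\<And>y. \<bar>u y\<bar> \<le> 1) ==> 0 \<le> t ==>
   ((\<lambda>s. act k s u x) has_real_derivative gen_op H (act k t u) x) (at t within {0..})"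
begin

lemma act_summable: "0 \<le> t ==> (\<And>y. \<bar>u y\<bar> \<le> B) ==> (\<lambda>y. k t x y * u y) summable_on UNIV"
 by (rule summable_mult_bounded(2)[where B=B]) (use k_summable k_nonneg in auto)

lemma act_bound:
 assumes "0 \<le> t" "\<And>y. \<bar>u y\<bar> \<le> B" shows "\<bar>act k t u x\<bar> \<le> exp (b * t) * B"
proof -
 have B: "0 \<le> B" using assms(2)[of undefined] by linarith
 have eq: "(\<lambda>y. \<bar>k t x y\<bar>) = k t x" using k_nonneg[OF assms(1)] by auto
 have "\<bar>act k t u x\<bar> \<le> (\<Sum>\<^sub>\<infinity>y. \<bar>k t x y\<bar>) * B"
  unfolding act_def by (rule summable_mult_bounded(3)) (use eq k_summable assms in auto)
 also have "\<dots> \<le> exp (b * t) * B" unfolding eq using k_mass assms(1) B by (intro mult_right_mono) auto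
 finally show ?thesis .
qed

lemma act_bound_upto:
 assumes "0 \<le> t" "t \<le> T" "\<And>y. \<bar>u y\<bar> \<le> B" shows "\<bar>act k t u x\<bar> \<le> exp (b * T) * B"
proof -
 have B: "0 \<le> B" using assms(3)[of undefined] by linarith
 have "\<bar>act k t u x\<bar> \<le> exp (b * t) * B" using assms by (intro act_bound)
 also have "\<dots> \<le> exp (b * T) * B" using assms growth_nonneg B by (intro mult_right_mono) (auto intro: mult_left_mono)
 finally show ?thesis .
qed

lemma act_diff:
 assumes "0 \<le> t" "\<And>y. \<bar>u y\<bar> \<le> B" "\<And>y. \<bar>v y\<bar> \<le> B'"
 shows "act k t (\<lambda>y. u y - v y) x = act k t u x - act k t v x"
 unfolding act_def using assms by (intro infsum_linear_diff act_summable) auto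

lemma act_scale: "act k t (\<lambda>y. c * u y) x = c * act k t u x"
proof -
 have "(\<lambda>y. k t x y * (c * u y)) = (\<lambda>y. c * (k t x y * u y))" by (auto simp: algebra_simps)
 then show ?thesis unfolding act_def by (simp add: infsum_cmult_right')
qed

lemma act_delta: "act k t (\<lambda>z. of_bool (z = y)) x = k t x y"
 unfolding act_def by (subst infsum_single[where x=y]) auto

lemma act_delta_fun: "act k t (\<lambda>z. of_bool (z = y)) = (\<lambda>x. k t x y)"
 by (rule ext) (rule act_delta)

lemma act_initial: "act k 0 u x = u x"
 unfolding act_def by (subst infsum_single[where x=x]) (auto simp: k_initial)

lemma act_initial_fun: "act k 0 u = u"
 by (rule ext) (rule act_initial)

lemma act_nonneg: "0 \<le> t ==> (\<And>y. 0 \<le> u y) ==> 0 \<le> act k t u x"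
 unfolding act_def using k_nonneg by (intro infsum_nonneg) auto

lemma act_backward:
 assumes "\<And>y. \<bar>u y\<bar> \<le> B" "0 \<le> t"
 shows "((\<lambda>s. act k s u x) has_real_derivative gen_op H (act k t u) x) (at t within {0..})"
proof -
 define D where "D = \<bar>B\<bar> + 1"
 have D: "D > 0" by (simp add: D_def)
 have le1: "\<bar>u y / D\<bar> \<le> 1" for y using assms(1)[of y] D by (simp add: abs_divide divide_le_eq D_def)
 have "((\<lambda>s. D * act k s (\<lambda>y. u y / D) x) has_real_derivative D * gen_op H (act k t (\<lambda>y. u y / D)) x) (at t within {0..})"
  by (intro DERIV_cmult k_backward le1 assms)
 then show ?thesis unfolding act_scale[symmetric] gen_scale[symmetric] using D by simp
qed

lemma kernel_backward:
 "0 \<le> t ==> ((\<lambda>s. k s x y) has_real_derivative gen_op H (\<lambda>z. k t z y) x) (at t within {0..})"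
 using act_backward[of "\<lambda>z. of_bool (z = y)" 1 t x] by (simp add: act_delta_fun)

lemma kernel_bound: "0 \<le> t ==> \<bar>k t x y\<bar> \<le> exp (b * t)"
 using act_bound[of t "\<lambda>z. of_bool (z = y)" 1 x] by (simp add: act_delta_fun)

lemma kernel_bound_upto: "0 \<le> t ==> t \<le> T ==> \<bar>k t x y\<bar> \<le> exp (b * T)"
 using act_bound_upto[of t T "\<lambda>z. of_bool (z = y)" 1 x] by (simp add: act_delta_fun)

lemma act_continuous: "(\<And>y. \<bar>u y\<bar> \<le> B) ==> continuous_on {0..} (\<lambda>t. act k t u x)"
 by (rule DERIV_continuous_on[OF act_backward]) auto

lemma kernel_continuous: "continuous_on {0..} (\<lambda>t. k t x y)"
 by (rule DERIV_continuous_on[OF kernel_backward]) auto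

lemma act_semigroup:
 assumes u: "\<And>y. \<bar>u y\<bar> \<le> B" and s: "0 \<le> s" and t: "0 \<le> t"
 shows "act k (s + t) u x = act k s (act k t u) x"
proof (rule ode_unique[where T=s and u="\<lambda>s x. act k (s + t) u x" and v="\<lambda>s. act k s (act k t u)"])
 show "\<bar>act k (s' + t) u x\<bar> \<le> exp (b * (s + t)) * B" if "0 \<le> s'" "s' \<le> s" for s' x
  by (rule act_bound_upto) (use that t u in auto)
 show "\<bar>act k s' (act k t u) x\<bar> \<le> exp (b * s) * (exp (b * t) * B)" if "0 \<le> s'" "s' \<le> s" for s' x
  by (rule act_bound_upto[OF _ _ act_bound]) (use that t u in auto)
 show "((\<lambda>s. act k s (act k t u) x) has_real_derivative gen_op H (act k s' (act k t u)) x) (at s' within {0..})"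
  if "0 \<le> s'" "s' \<le> s" for s' x
  by (rule act_backward[OF act_bound]) (use that t u in auto)
 show "((\<lambda>s. act k (s + t) u x) has_real_derivative gen_op H (\<lambda>x. act k (s' + t) u x) x) (at s' within {0..})"
  if s': "0 \<le> s'" "s' \<le> s" for s' x
 proof -
  have "((\<lambda>r. act k r u x) has_real_derivative gen_op H (act k (s' + t) u) x) (at (s' + t) within (\<lambda>s. s + t) ` {0..})"
   by (rule has_field_derivative_subset[OF act_backward]) (use u s' t in auto)
  moreover have "((\<lambda>s. s + t) has_real_derivative 1) (at s' within {0..})"
   by (auto intro!: derivative_eq_intros)
  ultimately show ?thesis
   using DERIV_image_chain[of "\<lambda>r. act k r u x" _ "\<lambda>s. s + t" s' "{0..}" 1] by (simp add: o_def)
 qed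
qed (use s in \<open>auto simp: act_initial\<close>)

lemma small_time:
 assumes u: "\<And>y. \<bar>u y\<bar> \<le> B" and h: "0 \<le> h" "h \<le> T"
 shows "\<bar>act k h u x - u x - h * gen_op H u x\<bar> \<le> C^2 * exp (b * T) * B * h^2"
proof -
 have B: "0 \<le> B" using u[of undefined] by linarith
 have bd: "\<bar>act k s u y\<bar> \<le> exp (b * T) * B" if "0 \<le> s" "s \<le> T" for s y
  using act_bound_upto[of s T u B y] that u by simp
 have first: "\<bar>act k s u y - u y\<bar> \<le> C * (exp (b * T) * B) * s" if s: "0 \<le> s" "s \<le> T" for s y
 proof -
  have "\<bar>act k s u y - act k 0 u y\<bar> \<le> C * (exp (b * T) * B) * (s - 0)"
  proof (rule increment_bound_from_derivative[where f="\<lambda>s. act k s u y" and f'="\<lambda>s. gen_op H (act k s u) y"])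
   show "((\<lambda>s. act k s u y) has_real_derivative gen_op H (act k r u) y) (at r within {0..s})" if "0 \<le> r" for r
    by (rule has_field_derivative_subset[OF act_backward]) (use u that in auto)
   show "\<bar>gen_op H (act k r u) y\<bar> \<le> C * (exp (b * T) * B)" if "0 \<le> r" "r \<le> s" for r
    by (rule gen_bound) (use bd that s in auto)
  qed (use s in auto)
  then show ?thesis by (simp add: act_initial)
 qed
 have "\<bar>(act k h u x - h * gen_op H u x) - (act k 0 u x - 0 * gen_op H u x)\<bar> \<le> C * (C * (exp (b * T) * B) * h) * (h - 0)"
 proof (rule increment_bound_from_derivative[where f="\<lambda>s. act k s u x - s * gen_op H u x"
    and f'="\<lambda>s. gen_op H (act k s u) x - gen_op H u x"])
  show "((\<lambda>s. act k s u x - s * gen_op H u x) has_real_derivative gen_op H (act k r u) x - gen_op H u x) (at r within {0..h})"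
   if "0 \<le> r" for r
   by (rule has_field_derivative_subset[where s="{0..}"])
    (auto intro!: derivative_eq_intros act_backward[OF u that])
  show "\<bar>gen_op H (act k r u) x - gen_op H u x\<bar> \<le> C * (C * (exp (b * T) * B) * h)" if r: "0 \<le> r" "r \<le> h" for r
  proof -
   have "gen_op H (act k r u) x - gen_op H u x = gen_op H (\<lambda>y. act k r u y - u y) x"
    by (rule gen_diff[symmetric, where B="exp (b * T) * B" and B'=B]) (use bd r h u in auto)
   moreover have "\<bar>act k r u y - u y\<bar> \<le> C * (exp (b * T) * B) * h" for y
   proof -
    have "\<bar>act k r u y - u y\<bar> \<le> C * (exp (b * T) * B) * r" using first r h by auto
    also have "\<dots> \<le> C * (exp (b * T) * B) * h" using r C_nonneg B by (intro mult_left_mono) auto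
    finally show ?thesis .
   qed
   ultimately show ?thesis using gen_bound by simp
  qed
 qed (use h in auto)
 then show ?thesis by (simp add: act_initial power2_eq_square algebra_simps)
qed

lemma quadratic_error_negligible: "((\<lambda>h::real. D * h^2 / h) \<longlongrightarrow> 0) (at_right 0)"
proof -
 have "((\<lambda>h::real. D * h) \<longlongrightarrow> D * 0) (at_right 0)" by (intro tendsto_intros)
 then have "((\<lambda>h::real. D * h) \<longlongrightarrow> 0) (at_right 0)" by simp
 then show ?thesis by (rule Lim_transform_eventually) (auto simp: eventually_at_filter power2_eq_square)
qed

text \<open>Semigroup and generator commute: the increment from s to r is act k s applied to the increment
 of act over the time r - s, and small_time controls the latter uniformly in the state.\<close>

lemma act_forward:
 assumes u: "\<And>y. \<bar>u y\<bar> \<le> B" and t: "0 \<le> t"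
 shows "((\<lambda>s. act k s u x) has_real_derivative act k t (gen_op H u) x) (at t within {0..})"
proof -
 define T where "T = t + 1"
 define D where "D = C^2 * exp (b * T) * B"
 have B: "0 \<le> B" using u[of undefined] by linarith
 have "((\<lambda>s. act k s u x) has_real_derivative act k t (gen_op H u) x) (at t within {0..T})"
 proof (rule derivative_from_increments[where \<eta>="\<lambda>h. exp (b * T) * D * h^2" and S="{0..T}"])
  show "((\<lambda>h. exp (b * T) * D * h^2 / h) \<longlongrightarrow> 0) (at_right 0)" by (rule quadratic_error_negligible)
  show "continuous_on {0..T} (\<lambda>s. act k s (gen_op H u) x)"
   by (rule continuous_on_subset[OF act_continuous[where B="C * B"]]) (use gen_bound u in auto)
  fix s r assume sr: "s \<in> {0..T}" "r \<in> {0..T}" "s < r"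
  define h where "h = r - s"
  have h: "0 \<le> h" "h \<le> T" "r = s + h" using sr by (auto simp: h_def)
  have ab: "\<bar>act k h u y - u y\<bar> \<le> exp (b * h) * B + B" for y
  proof -
   have "\<bar>act k h u y\<bar> \<le> exp (b * h) * B" by (rule act_bound) (use h u in auto)
   then show ?thesis using u[of y] by linarith
  qed
  have "act k s (\<lambda>y. (act k h u y - u y) - h * gen_op H u y) x
    = act k s (\<lambda>y. act k h u y - u y) x - act k s (\<lambda>y. h * gen_op H u y) x"
  proof (rule act_diff[where B="exp (b * h) * B + B" and B'="h * (C * B)"])
   show "\<bar>h * gen_op H u y\<bar> \<le> h * (C * B)" for y
    using gen_bound[of u B y] u h by (simp add: abs_mult mult_left_mono)
  qed (use sr ab in auto)
  also have "act k s (\<lambda>y. act k h u y - u y) x = act k s (act k h u) x - act k s u x"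
   by (rule act_diff[OF _ act_bound[OF h(1) u] u]) (use sr in auto)
  also have "act k s (act k h u) x = act k r u x"
   using act_semigroup[where u=u and B=B and s=s and t=h and x=x] sr h u by simp
  finally have "act k r u x - act k s u x - (r - s) * act k s (gen_op H u) x
    = act k s (\<lambda>y. (act k h u y - u y) - h * gen_op H u y) x" by (simp add: act_scale h_def)
  also have "\<bar>\<dots>\<bar> \<le> exp (b * T) * (D * h^2)"
   by (rule act_bound_upto) (use sr h small_time[OF u h(1,2)] in \<open>auto simp: D_def\<close>)
  finally show "\<bar>act k r u x - act k s u x - (r - s) * act k s (gen_op H u) x\<bar> \<le> exp (b * T) * D * (r - s)^2"
   by (simp add: h_def mult.assoc)
 qed (use t in \<open>auto simp: T_def\<close>)
 moreover have "at t within {0..T} = at t within {0..}"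
  by (rule at_within_nhd[where S="{..<T}"]) (use t in \<open>auto simp: T_def\<close>)
 ultimately show ?thesis by simp
qed

text \<open>As functions of x, k t x y solves the backward equation and k t y x the forward one; since H
 is symmetric, these are the same equation.\<close>

lemma kernel_sym:
 assumes "0 \<le> t" shows "k t x y = k t y x"
proof (rule ode_unique[where T=t and u="\<lambda>t x. k t x y" and v="\<lambda>t x. k t y x"])
 show "((\<lambda>s. k s y x) has_real_derivative gen_op H (k r y) x) (at r within {0..})" if "0 \<le> r" for r x
 proof -
  have "gen_op H (\<lambda>z. of_bool (z = x)) = H x" by (auto simp: gen_delta sym[of x])
  then have "act k r (gen_op H (\<lambda>z. of_bool (z = x))) y = gen_op H (k r y) x"
   by (simp add: act_def gen_op_def mult.commute)
  then show ?thesis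
   using act_forward[of "\<lambda>z. of_bool (z = x)" 1 r y] that by (simp add: act_delta_fun)
 qed
qed (use assms kernel_bound_upto kernel_backward in \<open>auto simp: k_initial\<close>)

lemma kernel_diag_semigroup:
 assumes "0 \<le> s" "0 \<le> t"
 shows "((\<lambda>z. k s x z * k t x z) has_sum k (s + t) x x) UNIV"
proof -
 have "(\<lambda>z. k s x z * k t z x) summable_on UNIV"
  by (rule act_summable[where B="exp (b * t)"]) (use assms kernel_bound in auto)
 moreover have "act k s (\<lambda>z. k t z x) x = k (s + t) x x"
  using act_semigroup[of "\<lambda>z. of_bool (z = x)" 1 s t x] assms by (simp add: act_delta_fun)
 ultimately show ?thesis using kernel_sym[OF assms(2)] by (simp add: has_sum_iff act_def)
qed

text \<open>By symmetry k (s + t) x x is the inner product of k s x and k t x, and this is the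
 Cauchy-Schwarz inequality.\<close>

lemma kernel_diag_log_convex:
 assumes s: "0 \<le> s" and t: "0 \<le> t"
 shows "(k (s + t) x x)^2 \<le> k (2 * s) x x * k (2 * t) x x"
proof -
 have st: "k (2 * s) x x = k (s + s) x x" "k (2 * t) x x = k (t + t) x x" by (simp_all only: mult_2)
 have q: "0 \<le> k (s + s) x x + 2 * l * k (s + t) x x + l^2 * k (t + t) x x" for l
 proof -
  have "((\<lambda>z. k s x z * k s x z + 2 * l * (k s x z * k t x z) + l^2 * (k t x z * k t x z)) has_sum
    k (s + s) x x + 2 * l * k (s + t) x x + l^2 * k (t + t) x x) UNIV"
   by (intro has_sum_add has_sum_cmult_right kernel_diag_semigroup s t)
  then show ?thesis
  proof (rule has_sum_nonneg)
   fix z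
   have "k s x z * k s x z + 2 * l * (k s x z * k t x z) + l^2 * (k t x z * k t x z) = (k s x z + l * k t x z)^2"
    by (simp add: power2_eq_square algebra_simps)
   then show "0 \<le> k s x z * k s x z + 2 * l * (k s x z * k t x z) + l^2 * (k t x z * k t x z)"
    by (simp only: zero_le_power2)
  qed
 qed
 have nn: "0 \<le> k (t + t) x x" "0 \<le> k (s + s) x x" "0 \<le> k (s + t) x x" using s t by (simp_all add: k_nonneg)
 show ?thesis
 proof (cases "k (t + t) x x = 0")
  case True
  have "k (s + t) x x = 0"
  proof (rule ccontr)
   assume n: "k (s + t) x x \<noteq> 0"
   show False using q[of "- (k (s + s) x x + 1) / (2 * k (s + t) x x)"] True n by (simp add: field_simps)
  qed
  then show ?thesis using True unfolding st by simp
 next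
  case False
  then have p: "0 < k (t + t) x x" using nn by simp
  have "0 \<le> k (s + s) x x - (k (s + t) x x)^2 / k (t + t) x x"
   using q[of "- k (s + t) x x / k (t + t) x x"] p by (simp add: field_simps power2_eq_square)
  then show ?thesis using p unfolding st by (simp add: field_simps)
 qed
qed

text \<open>An exponential factor does not affect log-convexity, so boundedness is the only thing to
 check.\<close>

lemma tilted_diag_antimono:
 assumes B: "\<And>t. 0 \<le> t ==> exp (- l * t) * k t x x \<le> B" and st: "0 \<le> s" "s \<le> t"
 shows "exp (- l * t) * k t x x \<le> exp (- l * s) * k s x x"
proof (rule log_convex_bounded_antimono[where v="\<lambda>t. exp (- l * t) * k t x x" and B=B and s=s and t=t])
 fix s t :: real assume st: "0 \<le> s" "0 \<le> t"
 have e: "exp (- l * (2 * s)) * exp (- l * (2 * t)) = (exp (- l * (s + t)))\<^sup>2"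
  by (simp add: power2_eq_square exp_add[symmetric] algebra_simps)
 have "(exp (- l * (s + t)))\<^sup>2 * (k (s + t) x x)\<^sup>2 \<le> (exp (- l * (s + t)))\<^sup>2 * (k (2 * s) x x * k (2 * t) x x)"
  by (intro mult_left_mono kernel_diag_log_convex st) simp
 then show "(exp (- l * (s + t)) * k (s + t) x x)\<^sup>2 \<le> exp (- l * (2 * s)) * k (2 * s) x x * (exp (- l * (2 * t)) * k (2 * t) x x)"
  unfolding e[symmetric] power_mult_distrib by (simp only: mult_ac)
qed (use st B k_nonneg in auto)

text \<open>But for the point source at x0, u would be an eigenfunction and e^(-l t) act k t u constant in
 t; what changes is the source transported by the kernel. Used with c = 1 for potentials of the
 walk, with 1 - \<beta> G for the same functions under the perturbed generator, and with c = 0 for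
 eigenfunctions.\<close>

lemma act_perturbed_eigenfunction:
 assumes u: "\<And>y. \<bar>u y\<bar> \<le> B" and gen: "\<And>y. gen_op H u y = l * u y - c * of_bool (y = x0)" and t: "0 \<le> t"
 shows "((\<lambda>s. - (c * (exp (- l * s) * k s x x0))) has_integral (exp (- l * t) * act k t u x - u x)) {0..t}"
proof -
 have "((\<lambda>s. - (c * (exp (- l * s) * k s x x0))) has_integral
   (exp (- l * t) * act k t u x - exp (- l * 0) * act k 0 u x)) {0..t}"
 proof (rule integral_from_derivative[OF _ t])
  fix s :: real assume s: "0 \<le> s"
  have "act k s (gen_op H u) x = act k s (\<lambda>y. l * u y - c * of_bool (y = x0)) x" by (simp only: gen[abs_def])
  also have "\<dots> = act k s (\<lambda>y. l * u y) x - act k s (\<lambda>y. c * of_bool (y = x0)) x"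
   by (rule act_diff[where B="\<bar>l\<bar> * B" and B'="\<bar>c\<bar>", OF s]) (use u in \<open>auto simp: abs_mult intro!: mult_left_mono\<close>)
  also have "\<dots> = l * act k s u x - c * k s x x0" by (simp only: act_scale act_delta)
  finally have "((\<lambda>s. act k s u x) has_real_derivative l * act k s u x - c * k s x x0) (at s within {0..})"
   using act_forward[where u=u and B=B and x=x, OF u s] by simp
  moreover have "((\<lambda>s. exp (- l * s)) has_real_derivative - l * exp (- l * s)) (at s within {0..})"
   by (auto intro!: derivative_eq_intros)
  ultimately have "((\<lambda>s. exp (- l * s) * act k s u x) has_real_derivative
    - l * exp (- l * s) * act k s u x + (l * act k s u x - c * k s x x0) * exp (- l * s)) (at s within {0..})"
   by (intro DERIV_mult)
  then show "((\<lambda>s. exp (- l * s) * act k s u x) has_real_derivative - (c * (exp (- l * s) * k s x x0))) (at s within {0..})"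
   by (rule DERIV_cong) (simp add: algebra_simps)
 qed
 then show ?thesis by (simp add: act_initial)
qed

end

text \<open>The function s \<mapsto> k1(t - s) k2(s) u interpolates between the two semigroups, and its derivative
 k1(t - s) (H2 - H1) k2(s) u only sees the rank one perturbation at x0. Interchanging the two
 generators changes the sign of c.\<close>

lemma duhamel:
 fixes x0 :: 'x
 assumes 1: "kernel_semigroup H1 C1 k1 b1" and 2: "kernel_semigroup H2 C2 k2 b2"
  and HH: "\<And>x y. H2 x y = H1 x y + c * of_bool (x = x0 \<and> y = x0)"
  and u: "\<And>y. \<bar>u y\<bar> \<le> B" and t: "0 \<le> t"
 shows "((\<lambda>s. c * k1 (t - s) x x0 * act k2 s u x0) has_integral (act k2 t u x - act k1 t u x)) {0..t}"
proof -
 interpret K1: kernel_semigroup H1 C1 k1 b1 by fact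
 interpret K2: kernel_semigroup H2 C2 k2 b2 by fact
 have B: "0 \<le> B" using u[of undefined] by linarith
 define B' where "B' = exp (b2 * t) * B"
 have B': "0 \<le> B'" using B by (simp add: B'_def)
 define G where "G s = act k1 (t - s) (act k2 s u) x" for s
 define g where "g s = c * k1 (t - s) x x0 * act k2 s u x0" for s
 define D1 where "D1 = C1^2 * exp (b1 * t) * B'"
 define D2 where "D2 = C2^2 * exp (b2 * t) * B'"
 define D where "D = exp (b1 * t) * (D2 + D1) + \<bar>c\<bar> * (C1 * exp (b1 * t)) * B'"
 have u2: "\<bar>act k2 s u y\<bar> \<le> B'" if "0 \<le> s" "s \<le> t" for s y
  unfolding B'_def by (rule K2.act_bound_upto) (use that u in auto)
 have gen2: "gen_op H2 v y = gen_op H1 v y + c * of_bool (y = x0) * v x0" if "\<And>y. \<bar>v y\<bar> \<le> B'" for v y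
 proof -
  have "((\<lambda>z. H1 y z * v z + c * of_bool (y = x0 \<and> z = x0) * v z) has_sum
    gen_op H1 v y + c * of_bool (y = x0) * v x0) UNIV"
  proof (rule has_sum_add)
   show "((\<lambda>z. H1 y z * v z) has_sum gen_op H1 v y) UNIV"
    unfolding gen_op_def by (rule has_sum_infsum[OF K1.gen_summable[OF that]])
   show "((\<lambda>z. c * of_bool (y = x0 \<and> z = x0) * v z) has_sum c * of_bool (y = x0) * v x0) UNIV"
    using infsum_single[of x0 "\<lambda>z. c * of_bool (y = x0 \<and> z = x0) * v z"] by (simp add: has_sum_iff)
  qed
  then show ?thesis unfolding gen_op_def HH by (simp add: infsumI distrib_right)
 qed
 have lip: "\<bar>k1 r x x0 - k1 r' x x0\<bar> \<le> C1 * exp (b1 * t) * (r - r')" if "0 \<le> r'" "r' \<le> r" "r \<le> t" for r r'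
 proof (rule increment_bound_from_derivative[where f="\<lambda>s. k1 s x x0" and f'="\<lambda>s. gen_op H1 (\<lambda>z. k1 s z x0) x"])
  show "((\<lambda>s. k1 s x x0) has_real_derivative gen_op H1 (\<lambda>z. k1 s z x0) x) (at s within {r'..r})" if "r' \<le> s" for s
   by (rule has_field_derivative_subset[OF K1.kernel_backward]) (use that \<open>0 \<le> r'\<close> in auto)
  show "\<bar>gen_op H1 (\<lambda>z. k1 s z x0) x\<bar> \<le> C1 * exp (b1 * t)" if "r' \<le> s" "s \<le> r" for s
   by (rule K1.gen_bound, rule K1.kernel_bound_upto) (use that \<open>0 \<le> r'\<close> \<open>r \<le> t\<close> in auto)
 qed (use that in auto)
 have inc: "\<bar>G r - G s - (r - s) * g s\<bar> \<le> D * (r - s)^2"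
  if "s \<in> {0..t}" "r \<in> {0..t}" "s < r" for s r
 proof -
  define h where "h = r - s"
  define v where "v = act k2 s u"
  have h: "0 \<le> h" "h \<le> t" "r = s + h" "0 \<le> t - r" using that by (auto simp: h_def)
  have ts: "t - s = (t - r) + h" by (simp add: h_def)
  have v: "\<bar>v y\<bar> \<le> B'" for y using u2 that by (auto simp: v_def)
  have v2: "\<bar>act k2 h v y\<bar> \<le> exp (b2 * t) * B'" for y by (rule K2.act_bound_upto) (use h v in auto)
  have v1: "\<bar>act k1 h v y\<bar> \<le> exp (b1 * t) * B'" for y by (rule K1.act_bound_upto) (use h v in auto)
  have "act k2 r u = act k2 h v"
  proof
   fix y show "act k2 r u y = act k2 h v y"
    using K2.act_semigroup[where u=u and B=B and s=h and t=s and x=y] u that h unfolding v_def h(3) by (simp add: add.commute)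
  qed
  then have "G r = act k1 (t - r) (act k2 h v) x" by (simp add: G_def)
  moreover have "G s = act k1 (t - s) v x" by (simp only: G_def v_def)
  then have "G s = act k1 (t - r) (act k1 h v) x"
   unfolding ts by (simp only: K1.act_semigroup[OF v h(4) h(1)])
  ultimately have "G r - G s - h * (c * v x0) * k1 (t - r) x x0
   = act k1 (t - r) (\<lambda>y. act k2 h v y - act k1 h v y) x - act k1 (t - r) (\<lambda>y. h * (c * v x0) * of_bool (y = x0)) x"
   by (simp only: K1.act_diff[OF h(4) v2 v1] K1.act_scale K1.act_delta)
  also have "\<dots> = act k1 (t - r) (\<lambda>y. (act k2 h v y - act k1 h v y) - h * (c * v x0) * of_bool (y = x0)) x"
  proof (rule K1.act_diff[symmetric, where B="exp (b2 * t) * B' + exp (b1 * t) * B'" and B'="\<bar>h * (c * v x0)\<bar>"])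
   show "\<bar>act k2 h v y - act k1 h v y\<bar> \<le> exp (b2 * t) * B' + exp (b1 * t) * B'" for y
    using v1[of y] v2[of y] by linarith
  qed (use h in auto)
  also have "\<bar>\<dots>\<bar> \<le> exp (b1 * t) * ((D2 + D1) * h^2)"
  proof (rule K1.act_bound_upto)
   fix y
   have "\<bar>act k2 h v y - v y - h * gen_op H2 v y\<bar> \<le> D2 * h^2"
    unfolding D2_def by (rule K2.small_time) (use v h in auto)
   moreover have "\<bar>act k1 h v y - v y - h * gen_op H1 v y\<bar> \<le> D1 * h^2"
    unfolding D1_def by (rule K1.small_time) (use v h in auto)
   moreover have "act k2 h v y - act k1 h v y - h * (c * v x0) * of_bool (y = x0)
    = (act k2 h v y - v y - h * gen_op H2 v y) - (act k1 h v y - v y - h * gen_op H1 v y)"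
    unfolding gen2[OF v] by (simp add: algebra_simps)
   ultimately show "\<bar>act k2 h v y - act k1 h v y - h * (c * v x0) * of_bool (y = x0)\<bar> \<le> (D2 + D1) * h^2"
    unfolding distrib_right by linarith
  qed (use that in auto)
  finally have e1: "\<bar>G r - G s - h * (c * v x0) * k1 (t - r) x x0\<bar> \<le> exp (b1 * t) * ((D2 + D1) * h^2)" .
  have "\<bar>h * (c * v x0) * k1 (t - r) x x0 - h * g s\<bar> = \<bar>c\<bar> * h * \<bar>v x0\<bar> * \<bar>k1 (t - s) x x0 - k1 (t - r) x x0\<bar>"
  proof -
   have "h * (c * v x0) * k1 (t - r) x x0 - h * g s = - (c * h * v x0 * (k1 (t - s) x x0 - k1 (t - r) x x0))"
    by (simp add: g_def v_def algebra_simps)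
   then show ?thesis using h(1) by (simp add: abs_mult)
  qed
  also have "\<dots> \<le> \<bar>c\<bar> * h * B' * (C1 * exp (b1 * t) * h)"
  proof (intro mult_mono)
   show "\<bar>k1 (t - s) x x0 - k1 (t - r) x x0\<bar> \<le> C1 * exp (b1 * t) * h"
    using lip[of "t - r" "t - s"] that by (simp add: h_def)
  qed (use v B' h(1) K1.C_nonneg in auto)
  finally have e2: "\<bar>h * (c * v x0) * k1 (t - r) x x0 - h * g s\<bar> \<le> \<bar>c\<bar> * (C1 * exp (b1 * t)) * B' * h^2"
   by (simp add: power2_eq_square algebra_simps)
  show ?thesis using e1 e2 unfolding D_def distrib_right h_def by (simp add: algebra_simps)
 qed
 have "(g has_integral (G t - G 0)) {0..t}"
 proof (rule fundamental_theorem_of_calculus)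
  fix s assume s: "s \<in> {0..t}"
  have "(G has_real_derivative g s) (at s within {0..t})"
  proof (rule derivative_from_increments[where \<eta>="\<lambda>h. D * h^2"])
   show "((\<lambda>h. D * h^2 / h) \<longlongrightarrow> 0) (at_right 0)" by (rule K1.quadratic_error_negligible)
   show "continuous_on {0..t} g" unfolding g_def
   proof (intro continuous_intros)
    show "continuous_on {0..t} (\<lambda>s. k1 (t - s) x x0)"
     by (rule continuous_on_compose2[OF K1.kernel_continuous]) (auto intro!: continuous_intros)
    show "continuous_on {0..t} (\<lambda>s. act k2 s u x0)"
     by (rule continuous_on_subset[OF K2.act_continuous]) (use u in auto)
   qed
  qed (use inc s in auto)
  then show "(G has_vector_derivative g s) (at s within {0..t})"
   by (simp add: has_real_derivative_iff_has_vector_derivative)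
 qed (rule t)
 then show ?thesis by (simp add: G_def g_def[abs_def] K1.act_initial_fun K2.act_initial_fun)
qed

section \<open>From infinitesimal jump rates to the backward equation\<close>

lemma pmf_has_sum: "(pmf p has_sum 1) UNIV"
proof -
 have "pmf p summable_on UNIV"
  using abs_summable_equivalent[THEN iffD2, OF pmf_abs_summable[of p UNIV]] by simp
 moreover have "infsum (pmf p) UNIV = 1"
  using infsetsum_pmf_eq_1[of p UNIV] infsetsum_infsum[OF pmf_abs_summable[of p UNIV]] by simp
 ultimately show ?thesis by (simp add: has_sum_iff)
qed

lemma pmf_expectation_infsum:
 fixes g :: "'a => real"
 assumes "\<And>x. \<bar>g x\<bar> \<le> B"
 shows "pmf_mean p g = (\<Sum>\<^sub>\<infinity>x. pmf p x * g x)"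
proof -
 have "(\<lambda>x. \<bar>pmf p x * g x\<bar>) summable_on UNIV"
  by (rule summable_mult_bounded(1)[where B=B]) (use pmf_has_sum assms in \<open>auto simp: summable_on_def\<close>)
 then have "Infinite_Set_Sum.abs_summable_on (\<lambda>x. pmf p x * g x) UNIV"
  by (intro abs_summable_equivalent[THEN iffD1]) simp
 from infsetsum_infsum[OF this] show ?thesis by (simp add: pmf_expectation_eq_infsetsum)
qed

text \<open>Scheffe's argument: the rates, given for each state separately, hold uniformly over all test
 functions. The errors sum to 0 and are at least - h q off x, so their absolute sum is controlled by
 finitely many of them and the tail of the sum of q.\<close>

lemma small_time_total_variation:
 fixes Q :: "real => 'a pmf" and q :: "'a => real"
 assumes q_nonneg: "\<And>\<xi>. \<xi> \<noteq> x ==> 0 \<le> q \<xi>" and q_sum: "(q has_sum 0) UNIV"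
  and rate: "\<And>\<xi>. \<xi> = x \<or> q \<xi> \<noteq> 0 ==>
   (\<lambda>h. pmf (Q h) \<xi> - (of_bool (\<xi> = x) + q \<xi> * h)) \<in> o[at_right 0](\<lambda>h. h)"
 shows "\<exists>\<eta>. ((\<lambda>h. \<eta> h / h) \<longlongrightarrow> 0) (at_right 0) \<and>
  (\<forall>h>0. \<forall>g. (\<forall>\<xi>. \<bar>g \<xi>\<bar> \<le> 1) \<longrightarrow>
   \<bar>pmf_mean (Q h) g - g x - h * (\<Sum>\<^sub>\<infinity>\<xi>. q \<xi> * g \<xi>)\<bar> \<le> \<eta> h)"
proof -
 define e where "e h \<xi> = pmf (Q h) \<xi> - (of_bool (\<xi> = x) + q \<xi> * h)" for h \<xi>
 have qs: "q summable_on UNIV" using q_sum by (auto simp: summable_on_def)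
 have qabs: "(\<lambda>\<xi>. \<bar>q \<xi>\<bar>) summable_on UNIV"
  using summable_on_iff_abs_summable_on_real[THEN iffD1, OF qs] by simp
 have dx: "((\<lambda>\<xi>. of_bool (\<xi> = x) :: real) has_sum 1) UNIV"
  using infsum_single[of x "\<lambda>\<xi>. of_bool (\<xi> = x) :: real"] by (simp add: has_sum_iff)
 have e_sum: "(e h has_sum 0) UNIV" for h
 proof -
  have "((\<lambda>\<xi>. - (of_bool (\<xi> = x) + q \<xi> * h)) has_sum - (1 + 0 * h)) UNIV"
   unfolding has_sum_uminus using has_sum_add[OF dx has_sum_cmult_left[OF q_sum, of h]] by simp
  from has_sum_add[OF pmf_has_sum this, of "Q h"] show ?thesis
   by (simp add: e_def[abs_def] diff_conv_add_uminus del: minus_add_distrib add_uminus_conv_diff)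
 qed
 have e_s: "e h summable_on UNIV" for h using e_sum by (auto simp: summable_on_def)
 have e_abs: "(\<lambda>\<xi>. \<bar>e h \<xi>\<bar>) summable_on UNIV" for h
  using summable_on_iff_abs_summable_on_real[THEN iffD1, OF e_s] by simp
 define \<eta> where "\<eta> h = (\<Sum>\<^sub>\<infinity>\<xi>. \<bar>e h \<xi>\<bar>)" for h
 have \<eta>_nonneg: "0 \<le> \<eta> h" for h unfolding \<eta>_def by (intro infsum_nonneg) auto
 have bound: "\<eta> h \<le> 2 * (\<Sum>\<xi>\<in>F. \<bar>e h \<xi>\<bar>) + 2 * h * (\<Sum>\<^sub>\<infinity>\<xi>\<in>-F. \<bar>q \<xi>\<bar>)"
  if F: "finite F" "x \<in> F" and h: "h > 0" for F h
 proof -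
  have sF: "f summable_on -F" if "f summable_on UNIV" for f :: "'a => real"
   by (rule summable_on_subset_banach[OF that]) auto
  have split: "infsum f UNIV = sum f F + infsum f (-F)" if "f summable_on UNIV" for f :: "'a => real"
   using infsum_Un_disjoint[of f F "-F"] sF[OF that] F by (simp add: Compl_partition)
  have "(\<Sum>\<^sub>\<infinity>\<xi>\<in>-F. \<bar>e h \<xi>\<bar>) \<le> (\<Sum>\<^sub>\<infinity>\<xi>\<in>-F. e h \<xi> + \<bar>q \<xi>\<bar> * (2 * h))"
  proof (rule infsum_mono)
   show "(\<lambda>\<xi>. e h \<xi> + \<bar>q \<xi>\<bar> * (2 * h)) summable_on -F"
    by (intro summable_on_add summable_on_cmult_left sF e_s qabs)
   fix \<xi> assume "\<xi> \<in> -F"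
   then have "\<xi> \<noteq> x" using F by auto
   then have "e h \<xi> \<ge> - (\<bar>q \<xi>\<bar> * h)" using pmf_nonneg[of "Q h" \<xi>] q_nonneg[of \<xi>] by (simp add: e_def)
   then show "\<bar>e h \<xi>\<bar> \<le> e h \<xi> + \<bar>q \<xi>\<bar> * (2 * h)" using h by (simp add: abs_if)
  qed (rule sF[OF e_abs])
  also have "\<dots> = infsum (e h) (-F) + (\<Sum>\<^sub>\<infinity>\<xi>\<in>-F. \<bar>q \<xi>\<bar>) * (2 * h)"
   by (subst infsum_add[OF sF[OF e_s] summable_on_cmult_left[OF sF[OF qabs]]]) (simp add: infsum_cmult_left')
  also have "infsum (e h) (-F) = - sum (e h) F"
   using split[OF e_s, of h] infsumI[OF e_sum, of h] by simp
  finally have "(\<Sum>\<^sub>\<infinity>\<xi>\<in>-F. \<bar>e h \<xi>\<bar>) \<le> (\<Sum>\<xi>\<in>F. \<bar>e h \<xi>\<bar>) + 2 * h * (\<Sum>\<^sub>\<infinity>\<xi>\<in>-F. \<bar>q \<xi>\<bar>)"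
   using sum_abs[of "e h" F] by (simp add: abs_le_iff algebra_simps)
  then show ?thesis using split[OF e_abs, of h] unfolding \<eta>_def by simp
 qed
 have lim: "((\<lambda>h. \<eta> h / h) \<longlongrightarrow> 0) (at_right 0)"
 proof (rule tendstoI)
  fix \<epsilon> :: real assume \<epsilon>: "\<epsilon> > 0"
  obtain F0 where F0: "finite F0" "dist (\<Sum>\<xi>\<in>F0. \<bar>q \<xi>\<bar>) (\<Sum>\<^sub>\<infinity>\<xi>. \<bar>q \<xi>\<bar>) \<le> \<epsilon>/8"
   using infsum_finite_approximation[OF qabs, of "\<epsilon>/8"] \<epsilon> by auto
  define F where "F = insert x {\<xi>\<in>F0. q \<xi> \<noteq> 0}"
  have F: "finite F" "x \<in> F" using F0 by (auto simp: F_def)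
  have tail: "(\<Sum>\<^sub>\<infinity>\<xi>\<in>-F. \<bar>q \<xi>\<bar>) \<le> \<epsilon>/8"
  proof -
   have sub: "(\<lambda>\<xi>. \<bar>q \<xi>\<bar>) summable_on A" for A by (rule summable_on_subset_banach[OF qabs]) auto
   have "(\<Sum>\<^sub>\<infinity>\<xi>\<in>-F. \<bar>q \<xi>\<bar>) \<le> (\<Sum>\<^sub>\<infinity>\<xi>\<in>-F0. \<bar>q \<xi>\<bar>)"
    by (rule infsum_mono_neutral[OF sub sub]) (auto simp: F_def)
   also have "\<dots> = (\<Sum>\<^sub>\<infinity>\<xi>. \<bar>q \<xi>\<bar>) - (\<Sum>\<xi>\<in>F0. \<bar>q \<xi>\<bar>)"
    using infsum_Diff[OF qabs sub, of F0] F0 by (simp add: Compl_eq_Diff_UNIV)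
   also have "\<dots> \<le> \<epsilon>/8" using F0(2) unfolding dist_real_def by linarith
   finally show ?thesis .
  qed
  have "((\<lambda>h. \<Sum>\<xi>\<in>F. \<bar>e h \<xi> / h\<bar>) \<longlongrightarrow> (\<Sum>\<xi>\<in>F. \<bar>0\<bar>)) (at_right 0)"
  proof (intro tendsto_sum tendsto_rabs)
   fix \<xi> assume "\<xi> \<in> F"
   then have "e h \<xi> = e h \<xi> \<and> (\<xi> = x \<or> q \<xi> \<noteq> 0)" for h by (auto simp: F_def)
   then have "(\<lambda>h. e h \<xi>) \<in> o[at_right 0](\<lambda>h. h)" unfolding e_def using rate by blast
   from smalloD_tendsto[OF this] show "((\<lambda>h. e h \<xi> / h) \<longlongrightarrow> 0) (at_right 0)" .
  qed
  then have "\<forall>\<^sub>F h in at_right 0. (\<Sum>\<xi>\<in>F. \<bar>e h \<xi> / h\<bar>) < \<epsilon>/8"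
   by (rule order_tendstoD) (use \<epsilon> in simp)
  moreover have "\<forall>\<^sub>F h in at_right (0::real). h > 0" by (simp add: eventually_at_filter)
  ultimately show "\<forall>\<^sub>F h in at_right 0. dist (\<eta> h / h) 0 < \<epsilon>"
  proof eventually_elim
   case (elim h)
   have "(\<Sum>\<xi>\<in>F. \<bar>e h \<xi> / h\<bar>) = (\<Sum>\<xi>\<in>F. \<bar>e h \<xi>\<bar>) / h"
    using elim by (simp add: sum_divide_distrib)
   then have "(\<Sum>\<xi>\<in>F. \<bar>e h \<xi>\<bar>) < \<epsilon>/8 * h" using elim by (simp add: pos_divide_less_eq)
   moreover have "2 * h * (\<Sum>\<^sub>\<infinity>\<xi>\<in>-F. \<bar>q \<xi>\<bar>) \<le> 2 * h * (\<epsilon>/8)"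
    using tail elim by (intro mult_left_mono) auto
   ultimately have "\<eta> h < \<epsilon> * h" using bound[OF F elim(2)] mult_pos_pos[OF \<epsilon> elim(2)] by (simp add: mult.commute)
   then show ?case using \<eta>_nonneg[of h] elim by (simp add: dist_real_def pos_divide_less_eq)
  qed
 qed
 moreover have "\<bar>pmf_mean (Q h) g - g x - h * (\<Sum>\<^sub>\<infinity>\<xi>. q \<xi> * g \<xi>)\<bar> \<le> \<eta> h"
  if h: "h > 0" and g: "\<And>\<xi>. \<bar>g \<xi>\<bar> \<le> 1" for h g
 proof -
  have 1: "((\<lambda>\<xi>. pmf (Q h) \<xi> * g \<xi>) has_sum pmf_mean (Q h) g) UNIV"
   unfolding pmf_expectation_infsum[OF g]
   by (rule has_sum_infsum, rule summable_mult_bounded(2)[where B=1])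
    (use pmf_has_sum g in \<open>auto simp: summable_on_def\<close>)
  have 2: "((\<lambda>\<xi>. of_bool (\<xi> = x) * g \<xi>) has_sum g x) UNIV"
   using infsum_single[of x "\<lambda>\<xi>. of_bool (\<xi> = x) * g \<xi>"] by (simp add: has_sum_iff)
  have 3: "((\<lambda>\<xi>. q \<xi> * g \<xi>) has_sum (\<Sum>\<^sub>\<infinity>\<xi>. q \<xi> * g \<xi>)) UNIV"
   by (rule has_sum_infsum, rule summable_mult_bounded(2)[OF qabs g])
  have "((\<lambda>\<xi>. (pmf (Q h) \<xi> * g \<xi> + - (of_bool (\<xi> = x) * g \<xi>)) + - (h * (q \<xi> * g \<xi>))) has_sum
    (pmf_mean (Q h) g + - g x) + - (h * (\<Sum>\<^sub>\<infinity>\<xi>. q \<xi> * g \<xi>))) UNIV"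
   using 1 2 3 by (intro has_sum_add) (auto simp: has_sum_uminus intro!: has_sum_cmult_right)
  then have "((\<lambda>\<xi>. e h \<xi> * g \<xi>) has_sum
    pmf_mean (Q h) g - g x - h * (\<Sum>\<^sub>\<infinity>\<xi>. q \<xi> * g \<xi>)) UNIV"
   by (simp add: e_def algebra_simps)
  then have "pmf_mean (Q h) g - g x - h * (\<Sum>\<^sub>\<infinity>\<xi>. q \<xi> * g \<xi>) = (\<Sum>\<^sub>\<infinity>\<xi>. e h \<xi> * g \<xi>)"
   by (simp add: infsumI)
  also have "\<bar>\<dots>\<bar> \<le> (\<Sum>\<^sub>\<infinity>\<xi>. \<bar>e h \<xi>\<bar>) * 1"
   by (rule summable_mult_bounded(3)[OF e_abs g])
  finally show ?thesis by (simp add: \<eta>_def)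
 qed
 ultimately show ?thesis by blast
qed

text \<open>The Markov property splits off a first step of length h, whose law is known up to o(h) in
 total variation. Continuity comes first and for one state, since the derivative is a sum over all
 states and its continuity requires that of every term.\<close>

lemma backward_equation:
 fixes Q :: "real => 'a pmf" and q :: "'a => real" and \<Phi> :: "real => 'a => real"
 assumes q_nonneg: "\<And>\<xi>. \<xi> \<noteq> x ==> 0 \<le> q \<xi>" and q_sum: "(q has_sum 0) UNIV"
  and rate: "\<And>\<xi>. \<xi> = x \<or> q \<xi> \<noteq> 0 ==>
   (\<lambda>h. pmf (Q h) \<xi> - (of_bool (\<xi> = x) + q \<xi> * h)) \<in> o[at_right 0](\<lambda>h. h)"
  and bounded: "\<And>t \<xi>. 0 \<le> t ==> \<bar>\<Phi> t \<xi>\<bar> \<le> 1"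
  and markov: "\<And>s h. 0 \<le> s ==> 0 \<le> h ==> \<Phi> (s + h) x = pmf_mean (Q h) (\<Phi> s)"
 shows "continuous_on {0..} (\<lambda>t. \<Phi> t x)"
  and "(\<And>\<xi>. continuous_on {0..} (\<lambda>t. \<Phi> t \<xi>)) ==> 0 \<le> t ==>
   ((\<lambda>t. \<Phi> t x) has_real_derivative (\<Sum>\<^sub>\<infinity>\<xi>. q \<xi> * \<Phi> t \<xi>)) (at t within {0..})"
proof -
 obtain \<eta> where \<eta>: "((\<lambda>h. \<eta> h / h) \<longlongrightarrow> 0) (at_right 0)"
  and inc: "\<And>h g. h > 0 ==> (\<And>\<xi>. \<bar>g \<xi>\<bar> \<le> 1) ==>
   \<bar>pmf_mean (Q h) g - g x - h * (\<Sum>\<^sub>\<infinity>\<xi>. q \<xi> * g \<xi>)\<bar> \<le> \<eta> h"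
  using small_time_total_variation[of x q Q, OF q_nonneg q_sum rate] by blast
 have "q summable_on UNIV" using q_sum by (auto simp: summable_on_def)
 then have qabs: "(\<lambda>\<xi>. \<bar>q \<xi>\<bar>) summable_on UNIV"
  using summable_on_iff_abs_summable_on_real[THEN iffD1, of q UNIV] by simp
 define S where "S = (\<Sum>\<^sub>\<infinity>\<xi>. \<bar>q \<xi>\<bar>)"
 have step: "\<bar>\<Phi> t x - \<Phi> s x - (t - s) * (\<Sum>\<^sub>\<infinity>\<xi>. q \<xi> * \<Phi> s \<xi>)\<bar> \<le> \<eta> (t - s)" if "0 \<le> s" "s < t" for s t
  using inc[of "t - s" "\<Phi> s"] markov[of s "t - s"] bounded[of s] that by simp
 have sum_le: "\<bar>\<Sum>\<^sub>\<infinity>\<xi>. q \<xi> * \<Phi> s \<xi>\<bar> \<le> S" if "0 \<le> s" for s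
  using summable_mult_bounded(3)[OF qabs, of "\<Phi> s" 1] bounded[OF that] by (simp add: S_def)
 show cont: "continuous_on {0..} (\<lambda>t. \<Phi> t x)"
  unfolding continuous_on_def
 proof
  fix t :: real assume t: "t \<in> {0..}"
  define m where "m h = \<bar>\<eta> h / h\<bar> * h + h * S" for h
  have "((\<lambda>h. \<bar>\<eta> h / h\<bar> * h + h * S) \<longlongrightarrow> \<bar>0\<bar> * 0 + 0 * S) (at_right 0)"
   by (intro tendsto_intros \<eta>)
  then have m: "(m \<longlongrightarrow> 0) (at_right 0)" by (simp add: m_def[abs_def])
  have "filterlim (\<lambda>y. \<bar>y - t\<bar>) (at_right 0) (at t within {0..})"
   unfolding filterlim_at
  proof
   have "((\<lambda>y. \<bar>y - t\<bar>) \<longlongrightarrow> \<bar>t - t\<bar>) (at t within {0..})" by (intro tendsto_intros)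
   then show "((\<lambda>y. \<bar>y - t\<bar>) \<longlongrightarrow> 0) (at t within {0..})" by simp
   show "\<forall>\<^sub>F y in at t within {0..}. \<bar>y - t\<bar> \<in> {0<..} \<and> \<bar>y - t\<bar> \<noteq> 0"
    unfolding eventually_at_filter by auto
  qed
  from filterlim_compose[OF m this] have lim: "((\<lambda>y. m \<bar>y - t\<bar>) \<longlongrightarrow> 0) (at t within {0..})" .
  have le: "\<bar>\<Phi> r x - \<Phi> s x\<bar> \<le> m (r - s)" if "0 \<le> s" "s < r" for r s
  proof -
   have "\<bar>(r - s) * (\<Sum>\<^sub>\<infinity>\<xi>. q \<xi> * \<Phi> s \<xi>)\<bar> \<le> (r - s) * S"
    using sum_le[OF that(1)] that by (simp add: abs_mult)
   moreover have "\<eta> (r - s) \<le> \<bar>\<eta> (r - s) / (r - s)\<bar> * (r - s)" using that by simp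
   ultimately show ?thesis using step[OF that] unfolding m_def by linarith
  qed
  have "((\<lambda>y. \<Phi> y x - \<Phi> t x) \<longlongrightarrow> 0) (at t within {0..})"
  proof (rule Lim_null_comparison[OF _ lim])
   have "norm (\<Phi> y x - \<Phi> t x) \<le> m \<bar>y - t\<bar>" if "y \<in> {0..}" "y \<noteq> t" for y
   proof (cases "t < y")
    case True then show ?thesis using le[of t y] t by simp
   next
    case False then show ?thesis using le[of y t] that by (simp add: abs_minus_commute)
   qed
   then show "\<forall>\<^sub>F y in at t within {0..}. norm (\<Phi> y x - \<Phi> t x) \<le> m \<bar>y - t\<bar>"
    unfolding eventually_at_filter by auto
  qed
  then show "((\<lambda>t. \<Phi> t x) \<longlongrightarrow> \<Phi> t x) (at t within {0..})" by (simp add: LIM_zero_iff)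
 qed
 show "((\<lambda>t. \<Phi> t x) has_real_derivative (\<Sum>\<^sub>\<infinity>\<xi>. q \<xi> * \<Phi> t \<xi>)) (at t within {0..})"
  if c: "\<And>\<xi>. continuous_on {0..} (\<lambda>t. \<Phi> t \<xi>)" and t: "0 \<le> t"
 proof (rule derivative_from_increments[OF _ \<eta>])
  show "continuous_on {0..} (\<lambda>t. \<Sum>\<^sub>\<infinity>\<xi>. q \<xi> * \<Phi> t \<xi>)"
  proof (rule continuous_on_infsum_dominated[where M="\<lambda>\<xi>. \<bar>q \<xi>\<bar>"])
   show "\<bar>q \<xi> * \<Phi> t \<xi>\<bar> \<le> \<bar>q \<xi>\<bar>" if "t \<in> {0..}" for t \<xi>
    using bounded[of t \<xi>] that mult_left_mono[of "\<bar>\<Phi> t \<xi>\<bar>" 1 "\<bar>q \<xi>\<bar>"] by (simp add: abs_mult)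
  qed (auto intro!: continuous_intros c qabs)
 qed (use step t in auto)
qed

section \<open>Fourier representation of the heat kernel of the walk\<close>

definition lat :: "int ^ 'd => real ^ 'd" where
 "lat z = (\<chi> i. real_of_int (z $ i))"

lemma lat_simps [simp]: "lat 0 = 0" "lat (x + y) = lat x + lat y" "lat (- x) = - lat x" "lat (x - y) = lat x - lat y"
 by (auto simp: lat_def vec_eq_iff)

lemma norm_lat: "norm (lat z) = lattice_norm z"
 by (simp add: lat_def lattice_norm_def)

abbreviation torus :: "(real ^ 'd) set" where
 "torus \<equiv> cbox (\<chi> i. - pi) (\<chi> i. pi)"

definition symb :: "(int ^ 'd => real) => real ^ 'd => real" where
 "symb a \<theta> = (\<Sum>\<^sub>\<infinity>z. a z * cos (\<theta> \<bullet> lat z))"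

definition heat :: "(int ^ 'd => real) => real => int ^ 'd => real" where
 "heat a t z = integral torus (\<lambda>\<theta>. exp (t * symb a \<theta>) * cos (\<theta> \<bullet> lat z)) / (2 * pi) ^ CARD('d)"

definition walk_rate :: "(int ^ 'd => real) => int ^ 'd => int ^ 'd => real" where
 "walk_rate a x y = a (y - x)"

abbreviation walk_gen :: "(int ^ 'd => real) => (int ^ 'd => real) => int ^ 'd => real" where
 "walk_gen a \<equiv> gen_op (walk_rate a)"

lemma integral_cis_interval:
 "(\<integral>x. indicator {-pi..pi} x *\<^sub>R cis (x * real_of_int m) \<partial>lborel) = of_bool (m = 0) * (2 * pi)"
proof (cases "m = 0")
 case True
 have "(\<integral>x. indicator {-pi..pi} x *\<^sub>R (1::complex) \<partial>lborel) = measure lborel {-pi..pi} *\<^sub>R 1"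
  by (subst integral_scaleR_left) auto
 then show ?thesis using True by (simp add: scaleR_conv_of_real)
next
 case False
 define F where "F x = cis (x * real_of_int m) / (\<i> * of_int m)" for x
 have key: "- (\<i> * (E * \<i>)) = E" for E by (simp add: complex_eq_iff)
 have "(F has_vector_derivative cis (x * real_of_int m)) (at x within {-pi..pi})" for x
 proof -
  have "((\<lambda>x. exp (\<i> * of_real (x * real_of_int m)) / (\<i> * of_int m)) has_vector_derivative exp (\<i> * of_real (x * real_of_int m))) (at x within {-pi..pi})"
   using False
   by (auto intro!: derivative_eq_intros has_vector_derivative_real_field simp: has_vector_derivative_def[symmetric] key)
  then show ?thesis unfolding F_def cis_conv_exp .
 qed
 then have "(\<integral>x. indicator {-pi..pi} x *\<^sub>R cis (x * real_of_int m) \<partial>lborel) = F pi - F (-pi)"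
  by (intro integral_FTC_Icc) (auto intro!: continuous_intros)
 also have "cis (pi * real_of_int m) = cis (- pi * real_of_int m)"
  by (simp add: complex_eq_iff)
 then have "F pi - F (-pi) = 0" by (simp add: F_def)
 finally show ?thesis using False by simp
qed

interpretation lborel_product: product_sigma_finite "\<lambda>_. lborel :: real measure"
 by standard

lemma lborel_integral_prod:
 fixes g :: "'a::euclidean_space => real => complex"
 assumes g: "\<And>b. b \<in> Basis ==> integrable lborel (g b)"
 shows "(\<integral>x. (\<Prod>b\<in>Basis. g b (x \<bullet> b)) \<partial>lborel) = (\<Prod>b\<in>Basis. \<integral>x. g b x \<partial>lborel)"
proof -
 have [measurable]: "g b \<in> borel_measurable borel" if "b \<in> Basis" for b
  using borel_measurable_integrable[OF g[OF that]] by simp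
 have "(\<integral>x. (\<Prod>b\<in>Basis. g b (x \<bullet> b)) \<partial>lborel)
   = (\<integral>f. (\<Prod>b\<in>Basis. g b ((\<Sum>b'\<in>Basis. f b' *\<^sub>R b') \<bullet> b)) \<partial>(\<Pi>\<^sub>M b\<in>(Basis::'a set). lborel))"
  unfolding lborel_def[where 'a='a] lborel_eq_real by (subst integral_distr) (auto)
 also have "\<dots> = (\<integral>f. (\<Prod>b\<in>Basis. g b (f b)) \<partial>(\<Pi>\<^sub>M b\<in>(Basis::'a set). lborel))"
  by (intro Bochner_Integration.integral_cong refl prod.cong)  simp_all
 also have "\<dots> = (\<Prod>b\<in>Basis. \<integral>x. g b x \<partial>lborel)"
  by (rule lborel_product.product_integral_prod) (auto intro: g)
 finally show ?thesis .
qed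

lemma cis_sum: "finite A ==> (\<Prod>b\<in>A. cis (h b)) = cis (\<Sum>b\<in>A. h b)"
 by (induction A rule: finite_induct) (simp_all add: cis_mult)

text \<open>Orthogonality of the characters, from the product of the one-dimensional integrals.\<close>

lemma integral_torus_cos:
 "integral torus (\<lambda>\<theta>::real^'d. cos (\<theta> \<bullet> lat z)) = of_bool (z = 0) * (2 * pi) ^ CARD('d)"
proof -
 define g :: "real^'d => real => complex" where "g b x = indicator {-pi..pi} x *\<^sub>R cis (x * (lat z \<bullet> b))" for b x
 have prod: "(\<Prod>b\<in>Basis. g b (\<theta> \<bullet> b)) = indicator torus \<theta> *\<^sub>R cis (\<theta> \<bullet> lat z)" for \<theta> :: "real^'d"
 proof -
  have "(\<Prod>b\<in>Basis. indicator {-pi..pi} (\<theta> \<bullet> b)) = (indicator torus \<theta> :: real)"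
  proof -
   have iff: "\<theta> \<in> torus \<longleftrightarrow> (\<forall>b\<in>Basis. \<theta> \<bullet> b \<in> {-pi..pi})"
    by (auto simp: mem_box Basis_vec_def inner_axis)
   show ?thesis
   proof (cases "\<theta> \<in> torus")
    case True
    with iff have "\<theta> \<bullet> b \<in> {-pi..pi}" if "b \<in> Basis" for b using that by blast
    then have "indicator {-pi..pi} (\<theta> \<bullet> b) = (1::real)" if "b \<in> Basis" for b
     using that by (simp only: indicator_simps)
    then show ?thesis using True by simp
   next
    case False
    with iff obtain b where b: "b \<in> Basis" "\<theta> \<bullet> b \<notin> {-pi..pi}" by blast
    then have "indicator {-pi..pi} (\<theta> \<bullet> b) = (0::real)" by (simp only: indicator_simps not_False_eq_True)
    with b have "(\<Prod>b\<in>Basis. indicator {-pi..pi} (\<theta> \<bullet> b)) = (0::real)"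
     by (intro prod_zero) (auto intro!: bexI[OF _ b(1)])
    then show ?thesis using False by simp
   qed
  qed
  moreover have "(\<Prod>b\<in>Basis. cis ((\<theta> \<bullet> b) * (lat z \<bullet> b))) = cis (\<theta> \<bullet> lat z)"
   unfolding euclidean_inner[of \<theta> "lat z"] by (rule cis_sum) simp
  moreover have "(\<Prod>b\<in>Basis. g b (\<theta> \<bullet> b)) = (\<Prod>b\<in>Basis. indicator {-pi..pi} (\<theta> \<bullet> b)) *\<^sub>R (\<Prod>b\<in>Basis. cis ((\<theta> \<bullet> b) * (lat z \<bullet> b)))"
   by (simp add: g_def scaleR_conv_of_real prod.distrib)
  ultimately show ?thesis by simp
 qed
 have gi: "integrable lborel (g b)" for b
  unfolding g_def by (intro borel_integrable_compact[of "{-pi..pi}"] continuous_intros) auto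
 have "(\<integral>\<theta>. indicator torus \<theta> *\<^sub>R cis (\<theta> \<bullet> lat z) \<partial>lborel) = (\<Prod>b\<in>(Basis::(real^'d) set). \<integral>x. g b x \<partial>lborel)"
  using lborel_integral_prod[of g] gi by (simp add: prod)
 also have "\<dots> = (\<Prod>i\<in>UNIV. of_bool (z $ i = 0) * (2 * pi))"
 proof -
  have B: "(Basis::(real^'d) set) = (\<lambda>i. axis i 1) ` UNIV" by (auto simp: Basis_vec_def)
  have inj: "inj_on (\<lambda>i::'d. axis i (1::real)) UNIV" by (auto simp: inj_on_def axis_eq_axis)
  have "(\<integral>x. g (axis i 1) x \<partial>lborel) = of_bool (z $ i = 0) * (2 * pi)" for i
   using integral_cis_interval[of "z $ i"] by (simp add: g_def inner_axis lat_def)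
  then show ?thesis unfolding B prod.reindex[OF inj] by simp
 qed
 also have "\<dots> = complex_of_real (of_bool (z = 0) * (2 * pi) ^ CARD('d))"
 proof (cases "z = 0")
  case False
  then obtain i where "z $ i \<noteq> 0" by (auto simp: vec_eq_iff)
  then have "(\<Prod>i\<in>UNIV. of_bool (z $ i = 0) * (2 * pi)) = (0::real)"
   by (intro prod_zero) auto
  then show ?thesis using False by simp
 qed simp
 finally have c: "(\<integral>\<theta>. indicator torus \<theta> *\<^sub>R cis (\<theta> \<bullet> lat z) \<partial>lborel) = complex_of_real (of_bool (z = 0) * (2 * pi) ^ CARD('d))" .
 have ic: "integrable lborel (\<lambda>\<theta>::real^'d. indicator torus \<theta> *\<^sub>R cis (\<theta> \<bullet> lat z))"
  by (intro borel_integrable_compact continuous_intros) auto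
 have "(\<integral>\<theta>. Re (indicator torus \<theta> *\<^sub>R cis (\<theta> \<bullet> lat z)) \<partial>lborel) = of_bool (z = 0) * (2 * pi) ^ CARD('d)"
  using integral_Re[OF ic] c by simp
 then have "(LINT \<theta>:torus|lborel. cos (\<theta> \<bullet> lat z)) = of_bool (z = 0) * (2 * pi) ^ CARD('d)"
  by (simp add: set_lebesgue_integral_def)
 moreover have "(LINT \<theta>:torus|lborel. cos (\<theta> \<bullet> lat z)) = integral torus (\<lambda>\<theta>::real^'d. cos (\<theta> \<bullet> lat z))"
  by (rule set_borel_integral_eq_integral(2))
   (use integrable_Re[OF ic] in \<open>simp add: set_integrable_def\<close>)
 ultimately show ?thesis by simp
qed

context walk_intensity
begin

definition mass :: real where "mass = (\<Sum>\<^sub>\<infinity>z. \<bar>a z\<bar>)"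

lemma a_summable: "a summable_on UNIV" "(\<lambda>z. \<bar>a z\<bar>) summable_on UNIV"
proof -
 show 1: "a summable_on UNIV" using regular by (auto simp: summable_on_def)
 show "(\<lambda>z. \<bar>a z\<bar>) summable_on UNIV"
  using summable_on_iff_abs_summable_on_real[THEN iffD1, OF 1] by simp
qed

lemma shift_bij: "bij_betw (\<lambda>v. x + v) UNIV (UNIV :: (int^'d) set)"
 by (rule bij_betwI[of _ _ _ "\<lambda>y. y - x"]) auto

lemma walk_rate_infsum:
 fixes u :: "int^'d => real"
 shows "(\<Sum>\<^sub>\<infinity>y. f (y - x) * u y) = (\<Sum>\<^sub>\<infinity>v. f v * u (x + v))"
 using infsum_reindex_bij_betw[OF shift_bij[of x], of "\<lambda>y. f (y - x) * u y"] by simp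

lemma generator_walk_rate: "generator (walk_rate a) mass"
proof
 show "0 \<le> walk_rate a x y" if "x \<noteq> y" for x y using that nonneg[of "y - x"] by (simp add: walk_rate_def)
 show "walk_rate a x y = walk_rate a y x" for x y using symmetric[of "y - x"] by (simp add: walk_rate_def)
 show "(\<lambda>y. \<bar>walk_rate a x y\<bar>) summable_on UNIV" for x
  using summable_on_reindex_bij_betw[OF shift_bij[of x], of "\<lambda>y. \<bar>a (y - x)\<bar>"] a_summable by (simp add: walk_rate_def)
 show "(\<Sum>\<^sub>\<infinity>y. \<bar>walk_rate a x y\<bar>) \<le> mass" for x
  using walk_rate_infsum[of "\<lambda>v. \<bar>a v\<bar>" x "\<lambda>_. 1"] by (simp add: walk_rate_def mass_def)
qed

lemma gen_walk: "walk_gen a u x = (\<Sum>\<^sub>\<infinity>v. a v * u (x + v))"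
 unfolding gen_op_def walk_rate_def by (rule walk_rate_infsum)

lemma cos_sum_uniform:
 "uniform_limit S (\<lambda>X \<theta>. \<Sum>z\<in>X. a z * cos (\<theta> \<bullet> lat z)) (symb a) (finite_subsets_at_top UNIV)"
 unfolding symb_def[abs_def]
 by (rule Weierstrass_m_test_general[OF _ a_summable(2)]) (simp add: abs_mult mult_left_le)

lemma symb_continuous: "continuous_on S (symb a)"
proof (rule uniform_limit_theorem[OF _ cos_sum_uniform])
 show "\<forall>\<^sub>F X in finite_subsets_at_top UNIV. continuous_on S (\<lambda>\<theta>. \<Sum>z\<in>X. a z * cos (\<theta> \<bullet> lat z))"
  by (intro always_eventually allI continuous_intros)
qed simp

lemma symb_bound: "\<bar>symb a \<theta>\<bar> \<le> mass"
 using summable_mult_bounded(3)[OF a_summable(2), of "\<lambda>z. cos (\<theta> \<bullet> lat z)" 1] by (simp add: symb_def mass_def)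

lemma symb_summable: "(\<lambda>z. a z * cos (\<theta> \<bullet> lat z)) summable_on UNIV"
 by (rule summable_mult_bounded(2)[OF a_summable(2), of _ 1]) simp

lemma symb_has_sum: "((\<lambda>z. a z * (1 - cos (\<theta> \<bullet> lat z))) has_sum - symb a \<theta>) UNIV"
proof -
 have "((\<lambda>z. a z + - (a z * cos (\<theta> \<bullet> lat z))) has_sum 0 + - symb a \<theta>) UNIV"
  unfolding symb_def by (intro has_sum_add regular has_sum_uminus[THEN iffD2]) (simp add: symb_summable)
 then show ?thesis by (simp add: algebra_simps)
qed

lemma symb_nonpos: "symb a \<theta> \<le> 0"
proof -
 have "0 \<le> - symb a \<theta>"
 proof (rule has_sum_nonneg[OF symb_has_sum])
  show "0 \<le> a z * (1 - cos (\<theta> \<bullet> lat z))" for z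
   by (cases "z = 0") (use nonneg in auto)
 qed
 then show ?thesis by simp
qed

lemma cos_convolution: "(\<Sum>\<^sub>\<infinity>v. a v * cos (\<theta> \<bullet> lat (x + v))) = symb a \<theta> * cos (\<theta> \<bullet> lat x)"
proof -
 have ss: "(\<lambda>v. a v * sin (\<theta> \<bullet> lat v)) summable_on UNIV"
  by (rule summable_mult_bounded(2)[OF a_summable(2), of _ 1]) simp
 have "bij_betw uminus UNIV (UNIV :: (int^'d) set)"
  by (rule bij_betwI[of _ _ _ uminus]) auto
 from infsum_reindex_bij_betw[OF this, of "\<lambda>v. a v * sin (\<theta> \<bullet> lat v)"]
 have "(\<Sum>\<^sub>\<infinity>v. - (a v * sin (\<theta> \<bullet> lat v))) = (\<Sum>\<^sub>\<infinity>v. a v * sin (\<theta> \<bullet> lat v))"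
  by (simp add: symmetric)
 then have s0: "(\<Sum>\<^sub>\<infinity>v. a v * sin (\<theta> \<bullet> lat v)) = 0" unfolding infsum_uminus by simp
 have "((\<lambda>v. a v * cos (\<theta> \<bullet> lat v) * cos (\<theta> \<bullet> lat x) + - (a v * sin (\<theta> \<bullet> lat v) * sin (\<theta> \<bullet> lat x))) has_sum
   symb a \<theta> * cos (\<theta> \<bullet> lat x) + - (0 * sin (\<theta> \<bullet> lat x))) UNIV"
  unfolding symb_def s0[symmetric]
  by (intro has_sum_add has_sum_uminus[THEN iffD2] has_sum_cmult_left) (simp_all add: symb_summable ss has_sum_cmult_left)
 then show ?thesis by (intro infsumI) (simp add: inner_add_right cos_add algebra_simps)
qed

lemma heat_integrand_continuous: "continuous_on S (\<lambda>\<theta>. exp (t * symb a \<theta>) * cos (\<theta> \<bullet> lat z))"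
 by (intro continuous_intros symb_continuous)

lemma heat_initial: "heat a 0 z = of_bool (z = 0)"
 by (simp add: heat_def integral_torus_cos)

lemma heat_bound: assumes "0 \<le> t" shows "\<bar>heat a t z\<bar> \<le> heat a t 0" "heat a t 0 \<le> 1"
proof -
 have i: "(\<lambda>\<theta>. exp (t * symb a \<theta>) * cos (\<theta> \<bullet> lat z)) integrable_on torus" for t z
  by (intro integrable_continuous heat_integrand_continuous)
 have "norm (integral torus (\<lambda>\<theta>. exp (t * symb a \<theta>) * cos (\<theta> \<bullet> lat z)))
   \<le> integral torus (\<lambda>\<theta>. exp (t * symb a \<theta>) * cos (\<theta> \<bullet> lat 0))"
  by (rule integral_norm_bound_integral[OF i i]) (simp add: abs_mult)
 then show "\<bar>heat a t z\<bar> \<le> heat a t 0" by (simp add: heat_def divide_right_mono)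
 have "integral torus (\<lambda>\<theta>. exp (t * symb a \<theta>) * cos (\<theta> \<bullet> lat 0)) \<le> integral torus (\<lambda>\<theta>. exp (0 * symb a \<theta>) * cos (\<theta> \<bullet> lat 0))"
  by (rule integral_le[OF i i]) (use symb_nonpos assms in \<open>auto simp: mult_nonneg_nonpos\<close>)
 then have "heat a t 0 \<le> heat a 0 0" unfolding heat_def by (intro divide_right_mono) auto
 then show "heat a t 0 \<le> 1" by (simp add: heat_initial)
qed

lemma heat_derivative:
 "((\<lambda>t. heat a t z) has_real_derivative
  integral torus (\<lambda>\<theta>. symb a \<theta> * exp (t * symb a \<theta>) * cos (\<theta> \<bullet> lat z)) / (2 * pi) ^ CARD('d)) (at t within {0..})"
 if "0 \<le> t"
proof -
 have c: "continuous_on ({0..} \<times> torus) (\<lambda>x. symb a (snd x))"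
  by (rule continuous_on_compose2[OF symb_continuous[of UNIV]]) (auto intro!: continuous_intros)
 show ?thesis unfolding heat_def
 proof (rule DERIV_cdivide, rule leibniz_rule_field_derivative)
  show "((\<lambda>t. exp (t * symb a \<theta>) * cos (\<theta> \<bullet> lat z)) has_real_derivative symb a \<theta> * exp (t * symb a \<theta>) * cos (\<theta> \<bullet> lat z)) (at t within {0..})" for t \<theta>
   by (auto intro!: derivative_eq_intros)
  show "continuous_on ({0..} \<times> torus) (\<lambda>(t, \<theta>). symb a \<theta> * exp (t * symb a \<theta>) * cos (\<theta> \<bullet> lat z))"
   unfolding split_beta by (intro continuous_intros c)
 qed (use that in \<open>auto intro!: integrable_continuous heat_integrand_continuous\<close>)
qed

text \<open>Convolution with a multiplies the Fourier transform by symb a; the series converges uniformly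
 on the torus, so it may be integrated term by term.\<close>

lemma heat_convolution:
 "(\<Sum>\<^sub>\<infinity>v. a v * heat a t (x + v)) =
  integral torus (\<lambda>\<theta>. symb a \<theta> * exp (t * symb a \<theta>) * cos (\<theta> \<bullet> lat x)) / (2 * pi) ^ CARD('d)"
proof -
 define f where "f X \<theta> = (\<Sum>v\<in>X. a v * (exp (t * symb a \<theta>) * cos (\<theta> \<bullet> lat (x + v))))" for X \<theta>
 define g where "g \<theta> = symb a \<theta> * exp (t * symb a \<theta>) * cos (\<theta> \<bullet> lat x)" for \<theta>
 have "uniform_limit torus f (\<lambda>\<theta>. \<Sum>\<^sub>\<infinity>v. a v * (exp (t * symb a \<theta>) * cos (\<theta> \<bullet> lat (x + v)))) (finite_subsets_at_top UNIV)"
  unfolding f_def[abs_def]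
 proof (rule Weierstrass_m_test_general)
  show "norm (a v * (exp (t * symb a \<theta>) * cos (\<theta> \<bullet> lat (x + v)))) \<le> \<bar>a v\<bar> * exp (\<bar>t\<bar> * mass)" for v \<theta>
  proof -
   have "t * symb a \<theta> \<le> \<bar>t\<bar> * mass"
    using abs_ge_self[of "t * symb a \<theta>"] mult_left_mono[OF symb_bound[of \<theta>], of "\<bar>t\<bar>"] by (simp add: abs_mult)
   then have "\<bar>exp (t * symb a \<theta>) * cos (\<theta> \<bullet> lat (x + v))\<bar> \<le> exp (\<bar>t\<bar> * mass) * 1"
    unfolding abs_mult by (intro mult_mono) auto
   then show ?thesis by (simp add: abs_mult mult_left_mono)
  qed
  show "(\<lambda>v. \<bar>a v\<bar> * exp (\<bar>t\<bar> * mass)) summable_on UNIV" by (intro summable_on_cmult_left a_summable)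
 qed
 moreover have "(\<Sum>\<^sub>\<infinity>v. a v * (exp (t * symb a \<theta>) * cos (\<theta> \<bullet> lat (x + v)))) = g \<theta>" for \<theta>
 proof -
  have "(\<lambda>v. a v * (exp (t * symb a \<theta>) * cos (\<theta> \<bullet> lat (x + v)))) = (\<lambda>v. exp (t * symb a \<theta>) * (a v * cos (\<theta> \<bullet> lat (x + v))))"
   by (auto simp: algebra_simps)
  then show ?thesis by (simp only: infsum_cmult_right' cos_convolution g_def) (simp add: algebra_simps)
 qed
 ultimately have ul: "uniform_limit torus f g (finite_subsets_at_top UNIV)" by (simp add: g_def[abs_def])
 obtain I J where I: "\<And>X. (f X has_integral I X) torus" and J: "(g has_integral J) torus"
  and lim: "(I \<longlongrightarrow> J) (finite_subsets_at_top UNIV)"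
  by (rule uniform_limit_integral_cbox[OF ul])
   (auto simp: f_def intro!: continuous_intros symb_continuous)
 have I': "I X = (\<Sum>v\<in>X. a v * (heat a t (x + v) * (2 * pi) ^ CARD('d)))" for X
 proof -
  have "I X = integral torus (f X)" by (rule integral_unique[OF I, symmetric])
  also have "\<dots> = (\<Sum>v\<in>X. a v * integral torus (\<lambda>\<theta>. exp (t * symb a \<theta>) * cos (\<theta> \<bullet> lat (x + v))))"
  proof (cases "finite X")
   case True then show ?thesis unfolding f_def
    by (subst integral_sum) (auto intro!: integrable_continuous continuous_intros symb_continuous)
  next
   case False then show ?thesis by (simp add: f_def[abs_def])
  qed
  finally show ?thesis by (simp add: heat_def)
 qed
 have "((\<lambda>v. a v * (heat a t (x + v) * (2 * pi) ^ CARD('d))) has_sum J) UNIV"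
  using lim unfolding I'[abs_def] has_sum_def .
 then have "((\<lambda>v. a v * (heat a t (x + v) * (2 * pi) ^ CARD('d)) * (1 / (2 * pi) ^ CARD('d))) has_sum J * (1 / (2 * pi) ^ CARD('d))) UNIV"
  by (rule has_sum_cmult_left)
 then have "(\<Sum>\<^sub>\<infinity>v. a v * heat a t (x + v)) = J / (2 * pi) ^ CARD('d)"
  by (intro infsumI) simp
 then show ?thesis using J by (simp add: integral_unique g_def[abs_def])
qed

text \<open>This identifies the transition probabilities, known only through their backward equation, with
 the Fourier integral.\<close>

lemma heat_unique:
 assumes B: "\<And>s x. 0 \<le> s ==> s \<le> t ==> \<bar>k s x\<bar> \<le> B"
  and d: "\<And>s x. 0 \<le> s ==> s \<le> t ==> (((\<lambda>s. k s x) has_real_derivative walk_gen a (k s) x) (at s within {0..}))"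
  and init: "\<And>x. k 0 x = of_bool (x = y)" and t: "0 \<le> t"
 shows "k t x = heat a t (x - y)"
proof -
 interpret W: generator "walk_rate a" mass by (rule generator_walk_rate)
 show ?thesis
 proof (rule W.ode_unique[where T=t and u=k and v="\<lambda>t x. heat a t (x - y)" and B=B and B'=1])
  show "\<bar>heat a s (x - y)\<bar> \<le> 1" if "0 \<le> s" for s x
   using heat_bound(1)[OF that, of "x - y"] heat_bound(2)[OF that] by linarith
  show "((\<lambda>s. heat a s (x - y)) has_real_derivative walk_gen a (\<lambda>x. heat a s (x - y)) x) (at s within {0..})" if "0 \<le> s" for s x
   unfolding gen_walk using heat_derivative[OF that, of "x - y"] heat_convolution[of s "x - y"]
   by (simp add: add_diff_eq diff_add_eq)
 qed (use assms in \<open>auto simp: heat_initial\<close>)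
qed

end

section \<open>Stable scaling of the symbol and the local limit theorem\<close>

text \<open>A substitute for polar coordinates: if every point where f does not vanish lies in some ball
 of radius R k with f at most c k there, the integral is at most the sum of c k times the volumes.\<close>

lemma integrable_by_shells:
 fixes f :: "'a::euclidean_space => real"
 assumes [measurable]: "f \<in> borel_measurable borel" and f: "\<And>x. 0 \<le> f x"
  and c: "\<And>k. 0 \<le> c k" and R: "\<And>k. 0 \<le> R k" and s: "summable (\<lambda>k. c k * R k ^ DIM('a))"
  and shell: "\<And>x. f x \<noteq> 0 ==> \<exists>k::nat. norm x < R k \<and> f x \<le> c k"
 shows "integrable lborel f"
proof (rule integrableI_bounded)
 have "(\<integral>\<^sup>+x. ennreal (norm (f x)) \<partial>lborel) \<le> (\<integral>\<^sup>+(x::'a). (\<Sum>k. ennreal (c k) * indicator (ball 0 (R k)) x) \<partial>lborel)"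
 proof (rule nn_integral_mono)
  fix x :: 'a
  show "ennreal (norm (f x)) \<le> (\<Sum>k. ennreal (c k) * indicator (ball 0 (R k)) x)"
  proof (cases "f x = 0")
   case False
   then obtain k where k: "norm x < R k" "f x \<le> c k" using shell by blast
   have "ennreal (norm (f x)) \<le> ennreal (c k) * indicator (ball 0 (R k)) x"
    using k f[of x] by (simp add: indicator_def ennreal_leI)
   also have "\<dots> \<le> (\<Sum>k. ennreal (c k) * indicator (ball 0 (R k)) x)"
   proof -
    have "sum (\<lambda>k. ennreal (c k) * indicator (ball 0 (R k)) x) {k} \<le> (\<Sum>k. ennreal (c k) * indicator (ball 0 (R k)) x)"
     by (rule sum_le_suminf) auto
    then show ?thesis by (simp only: sum.insert[OF finite.emptyI] sum.empty empty_iff not_False_eq_True add_0_right)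
   qed
   finally show ?thesis .
  qed simp
 qed
 also have "\<dots> = (\<Sum>k. ennreal (c k) * emeasure lborel (ball (0::'a) (R k)))"
  by (subst nn_integral_suminf) (auto simp: nn_integral_cmult_indicator intro!: borel_measurable_times_ennreal borel_measurable_indicator)
 also have "\<dots> = (\<Sum>k. ennreal (unit_ball_vol (DIM('a)) * (c k * R k ^ DIM('a))))"
  using R c by (intro suminf_cong) (simp add: emeasure_ball ennreal_mult[symmetric] algebra_simps)
 also have "\<dots> = ennreal (\<Sum>k. unit_ball_vol (DIM('a)) * (c k * R k ^ DIM('a)))"
  by (rule suminf_ennreal2) (use R c s in \<open>auto intro!: summable_mult\<close>)
 also have "\<dots> < \<infinity>" by simp
 finally show "(\<integral>\<^sup>+x. ennreal (norm (f x)) \<partial>lborel) < \<infinity>" .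
qed simp

lemma dyadic_bracket: assumes "(1::real) \<le> y" shows "\<exists>k::nat. 2^k \<le> y \<and> y < 2^(k+1)"
proof -
 define n where "n = (LEAST n::nat. y < 2^n)"
 have ex: "\<exists>n::nat. y < 2^n" using real_arch_pow[of 2 y] by auto
 then have n: "y < 2^n" unfolding n_def by (rule LeastI_ex)
 have "n \<noteq> 0" using n assms by (auto intro: ccontr)
 then obtain k where k: "n = Suc k" by (cases n) auto
 have "\<not> y < 2^k" using not_less_Least[of k "\<lambda>n. y < 2^n"] k unfolding n_def by simp
 then show ?thesis using n k by (intro exI[of _ k]) auto
qed

lemma integrable_outer_power:
 assumes s: "real (DIM('a)) < s"
 shows "integrable lborel (\<lambda>x::'a::euclidean_space. if 1 \<le> norm x then norm x powr (- s) else 0)"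
proof (rule integrable_by_shells[where c="\<lambda>k. (2 powr (- s)) ^ k" and R="\<lambda>k. 2^(k+1)"])
 define q where "q = 2 powr (real (DIM('a)) - s)"
 have q: "0 \<le> q" "q < 1" using s by (auto simp: q_def powr_less_one)
 have "(2 powr (- s)) ^ k * (2^(k+1)) ^ DIM('a) = 2 ^ DIM('a) * q ^ k" for k :: nat
 proof -
  have "(2 powr (- s)) ^ k * (2^(k+1)) ^ DIM('a) = 2 ^ DIM('a) * ((2 powr (- s)) ^ k * (2 ^ DIM('a))^k)"
   by (simp add: power_mult[symmetric] power_add[symmetric] mult.commute)
  also have "(2 powr (- s)) ^ k * (2 ^ DIM('a))^k = q ^ k"
  proof -
   have "2 powr (- s) * 2 ^ DIM('a) = q" by (simp add: q_def powr_realpow[symmetric] powr_add[symmetric])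
   then show ?thesis by (simp add: power_mult_distrib[symmetric])
  qed
  finally show ?thesis .
 qed
 then have eq: "(\<lambda>k::nat. (2 powr (- s)) ^ k * (2^(k+1)) ^ DIM('a)) = (\<lambda>k. 2 ^ DIM('a) * q ^ k)" by blast
 show "summable (\<lambda>k. (2 powr (- s)) ^ k * (2^(k+1)) ^ DIM('a))"
  unfolding eq using q by (auto intro!: summable_mult summable_geometric)
 fix x :: 'a
 assume "(if 1 \<le> norm x then norm x powr (- s) else 0) \<noteq> 0"
 then have x: "1 \<le> norm x" by (auto split: if_splits)
 then obtain k where k: "2^k \<le> norm x" "norm x < 2^(k+1)" using dyadic_bracket by blast
 have "norm x powr (- s) \<le> (2^k) powr (- s)"
  using k s by (intro powr_mono2') auto
 also have "\<dots> = (2 powr (- s)) ^ k"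
  by (simp add: powr_realpow[symmetric] powr_powr mult.commute)
 finally show "\<exists>k. norm x < 2^(k+1) \<and> (if 1 \<le> norm x then norm x powr (- s) else 0) \<le> (2 powr (- s)) ^ k"
  using k x by auto
qed auto

lemma integrable_inner_power:
 assumes s: "0 \<le> s" "s < real (DIM('a))"
 shows "integrable lborel (\<lambda>x::'a::euclidean_space. if norm x < 1 then norm x powr (- s) else 0)"
proof (rule integrable_by_shells[where c="\<lambda>k. (2 powr s) ^ (k+1)" and R="\<lambda>k. 2 * (1/2)^k"])
 define q where "q = 2 powr (s - real (DIM('a)))"
 have q: "0 \<le> q" "q < 1" using s by (auto simp: q_def powr_less_one)
 have "(2 powr s) ^ (k+1) * (2 * (1/2)^k) ^ DIM('a) = 2 powr s * 2 ^ DIM('a) * q ^ k" for k :: nat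
 proof -
  have "(2 powr s) ^ (k+1) * (2 * (1/2)^k) ^ DIM('a) = 2 powr s * 2 ^ DIM('a) * ((2 powr s) ^ k * ((1/2) ^ DIM('a))^k)"
   by (simp add: power_mult_distrib power_mult[symmetric] mult.commute)
  also have "((2 powr s) ^ k * ((1/2) ^ DIM('a))^k) = q ^ k"
  proof -
   have "2 powr s * (1/2) ^ DIM('a) = q" by (simp add: q_def powr_diff powr_realpow power_one_over)
   then show ?thesis by (simp add: power_mult_distrib[symmetric])
  qed
  finally show ?thesis .
 qed
 then have eq: "(\<lambda>k::nat. (2 powr s) ^ (k+1) * (2 * (1/2)^k) ^ DIM('a)) = (\<lambda>k. 2 powr s * 2 ^ DIM('a) * q ^ k)" by blast
 show "summable (\<lambda>k. (2 powr s) ^ (k+1) * (2 * (1/2)^k) ^ DIM('a))"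
  unfolding eq using q by (auto intro!: summable_mult summable_geometric)
 fix x :: 'a
 assume "(if norm x < 1 then norm x powr (- s) else 0) \<noteq> 0"
 then have x: "norm x < 1" "0 < norm x" by (auto split: if_splits)
 then obtain k where k: "2^k \<le> 1 / norm x" "1 / norm x < 2^(k+1)" using dyadic_bracket[of "1 / norm x"] by (auto simp: field_simps)
 have "norm x powr (- s) = (1 / norm x) powr s"
  using x by (simp add: powr_minus powr_divide field_simps)
 also have "\<dots> \<le> (2^(k+1)) powr s"
  using k s x by (intro powr_mono2) auto
 also have "\<dots> = (2 powr s) ^ (k+1)"
  by (simp only: powr_realpow[symmetric, of "2::real", simplified] powr_powr powr_power mult.commute)
 finally have 1: "norm x powr (- s) \<le> (2 powr s) ^ (k+1)" .
 have "norm x \<le> (1/2)^k" using k(1) x by (simp add: field_simps)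
 also have "\<dots> < 2 * (1/2)^k" by simp
 finally show "\<exists>k. norm x < 2 * (1/2)^k \<and> (if norm x < 1 then norm x powr (- s) else 0) \<le> (2 powr s) ^ (k+1)"
  using 1 x by auto
qed auto

lemma integrable_stretched_exponential:
 assumes "0 < c" "0 < \<alpha>"
 shows "integrable lborel (\<lambda>x::'a::euclidean_space. exp (- (c * norm x powr \<alpha>)))"
proof -
 obtain N :: nat where N: "real (DIM('a)) / \<alpha> < real N" using reals_Archimedean2 by blast
 have N': "real (DIM('a)) < \<alpha> * N" using N assms by (simp add: field_simps)
 define g :: "'a => real" where "g x = (fact N / c ^ N) * (if 1 \<le> norm x then norm x powr (- (\<alpha> * N)) else 0)
  + (if norm x < 1 then norm x powr (- 0) else 0) + indicator {0} x" for x
 have "integrable lborel g"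
  unfolding g_def
  by (intro Bochner_Integration.integrable_add integrable_mult_right integrable_outer_power integrable_inner_power N')
   auto
 then show ?thesis
 proof (rule Bochner_Integration.integrable_bound)
  show "AE x in lborel. norm (exp (- (c * norm x powr \<alpha>))) \<le> norm (g x)"
  proof (rule AE_I2)
   fix x :: 'a
   have g0: "0 \<le> g x" using assms by (auto simp: g_def)
   have "exp (- (c * norm x powr \<alpha>)) \<le> g x"
   proof (cases "1 \<le> norm x")
    case True
    define y where "y = c * norm x powr \<alpha>"
    have "norm x \<noteq> 0" using True by auto
    then have y: "0 < y" using assms by (simp add: y_def)
    have "(\<Sum>k\<in>{N}. y ^ k /\<^sub>R fact k) \<le> exp y"
     unfolding exp_def by (rule sum_le_suminf) (use y summable_exp_generic[of y] in auto)
    then have "y ^ N / fact N \<le> exp y" by (simp add: field_simps)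
    then have "exp (- y) \<le> fact N / y ^ N" using y by (simp add: exp_minus field_simps)
    also have "y ^ N = c ^ N * norm x powr (\<alpha> * N)"
    proof -
     have "0 < norm x powr \<alpha>" using \<open>norm x \<noteq> 0\<close> by simp
     from powr_realpow[OF this, of N] show ?thesis by (simp add: y_def power_mult_distrib powr_powr)
    qed
    finally have "exp (- y) \<le> (fact N / c ^ N) * norm x powr (- (\<alpha> * N))"
     by (simp add: powr_minus field_simps)
    then have "exp (- (c * norm x powr \<alpha>)) \<le> fact N / c ^ N * norm x powr (- (\<alpha> * N)) + indicator {0} x"
     unfolding y_def by (rule order_trans) simp
    then show ?thesis using True by (simp add: g_def)
   next
    case False
    then show ?thesis using assms by (cases "x = 0") (auto simp: g_def)
   qed
   then show "norm (exp (- (c * norm x powr \<alpha>))) \<le> norm (g x)" using g0 by simp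
  qed
 qed simp
qed

text \<open>The lattice point whose \<epsilon>-cube contains x. A lattice sum is thus the Lebesgue integral of a
 step function, and dominated convergence becomes available for Riemann sums.\<close>

definition cell :: "real => real ^ 'd => int ^ 'd" where
 "cell \<epsilon> x = (\<chi> i. \<lfloor>x $ i / \<epsilon>\<rfloor>)"

lemma cell_vimage:
 assumes \<epsilon>: "0 < \<epsilon>"
 shows "cell \<epsilon> -` {z} \<in> sets borel" "emeasure lborel (cell \<epsilon> -` {z} :: (real^'d) set) = ennreal (\<epsilon> ^ CARD('d))"
proof -
 define l :: "real^'d" where "l = \<epsilon> *\<^sub>R lat z"
 define u :: "real^'d" where "u = \<epsilon> *\<^sub>R lat z + (\<chi> i. \<epsilon>)"
 have eq: "cell \<epsilon> -` {z} = {x. \<forall>i. l $ i \<le> x $ i \<and> x $ i < u $ i}"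
 proof -
  have "\<lfloor>v / \<epsilon>\<rfloor> = m \<longleftrightarrow> \<epsilon> * real_of_int m \<le> v \<and> v < \<epsilon> * real_of_int m + \<epsilon>" for v m
   using \<epsilon> by (simp add: floor_eq_iff field_simps)
  then have "cell \<epsilon> x = z \<longleftrightarrow> (\<forall>i. \<epsilon> * real_of_int (z $ i) \<le> x $ i \<and> x $ i < \<epsilon> * real_of_int (z $ i) + \<epsilon>)" for x
   by (simp add: cell_def vec_eq_iff)
  then show ?thesis by (auto simp: l_def u_def lat_def)
 qed
 show meas: "cell \<epsilon> -` {z} \<in> sets borel" unfolding eq by measurable
 have lu: "\<forall>b\<in>Basis. l \<bullet> b \<le> u \<bullet> b"
  using \<epsilon> by (auto simp: Basis_vec_def inner_axis l_def u_def)
 have "(\<Prod>b\<in>(Basis::(real^'d) set). (u - l) \<bullet> b) = (\<Prod>b\<in>(Basis::(real^'d) set). \<epsilon>)"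
  by (rule prod.cong) (auto simp: Basis_vec_def inner_axis l_def u_def)
 then have vol: "(\<Prod>b\<in>(Basis::(real^'d) set). (u - l) \<bullet> b) = \<epsilon> ^ CARD('d)" by simp
 have "box l u \<subseteq> cell \<epsilon> -` {z}" unfolding eq by (auto simp: mem_box_cart less_imp_le)
 from emeasure_mono[OF this, of lborel] have 1: "ennreal (\<epsilon> ^ CARD('d)) \<le> emeasure lborel (cell \<epsilon> -` {z} :: (real^'d) set)"
  using meas lu vol by (simp add: emeasure_lborel_box_eq)
 have "cell \<epsilon> -` {z} \<subseteq> cbox l u" unfolding eq by (auto simp: mem_box_cart less_imp_le)
 from emeasure_mono[OF this, of lborel] have 2: "emeasure lborel (cell \<epsilon> -` {z} :: (real^'d) set) \<le> ennreal (\<epsilon> ^ CARD('d))"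
  using lu vol by (simp add: emeasure_lborel_cbox_eq)
 show "emeasure lborel (cell \<epsilon> -` {z} :: (real^'d) set) = ennreal (\<epsilon> ^ CARD('d))"
  using 1 2 by (rule antisym[rotated])
qed

lemma cell_measurable: "0 < \<epsilon> ==> cell \<epsilon> \<in> measurable borel (count_space (UNIV :: (int^'d) set))"
 by (subst measurable_count_space_eq2_countable) (auto simp: cell_vimage)

lemma integral_cell:
 fixes g :: "int ^ 'd => real"
 assumes \<epsilon>: "0 < \<epsilon>" and g: "\<And>z. 0 \<le> g z" "(g has_sum S) UNIV"
 shows "(\<integral>x. g (cell \<epsilon> x) \<partial>(lborel :: (real^'d) measure)) = \<epsilon> ^ CARD('d) * S"
  "(\<lambda>x. g (cell \<epsilon> x)) \<in> borel_measurable borel"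
proof -
 note [measurable] = cell_measurable[OF \<epsilon>]
 have gm: "g \<in> borel_measurable (count_space UNIV)" by simp
 show m: "(\<lambda>x. g (cell \<epsilon> x)) \<in> borel_measurable borel" using gm by measurable
 have S: "0 \<le> S" by (rule has_sum_nonneg[OF g(2)]) (use g in auto)
 have distr: "distr lborel (count_space UNIV) (cell \<epsilon>) = scale_measure (ennreal (\<epsilon> ^ CARD('d))) (count_space (UNIV :: (int^'d) set))"
 proof (rule measure_eqI_countable[where A=UNIV])
  fix z :: "int^'d"
  show "emeasure (distr lborel (count_space UNIV) (cell \<epsilon>)) {z} = emeasure (scale_measure (ennreal (\<epsilon> ^ CARD('d))) (count_space UNIV)) {z}"
   by (subst emeasure_distr) (auto simp: cell_vimage[OF \<epsilon>] emeasure_count_space)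
 qed auto
 have "(\<lambda>z. norm (g z)) summable_on UNIV" using g by (auto simp: summable_on_def)
 then have ab: "Infinite_Set_Sum.abs_summable_on g UNIV" by (rule abs_summable_equivalent[THEN iffD1])
 have "(\<integral>\<^sup>+z. ennreal (g z) \<partial>count_space UNIV) = ennreal S"
  using nn_integral_conv_infsetsum[OF ab] infsetsum_infsum[OF ab] g by (simp add: infsumI)
 moreover have "(\<integral>\<^sup>+x. ennreal (g (cell \<epsilon> x)) \<partial>(lborel :: (real^'d) measure)) = (\<integral>\<^sup>+z. ennreal (g z) \<partial>distr lborel (count_space UNIV) (cell \<epsilon>))"
  by (subst nn_integral_distr) auto
 ultimately have "(\<integral>\<^sup>+x. ennreal (g (cell \<epsilon> x)) \<partial>(lborel :: (real^'d) measure)) = ennreal (\<epsilon> ^ CARD('d) * S)"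
  unfolding distr by (subst (asm) nn_integral_scale_measure) (use \<epsilon> S in \<open>auto simp: ennreal_mult\<close>)
 then show "(\<integral>x. g (cell \<epsilon> x) \<partial>(lborel :: (real^'d) measure)) = \<epsilon> ^ CARD('d) * S"
  using m g \<epsilon> S by (subst integral_eq_nn_integral) auto
qed

lemma cell_close:
 fixes x :: "real^'d"
 assumes "0 < \<epsilon>" shows "norm (\<epsilon> *\<^sub>R lat (cell \<epsilon> x) - x) \<le> \<epsilon> * CARD('d)"
proof -
 have "norm (\<epsilon> *\<^sub>R lat (cell \<epsilon> x) - x) \<le> (\<Sum>i\<in>UNIV. \<bar>(\<epsilon> *\<^sub>R lat (cell \<epsilon> x) - x) $ i\<bar>)"
  by (rule norm_le_l1_cart)
 also have "\<dots> \<le> (\<Sum>i\<in>(UNIV::'d set). \<epsilon>)"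
 proof (rule sum_mono)
  fix i :: 'd
  have f: "real_of_int \<lfloor>x $ i / \<epsilon>\<rfloor> \<le> x $ i / \<epsilon>" "x $ i / \<epsilon> \<le> real_of_int \<lfloor>x $ i / \<epsilon>\<rfloor> + 1" by linarith+
  have "\<epsilon> * real_of_int \<lfloor>x $ i / \<epsilon>\<rfloor> \<le> x $ i" "x $ i \<le> \<epsilon> * real_of_int \<lfloor>x $ i / \<epsilon>\<rfloor> + \<epsilon>"
   using mult_left_mono[OF f(1), of \<epsilon>] mult_left_mono[OF f(2), of \<epsilon>] assms by (simp_all add: distrib_left)
  then show "\<bar>(\<epsilon> *\<^sub>R lat (cell \<epsilon> x) - x) $ i\<bar> \<le> \<epsilon>" by (simp add: cell_def lat_def)
 qed
 finally show ?thesis by (simp add: mult.commute)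
qed

lemma norm_lat_ge_1: assumes "z \<noteq> 0" shows "1 \<le> norm (lat z)"
proof -
 obtain i where "z $ i \<noteq> 0" using assms by (auto simp: vec_eq_iff)
 then have "1 \<le> \<bar>lat z $ i\<bar>" by (simp add: lat_def)
 also have "\<dots> \<le> norm (lat z)" by (rule component_le_norm_cart)
 finally show ?thesis .
qed

lemma finite_lattice_ball: "finite {z :: int^'d. norm (lat z) \<le> R}"
proof -
 have "(\<lambda>z. ($) z) ` {z :: int^'d. norm (lat z) \<le> R} \<subseteq> PiE UNIV (\<lambda>_. {-\<lceil>R\<rceil>..\<lceil>R\<rceil>})"
 proof clarify
  fix z :: "int^'d" assume z: "norm (lat z) \<le> R"
  have "z $ i \<in> {-\<lceil>R\<rceil>..\<lceil>R\<rceil>}" for i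
  proof -
   have "\<bar>real_of_int (z $ i)\<bar> \<le> R" using component_le_norm_cart[of "lat z" i] z by (simp add: lat_def)
   then show ?thesis by (simp add: abs_le_iff) linarith
  qed
  then show "($) z \<in> PiE UNIV (\<lambda>_. {-\<lceil>R\<rceil>..\<lceil>R\<rceil>})" by auto
 qed
 then have "finite ((\<lambda>z. ($) z) ` {z :: int^'d. norm (lat z) \<le> R})"
  by (rule finite_subset) (auto intro!: finite_PiE)
 then show ?thesis by (rule finite_imageD) (auto simp: inj_on_def vec_eq_iff)
qed

lemma one_minus_cos_le: "1 - cos u \<le> u^2 / 2" for u :: real
proof -
 have "1 - cos u = 2 * (sin (u/2))^2" using cos_double_sin[of "u/2"] by simp
 also have "(sin (u/2))^2 \<le> (u/2)^2"
  using abs_sin_x_le_abs_x[of "u/2"] by (simp only: abs_le_square_iff)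
 finally show ?thesis by (simp add: power2_eq_square)
qed

lemma one_minus_cos_le_powr:
 fixes u :: real
 assumes "0 \<le> \<kappa>" "\<kappa> \<le> 2" shows "1 - cos u \<le> 2 * \<bar>u\<bar> powr \<kappa>"
proof (cases "\<bar>u\<bar> \<le> 1")
 case True
 show ?thesis
 proof (cases "u = 0")
  case False
  have "u^2 = \<bar>u\<bar> powr 2" using False by (simp add: powr_numeral)
  also have "\<dots> \<le> \<bar>u\<bar> powr \<kappa>" using True False assms by (intro powr_mono') auto
  finally show ?thesis using one_minus_cos_le[of u] powr_ge_zero[of "\<bar>u\<bar>" \<kappa>] by linarith
 qed simp
next
 case False
 then have "1 \<le> \<bar>u\<bar> powr \<kappa>" using assms by (intro ge_one_powr_ge_zero) auto
 then show ?thesis using cos_ge_minus_one[of u] by linarith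
qed

locale heavy_tailed_walk = walk_intensity a for a :: "int ^ 'd => real" +
 fixes \<alpha> H0 :: real
 assumes alpha: "0 < \<alpha>" "\<alpha> < 2" and H0: "0 < H0"
  and heavy_tail: "a \<sim>[at_lattice_infinity] (\<lambda>z. H0 / lattice_norm z powr (real CARD('d) + \<alpha>))"
begin

definition tail_exp :: real where "tail_exp = real CARD('d) + \<alpha>"

lemma tail_exp_pos: "0 < tail_exp" "\<alpha> < tail_exp" "real CARD('d) < tail_exp"
 using alpha by (auto simp: tail_exp_def)

text \<open>Bounded and convergent to H0, so that all the singular behaviour of a sits in the power of the
 norm.\<close>

definition scaled_tail :: "int ^ 'd => real" where
 "scaled_tail z = a z * norm (lat z) powr tail_exp"

lemma scaled_tail_tendsto: "(scaled_tail \<longlongrightarrow> H0) at_lattice_infinity"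
proof -
 have pos: "\<forall>\<^sub>F z in at_lattice_infinity. 0 < lattice_norm z"
  unfolding at_lattice_infinity_def eventually_filtercomap_at_top_linorder by (auto intro!: exI[of _ 1])
 then have "\<forall>\<^sub>F z in at_lattice_infinity. a z \<noteq> 0 \<or> H0 / lattice_norm z powr tail_exp \<noteq> 0"
  by eventually_elim (use H0 in auto)
 with heavy_tail have "((\<lambda>z. a z / (H0 / lattice_norm z powr tail_exp)) \<longlongrightarrow> 1) at_lattice_infinity"
  unfolding tail_exp_def by (rule asymp_equivD_strong)
 from tendsto_mult_right[OF this, of H0]
 have "((\<lambda>z. H0 * (a z / (H0 / lattice_norm z powr tail_exp))) \<longlongrightarrow> H0) at_lattice_infinity"
  by simp
 moreover have "(\<lambda>z. H0 * (a z / (H0 / lattice_norm z powr tail_exp))) = scaled_tail"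
  using H0 by (auto simp: scaled_tail_def norm_lat)
 ultimately show ?thesis by simp
qed

lemma scaled_tail_near:
 assumes "e > 0" shows "\<exists>R. \<forall>z. R \<le> norm (lat z) \<longrightarrow> \<bar>scaled_tail z - H0\<bar> < e"
proof -
 have "\<forall>\<^sub>F z in at_lattice_infinity. dist (scaled_tail z) H0 < e"
  using scaled_tail_tendsto assms by (rule tendstoD)
 then show ?thesis
  unfolding at_lattice_infinity_def eventually_filtercomap_at_top_linorder by (auto simp: norm_lat dist_real_def)
qed

lemma scaled_tail_bounded: "\<exists>K>0. \<forall>z. z \<noteq> 0 \<longrightarrow> 0 \<le> scaled_tail z \<and> scaled_tail z \<le> K"
proof -
 obtain R where R: "\<And>z. R \<le> norm (lat z) ==> \<bar>scaled_tail z - H0\<bar> < H0"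
  using scaled_tail_near[OF H0] by blast
 define F where "F = {z :: int^'d. norm (lat z) \<le> R}"
 define K where "K = 2 * H0 + (\<Sum>z\<in>F. \<bar>scaled_tail z\<bar>)"
 have F: "finite F" unfolding F_def by (rule finite_lattice_ball)
 have "scaled_tail z \<le> K" for z
 proof (cases "z \<in> F")
  case True
  have "\<bar>scaled_tail z\<bar> \<le> (\<Sum>z\<in>F. \<bar>scaled_tail z\<bar>)" by (rule member_le_sum) (use True F in auto)
  then show ?thesis using H0 by (simp add: K_def)
 next
  case False
  then have "\<bar>scaled_tail z - H0\<bar> < H0" using R by (auto simp: F_def)
  moreover have "0 \<le> (\<Sum>z\<in>F. \<bar>scaled_tail z\<bar>)" by (intro sum_nonneg) auto
  ultimately show ?thesis unfolding K_def by linarith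
 qed
 moreover have "0 < K" using H0 by (simp add: K_def add_pos_nonneg sum_nonneg)
 moreover have "0 \<le> scaled_tail z" if "z \<noteq> 0" for z using nonneg[OF that] by (simp add: scaled_tail_def)
 ultimately show ?thesis by blast
qed

lemma a_eq_scaled: "z \<noteq> 0 ==> a z = scaled_tail z * norm (lat z) powr (- tail_exp)"
proof -
 assume "z \<noteq> 0"
 then have "norm (lat z) powr tail_exp \<noteq> 0" using norm_lat_ge_1[of z] by auto
 then show ?thesis by (simp add: scaled_tail_def powr_minus)
qed

definition limit_integrand :: "real ^ 'd => real ^ 'd => real" where
 "limit_integrand \<theta> x = H0 * norm x powr (- tail_exp) * (1 - cos (\<theta> \<bullet> x))"

text \<open>The characteristic exponent of the isotropic stable law with Levy density H0 |x|^(-d-\<alpha>).\<close>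

definition stable_exponent :: "real ^ 'd => real" where
 "stable_exponent \<theta> = (\<integral>x. limit_integrand \<theta> x \<partial>lborel)"

text \<open>At the origin 1 - cos gains the power 2, which leaves |x|^(2-d-\<alpha>); the minimum keeps the
 exponent nonpositive when d + \<alpha> < 2.\<close>

definition dominating :: "real => real ^ 'd => real" where
 "dominating K x = K * ((if 1 \<le> norm x then norm x powr (- tail_exp) else 0)
  + (if norm x < 1 then norm x powr (- (tail_exp - min 2 tail_exp)) else 0))"

lemma dominating_integrable: "integrable lborel (dominating K)"
 unfolding dominating_def
 by (intro integrable_mult_right Bochner_Integration.integrable_add integrable_outer_power integrable_inner_power)
  (use alpha in \<open>auto simp: tail_exp_def min_def\<close>)

text \<open>The point y is a lattice approximation of x, comparable to it up to the factor D only. As the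
 bound is a nonincreasing power of the norm, it can be moved from y to x.\<close>

lemma cosine_power_bound:
 assumes x: "x \<noteq> 0" and y: "norm x / D \<le> norm y" and D: "1 \<le> D" and Th: "norm \<theta> \<le> \<Theta>" "1 \<le> \<Theta>"
 shows "norm y powr (- tail_exp) * (1 - cos (\<theta> \<bullet> y)) \<le> dominating (2 * D powr tail_exp * \<Theta>\<^sup>2) x"
proof -
 (* the exponent up to which 1 - cos is estimated: none far out, as much as is integrable near 0 *)
 define \<kappa> where "\<kappa> = (if 1 \<le> norm x then 0 else min 2 tail_exp)"
 have \<kappa>: "0 \<le> \<kappa>" "\<kappa> \<le> 2" "\<kappa> \<le> tail_exp" using tail_exp_pos by (auto simp: \<kappa>_def)
 have px: "0 < norm x" using x by simp
 have q0: "0 < norm x / D" using px D by simp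
 have py: "0 < norm y" using q0 y by linarith
 have "1 - cos (\<theta> \<bullet> y) \<le> 2 * \<bar>\<theta> \<bullet> y\<bar> powr \<kappa>" by (rule one_minus_cos_le_powr) (use \<kappa> in auto)
 also have "\<bar>\<theta> \<bullet> y\<bar> \<le> \<Theta> * norm y"
  using Cauchy_Schwarz_ineq2[of \<theta> y] mult_right_mono[OF Th(1), of "norm y"] by simp
 then have "2 * \<bar>\<theta> \<bullet> y\<bar> powr \<kappa> \<le> 2 * (\<Theta> * norm y) powr \<kappa>"
  using \<kappa> by (intro mult_left_mono powr_mono2) auto
 also have "(\<Theta> * norm y) powr \<kappa> = \<Theta> powr \<kappa> * norm y powr \<kappa>" using Th by (simp add: powr_mult)
 also have "\<Theta> powr \<kappa> \<le> \<Theta> powr 2" using \<kappa> Th by (intro powr_mono) auto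
 also have "\<Theta> powr 2 = \<Theta>\<^sup>2" using Th by (simp add: powr_numeral)
 finally have "1 - cos (\<theta> \<bullet> y) \<le> 2 * (\<Theta>\<^sup>2 * norm y powr \<kappa>)" by (simp add: mult_right_mono)
 then have "norm y powr (- tail_exp) * (1 - cos (\<theta> \<bullet> y)) \<le> norm y powr (- tail_exp) * (2 * (\<Theta>\<^sup>2 * norm y powr \<kappa>))"
  by (intro mult_left_mono) auto
 also have "\<dots> = 2 * \<Theta>\<^sup>2 * norm y powr (\<kappa> - tail_exp)"
  using py by (simp add: powr_diff powr_minus field_simps)
 also have "norm y powr (\<kappa> - tail_exp) \<le> (norm x / D) powr (\<kappa> - tail_exp)"
  using \<kappa> y q0 by (intro powr_mono2') auto
 also have "(norm x / D) powr (\<kappa> - tail_exp) = norm x powr (\<kappa> - tail_exp) * D powr (tail_exp - \<kappa>)"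
  using px D by (simp add: powr_divide powr_diff field_simps)
 also have "D powr (tail_exp - \<kappa>) \<le> D powr tail_exp" using D \<kappa> by (intro powr_mono) auto
 finally have "norm y powr (- tail_exp) * (1 - cos (\<theta> \<bullet> y)) \<le> 2 * \<Theta>\<^sup>2 * (norm x powr (\<kappa> - tail_exp) * D powr tail_exp)"
  by (simp add: mult_left_mono)
 also have "\<dots> = dominating (2 * D powr tail_exp * \<Theta>\<^sup>2) x"
  by (auto simp: dominating_def \<kappa>_def)
 finally show ?thesis .
qed

lemma limit_integrand_bound:
 assumes "norm \<theta> \<le> \<Theta>" "1 \<le> \<Theta>"
 shows "0 \<le> limit_integrand \<theta> x" "limit_integrand \<theta> x \<le> dominating (H0 * (2 * \<Theta>\<^sup>2)) x"
proof -
 show "0 \<le> limit_integrand \<theta> x" using H0 by (simp add: limit_integrand_def)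
 show "limit_integrand \<theta> x \<le> dominating (H0 * (2 * \<Theta>\<^sup>2)) x"
 proof (cases "x = 0")
  case False
  from cosine_power_bound[OF this, of 1 x \<theta> \<Theta>] assms
  have "norm x powr (- tail_exp) * (1 - cos (\<theta> \<bullet> x)) \<le> dominating (2 * \<Theta>\<^sup>2) x" by simp
  then have "H0 * (norm x powr (- tail_exp) * (1 - cos (\<theta> \<bullet> x))) \<le> H0 * dominating (2 * \<Theta>\<^sup>2) x"
   using H0 by (intro mult_left_mono) auto
  then show ?thesis by (simp add: limit_integrand_def dominating_def mult.assoc)
 qed (simp add: limit_integrand_def dominating_def H0 less_imp_le)
qed

lemma limit_integrand_measurable: "limit_integrand \<theta> \<in> borel_measurable borel"
 unfolding limit_integrand_def[abs_def] by measurable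

lemma limit_integrand_integrable: "integrable lborel (limit_integrand \<theta>)"
proof (rule Bochner_Integration.integrable_bound[OF dominating_integrable])
 show "AE x in lborel. norm (limit_integrand \<theta> x) \<le> norm (dominating (H0 * (2 * (max 1 (norm \<theta>))\<^sup>2)) x)"
 proof (rule AE_I2)
  fix x
  show "norm (limit_integrand \<theta> x) \<le> norm (dominating (H0 * (2 * (max 1 (norm \<theta>))\<^sup>2)) x)"
   using limit_integrand_bound[of \<theta> "max 1 (norm \<theta>)" x] by simp
 qed
qed (simp add: limit_integrand_measurable)

text \<open>Otherwise the cosine would equal 1 almost everywhere, but it is less than 1 on a nonempty open
 set.\<close>

lemma stable_exponent_pos: assumes "\<theta> \<noteq> 0" shows "0 < stable_exponent \<theta>"
proof (rule ccontr)
 assume "\<not> ?thesis"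
 moreover have nn: "AE x in lborel. 0 \<le> limit_integrand \<theta> x" using H0 by (simp add: limit_integrand_def)
 then have "0 \<le> stable_exponent \<theta>" unfolding stable_exponent_def by (rule integral_nonneg_AE)
 ultimately have "(\<integral>x. limit_integrand \<theta> x \<partial>lborel) = 0" by (simp add: stable_exponent_def)
 then have ae: "AE x in lborel. limit_integrand \<theta> x = 0"
  using integral_nonneg_eq_0_iff_AE[OF limit_integrand_integrable nn] by simp
 define U where "U = {x. cos (\<theta> \<bullet> x) < 1}"
 have U: "open U" unfolding U_def by (intro open_Collect_less continuous_intros)
 have "(pi / (\<theta> \<bullet> \<theta>)) *\<^sub>R \<theta> \<in> U" using assms by (simp add: U_def)
 then have "U \<noteq> {}" by auto
 moreover have "AE x in lborel. x \<notin> U"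
  using ae by eventually_elim (use H0 in \<open>auto simp: U_def limit_integrand_def\<close>)
 then have "U \<in> null_sets lborel" using U by (subst (asm) AE_iff_null_sets[symmetric]) auto
 then have "negligible U" using negligible_iff_null_sets null_sets_completionI by blast
 ultimately show False using open_not_negligible[OF U] by blast
qed

text \<open>The left-hand side is the integral over x of the \<epsilon>-cell function with values \<epsilon>^(-d-\<alpha>) a(z) (1
 - cos(\<epsilon> \<theta> z)), which converges pointwise to the limit integrand. The direction may vary with n so
 that the limit can be combined with compactness of the sphere.\<close>

lemma symb_scaling:
 assumes \<epsilon>: "\<And>n. 0 < \<epsilon> n" "\<epsilon> \<longlonglongrightarrow> 0" and \<theta>: "\<theta> \<longlonglongrightarrow> \<theta>'"
 shows "(\<lambda>n. \<epsilon> n powr (- \<alpha>) * - symb a (\<epsilon> n *\<^sub>R \<theta> n)) \<longlonglongrightarrow> stable_exponent \<theta>'"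
proof -
 (* a nonzero lattice point has norm at least 1 and lies within d of x / \<epsilon> *)
 define D where "D = 1 + real CARD('d)"
 have D: "1 \<le> D" by (simp add: D_def)
 obtain K where K: "K > 0" "\<And>z. z \<noteq> 0 ==> 0 \<le> scaled_tail z \<and> scaled_tail z \<le> K"
  using scaled_tail_bounded by blast
 have "Bseq \<theta>" using \<theta> by (intro convergent_imp_Bseq) (auto simp: convergent_def)
 then obtain \<Theta>0 where "\<And>n. norm (\<theta> n) \<le> \<Theta>0" by (auto simp: Bseq_def)
 then have \<Theta>: "norm (\<theta> n) \<le> max 1 \<Theta>0" for n by (simp add: max.coboundedI2)
 define \<Theta> where "\<Theta> = max 1 \<Theta>0"
 define y where "y n x = \<epsilon> n *\<^sub>R lat (cell (\<epsilon> n) x)" for n and x :: "real^'d"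
 define g where "g n z = \<epsilon> n powr (- tail_exp) * (a z * (1 - cos ((\<epsilon> n *\<^sub>R \<theta> n) \<bullet> lat z)))" for n and z :: "int^'d"
 have g0: "0 \<le> g n z" for n z
  by (cases "z = 0") (use nonneg in \<open>auto simp: g_def\<close>)
 have gs: "(g n has_sum \<epsilon> n powr (- tail_exp) * - symb a (\<epsilon> n *\<^sub>R \<theta> n)) UNIV" for n
  unfolding g_def by (intro has_sum_cmult_right symb_has_sum)
 have int_g: "(\<integral>x. g n (cell (\<epsilon> n) x) \<partial>(lborel :: (real^'d) measure)) = \<epsilon> n powr (- \<alpha>) * - symb a (\<epsilon> n *\<^sub>R \<theta> n)" for n
 proof -
  have "\<epsilon> n ^ CARD('d) * \<epsilon> n powr (- tail_exp) = \<epsilon> n powr (- \<alpha>)"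
   using \<epsilon>(1)[of n] by (simp add: tail_exp_def powr_realpow[symmetric] powr_add[symmetric])
  then show ?thesis using integral_cell(1)[OF \<epsilon>(1) g0 gs, of n] by (simp add: mult.assoc[symmetric])
 qed
 have g_eq: "g n (cell (\<epsilon> n) x) = scaled_tail (cell (\<epsilon> n) x) * (norm (y n x) powr (- tail_exp) * (1 - cos (\<theta> n \<bullet> y n x)))" for n x
 proof (cases "cell (\<epsilon> n) x = 0")
  case False
  have "norm (y n x) powr (- tail_exp) = \<epsilon> n powr (- tail_exp) * norm (lat (cell (\<epsilon> n) x)) powr (- tail_exp)"
   using \<epsilon>(1)[of n] by (simp add: y_def powr_mult)
  then show ?thesis by (simp add: g_def a_eq_scaled[OF False] y_def)
 qed (simp add: g_def y_def)
 have close: "norm (y n x - x) \<le> \<epsilon> n * CARD('d)" for n x unfolding y_def by (rule cell_close[OF \<epsilon>(1)])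
 have ylim: "(\<lambda>n. y n x) \<longlonglongrightarrow> x" for x
 proof -
  have "(\<lambda>n. \<epsilon> n * real CARD('d)) \<longlonglongrightarrow> 0 * real CARD('d)" by (intro tendsto_intros \<epsilon>)
  then have "(\<lambda>n. \<epsilon> n * CARD('d)) \<longlonglongrightarrow> 0" by simp
  then have "(\<lambda>n. y n x - x) \<longlonglongrightarrow> 0" by (rule Lim_null_comparison[rotated]) (use close in auto)
  then show ?thesis by (simp add: LIM_zero_iff)
 qed
 have "(\<lambda>n. \<integral>x. g n (cell (\<epsilon> n) x) \<partial>(lborel :: (real^'d) measure)) \<longlonglongrightarrow> (\<integral>x. limit_integrand \<theta>' x \<partial>lborel)"
 proof (rule integral_dominated_convergence[where w="dominating (K * (2 * D powr tail_exp * \<Theta>\<^sup>2))"])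
  show "limit_integrand \<theta>' \<in> borel_measurable lborel" by (simp add: limit_integrand_measurable)
  show "(\<lambda>x. g n (cell (\<epsilon> n) x)) \<in> borel_measurable lborel" for n
   using integral_cell(2)[OF \<epsilon>(1) g0 gs, of n] by simp
  show "AE x in lborel. (\<lambda>n. g n (cell (\<epsilon> n) x)) \<longlonglongrightarrow> limit_integrand \<theta>' x"
   using AE_lborel_singleton[of 0]
  proof eventually_elim
   fix x :: "real^'d" assume x: "x \<noteq> 0"
   have "filterlim (\<lambda>n. cell (\<epsilon> n) x) at_lattice_infinity sequentially"
    unfolding at_lattice_infinity_def filterlim_filtercomap_iff
   proof -
    have "filterlim (\<lambda>n. inverse (\<epsilon> n)) at_top sequentially"
     using \<epsilon> by (intro filterlim_inverse_at_top) auto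
    then have "filterlim (\<lambda>n. norm (y n x) * inverse (\<epsilon> n)) at_top sequentially"
     by (rule filterlim_tendsto_pos_mult_at_top[OF tendsto_norm[OF ylim], rotated]) (use x in auto)
    then have "filterlim (\<lambda>n. norm (y n x) / \<epsilon> n) at_top sequentially" by (simp add: divide_inverse)
    moreover have "norm (y n x) / \<epsilon> n = (lattice_norm \<circ> (\<lambda>n. cell (\<epsilon> n) x)) n" for n
     using \<epsilon>(1)[of n] by (simp add: y_def norm_lat)
    ultimately show "filterlim (lattice_norm \<circ> (\<lambda>n. cell (\<epsilon> n) x)) at_top sequentially" by (simp add: o_def)
   qed
   from filterlim_compose[OF scaled_tail_tendsto this]
   have 1: "(\<lambda>n. scaled_tail (cell (\<epsilon> n) x)) \<longlonglongrightarrow> H0" .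
   have "(\<lambda>n. scaled_tail (cell (\<epsilon> n) x) * (norm (y n x) powr (- tail_exp) * (1 - cos (\<theta> n \<bullet> y n x))))
     \<longlonglongrightarrow> H0 * (norm x powr (- tail_exp) * (1 - cos (\<theta>' \<bullet> x)))"
    using x by (intro tendsto_intros 1 ylim \<theta>) auto
   then show "(\<lambda>n. g n (cell (\<epsilon> n) x)) \<longlonglongrightarrow> limit_integrand \<theta>' x"
    unfolding g_eq by (simp add: limit_integrand_def mult.assoc)
  qed
  show "AE x in lborel. norm (g n (cell (\<epsilon> n) x)) \<le> dominating (K * (2 * D powr tail_exp * \<Theta>\<^sup>2)) x" for n
   using AE_lborel_singleton[of 0]
  proof eventually_elim
   fix x :: "real^'d" assume x: "x \<noteq> 0"
   define B where "B = dominating (2 * D powr tail_exp * \<Theta>\<^sup>2) x"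
   have B0: "0 \<le> B" by (auto simp: B_def dominating_def)
   have KB: "K * B = dominating (K * (2 * D powr tail_exp * \<Theta>\<^sup>2)) x" by (simp add: B_def dominating_def)
   have "g n (cell (\<epsilon> n) x) \<le> K * B"
   proof (cases "cell (\<epsilon> n) x = 0")
    case False
    have "\<epsilon> n \<le> norm (y n x)"
     using norm_lat_ge_1[OF False] \<epsilon>(1)[of n] by (simp add: y_def)
    then have "\<epsilon> n * CARD('d) \<le> norm (y n x) * CARD('d)" by (intro mult_right_mono) auto
    moreover have "norm x \<le> norm (y n x) + norm (y n x - x)"
     using norm_triangle_ineq4[of "y n x" "y n x - x"] by simp
    ultimately have "norm x \<le> norm (y n x) + norm (y n x) * CARD('d)" using close[of n x] by linarith
    then have "norm x \<le> norm (y n x) * D" by (simp add: D_def distrib_left)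
    then have "norm x / D \<le> norm (y n x)" using D by (simp add: divide_le_eq)
    from cosine_power_bound[OF x this D, of "\<theta> n" \<Theta>]
    have "norm (y n x) powr (- tail_exp) * (1 - cos (\<theta> n \<bullet> y n x)) \<le> B"
     using \<Theta>[of n] by (simp add: B_def \<Theta>_def)
    then show ?thesis unfolding g_eq using K(2)[OF False] K(1)
     by (intro mult_mono) auto
   qed (use K B0 in \<open>simp add: g_def\<close>)
   then show "norm (g n (cell (\<epsilon> n) x)) \<le> dominating (K * (2 * D powr tail_exp * \<Theta>\<^sup>2)) x"
    using g0[of n "cell (\<epsilon> n) x"] KB by simp
  qed
 qed (rule dominating_integrable)
 then show ?thesis unfolding int_g stable_exponent_def .
qed

text \<open>Far out a is positive, in particular at two consecutive multiples of each unit vector; if the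
 symbol vanished, the cosine would be 1 at both, hence at their difference.\<close>

lemma symb_neg:
 assumes "\<theta> \<in> torus" "\<theta> \<noteq> 0" shows "symb a \<theta> < 0"
proof (rule ccontr)
 assume "\<not> ?thesis"
 then have s0: "- symb a \<theta> \<le> 0" by simp
 obtain R where R: "\<And>z. R \<le> norm (lat z) ==> \<bar>scaled_tail z - H0\<bar> < H0"
  using scaled_tail_near[OF H0] by blast
 have cos1: "cos (\<theta> \<bullet> lat z) = 1" if z: "max 1 R \<le> norm (lat z)" for z
 proof -
  have z0: "z \<noteq> 0" using z by auto
  have "0 < scaled_tail z" using R[of z] z by auto
  then have "0 < a z" using z unfolding a_eq_scaled[OF z0] by (intro mult_pos_pos) auto
  moreover have "a z * (1 - cos (\<theta> \<bullet> lat z)) = 0"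
  proof (rule nonneg_has_sum_le_0D[OF symb_has_sum s0])
   show "0 \<le> a z * (1 - cos (\<theta> \<bullet> lat z))" for z
    by (cases "z = 0") (use nonneg in auto)
  qed simp
  ultimately show ?thesis by simp
 qed
 have "\<theta> $ i = 0" for i
 proof -
  define N :: int where "N = \<lceil>max 1 R\<rceil>"
  have N: "max 1 R \<le> real_of_int N" unfolding N_def by (rule le_of_int_ceiling)
  have "\<theta> \<bullet> lat (axis i m) = real_of_int m * \<theta> $ i" and "norm (lat (axis i m)) = \<bar>real_of_int m\<bar>" for m
  proof -
   have "lat (axis i m) = axis i (real_of_int m)" by (auto simp: lat_def axis_def vec_eq_iff)
   then show "\<theta> \<bullet> lat (axis i m) = real_of_int m * \<theta> $ i" "norm (lat (axis i m)) = \<bar>real_of_int m\<bar>"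
    by (simp_all add: inner_axis norm_eq_sqrt_inner)
  qed
  note ax = this
  have c: "cos (real_of_int N * \<theta> $ i) = 1" "cos (real_of_int (N + 1) * \<theta> $ i) = 1"
   using cos1[of "axis i N"] cos1[of "axis i (N + 1)"] N unfolding ax by auto
  have "cos (\<theta> $ i) = cos (real_of_int (N + 1) * \<theta> $ i - real_of_int N * \<theta> $ i)" by (simp add: algebra_simps)
  also have "\<dots> = 1" unfolding cos_diff c using cos_one_sin_zero[OF c(1)] by simp
  finally have c0: "cos \<bar>\<theta> $ i\<bar> = cos 0" by simp
  have "- pi \<le> \<theta> $ i" "\<theta> $ i \<le> pi" using assms(1) by (auto simp: mem_box_cart)
  then have b: "\<bar>\<theta> $ i\<bar> \<le> pi" by linarith
  have "\<bar>\<theta> $ i\<bar> = 0" using cos_inj_pi[OF abs_ge_zero b order_refl pi_ge_zero c0] .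
  then show ?thesis by simp
 qed
 then show False using assms(2) by (simp add: vec_eq_iff)
qed

text \<open>By compactness of the torus, a sequence violating the bound for every c accumulates at a point
 different from 0, which symb_neg excludes, or at 0, where symb_scaling along a convergent sequence
 of directions would give a zero of the stable exponent.\<close>

lemma symb_lower_bound: "\<exists>c>0. \<forall>\<theta>\<in>torus. c * norm \<theta> powr \<alpha> \<le> - symb a \<theta>"
proof (rule ccontr)
 assume neg: "\<not> ?thesis"
 have "\<exists>\<theta>\<in>torus. - symb a \<theta> < 1 / real (Suc n) * norm \<theta> powr \<alpha>" for n
 proof (rule ccontr)
  assume "\<not> ?thesis"
  then have "\<forall>\<theta>\<in>torus. 1 / real (Suc n) * norm \<theta> powr \<alpha> \<le> - symb a \<theta>" by (meson not_le)
  moreover have "0 < 1 / real (Suc n)" by simp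
  ultimately show False using neg by blast
 qed
 then obtain \<theta> where \<theta>: "\<And>n. \<theta> n \<in> torus" "\<And>n. - symb a (\<theta> n) < 1 / real (Suc n) * norm (\<theta> n) powr \<alpha>"
  by metis
 have nz: "\<theta> n \<noteq> 0" for n using \<theta>(2)[of n] symb_nonpos[of "\<theta> n"] alpha by auto
 obtain l \<sigma> where l: "l \<in> torus" "strict_mono \<sigma>" "(\<theta> \<circ> \<sigma>) \<longlonglongrightarrow> l"
  using compact_cbox[unfolded compact_def] \<theta>(1) by metis
 have small: "(\<lambda>n. - symb a (\<theta> (\<sigma> n)) * norm (\<theta> (\<sigma> n)) powr (- \<alpha>)) \<longlonglongrightarrow> 0"
 proof (rule real_tendsto_sandwich[where f="\<lambda>_. 0" and h="\<lambda>n. 1 / real (Suc (\<sigma> n))"])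
  show "(\<lambda>n. 1 / real (Suc (\<sigma> n))) \<longlonglongrightarrow> 0"
   using LIMSEQ_subseq_LIMSEQ[OF LIMSEQ_inverse_real_of_nat l(2)] by (simp add: o_def inverse_eq_divide)
  show "\<forall>\<^sub>F n in sequentially. 0 \<le> - symb a (\<theta> (\<sigma> n)) * norm (\<theta> (\<sigma> n)) powr (- \<alpha>)"
   using symb_nonpos by (intro always_eventually allI mult_nonneg_nonneg) auto
  show "\<forall>\<^sub>F n in sequentially. - symb a (\<theta> (\<sigma> n)) * norm (\<theta> (\<sigma> n)) powr (- \<alpha>) \<le> 1 / real (Suc (\<sigma> n))"
  proof (intro always_eventually allI)
   fix n
   have p: "0 < norm (\<theta> (\<sigma> n)) powr \<alpha>" using nz by simp
   show "- symb a (\<theta> (\<sigma> n)) * norm (\<theta> (\<sigma> n)) powr (- \<alpha>) \<le> 1 / real (Suc (\<sigma> n))"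
    using less_imp_le[OF \<theta>(2)[of "\<sigma> n"]] p by (simp only: powr_minus divide_inverse[symmetric] pos_divide_le_eq)
  qed
 qed simp
 show False
 proof (cases "l = 0")
  case False
  have "(\<lambda>n. - symb a (\<theta> (\<sigma> n))) \<longlonglongrightarrow> - symb a l"
   using continuous_on_tendsto_compose[OF symb_continuous[of UNIV], of "\<theta> \<circ> \<sigma>" l] l(3) by (intro tendsto_minus) (simp add: o_def)
  moreover have "(\<lambda>n. norm (\<theta> (\<sigma> n)) powr (- \<alpha>)) \<longlonglongrightarrow> norm l powr (- \<alpha>)"
   using l(3) False by (intro tendsto_intros) (auto simp: o_def)
  ultimately have "(\<lambda>n. - symb a (\<theta> (\<sigma> n)) * norm (\<theta> (\<sigma> n)) powr (- \<alpha>)) \<longlonglongrightarrow> - symb a l * norm l powr (- \<alpha>)"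
   by (rule tendsto_mult)
  from LIMSEQ_unique[OF small this] have "symb a l = 0" using False by simp
  then show False using symb_neg[OF l(1) False] by simp
 next
  case True
  define v where "v n = \<theta> (\<sigma> n) /\<^sub>R norm (\<theta> (\<sigma> n))" for n
  have "v n \<in> sphere 0 1" for n using nz by (simp add: v_def)
  then obtain l' \<tau> where l': "l' \<in> sphere 0 1" "strict_mono \<tau>" "(v \<circ> \<tau>) \<longlonglongrightarrow> l'"
   using compact_sphere[of "0::real^'d" 1, unfolded compact_def] by metis
  define \<epsilon> where "\<epsilon> n = norm (\<theta> (\<sigma> (\<tau> n)))" for n
  have "(\<lambda>n. norm (\<theta> (\<sigma> n))) \<longlonglongrightarrow> 0"
   using l(3) True by (intro tendsto_norm_zero) (simp add: o_def)
  then have \<epsilon>0: "\<epsilon> \<longlonglongrightarrow> 0" using LIMSEQ_subseq_LIMSEQ[OF _ l'(2)] by (fastforce simp: \<epsilon>_def[abs_def] o_def)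
  have "(\<lambda>n. \<epsilon> n powr (- \<alpha>) * - symb a (\<epsilon> n *\<^sub>R (v \<circ> \<tau>) n)) \<longlonglongrightarrow> stable_exponent l'"
   by (rule symb_scaling[OF _ \<epsilon>0 l'(3)]) (use nz in \<open>simp add: \<epsilon>_def\<close>)
  moreover have "\<epsilon> n *\<^sub>R (v \<circ> \<tau>) n = \<theta> (\<sigma> (\<tau> n))" for n using nz by (simp add: \<epsilon>_def v_def)
  ultimately have "(\<lambda>n. - symb a (\<theta> (\<sigma> (\<tau> n))) * norm (\<theta> (\<sigma> (\<tau> n))) powr (- \<alpha>)) \<longlonglongrightarrow> stable_exponent l'"
   by (simp add: \<epsilon>_def mult.commute)
  moreover have "(\<lambda>n. - symb a (\<theta> (\<sigma> (\<tau> n))) * norm (\<theta> (\<sigma> (\<tau> n))) powr (- \<alpha>)) \<longlonglongrightarrow> 0"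
   using LIMSEQ_subseq_LIMSEQ[OF small l'(2)] by (simp add: o_def)
  ultimately have "stable_exponent l' = 0" by (rule LIMSEQ_unique)
  moreover have "l' \<noteq> 0" using l'(1) by auto
  ultimately show False using stable_exponent_pos by force
 qed
qed

lemma integral_torus_scale:
 fixes f :: "real^'d => real"
 assumes f: "f integrable_on torus" and \<epsilon>: "0 < \<epsilon>"
 shows "((\<lambda>\<eta>. if \<epsilon> *\<^sub>R \<eta> \<in> torus then f (\<epsilon> *\<^sub>R \<eta>) else 0) has_integral integral torus f / \<epsilon> ^ CARD('d)) UNIV"
proof -
 have "((\<lambda>x. f (\<epsilon> *\<^sub>R x + 0)) has_integral (1 / \<bar>\<epsilon>\<bar> ^ DIM(real^'d)) *\<^sub>R integral torus f)
   ((\<lambda>x. (1 / \<epsilon>) *\<^sub>R x + - ((1 / \<epsilon>) *\<^sub>R 0)) ` torus)"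
  by (rule has_integral_affinity) (use f \<epsilon> in \<open>auto intro: integrable_integral\<close>)
 moreover have "(\<lambda>x. (1 / \<epsilon>) *\<^sub>R x + - ((1 / \<epsilon>) *\<^sub>R 0)) ` torus = {\<eta>. \<epsilon> *\<^sub>R \<eta> \<in> (torus :: (real^'d) set)}"
 proof (intro set_eqI iffI)
  fix \<eta> assume "\<eta> \<in> {\<eta>. \<epsilon> *\<^sub>R \<eta> \<in> (torus :: (real^'d) set)}"
  then show "\<eta> \<in> (\<lambda>x. (1 / \<epsilon>) *\<^sub>R x + - ((1 / \<epsilon>) *\<^sub>R 0)) ` torus"
   using \<epsilon> by (intro image_eqI[of _ _ "\<epsilon> *\<^sub>R \<eta>"]) auto
 qed (use \<epsilon> in auto)
 ultimately have "((\<lambda>x. f (\<epsilon> *\<^sub>R x)) has_integral integral torus f / \<epsilon> ^ CARD('d)) {\<eta>. \<epsilon> *\<^sub>R \<eta> \<in> torus}"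
  using \<epsilon> by simp
 then show ?thesis by (subst (asm) has_integral_restrict_UNIV[symmetric]) simp
qed

text \<open>The density at 0 of the stable law with exponent stable_exponent.\<close>

definition stable_density :: real where
 "stable_density = integral UNIV (\<lambda>\<eta>::real^'d. exp (- stable_exponent \<eta>)) / (2 * pi) ^ CARD('d)"

text \<open>With t = \<epsilon>^(-\<alpha>) and \<theta> = \<epsilon> \<eta> the Fourier integrand converges by symb_scaling, and
 symb_lower_bound dominates it by a stretched exponential in \<eta>.\<close>

lemma heat_scaling_limit:
 assumes \<epsilon>: "\<And>n. 0 < \<epsilon> n" "\<epsilon> \<longlonglongrightarrow> 0"
 shows "(\<lambda>\<eta>::real^'d. exp (- stable_exponent \<eta>)) integrable_on UNIV"
  "(\<lambda>n. heat a (\<epsilon> n powr (- \<alpha>)) z / \<epsilon> n ^ CARD('d)) \<longlonglongrightarrow> stable_density"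
proof -
 obtain c where c: "c > 0" "\<And>\<theta>. \<theta> \<in> torus ==> c * norm \<theta> powr \<alpha> \<le> - symb a \<theta>"
  using symb_lower_bound by blast
 define F where "F n \<theta> = exp (\<epsilon> n powr (- \<alpha>) * symb a \<theta>) * cos (\<theta> \<bullet> lat z)" for n \<theta>
 define G where "G n \<eta> = (if \<epsilon> n *\<^sub>R \<eta> \<in> torus then F n (\<epsilon> n *\<^sub>R \<eta>) else 0)" for n \<eta>
 have G: "(G n has_integral integral torus (F n) / \<epsilon> n ^ CARD('d)) UNIV" for n
  unfolding G_def[abs_def] F_def
  by (rule integral_torus_scale[OF _ \<epsilon>(1)]) (auto intro!: integrable_continuous heat_integrand_continuous)
 have dom: "norm (G n \<eta>) \<le> exp (- (c * norm \<eta> powr \<alpha>))" for n \<eta>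
 proof (cases "\<epsilon> n *\<^sub>R \<eta> \<in> torus")
  case True
  have "\<epsilon> n powr (- \<alpha>) * symb a (\<epsilon> n *\<^sub>R \<eta>) \<le> \<epsilon> n powr (- \<alpha>) * - (c * norm (\<epsilon> n *\<^sub>R \<eta>) powr \<alpha>)"
   using c(2)[OF True] by (intro mult_left_mono) auto
  also have "norm (\<epsilon> n *\<^sub>R \<eta>) powr \<alpha> = \<epsilon> n powr \<alpha> * norm \<eta> powr \<alpha>"
   using \<epsilon>(1)[of n] by (simp add: powr_mult)
  also have "\<epsilon> n powr (- \<alpha>) * - (c * (\<epsilon> n powr \<alpha> * norm \<eta> powr \<alpha>)) = - (c * norm \<eta> powr \<alpha>)"
   using \<epsilon>(1)[of n] by (simp add: powr_minus field_simps)
  finally have 1: "exp (\<epsilon> n powr (- \<alpha>) * symb a (\<epsilon> n *\<^sub>R \<eta>)) \<le> exp (- (c * norm \<eta> powr \<alpha>))"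
   by (simp only: exp_le_cancel_iff)
  have 2: "norm (F n (\<epsilon> n *\<^sub>R \<eta>)) \<le> exp (\<epsilon> n powr (- \<alpha>) * symb a (\<epsilon> n *\<^sub>R \<eta>))"
   by (simp add: F_def abs_mult)
  show ?thesis using order_trans[OF 2 1] True by (simp only: G_def if_True)
 qed (simp add: G_def)
 have conv: "(\<lambda>n. G n \<eta>) \<longlonglongrightarrow> exp (- stable_exponent \<eta>)" for \<eta>
 proof -
  have e0: "(\<lambda>n. \<epsilon> n *\<^sub>R \<eta>) \<longlonglongrightarrow> 0 *\<^sub>R \<eta>" by (intro tendsto_intros \<epsilon>)
  have A: "(\<lambda>n. \<epsilon> n powr (- \<alpha>) * - symb a (\<epsilon> n *\<^sub>R \<eta>)) \<longlonglongrightarrow> stable_exponent \<eta>"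
   using symb_scaling[OF \<epsilon>, of "\<lambda>_. \<eta>" \<eta>] by simp
  have B: "(\<lambda>n. (\<epsilon> n *\<^sub>R \<eta>) \<bullet> lat z) \<longlonglongrightarrow> (0 *\<^sub>R \<eta>) \<bullet> lat z" by (intro tendsto_inner e0 tendsto_const)
  have "(\<lambda>n. exp (- (\<epsilon> n powr (- \<alpha>) * - symb a (\<epsilon> n *\<^sub>R \<eta>))) * cos ((\<epsilon> n *\<^sub>R \<eta>) \<bullet> lat z))
    \<longlonglongrightarrow> exp (- stable_exponent \<eta>) * cos ((0 *\<^sub>R \<eta>) \<bullet> lat z)"
   by (rule tendsto_mult[OF tendsto_exp[OF tendsto_minus[OF A]] tendsto_cos[OF B]])
  then have "(\<lambda>n. F n (\<epsilon> n *\<^sub>R \<eta>)) \<longlonglongrightarrow> exp (- stable_exponent \<eta>)" by (simp add: F_def)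
  moreover have "\<forall>\<^sub>F n in sequentially. \<epsilon> n *\<^sub>R \<eta> \<in> box (\<chi> i. - pi) (\<chi> i. pi)"
  proof (rule topological_tendstoD[OF e0 open_box])
   show "0 *\<^sub>R \<eta> \<in> box (\<chi> i. - pi) (\<chi> i. pi)" by (simp add: mem_box_cart)
  qed
  then have "\<forall>\<^sub>F n in sequentially. F n (\<epsilon> n *\<^sub>R \<eta>) = G n \<eta>"
   by eventually_elim (use box_subset_cbox in \<open>auto simp: G_def\<close>)
  ultimately show ?thesis by (rule Lim_transform_eventually)
 qed
 have hi: "(\<lambda>\<eta>::real^'d. exp (- (c * norm \<eta> powr \<alpha>))) integrable_on UNIV"
  using integrable_stretched_exponential[OF c(1) alpha(1), where 'a="real^'d"] by (rule integrable_on_lborel)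
 note dc = dominated_convergence[of G UNIV "\<lambda>\<eta>. exp (- (c * norm \<eta> powr \<alpha>))" "\<lambda>\<eta>. exp (- stable_exponent \<eta>)"]
 show "(\<lambda>\<eta>::real^'d. exp (- stable_exponent \<eta>)) integrable_on UNIV"
  by (rule dc(1)) (use G hi dom conv in \<open>auto simp: has_integral_integrable\<close>)
 have "(\<lambda>n. integral UNIV (G n)) \<longlonglongrightarrow> integral UNIV (\<lambda>\<eta>::real^'d. exp (- stable_exponent \<eta>))"
  by (rule dc(2)) (use G hi dom conv in \<open>auto simp: has_integral_integrable\<close>)
 from tendsto_divide[OF this tendsto_const[of "(2 * pi) ^ CARD('d)"]]
 show "(\<lambda>n. heat a (\<epsilon> n powr (- \<alpha>)) z / \<epsilon> n ^ CARD('d)) \<longlonglongrightarrow> stable_density"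
  using integral_unique[OF G] by (simp add: stable_density_def heat_def F_def[abs_def] mult.commute)
qed

lemma stable_density_pos: "0 < stable_density"
proof -
 have int: "(\<lambda>\<eta>::real^'d. exp (- stable_exponent \<eta>)) integrable_on UNIV"
  by (rule heat_scaling_limit(1)[where \<epsilon>="\<lambda>n. inverse (real (Suc n))"]) (simp, rule LIMSEQ_inverse_real_of_nat)
 define \<Theta> where "\<Theta> = real CARD('d)"
 define C where "C = (\<integral>x. dominating (H0 * (2 * \<Theta>\<^sup>2)) x \<partial>lborel)"
 define Q :: "(real^'d) set" where "Q = cbox (\<chi> i. 0) (\<chi> i. 1)"
 have le: "stable_exponent \<eta> \<le> C" if "\<eta> \<in> Q" for \<eta>
 proof -
  have "norm \<eta> \<le> (\<Sum>i\<in>UNIV. \<bar>\<eta> $ i\<bar>)" by (rule norm_le_l1_cart)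
  also have "\<dots> \<le> (\<Sum>i\<in>(UNIV::'d set). 1)" using that by (intro sum_mono) (auto simp: Q_def mem_box_cart)
  finally have "norm \<eta> \<le> \<Theta>" by (simp add: \<Theta>_def)
  moreover have "1 \<le> \<Theta>" by (simp add: \<Theta>_def Suc_leI)
  ultimately show ?thesis unfolding stable_exponent_def C_def
   by (intro integral_mono limit_integrand_integrable dominating_integrable limit_integrand_bound)
 qed
 have Q1: "Henstock_Kurzweil_Integration.content Q = 1"
 proof -
  have "(0 :: real^'d) \<in> cbox (\<chi> i. 0) (\<chi> i. 1)" by (simp add: mem_box_cart)
  then have "cbox (\<chi> i. 0) ((\<chi> i. 1) :: real^'d) \<noteq> {}" by blast
  then show ?thesis unfolding Q_def by (subst content_cbox_cart) simp_all
 qed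
 have "0 < exp (- C)" by simp
 also have "\<dots> = integral Q (\<lambda>\<eta>::real^'d. exp (- C))"
  using Q1 unfolding Q_def by (simp add: integral_const)
 also have "\<dots> \<le> integral Q (\<lambda>\<eta>::real^'d. exp (- stable_exponent \<eta>))"
  unfolding Q_def by (rule integral_le) (use le integrable_on_subcbox[OF int] in \<open>auto simp: Q_def\<close>)
 also have "\<dots> \<le> integral UNIV (\<lambda>\<eta>::real^'d. exp (- stable_exponent \<eta>))"
  unfolding Q_def by (rule integral_subset_le) (use int integrable_on_subcbox[OF int] in auto)
 finally show ?thesis by (simp add: stable_density_def)
qed

lemma heat_asymptotics: "(\<lambda>t. heat a t z * t powr (real CARD('d) / \<alpha>)) \<leadsto> stable_density"
proof (rule tendsto_at_topI_sequentially)
 fix X :: "nat => real" assume X: "filterlim X at_top sequentially"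
 (* truncated at 1 so that \<epsilon> n is positive for every n *)
 define Y where "Y n = max 1 (X n)" for n
 define \<epsilon> where "\<epsilon> n = Y n powr (- (1 / \<alpha>))" for n
 have ev: "\<forall>\<^sub>F n in sequentially. Y n = X n"
  using filterlim_at_top[THEN iffD1, OF X, rule_format, of 1] by eventually_elim (simp add: Y_def)
 have Y: "filterlim Y at_top sequentially"
  using X ev by (subst filterlim_cong[OF refl refl ev])
 have "(\<lambda>x. x powr (- (1 / \<alpha>))) \<leadsto> 0"
  by (rule tendsto_neg_powr) (use alpha in \<open>auto intro: filterlim_ident\<close>)
 from filterlim_compose[OF this Y] have e0: "\<epsilon> \<longlonglongrightarrow> 0" by (simp add: \<epsilon>_def[abs_def])
 have Y1: "1 \<le> Y n" for n by (simp add: Y_def)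
 have ep: "0 < \<epsilon> n" for n using Y1[of n] by (simp add: \<epsilon>_def)
 have "heat a (\<epsilon> n powr (- \<alpha>)) z / \<epsilon> n ^ CARD('d) = heat a (Y n) z * Y n powr (real CARD('d) / \<alpha>)" for n
 proof -
  have "\<epsilon> n powr (- \<alpha>) = Y n" using Y1[of n] alpha by (simp add: \<epsilon>_def powr_powr)
  moreover have "\<epsilon> n ^ CARD('d) = Y n powr (- (real CARD('d) / \<alpha>))"
   using ep[of n] by (simp add: powr_realpow[symmetric] \<epsilon>_def powr_powr)
  ultimately show ?thesis by (simp add: powr_minus field_simps)
 qed
 with heat_scaling_limit(2)[OF ep e0, of z]
 have "(\<lambda>n. heat a (Y n) z * Y n powr (real CARD('d) / \<alpha>)) \<longlonglongrightarrow> stable_density" by simp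
 then show "(\<lambda>n. heat a (X n) z * X n powr (real CARD('d) / \<alpha>)) \<longlonglongrightarrow> stable_density"
  by (rule Lim_transform_eventually) (use ev in \<open>auto elim: eventually_mono\<close>)
qed

end

section \<open>First moments of the branching random walk\<close>

definition branch_rate :: "(int ^ 'd => real) => real => int ^ 'd => int ^ 'd => real" where
 "branch_rate a \<beta> x y = walk_rate a x y + \<beta> * of_bool (x = 0 \<and> y = 0)"

abbreviation branch_gen :: "(int ^ 'd => real) => real => (int ^ 'd => real) => int ^ 'd => real" where
 "branch_gen a \<beta> \<equiv> gen_op (branch_rate a \<beta>)"

lemma has_sum_supported_on_image:
 fixes f :: "'b => real"
 assumes "inj_on h A" "\<And>i. i \<in> A ==> f (h i) = F i" "(F has_sum S) A" "\<And>\<xi>. \<xi> \<notin> h ` A ==> f \<xi> = 0"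
 shows "(f has_sum S) UNIV"
proof -
 have "((f \<circ> h) has_sum S) A" using assms(2,3) by (subst has_sum_cong[of _ _ F]) auto
 then have "(f has_sum S) (h ` A)" using has_sum_reindex[OF assms(1)] by blast
 then show ?thesis by (rule has_sum_cong_neutral[THEN iffD1, rotated -1]) (use assms(4) in auto)
qed

lemma has_sum_from_nn_integral:
 fixes f :: "'x => real"
 assumes f: "\<And>y. 0 \<le> f y" and I: "(\<integral>\<^sup>+y. ennreal (f y) \<partial>count_space UNIV) = ennreal S" and S: "0 \<le> S"
 shows "(f has_sum S) UNIV"
proof -
 have "integrable (count_space UNIV) f"
  by (rule integrableI_bounded) (use f I in auto)
 then have ab: "Infinite_Set_Sum.abs_summable_on f UNIV" unfolding abs_summable_on_def .
 have "(\<lambda>y. norm (f y)) summable_on UNIV" using ab by (rule abs_summable_equivalent[THEN iffD2])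
 then have "f summable_on UNIV" using f by simp
 moreover have "infsum f UNIV = S"
  using nn_integral_conv_infsetsum[OF ab] infsetsum_infsum[OF ab] f I S
  by (simp add: infsum_nonneg)
 ultimately show ?thesis by (simp add: has_sum_iff)
qed

lemma expectation_bind_pmf:
 fixes g :: "'b => real"
 assumes g: "\<And>y. 0 \<le> g y" "\<And>y. g y \<le> B"
 shows "pmf_mean (bind_pmf p f) g = pmf_mean p (\<lambda>x. pmf_mean (f x) g)"
proof -
 have B: "0 \<le> B" using g[of undefined] by linarith
 have ig: "integrable (measure_pmf q) g" for q :: "'b pmf"
  by (rule measure_pmf.integrable_const_bound[where B=B]) (use g in auto)
 have e: "(\<integral>\<^sup>+y. ennreal (g y) \<partial>measure_pmf q) = ennreal (pmf_mean q g)" for q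
  by (rule nn_integral_eq_integral[OF ig]) (use g in auto)
 have b: "pmf_mean q g \<le> B" "0 \<le> pmf_mean q g" for q
  using integral_mono[OF ig[of q], of "\<lambda>_. B"] g by (auto intro: integral_nonneg_AE)
 have ih: "integrable (measure_pmf p) (\<lambda>x. pmf_mean (f x) g)"
  by (rule measure_pmf.integrable_const_bound[where B=B]) (use b in auto)
 have "ennreal (pmf_mean (bind_pmf p f) g) = (\<integral>\<^sup>+x. \<integral>\<^sup>+y. ennreal (g y) \<partial>f x \<partial>p)"
  by (simp add: e[symmetric])
 also have "\<dots> = ennreal (pmf_mean p (\<lambda>x. pmf_mean (f x) g))"
  unfolding e by (rule nn_integral_eq_integral[OF ih]) (use b in auto)
 finally show ?thesis using b by (simp add: integral_nonneg_AE)
qed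

definition mult_functional :: "('x => real) => 'x multiset => real" where
 "mult_functional g \<xi> = (\<Prod>z\<in>#\<xi>. g z)"

definition add_functional :: "('x => real) => 'x multiset => real" where
 "add_functional h \<xi> = (\<Sum>z\<in>#\<xi>. h z)"

lemma mult_functional_simps [simp]:
 "mult_functional g {#} = 1" "mult_functional g (add_mset x \<xi>) = g x * mult_functional g \<xi>"
 "mult_functional g (\<xi> + \<zeta>) = mult_functional g \<xi> * mult_functional g \<zeta>"
 "mult_functional g (replicate_mset n x) = g x ^ n"
 by (simp_all add: mult_functional_def)

lemma add_functional_simps [simp]:
 "add_functional g {#} = 0" "add_functional g (add_mset x \<xi>) = g x + add_functional g \<xi>"
 "add_functional g (\<xi> + \<zeta>) = add_functional g \<xi> + add_functional g \<zeta>"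
 by (simp_all add: add_functional_def)

lemma mult_functional_range:
 assumes "\<And>z. 0 \<le> g z" "\<And>z. g z \<le> 1"
 shows "0 \<le> mult_functional g \<xi>" "mult_functional g \<xi> \<le> 1"
 by (induction \<xi>) (use assms in \<open>auto intro: mult_le_one\<close>)

lemma add_functional_nonneg: "(\<And>z. 0 \<le> h z) ==> 0 \<le> add_functional h \<xi>"
 by (induction \<xi>) auto

lemma one_minus_mult_functional_le:
 assumes h: "\<And>z. 0 \<le> h z" "\<And>z. h z \<le> 1" and \<epsilon>: "0 \<le> \<epsilon>" "\<epsilon> \<le> 1"
 shows "1 - mult_functional (\<lambda>z. 1 - \<epsilon> * h z) \<xi> \<le> \<epsilon> * add_functional h \<xi>"
proof (induction \<xi>)
 case (add x \<xi>)
 define p where "p = mult_functional (\<lambda>z. 1 - \<epsilon> * h z) \<xi>"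
 have r: "0 \<le> \<epsilon> * h z" "\<epsilon> * h z \<le> 1" for z using h[of z] \<epsilon> by (auto intro: mult_le_one)
 have "p \<le> 1" unfolding p_def by (rule mult_functional_range) (use r in auto)
 then have "\<epsilon> * h x * p \<le> \<epsilon> * h x" using r(1)[of x] mult_left_mono[of p 1 "\<epsilon> * h x"] by simp
 then show ?case using add by (simp add: p_def[symmetric] algebra_simps)
qed simp

text \<open>The derivative at \<epsilon> = 0 along \<epsilon> = 1/(k+1); the first moment is recovered from the generating
 functional in this way.\<close>

lemma mult_functional_derivative:
 "(\<lambda>k. (1 - mult_functional (\<lambda>z. 1 - inverse (real (Suc k)) * h z) \<xi>) * real (Suc k)) \<longlonglongrightarrow> add_functional h \<xi>"
proof (induction \<xi>)
 case (add x \<xi>)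
 have ev: "mult_functional (\<lambda>z. 1 - inverse (real (Suc k)) * h z) \<xi>
   = 1 - inverse (real (Suc k)) * ((1 - mult_functional (\<lambda>z. 1 - inverse (real (Suc k)) * h z) \<xi>) * real (Suc k))" for k
  by (simp add: field_simps del: of_nat_Suc)
 have "(\<lambda>k. 1 - inverse (real (Suc k)) * ((1 - mult_functional (\<lambda>z. 1 - inverse (real (Suc k)) * h z) \<xi>) * real (Suc k)))
   \<longlonglongrightarrow> 1 - 0 * add_functional h \<xi>"
  by (intro tendsto_diff tendsto_const tendsto_mult LIMSEQ_inverse_real_of_nat add)
 then have p: "(\<lambda>k. mult_functional (\<lambda>z. 1 - inverse (real (Suc k)) * h z) \<xi>) \<longlonglongrightarrow> 1"
  unfolding ev[symmetric] by simp
 have "(\<lambda>k. (1 - mult_functional (\<lambda>z. 1 - inverse (real (Suc k)) * h z) \<xi>) * real (Suc k)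
   + h x * mult_functional (\<lambda>z. 1 - inverse (real (Suc k)) * h z) \<xi>) \<longlonglongrightarrow> add_functional h \<xi> + h x * 1"
  by (intro tendsto_add tendsto_mult tendsto_const add p)
 moreover have "(1 - mult_functional (\<lambda>z. 1 - inverse (real (Suc k)) * h z) \<xi>) * real (Suc k)
   + h x * mult_functional (\<lambda>z. 1 - inverse (real (Suc k)) * h z) \<xi>
   = (1 - mult_functional (\<lambda>z. 1 - inverse (real (Suc k)) * h z) (add_mset x \<xi>)) * real (Suc k)" for k
  by (simp add: field_simps del: of_nat_Suc)
 ultimately show ?case by (simp add: add.commute del: mult_functional_simps(2))
qed simp

lemma (in walk_intensity) branch_generator:
 assumes "0 \<le> \<beta>"
 shows "generator (branch_rate a \<beta>) (mass + \<beta>)"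
  and "(\<And>y. \<bar>u y\<bar> \<le> B) ==>
   branch_gen a \<beta> u x = walk_gen a u x + \<beta> * of_bool (x = 0) * u 0"
proof -
 interpret W: generator "walk_rate a" mass by (rule generator_walk_rate)
 have point: "((\<lambda>y. \<beta> * of_bool (x = 0 \<and> y = 0) * v y) has_sum \<beta> * of_bool (x = 0) * v 0) UNIV" for x and v :: "int^'d => real"
  using infsum_single[of 0 "\<lambda>y. \<beta> * of_bool (x = 0 \<and> y = 0) * v y"] by (simp add: has_sum_iff)
 have abs: "((\<lambda>y. \<bar>walk_rate a x y\<bar> + \<beta> * of_bool (x = 0 \<and> y = 0) * 1) has_sum
   ((\<Sum>\<^sub>\<infinity>y. \<bar>walk_rate a x y\<bar>) + \<beta> * of_bool (x = 0) * 1)) UNIV" for x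
  by (intro has_sum_add has_sum_infsum W.row_summable point)
 have le: "\<bar>branch_rate a \<beta> x y\<bar> \<le> \<bar>walk_rate a x y\<bar> + \<beta> * of_bool (x = 0 \<and> y = 0) * 1" for x y
  using assms abs_triangle_ineq[of "walk_rate a x y" "\<beta> * of_bool (x = 0 \<and> y = 0)"] by (simp add: branch_rate_def)
 show "generator (branch_rate a \<beta>) (mass + \<beta>)"
 proof
  show "0 \<le> branch_rate a \<beta> x y" if "x \<noteq> y" for x y
   using W.offdiag[OF that] assms by (simp add: branch_rate_def)
  show "branch_rate a \<beta> x y = branch_rate a \<beta> y x" for x y
   using W.sym[of x y] by (auto simp: branch_rate_def)
  show s: "(\<lambda>y. \<bar>branch_rate a \<beta> x y\<bar>) summable_on UNIV" for x
   by (rule summable_on_comparison_test[OF has_sum_imp_summable[OF abs]], rule le, simp)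
  show "(\<Sum>\<^sub>\<infinity>y. \<bar>branch_rate a \<beta> x y\<bar>) \<le> mass + \<beta>" for x
  proof -
   have "(\<Sum>\<^sub>\<infinity>y. \<bar>branch_rate a \<beta> x y\<bar>) \<le> (\<Sum>\<^sub>\<infinity>y. \<bar>walk_rate a x y\<bar>) + \<beta> * of_bool (x = 0) * 1"
    by (rule has_sum_mono[OF has_sum_infsum[OF s] abs]) (rule le)
   then show ?thesis using W.row_bound[of x] assms by (cases "x = 0") auto
  qed
 qed
 assume u: "\<And>y. \<bar>u y\<bar> \<le> B"
 have "((\<lambda>y. walk_rate a x y * u y + \<beta> * of_bool (x = 0 \<and> y = 0) * u y) has_sum
   walk_gen a u x + \<beta> * of_bool (x = 0) * u 0) UNIV"
  unfolding gen_op_def by (intro has_sum_add has_sum_infsum W.gen_summable[OF u] point)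
 then show "branch_gen a \<beta> u x = walk_gen a u x + \<beta> * of_bool (x = 0) * u 0"
  by (simp add: gen_op_def[of "branch_rate a \<beta>"] branch_rate_def distrib_right infsumI)
qed

lemma geometric_excess:
 fixes F :: real
 assumes "0 \<le> F" "F \<le> 1" "1 < n"
 shows "0 \<le> (\<Sum>i<n. F ^ i) - 1" "(\<Sum>i<n. F ^ i) - 1 \<le> real n - 1"
proof -
 have "(\<Sum>i\<in>{0}. F ^ i) \<le> (\<Sum>i<n. F ^ i)" using assms by (intro sum_mono2) auto
 then show "0 \<le> (\<Sum>i<n. F ^ i) - 1" by simp
 have "(\<Sum>i<n. F ^ i) \<le> (\<Sum>i<n. 1)" using assms by (intro sum_mono power_le_one) auto
 then show "(\<Sum>i<n. F ^ i) - 1 \<le> real n - 1" by simp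
qed

context branching_transition
begin

abbreviation \<beta> :: real where "\<beta> \<equiv> beta_star b"

lemma b_has_sum: "(b has_sum 0) UNIV"
 by (rule sums_nonneg_imp_has_sum_strong[OF sum_zero])
  (use offspring_nonneg in \<open>auto simp: eventually_sequentially intro!: exI[of _ 2]\<close>)

lemma b_branching_sum: "(b has_sum (- b 0 - b 1)) {1<..}"
proof -
 have "(b has_sum (0 - (b 0 + b 1))) (UNIV - {0, 1})"
  by (rule has_sum_Diff[OF b_has_sum]) (auto intro!: has_sum_finiteI)
 moreover have "UNIV - {0, 1} = {1::nat<..}" by auto
 ultimately show ?thesis by (simp add: algebra_simps)
qed

lemma b_abs_summable: "(\<lambda>n. \<bar>b n\<bar>) summable_on {1<..}"
proof -
 have "b summable_on {1<..}" using b_branching_sum by (auto simp: summable_on_def)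
 moreover have "\<bar>b n\<bar> = b n" if "n \<in> {1<..}" for n using offspring_nonneg[of n] that by simp
 ultimately show ?thesis by (subst summable_on_cong[of _ _ b])
qed

lemma beta_has_sum: "((\<lambda>n. (real n - 1) * b n) has_sum \<beta>) {1<..}"
 unfolding beta_star_def using finite_mean by simp

lemma beta_nonneg: "0 \<le> \<beta>"
 by (rule has_sum_nonneg[OF beta_has_sum]) (use offspring_nonneg in auto)

text \<open>The rate at which a particle at x dies or splits; at the origin, - b 1 = b 0 + sum of b n over
 n > 1.\<close>

definition kappa :: "int ^ 'd => real" where "kappa x = (if x = 0 then - b 1 else b 0)"

text \<open>The rate of the transition from one particle at x to \<xi>, with minus the total rate on the
 diagonal.\<close>

definition rate :: "int ^ 'd => (int ^ 'd) multiset => real" where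
 "rate x \<xi> = (if size \<xi> = 1 then a (the_elem (set_mset \<xi>) - x) - kappa x * of_bool (\<xi> = {#x#})
  else if \<xi> = {#} then b 0
  else if x = 0 \<and> \<xi> = replicate_mset (size \<xi>) 0 then b (size \<xi>) else 0)"

lemma rate_simps:
 "rate x {#y#} = a (y - x) - kappa x * of_bool (y = x)" "rate x {#} = b 0"
 "1 < n ==> rate x (replicate_mset n 0) = (if x = 0 then b n else 0)"
 by (auto simp: rate_def)

lemma rate_has_sum:
 assumes G: "\<And>\<xi>. \<bar>G \<xi>\<bar> \<le> 1"
 shows "((\<lambda>\<xi>. rate x \<xi> * G \<xi>) has_sum
  (walk_gen a (\<lambda>y. G {#y#}) x - kappa x * G {#x#} + b 0 * G {#}
   + (if x = 0 then \<Sum>\<^sub>\<infinity>n\<in>{1<..}. b n * G (replicate_mset n 0) else 0))) UNIV"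
proof -
 interpret W: generator "walk_rate a" mass by (rule generator_walk_rate)
 define f1 where "f1 \<xi> = (if size \<xi> = 1 then rate x \<xi> * G \<xi> else 0)" for \<xi>
 define f2 where "f2 \<xi> = (if \<xi> = {#} then rate x \<xi> * G \<xi> else 0)" for \<xi>
 define f3 where "f3 \<xi> = (if 1 < size \<xi> then rate x \<xi> * G \<xi> else 0)" for \<xi>
 have 1: "(f1 has_sum walk_gen a (\<lambda>y. G {#y#}) x + - (kappa x * G {#x#})) UNIV"
 proof (rule has_sum_supported_on_image[where h="\<lambda>y. {#y#}" and A=UNIV])
  show "((\<lambda>y. walk_rate a x y * G {#y#} + - (kappa x * of_bool (y = x) * G {#y#})) has_sum
    walk_gen a (\<lambda>y. G {#y#}) x + - (kappa x * G {#x#})) UNIV"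
  proof (rule has_sum_add)
   show "((\<lambda>y. walk_rate a x y * G {#y#}) has_sum walk_gen a (\<lambda>y. G {#y#}) x) UNIV"
    unfolding gen_op_def by (rule has_sum_infsum[OF W.gen_summable]) (rule G)
   show "((\<lambda>y. - (kappa x * of_bool (y = x) * G {#y#})) has_sum - (kappa x * G {#x#})) UNIV"
    using infsum_single[of x "\<lambda>y. - (kappa x * of_bool (y = x) * G {#y#})"] by (simp add: has_sum_iff)
  qed
  show "f1 {#y#} = walk_rate a x y * G {#y#} + - (kappa x * of_bool (y = x) * G {#y#})" for y
   by (simp add: f1_def rate_simps walk_rate_def left_diff_distrib)
  show "f1 \<xi> = 0" if "\<xi> \<notin> range (\<lambda>y. {#y#})" for \<xi>
   using that size_1_singleton_mset[of \<xi>] by (auto simp: f1_def)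
 qed (auto simp: inj_on_def)
 have 2: "(f2 has_sum b 0 * G {#}) UNIV"
  using infsum_single[of "{#}" f2] by (simp add: has_sum_iff f2_def rate_simps)
 have 3: "(f3 has_sum (if x = 0 then \<Sum>\<^sub>\<infinity>n\<in>{1<..}. b n * G (replicate_mset n 0) else 0)) UNIV"
 proof (rule has_sum_supported_on_image[where h="\<lambda>n. replicate_mset n 0" and A="{1<..}"])
  show "inj_on (\<lambda>n. replicate_mset n (0::int^'d)) {1<..}"
   by (auto simp: inj_on_def dest: arg_cong[of _ _ size])
  have "(\<lambda>n. b n * G (replicate_mset n 0)) summable_on {1<..}"
   by (rule summable_mult_bounded(2)[OF b_abs_summable G])
  then show "((\<lambda>n. (if x = 0 then b n else 0) * G (replicate_mset n 0)) has_sum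
   (if x = 0 then \<Sum>\<^sub>\<infinity>n\<in>{1<..}. b n * G (replicate_mset n 0) else 0)) {1<..}"
   by (cases "x = 0") simp_all
  show "f3 (replicate_mset n 0) = (if x = 0 then b n else 0) * G (replicate_mset n 0)" if "n \<in> {1<..}" for n
   using that by (simp add: f3_def rate_simps)
  show "f3 \<xi> = 0" if \<xi>: "\<xi> \<notin> (\<lambda>n. replicate_mset n 0) ` {1<..}" for \<xi>
  proof (rule ccontr)
   assume "f3 \<xi> \<noteq> 0"
   then have "1 < size \<xi>" "rate x \<xi> \<noteq> 0" by (auto simp: f3_def split: if_splits)
   then have "\<xi> = replicate_mset (size \<xi>) 0" "1 < size \<xi>" by (auto simp: rate_def split: if_splits)
   then show False using \<xi> by blast
  qed
 qed
 have "rate x \<xi> * G \<xi> = f1 \<xi> + f2 \<xi> + f3 \<xi>" for \<xi>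
 proof -
  consider "\<xi> = {#}" | "size \<xi> = 1" | "1 < size \<xi>"
   by (metis One_nat_def Suc_lessI gr0I size_eq_0_iff_empty)
  then show ?thesis by cases (auto simp: f1_def f2_def f3_def)
 qed
 then have eq: "(\<lambda>\<xi>. rate x \<xi> * G \<xi>) = (\<lambda>\<xi>. f1 \<xi> + f2 \<xi> + f3 \<xi>)" by blast
 show ?thesis unfolding eq using has_sum_add[OF has_sum_add[OF 1 2] 3] by simp
qed

lemma gen_walk_const: "walk_gen a (\<lambda>_. c) x = 0"
proof -
 have "(\<Sum>\<^sub>\<infinity>v. a v * c) = 0" using has_sum_cmult_left[OF regular, of c] by (simp add: infsumI)
 then show ?thesis by (simp add: gen_walk)
qed

lemma rate_total: "(rate x has_sum 0) UNIV"
proof -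
 have "(\<Sum>\<^sub>\<infinity>n\<in>{1<..}. b n) = - b 0 - b 1" using b_branching_sum by (rule infsumI)
 then show ?thesis
  using rate_has_sum[of "\<lambda>_. 1" x] gen_walk_const[of 1 x] by (cases "x = 0") (simp_all add: kappa_def)
qed

lemma rate_nonneg: "\<xi> \<noteq> {#x#} ==> 0 \<le> rate x \<xi>"
proof (cases "size \<xi> = 1")
 case True
 then obtain y where "\<xi> = {#y#}" using size_1_singleton_mset by blast
 moreover assume "\<xi> \<noteq> {#x#}"
 ultimately show ?thesis using nonneg[of "y - x"] by (simp add: rate_simps)
next
 case False
 then show ?thesis using offspring_nonneg by (simp add: rate_def)
qed

lemma rate_small_time:
 assumes "\<xi> = {#x#} \<or> rate x \<xi> \<noteq> 0"
 shows "(\<lambda>h. pmf (P h {#x#}) \<xi> - (of_bool (\<xi> = {#x#}) + rate x \<xi> * h)) \<in> o[at_right 0](\<lambda>h. h)"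
proof -
 consider "\<xi> = {#x#}" | y where "\<xi> = {#y#}" "y \<noteq> x" | "\<xi> = {#}" | n where "x = 0" "1 < n" "\<xi> = replicate_mset n 0"
 proof -
  assume *: "\<xi> = {#x#} ==> thesis" "\<And>y. \<xi> = {#y#} ==> y \<noteq> x ==> thesis" "\<xi> = {#} ==> thesis"
   "\<And>n. x = 0 ==> 1 < n ==> \<xi> = replicate_mset n 0 ==> thesis"
  show thesis
  proof (cases "size \<xi> = 1")
   case True
   then show ?thesis using *(1,2) size_1_singleton_mset by metis
  next
   case False
   show ?thesis
   proof (cases "\<xi> = {#}")
    case False2: False
    have "size \<xi> \<noteq> 0" using False2 by simp
    then have "1 < size \<xi>" using False by linarith
    moreover have "x = 0" "\<xi> = replicate_mset (size \<xi>) 0"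
     using assms False False2 by (auto simp: rate_def split: if_splits)
    ultimately show ?thesis using *(4) by blast
   qed (rule *(3))
  qed
 qed
 then show ?thesis
 proof cases
  case 1
  then show ?thesis using stay[of x] stay_origin by (cases "x = 0") (simp_all add: rate_simps kappa_def)
 next
  case 2
  then show ?thesis using jump[of x y] by (simp add: rate_simps)
 next
  case 3
  then show ?thesis using death[of x] by (simp add: rate_simps)
 next
  case 4
  moreover have "replicate_mset n (0::int^'d) \<noteq> {#0#}" using 4 by (auto dest: arg_cong[of _ _ size])
  ultimately show ?thesis using branch[of n] by (simp add: rate_simps)
 qed
qed

text \<open>The generating functional of the population. It is bounded, unlike the moments, so the
 backward equation applies to it directly.\<close>

definition Phi :: "(int ^ 'd => real) => real => (int ^ 'd) multiset => real" where
 "Phi g t \<xi> = pmf_mean (P t \<xi>) (mult_functional g)"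

context
 fixes g :: "int ^ 'd => real"
 assumes g: "\<And>z. 0 \<le> g z" "\<And>z. g z \<le> 1"
begin

lemma Phi_range: "0 \<le> Phi g t \<xi>" "Phi g t \<xi> \<le> 1"
proof -
 have i: "integrable (measure_pmf (P t \<xi>)) (mult_functional g)"
  by (rule measure_pmf.integrable_const_bound[where B=1]) (use mult_functional_range[of g, OF g] in auto)
 show "0 \<le> Phi g t \<xi>" unfolding Phi_def by (rule integral_nonneg_AE) (use mult_functional_range[of g, OF g] in auto)
 show "Phi g t \<xi> \<le> 1" unfolding Phi_def
  using integral_mono[OF i, of "\<lambda>_. 1"] mult_functional_range[of g, OF g] by simp
qed

lemma Phi_branching: "0 \<le> t ==> Phi g t \<xi> = mult_functional (\<lambda>z. Phi g t {#z#}) \<xi>"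
proof (induction \<xi>)
 case empty
 then show ?case by (simp add: Phi_def extinct)
next
 case (add x \<xi>)
 have "Phi g t (add_mset x \<xi>) = pmf_mean (bind_pmf (P t {#x#}) (\<lambda>\<xi>'. map_pmf (\<lambda>\<zeta>'. \<xi>' + \<zeta>') (P t \<xi>))) (mult_functional g)"
  using independent[OF add.prems, of "{#x#}" \<xi>] by (simp add: Phi_def)
 also have "\<dots> = pmf_mean (P t {#x#}) (\<lambda>\<xi>'. mult_functional g \<xi>' * Phi g t \<xi>)"
  by (subst expectation_bind_pmf[where B=1]) (use mult_functional_range[of g, OF g] in \<open>auto simp: Phi_def\<close>)
 finally show ?case using add by (simp add: Phi_def)
qed

lemma Phi_markov: "0 \<le> s ==> 0 \<le> h ==> Phi g (s + h) \<xi> = pmf_mean (P h \<xi>) (Phi g s)"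
 unfolding Phi_def[abs_def] add.commute[of s]
 by (subst semigroup, simp, simp, subst expectation_bind_pmf[where B=1]) (use mult_functional_range[of g, OF g] in auto)

lemma Phi_initial: "Phi g 0 {#x#} = g x"
 by (simp add: Phi_def initial)

text \<open>The backward equation is available for single ancestors; for several, continuity follows from
 the branching property.\<close>

lemma Phi_continuous: "continuous_on {0..} (\<lambda>t. Phi g t \<xi>)"
proof -
 have "continuous_on {0..} (\<lambda>t. Phi g t {#x#})" for x
  by (rule backward_equation(1)[where Q="\<lambda>h. P h {#x#}" and q="rate x", OF rate_nonneg rate_total rate_small_time])
   (use Phi_range Phi_markov in auto)
 then have "continuous_on {0..} (\<lambda>t. mult_functional (\<lambda>z. Phi g t {#z#}) \<xi>)"
  by (induction \<xi>) (auto intro!: continuous_intros)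
 then show ?thesis by (subst continuous_on_cong[OF refl Phi_branching]) auto
qed

lemma Phi_backward:
 assumes "0 \<le> t"
 shows "((\<lambda>t. Phi g t {#x#}) has_real_derivative (\<Sum>\<^sub>\<infinity>\<xi>. rate x \<xi> * Phi g t \<xi>)) (at t within {0..})"
 by (rule backward_equation(2)[where Q="\<lambda>h. P h {#x#}" and q="rate x", OF rate_nonneg rate_total rate_small_time])
  (use Phi_range Phi_markov Phi_continuous assms in auto)

text \<open>Written for v = 1 - Phi, which is small when g is close to 1. Splitting 1 - (1-v)^n into v
 times a geometric sum and taking out the first term leaves - b0 v as the linear part at every site,
 origin included, because - b1 = b0 + sum of b n over n > 1.\<close>

lemma one_minus_Phi_backward:
 assumes t: "0 \<le> t"
 defines "v \<equiv> \<lambda>y. 1 - Phi g t {#y#}"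
 shows "((\<lambda>t. 1 - Phi g t {#x#}) has_real_derivative
  (walk_gen a v x - b 0 * v x +
  (if x = 0 then \<Sum>\<^sub>\<infinity>n\<in>{1<..}. b n * (v 0 * ((\<Sum>i<n. (1 - v 0) ^ i) - 1)) else 0))) (at t within {0..})"
proof -
 have vr: "0 \<le> v y" "v y \<le> 1" for y using Phi_range[of t "{#y#}"] by (auto simp: v_def)
 have G: "\<bar>1 - Phi g t \<xi>\<bar> \<le> 1" for \<xi> using Phi_range[of t \<xi>] by auto
 have rep: "1 - Phi g t (replicate_mset n 0) = v 0 * (\<Sum>i<n. (1 - v 0) ^ i)" for n
  using Phi_branching[OF t, of "replicate_mset n 0"] one_diff_power_eq[of "1 - v 0" n] by (simp add: v_def)
 have "(\<Sum>\<^sub>\<infinity>\<xi>. rate x \<xi> * (1 - Phi g t \<xi>)) = (\<Sum>\<^sub>\<infinity>\<xi>. rate x \<xi> * 1) - (\<Sum>\<^sub>\<infinity>\<xi>. rate x \<xi> * Phi g t \<xi>)"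
 proof (rule infsum_linear_diff)
  have "\<bar>Phi g t \<xi>\<bar> \<le> 1" for \<xi> using Phi_range[of t \<xi>] by auto
  from rate_has_sum[of "Phi g t", OF this, of x] show "(\<lambda>\<xi>. rate x \<xi> * Phi g t \<xi>) summable_on UNIV" by (auto simp: summable_on_def)
  show "(\<lambda>\<xi>. rate x \<xi> * 1) summable_on UNIV" using rate_total by (auto simp: summable_on_def)
 qed
 then have "- (\<Sum>\<^sub>\<infinity>\<xi>. rate x \<xi> * Phi g t \<xi>) = (\<Sum>\<^sub>\<infinity>\<xi>. rate x \<xi> * (1 - Phi g t \<xi>))"
  using infsumI[OF rate_total, of x] by simp
 also have "\<dots> = walk_gen a v x - kappa x * v x + b 0 * (1 - Phi g t {#})
   + (if x = 0 then \<Sum>\<^sub>\<infinity>n\<in>{1<..}. b n * (1 - Phi g t (replicate_mset n 0)) else 0)"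
  using infsumI[OF rate_has_sum[of "\<lambda>\<xi>. 1 - Phi g t \<xi>", OF G, of x]] by (simp add: v_def)
 also have "Phi g t {#} = 1" using Phi_branching[OF t, of "{#}"] by simp
 also have "walk_gen a v x - kappa x * v x + b 0 * (1 - 1)
   + (if x = 0 then \<Sum>\<^sub>\<infinity>n\<in>{1<..}. b n * (1 - Phi g t (replicate_mset n 0)) else 0)
  = walk_gen a v x - b 0 * v x +
  (if x = 0 then \<Sum>\<^sub>\<infinity>n\<in>{1<..}. b n * (v 0 * ((\<Sum>i<n. (1 - v 0) ^ i) - 1)) else 0)"
 proof (cases "x = 0")
  case True
  have "(\<Sum>\<^sub>\<infinity>n\<in>{1<..}. b n * (v 0 * (\<Sum>i<n. (1 - v 0) ^ i) - v 0))
    = (\<Sum>\<^sub>\<infinity>n\<in>{1<..}. b n * (v 0 * (\<Sum>i<n. (1 - v 0) ^ i))) - (\<Sum>\<^sub>\<infinity>n\<in>{1<..}. b n * v 0)"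
   by (intro infsum_linear_diff summable_mult_bounded(2)[OF b_abs_summable, where B=1])
    (use G[of "replicate_mset _ 0"] rep vr[of 0] in auto)
  moreover have "(\<Sum>\<^sub>\<infinity>n\<in>{1<..}. b n * v 0) = (- b 0 - b 1) * v 0"
   using has_sum_cmult_left[OF b_branching_sum] by (rule infsumI)
  ultimately show ?thesis using True by (simp add: kappa_def rep algebra_simps)
 qed (simp add: kappa_def)
 finally have "- (\<Sum>\<^sub>\<infinity>\<xi>. rate x \<xi> * Phi g t \<xi>) = \<dots>" .
 then show ?thesis using Phi_backward[OF t, of x] by (auto intro!: derivative_eq_intros)
qed

end

definition moment :: "(int ^ 'd => real) => real => int ^ 'd => real" where
 "moment h t x = exp (b 0 * t) * pmf_mean (P t {#x#}) (add_functional h)"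

context
 fixes h :: "int ^ 'd => real"
 assumes h: "\<And>z. 0 \<le> h z" "\<And>z. h z \<le> 1"
begin

text \<open>The parameter \<epsilon> is 1/(k+1); approx is the difference quotient of the generating functional,
 freed of deaths by e^(b0 t), and excess the growth at the origin, which tends to \<beta> times the moment
 there.\<close>

definition thin :: "nat => int ^ 'd => real" where "thin k z = 1 - inverse (real (Suc k)) * h z"

definition approx :: "nat => real => int ^ 'd => real" where
 "approx k t x = exp (b 0 * t) * real (Suc k) * (1 - Phi (thin k) t {#x#})"

definition excess :: "nat => real => real" where
 "excess k t = (\<Sum>\<^sub>\<infinity>n\<in>{1<..}. b n * (approx k t 0 * ((\<Sum>i<n. Phi (thin k) t {#0#} ^ i) - 1)))"

lemma thin_range: "0 \<le> thin k z" "thin k z \<le> 1"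
proof -
 have "inverse (real (Suc k)) * h z \<le> 1 * 1"
  using h by (intro mult_mono) (auto simp: field_simps)
 then show "0 \<le> thin k z" by (simp add: thin_def)
 show "thin k z \<le> 1" using h by (simp add: thin_def)
qed

lemma Phi_thin_range: "0 \<le> Phi (thin k) t \<xi>" "Phi (thin k) t \<xi> \<le> 1"
 by (rule Phi_range[of "thin k", OF thin_range])+

lemma b0_nonneg: "0 \<le> b 0" using offspring_nonneg[of 0] by simp

lemma approx_nonneg: "0 \<le> approx k t x"
 using Phi_thin_range[of k t "{#x#}"] by (simp add: approx_def)

lemma approx_crude: assumes "0 \<le> t" "t \<le> T" shows "approx k t x \<le> exp (b 0 * T) * real (Suc k)"
proof -
 have "approx k t x \<le> exp (b 0 * T) * real (Suc k) * 1"
  unfolding approx_def using Phi_thin_range[of k t "{#x#}"] b0_nonneg assms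
  by (intro mult_mono) (auto intro: mult_left_mono)
 then show ?thesis by simp
qed

lemma approx_derivative:
 assumes t: "0 \<le> t"
 shows "((\<lambda>t. approx k t x) has_real_derivative
  walk_gen a (approx k t) x + of_bool (x = 0) * excess k t) (at t within {0..})"
proof -
 interpret W: generator "walk_rate a" mass by (rule generator_walk_rate)
 define c where "c = exp (b 0 * t) * real (Suc k)"
 define v where "v y = 1 - Phi (thin k) t {#y#}" for y
 define N where "N = (\<Sum>\<^sub>\<infinity>n\<in>{1<..}. b n * (v 0 * ((\<Sum>i<n. (1 - v 0) ^ i) - 1)))"
 have av: "approx k t = (\<lambda>y. c * v y)" by (auto simp: approx_def c_def v_def)
 have "excess k t = (\<Sum>\<^sub>\<infinity>n\<in>{1<..}. c * (b n * (v 0 * ((\<Sum>i<n. (1 - v 0) ^ i) - 1))))"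
  by (simp add: excess_def av v_def algebra_simps)
 then have ex: "excess k t = c * N" unfolding N_def by (simp add: infsum_cmult_right')
 have dv: "((\<lambda>t. 1 - Phi (thin k) t {#x#}) has_real_derivative
   walk_gen a v x - b 0 * v x + (if x = 0 then N else 0)) (at t within {0..})"
  using one_minus_Phi_backward[of "thin k", OF thin_range t, of x] unfolding v_def N_def by simp
 have "((\<lambda>t. exp (b 0 * t) * real (Suc k)) has_real_derivative b 0 * c) (at t within {0..})"
  unfolding c_def by (auto intro!: derivative_eq_intros)
 from DERIV_mult[OF this dv]
 have "((\<lambda>t. approx k t x) has_real_derivative
   b 0 * c * (1 - Phi (thin k) t {#x#}) + (walk_gen a v x - b 0 * v x + (if x = 0 then N else 0)) * (exp (b 0 * t) * real (Suc k))) (at t within {0..})"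
  unfolding approx_def .
 moreover have "b 0 * c * (1 - Phi (thin k) t {#x#}) + (walk_gen a v x - b 0 * v x + (if x = 0 then N else 0)) * (exp (b 0 * t) * real (Suc k))
  = walk_gen a (approx k t) x + of_bool (x = 0) * excess k t"
  unfolding av W.gen_scale ex c_def[symmetric] by (simp add: v_def[symmetric] algebra_simps)
 ultimately show ?thesis by simp
qed

lemma excess_term:
 assumes "n \<in> {1<..}"
 shows "0 \<le> b n * (approx k t 0 * ((\<Sum>i<n. Phi (thin k) t {#0#} ^ i) - 1))"
  "b n * (approx k t 0 * ((\<Sum>i<n. Phi (thin k) t {#0#} ^ i) - 1)) \<le> (real n - 1) * b n * approx k t 0"
proof -
 have bn: "0 \<le> b n" using offspring_nonneg assms by simp
 note e = geometric_excess[OF Phi_thin_range(1)[of k t "{#0#}"] Phi_thin_range(2), of n]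
 show "0 \<le> b n * (approx k t 0 * ((\<Sum>i<n. Phi (thin k) t {#0#} ^ i) - 1))"
  using bn e(1) approx_nonneg[of k t 0] assms by (intro mult_nonneg_nonneg) auto
 have "b n * (approx k t 0 * ((\<Sum>i<n. Phi (thin k) t {#0#} ^ i) - 1)) \<le> b n * (approx k t 0 * (real n - 1))"
  using bn e(2) approx_nonneg[of k t 0] assms by (intro mult_left_mono) auto
 then show "b n * (approx k t 0 * ((\<Sum>i<n. Phi (thin k) t {#0#} ^ i) - 1)) \<le> (real n - 1) * b n * approx k t 0"
  by (simp add: mult_ac)
qed

lemma excess_bounds: "0 \<le> excess k t" "excess k t \<le> \<beta> * approx k t 0"
proof -
 have dom: "((\<lambda>n. (real n - 1) * b n * approx k t 0) has_sum \<beta> * approx k t 0) {1<..}"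
  by (rule has_sum_cmult_left[OF beta_has_sum])
 have s: "(\<lambda>n. b n * (approx k t 0 * ((\<Sum>i<n. Phi (thin k) t {#0#} ^ i) - 1))) summable_on {1<..}"
  by (rule summable_on_comparison_test[OF has_sum_imp_summable[OF dom]]) (use excess_term in auto)
 show "0 \<le> excess k t" unfolding excess_def by (rule infsum_nonneg) (rule excess_term)
 show "excess k t \<le> \<beta> * approx k t 0"
  using has_sum_mono[OF has_sum_infsum[OF s] dom] excess_term(2) unfolding excess_def by blast
qed

text \<open>The function e^(\<beta> t) is a supersolution of the equation in which the excess is replaced by its
 upper bound \<beta> approx. The point is that the bound does not depend on k.\<close>

lemma approx_le: assumes t: "0 \<le> t" shows "approx k t x \<le> exp (\<beta> * t)"
proof -
 interpret H: generator "branch_rate a \<beta>" "mass + \<beta>" by (rule branch_generator(1)[OF beta_nonneg])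
 interpret W: generator "walk_rate a" mass by (rule generator_walk_rate)
 have "0 \<le> exp (\<beta> * t) - approx k t x"
 proof (rule H.comparison[where T=t and u="\<lambda>t x. exp (\<beta> * t) - approx k t x"
    and u'="\<lambda>t x. \<beta> * exp (\<beta> * t) - (walk_gen a (approx k t) x + of_bool (x = 0) * excess k t)"
    and B="exp (\<beta> * t) + exp (b 0 * t) * real (Suc k)"])
  fix s x assume s: "0 \<le> s" "s \<le> t"
  have ba: "\<bar>approx k s y\<bar> \<le> exp (b 0 * t) * real (Suc k)" for y
   using approx_crude[OF s] approx_nonneg by (simp only: abs_of_nonneg)
  have bc: "\<bar>exp (\<beta> * s)\<bar> \<le> exp (\<beta> * t)" using s beta_nonneg by (auto intro: mult_left_mono)
  show "\<bar>exp (\<beta> * s) - approx k s x\<bar> \<le> exp (\<beta> * t) + exp (b 0 * t) * real (Suc k)"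
   using ba[of x] bc abs_triangle_ineq4[of "exp (\<beta> * s)" "approx k s x"] by linarith
  show "((\<lambda>s. exp (\<beta> * s) - approx k s x) has_real_derivative
    \<beta> * exp (\<beta> * s) - (walk_gen a (approx k s) x + of_bool (x = 0) * excess k s)) (at s within {0..})"
   by (intro DERIV_diff approx_derivative s) (auto intro!: derivative_eq_intros)
  have "branch_gen a \<beta> (\<lambda>y. exp (\<beta> * s) - approx k s y) x
    = branch_gen a \<beta> (\<lambda>y. exp (\<beta> * s)) x - branch_gen a \<beta> (approx k s) x"
   by (rule H.gen_diff[OF bc ba])
  also have "branch_gen a \<beta> (\<lambda>y. exp (\<beta> * s)) x = \<beta> * of_bool (x = 0) * exp (\<beta> * s)"
   using branch_generator(2)[where u="\<lambda>_. exp (\<beta> * s)" and x=x, OF beta_nonneg bc] gen_walk_const by simp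
  also have "\<dots> \<le> \<beta> * exp (\<beta> * s)" using beta_nonneg by simp
  also have "branch_gen a \<beta> (approx k s) x = walk_gen a (approx k s) x + \<beta> * of_bool (x = 0) * approx k s 0"
   by (rule branch_generator(2)[OF beta_nonneg ba])
  finally show "branch_gen a \<beta> (\<lambda>y. exp (\<beta> * s) - approx k s y) x
    \<le> \<beta> * exp (\<beta> * s) - (walk_gen a (approx k s) x + of_bool (x = 0) * excess k s)"
   using excess_bounds(2)[of k s] by (cases "x = 0") auto
 next
  fix x show "0 \<le> exp (\<beta> * 0) - approx k 0 x"
  proof -
   have "Phi (thin k) 0 {#x#} = thin k x" by (rule Phi_initial) (rule thin_range)+
   then have "approx k 0 x = h x" by (simp add: approx_def thin_def mult.assoc[symmetric] del: of_nat_Suc)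
   then show ?thesis using h[of x] by simp
  qed
 qed (use t in auto)
 then show ?thesis by simp
qed

definition quotient :: "nat => (int ^ 'd) multiset => real" where
 "quotient k \<xi> = (1 - mult_functional (thin k) \<xi>) * real (Suc k)"

lemma quotient_range: "0 \<le> quotient k \<xi>" "quotient k \<xi> \<le> real (Suc k)" "quotient k \<xi> \<le> add_functional h \<xi>"
proof -
 show "0 \<le> quotient k \<xi>" "quotient k \<xi> \<le> real (Suc k)"
  using mult_functional_range[of "thin k", OF thin_range] by (auto simp: quotient_def)
 show "quotient k \<xi> \<le> add_functional h \<xi>"
  using one_minus_mult_functional_le[of h, OF h, of "inverse (real (Suc k))" \<xi>]
  by (simp add: quotient_def thin_def[abs_def] field_simps del: of_nat_Suc)
qed

lemma quotient_tendsto: "(\<lambda>k. quotient k \<xi>) \<longlonglongrightarrow> add_functional h \<xi>"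
 using mult_functional_derivative[of h \<xi>] by (simp add: quotient_def thin_def[abs_def])

lemma quotient_mean: "pmf_mean (P t {#x#}) (quotient k) = exp (- (b 0 * t)) * approx k t x"
proof -
 have "integrable (measure_pmf (P t {#x#})) (mult_functional (thin k))"
  by (rule measure_pmf.integrable_const_bound[where B=1]) (use mult_functional_range[of "thin k", OF thin_range] in auto)
 then show ?thesis unfolding quotient_def by (simp add: approx_def Phi_def exp_minus)
qed

text \<open>Fatou's lemma turns the uniform bound on the difference quotients into a finite first moment.\<close>

lemma add_functional_integrable:
 assumes t: "0 \<le> t" shows "integrable (measure_pmf (P t {#x#})) (add_functional h)"
proof (rule integrableI_bounded)
 have "(\<integral>\<^sup>+\<xi>. ennreal (norm (add_functional h \<xi>)) \<partial>P t {#x#}) = (\<integral>\<^sup>+\<xi>. liminf (\<lambda>k. ennreal (quotient k \<xi>)) \<partial>P t {#x#})"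
 proof (rule nn_integral_cong)
  fix \<xi>
  have "(\<lambda>k. ennreal (quotient k \<xi>)) \<longlonglongrightarrow> ennreal (add_functional h \<xi>)" using quotient_tendsto by (rule tendsto_ennrealI)
  then show "ennreal (norm (add_functional h \<xi>)) = liminf (\<lambda>k. ennreal (quotient k \<xi>))"
   using add_functional_nonneg[of h \<xi>] h by (simp add: lim_imp_Liminf)
 qed
 also have "\<dots> \<le> liminf (\<lambda>k. \<integral>\<^sup>+\<xi>. ennreal (quotient k \<xi>) \<partial>P t {#x#})"
  by (rule nn_integral_liminf) simp
 also have "\<dots> \<le> ennreal (exp (- (b 0 * t)) * exp (\<beta> * t))"
 proof (rule Liminf_le[OF _ always_eventually[OF allI]])
  fix k
  have "integrable (measure_pmf (P t {#x#})) (quotient k)"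
   by (rule measure_pmf.integrable_const_bound[where B="real (Suc k)"]) (use quotient_range in auto)
  then have "(\<integral>\<^sup>+\<xi>. ennreal (quotient k \<xi>) \<partial>P t {#x#}) = ennreal (pmf_mean (P t {#x#}) (quotient k))"
   by (rule nn_integral_eq_integral) (use quotient_range in auto)
  also have "\<dots> \<le> ennreal (exp (- (b 0 * t)) * exp (\<beta> * t))"
   unfolding quotient_mean using approx_le[OF t] by (intro ennreal_leI mult_left_mono) auto
  finally show "(\<integral>\<^sup>+\<xi>. ennreal (quotient k \<xi>) \<partial>P t {#x#}) \<le> ennreal (exp (- (b 0 * t)) * exp (\<beta> * t))" .
 qed simp
 also have "\<dots> < \<infinity>" by simp
 finally show "(\<integral>\<^sup>+\<xi>. ennreal (norm (add_functional h \<xi>)) \<partial>P t {#x#}) < \<infinity>" .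
qed simp

lemma approx_tendsto: assumes t: "0 \<le> t" shows "(\<lambda>k. approx k t x) \<longlonglongrightarrow> moment h t x"
proof -
 have "(\<lambda>k. pmf_mean (P t {#x#}) (quotient k)) \<longlonglongrightarrow> pmf_mean (P t {#x#}) (add_functional h)"
  by (rule integral_dominated_convergence[where w="add_functional h"])
   (use add_functional_integrable[OF t] quotient_range quotient_tendsto in auto)
 from tendsto_mult_left[OF this[unfolded quotient_mean], of "exp (b 0 * t)"]
 have "(\<lambda>k. exp (b 0 * t) * (exp (- (b 0 * t)) * approx k t x)) \<longlonglongrightarrow> moment h t x" unfolding moment_def .
 moreover have "exp (b 0 * t) * (exp (- (b 0 * t)) * z) = z" for z :: real
  by (simp add: mult.assoc[symmetric] exp_add[symmetric])
 ultimately show ?thesis by (simp only:)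
qed

lemma moment_bounds: assumes "0 \<le> t" shows "0 \<le> moment h t x" "moment h t x \<le> exp (\<beta> * t)"
 using LIMSEQ_le_const[OF approx_tendsto[OF assms], of 0] LIMSEQ_le_const2[OF approx_tendsto[OF assms], of _ "exp (\<beta> * t)"]
  approx_nonneg approx_le[OF assms] by auto

text \<open>Each geometric sum of n terms tends to n, and finiteness of \<beta> dominates the series.\<close>

lemma excess_tendsto: assumes t: "0 \<le> t" shows "(\<lambda>k. excess k t) \<longlonglongrightarrow> \<beta> * moment h t 0"
proof -
 define F where "F k = Phi (thin k) t {#0#}" for k
 have "(\<lambda>k. 1 - inverse (real (Suc k)) * (exp (- (b 0 * t)) * approx k t 0)) \<longlonglongrightarrow> 1 - 0 * (exp (- (b 0 * t)) * moment h t 0)"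
  by (intro tendsto_diff tendsto_mult tendsto_const LIMSEQ_inverse_real_of_nat approx_tendsto t)
 moreover have "1 - inverse (real (Suc k)) * (exp (- (b 0 * t)) * approx k t 0) = F k" for k
  by (simp add: approx_def F_def exp_minus field_simps del: of_nat_Suc)
 ultimately have F: "F \<longlonglongrightarrow> 1" by simp
 have "(\<lambda>k. \<Sum>\<^sub>\<infinity>n\<in>{1<..}. b n * (approx k t 0 * ((\<Sum>i<n. F k ^ i) - 1))) \<longlonglongrightarrow> (\<Sum>\<^sub>\<infinity>n\<in>{1<..}. b n * (moment h t 0 * ((\<Sum>i<n. 1 ^ i) - 1)))"
 proof (rule tendsto_infsum_dominated[where M="\<lambda>n. (real n - 1) * b n * exp (\<beta> * t)"])
  show "(\<lambda>k. b n * (approx k t 0 * ((\<Sum>i<n. F k ^ i) - 1))) \<longlonglongrightarrow> b n * (moment h t 0 * ((\<Sum>i<n. 1 ^ i) - 1))" for n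
   by (intro tendsto_intros approx_tendsto t F)
  show "\<forall>\<^sub>F k in sequentially. \<forall>n\<in>{1<..}. \<bar>b n * (approx k t 0 * ((\<Sum>i<n. F k ^ i) - 1))\<bar> \<le> (real n - 1) * b n * exp (\<beta> * t)"
  proof (intro always_eventually allI ballI)
   fix k n assume n: "n \<in> {1::nat<..}"
   have "(real n - 1) * b n * approx k t 0 \<le> (real n - 1) * b n * exp (\<beta> * t)"
    using approx_le[OF t] n offspring_nonneg[of n] by (intro mult_left_mono) auto
   then show "\<bar>b n * (approx k t 0 * ((\<Sum>i<n. F k ^ i) - 1))\<bar> \<le> (real n - 1) * b n * exp (\<beta> * t)"
    using excess_term[OF n, of k t] unfolding F_def by linarith
  qed
  show "(\<lambda>n. (real n - 1) * b n * exp (\<beta> * t)) summable_on {1<..}"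
   using has_sum_cmult_left[OF beta_has_sum] by (rule has_sum_imp_summable)
 qed
 moreover have "(\<Sum>\<^sub>\<infinity>n\<in>{1<..}. b n * (moment h t 0 * ((\<Sum>i<n. 1 ^ i) - 1))) = \<beta> * moment h t 0"
  using has_sum_cmult_left[OF beta_has_sum, of "moment h t 0"] by (intro infsumI) (simp add: mult_ac)
 ultimately show ?thesis by (simp add: excess_def F_def)
qed

text \<open>The equation of the difference quotients has a limit in integrated form, by dominated
 convergence; moment_backward recovers the derivative, after continuity has been read off from the
 integral.\<close>

lemma moment_integral:
 assumes t: "0 \<le> t"
 shows "((\<lambda>s. branch_gen a \<beta> (moment h s) x) has_integral (moment h t x - moment h 0 x)) {0..t}"
proof -
 interpret W: generator "walk_rate a" mass by (rule generator_walk_rate)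
 define E where "E = exp (\<beta> * t)"
 define f where "f k s = walk_gen a (approx k s) x + of_bool (x = 0) * excess k s" for k s
 have E: "approx k s y \<le> E" "moment h s y \<le> E" "\<bar>approx k s y\<bar> \<le> E" "\<bar>moment h s y\<bar> \<le> E" if s: "0 \<le> s" "s \<le> t" for k s y
 proof -
  have "exp (\<beta> * s) \<le> E" unfolding E_def using s beta_nonneg by (auto intro: mult_left_mono)
  then show *: "approx k s y \<le> E" "moment h s y \<le> E" using approx_le[OF s(1), of k y] moment_bounds[OF s(1), of y] by linarith+
  then show "\<bar>approx k s y\<bar> \<le> E" "\<bar>moment h s y\<bar> \<le> E" using approx_nonneg[of k s y] moment_bounds[OF s(1), of y] by linarith+
 qed
 have fi: "(f k has_integral (approx k t x - approx k 0 x)) {0..t}" for k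
 proof (rule fundamental_theorem_of_calculus[OF t])
  fix s assume s: "s \<in> {0..t}"
  have "((\<lambda>t. approx k t x) has_real_derivative f k s) (at s within {0..t})"
   unfolding f_def by (rule has_field_derivative_subset[OF approx_derivative]) (use s in auto)
  then show "((\<lambda>t. approx k t x) has_vector_derivative f k s) (at s within {0..t})"
   by (simp add: has_real_derivative_iff_has_vector_derivative)
 qed
 have fb: "norm (f k s) \<le> mass * E + \<beta> * E" if s: "s \<in> {0..t}" for k s
 proof -
  have "\<bar>walk_gen a (approx k s) x\<bar> \<le> mass * E" by (rule W.gen_bound) (use E s in auto)
  moreover have "\<beta> * approx k s 0 \<le> \<beta> * E" using E(1)[of s k 0] s beta_nonneg by (intro mult_left_mono) auto
  ultimately show ?thesis using excess_bounds[of k s] by (cases "x = 0") (auto simp: f_def abs_le_iff)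
 qed
 have lim: "(\<lambda>k. f k s) \<longlonglongrightarrow> branch_gen a \<beta> (moment h s) x" if s: "s \<in> {0..t}" for s
 proof -
  have "(\<lambda>k. f k s) \<longlonglongrightarrow> walk_gen a (moment h s) x + of_bool (x = 0) * (\<beta> * moment h s 0)"
   unfolding f_def
   by (intro tendsto_add tendsto_mult tendsto_const excess_tendsto W.gen_tendsto[where B=E] approx_tendsto always_eventually)
    (use E s in auto)
  then show ?thesis using branch_generator(2)[where u="moment h s" and x=x, OF beta_nonneg E(4)] s by (simp add: mult_ac)
 qed
 note dc = dominated_convergence[of f "{0..t}" "\<lambda>_. mass * E + \<beta> * E" "\<lambda>s. branch_gen a \<beta> (moment h s) x"]
 have 1: "(\<lambda>s. branch_gen a \<beta> (moment h s) x) integrable_on {0..t}"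
  by (rule dc(1)) (use fi fb lim in auto)
 have "(\<lambda>k. integral {0..t} (f k)) \<longlonglongrightarrow> integral {0..t} (\<lambda>s. branch_gen a \<beta> (moment h s) x)"
  by (rule dc(2)) (use fi fb lim in auto)
 moreover have "(\<lambda>k. integral {0..t} (f k)) = (\<lambda>k. approx k t x - approx k 0 x)"
  using integral_unique[OF fi] by auto
 moreover have "(\<lambda>k. approx k t x - approx k 0 x) \<longlonglongrightarrow> moment h t x - moment h 0 x"
  by (intro tendsto_diff approx_tendsto t) simp
 ultimately have "integral {0..t} (\<lambda>s. branch_gen a \<beta> (moment h s) x) = moment h t x - moment h 0 x"
  using LIMSEQ_unique by force
 then show ?thesis using 1 by (simp add: has_integral_iff)
qed

lemma moment_backward:
 assumes t: "0 \<le> t"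
 shows "((\<lambda>s. moment h s x) has_real_derivative branch_gen a \<beta> (moment h t) x) (at t within {0..})"
proof -
 interpret H: generator "branch_rate a \<beta>" "mass + \<beta>" by (rule branch_generator(1)[OF beta_nonneg])
 define T where "T = t + 1"
 have T: "0 \<le> T" "t \<in> {0..T}" using t by (auto simp: T_def)
 define E where "E = exp (\<beta> * T)"
 have E: "\<bar>moment h s y\<bar> \<le> E" if s: "s \<in> {0..T}" for s y
 proof -
  have "exp (\<beta> * s) \<le> E" unfolding E_def using s beta_nonneg by (auto intro: mult_left_mono)
  then show ?thesis using moment_bounds[of s y] s by auto
 qed
 have int: "moment h s y = moment h 0 y + integral {0..s} (\<lambda>s. branch_gen a \<beta> (moment h s) y)" if "s \<in> {0..T}" for s y
  using integral_unique[OF moment_integral, of s y] that by simp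
 have cont: "continuous_on {0..T} (\<lambda>s. moment h s y)" for y
 proof (subst continuous_on_cong[OF refl int])
  show "continuous_on {0..T} (\<lambda>s. moment h 0 y + integral {0..s} (\<lambda>s. branch_gen a \<beta> (moment h s) y))"
   by (intro continuous_intros indefinite_integral_continuous_1 has_integral_integrable[OF moment_integral] T)
 qed auto
 have "continuous_on {0..T} (\<lambda>s. branch_gen a \<beta> (moment h s) x)"
  by (rule H.gen_continuous[OF cont E])
 from integral_has_real_derivative[OF this T(2)]
 have "((\<lambda>s. moment h 0 x + integral {0..s} (\<lambda>s. branch_gen a \<beta> (moment h s) x)) has_real_derivative
   branch_gen a \<beta> (moment h t) x) (at t within {0..T})"
  by (auto intro!: derivative_eq_intros)
 then have "((\<lambda>s. moment h s x) has_real_derivative branch_gen a \<beta> (moment h t) x) (at t within {0..T})"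
  by (rule has_field_derivative_transform_within[where d=1]) (simp, rule T(2), rule int[symmetric])
 moreover have "at t within {0..T} = at t within {0..}"
  by (rule at_within_nhd[where S="{..<T}"]) (use t in \<open>auto simp: T_def\<close>)
 ultimately show ?thesis by simp
qed

end

lemma add_functional_count: "(\<integral>\<^sup>+y. ennreal (real (count \<xi> y) * h y) \<partial>count_space UNIV) = ennreal (add_functional h \<xi>)"
 if h: "\<And>z. 0 \<le> h z" for h :: "int ^ 'd => real"
proof (induction \<xi>)
 case (add x \<xi>)
 have "(\<integral>\<^sup>+y. ennreal (real (count (add_mset x \<xi>) y) * h y) \<partial>count_space UNIV)
   = (\<integral>\<^sup>+y. ennreal (h y) * indicator {x} y + ennreal (real (count \<xi> y) * h y) \<partial>count_space UNIV)"
  using h by (intro nn_integral_cong) (auto simp: ennreal_plus[symmetric] algebra_simps indicator_def simp del: ennreal_plus)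
 also have "\<dots> = ennreal (h x) + ennreal (add_functional h \<xi>)"
  using add by (subst nn_integral_add) auto
 finally show ?case using h add_functional_nonneg[of h \<xi>] by (simp add: ennreal_plus[symmetric] del: ennreal_plus)
qed simp

definition mean_kernel :: "real => int ^ 'd => int ^ 'd => real" where
 "mean_kernel t x y = exp (b 0 * t) * pmf_mean (P t {#x#}) (\<lambda>\<xi>. real (count \<xi> y))"

lemma mean_kernel_moment: "mean_kernel t x y = moment (\<lambda>z. of_bool (z = y)) t x"
proof -
 have "real (count \<xi> y) = add_functional (\<lambda>z. of_bool (z = y)) \<xi>" for \<xi> :: "(int^'d) multiset"
  by (induction \<xi>) auto
 then show ?thesis by (simp add: mean_kernel_def moment_def)
qed

lemma mean_kernel_has_sum:
 assumes h: "\<And>z. 0 \<le> h z" "\<And>z. h z \<le> 1" and t: "0 \<le> t"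
 shows "((\<lambda>y. mean_kernel t x y * h y) has_sum moment h t x) UNIV"
proof -
 have c: "integrable (measure_pmf (P t {#x#})) (\<lambda>\<xi>. real (count \<xi> y))" for y
 proof -
  have "real (count \<xi> y) = add_functional (\<lambda>z. of_bool (z = y)) \<xi>" for \<xi> :: "(int^'d) multiset"
   by (induction \<xi>) auto
  then show ?thesis using add_functional_integrable[of "\<lambda>z. of_bool (z = y)" t x] t by simp
 qed
 have cn: "0 \<le> pmf_mean (P t {#x#}) (\<lambda>\<xi>. real (count \<xi> y))" for y
  by (rule integral_nonneg_AE) simp
 have an: "0 \<le> pmf_mean (P t {#x#}) (add_functional h)"
  by (rule integral_nonneg_AE) (use add_functional_nonneg h in auto)
 have "(\<integral>\<^sup>+y. ennreal (pmf_mean (P t {#x#}) (\<lambda>\<xi>. real (count \<xi> y)) * h y) \<partial>count_space UNIV)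
   = (\<integral>\<^sup>+y. \<integral>\<^sup>+\<xi>. ennreal (real (count \<xi> y) * h y) \<partial>P t {#x#} \<partial>count_space UNIV)"
 proof (rule nn_integral_cong)
  fix y
  have "(\<integral>\<^sup>+\<xi>. ennreal (real (count \<xi> y) * h y) \<partial>P t {#x#}) = ennreal (pmf_mean (P t {#x#}) (\<lambda>\<xi>. real (count \<xi> y) * h y))"
   by (rule nn_integral_eq_integral) (use c[of y] h in auto)
  then show "ennreal (pmf_mean (P t {#x#}) (\<lambda>\<xi>. real (count \<xi> y)) * h y) = (\<integral>\<^sup>+\<xi>. ennreal (real (count \<xi> y) * h y) \<partial>P t {#x#})"
   by simp
 qed
 also have "\<dots> = (\<integral>\<^sup>+\<xi>. \<integral>\<^sup>+y. ennreal (real (count \<xi> y) * h y) \<partial>count_space UNIV \<partial>P t {#x#})"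
  by (rule nn_integral_count_space_nn_integral[symmetric]) auto
 also have "\<dots> = (\<integral>\<^sup>+\<xi>. ennreal (add_functional h \<xi>) \<partial>P t {#x#})"
  using add_functional_count[OF h(1)] by simp
 also have "\<dots> = ennreal (pmf_mean (P t {#x#}) (add_functional h))"
  by (rule nn_integral_eq_integral[OF add_functional_integrable[OF h t]]) (use add_functional_nonneg h in auto)
 finally have "((\<lambda>y. pmf_mean (P t {#x#}) (\<lambda>\<xi>. real (count \<xi> y)) * h y) has_sum
   pmf_mean (P t {#x#}) (add_functional h)) UNIV"
  by (intro has_sum_from_nn_integral) (use cn h an in auto)
 from has_sum_cmult_right[OF this, of "exp (b 0 * t)"] show ?thesis
  by (simp add: mean_kernel_def moment_def mult.assoc)
qed

text \<open>The moments are known for weights in [0,1]; a function with values in [-1,1] is 2 h - 1 for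
 such an h.\<close>

lemma mean_kernel_semigroup: "kernel_semigroup (branch_rate a \<beta>) (mass + \<beta>) mean_kernel \<beta>"
proof -
 interpret H: generator "branch_rate a \<beta>" "mass + \<beta>" by (rule branch_generator(1)[OF beta_nonneg])
 have one: "((\<lambda>y. mean_kernel t x y) has_sum moment (\<lambda>_. 1) t x) UNIV" if "0 \<le> t" for t x
  using mean_kernel_has_sum[of "\<lambda>_. 1" t x] that by simp
 show ?thesis
 proof
  show "0 \<le> mean_kernel t x y" if "0 \<le> t" for t x y
   unfolding mean_kernel_moment by (rule moment_bounds) (use that in auto)
  show "mean_kernel t x summable_on UNIV" if "0 \<le> t" for t x
   using one[OF that] by (rule has_sum_imp_summable)
  show "(\<Sum>\<^sub>\<infinity>y. mean_kernel t x y) \<le> exp (\<beta> * t)" if "0 \<le> t" for t x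
   using infsumI[OF one[OF that, of x]] moment_bounds(2)[of "\<lambda>_. 1" t x] that by simp
  show "0 \<le> \<beta>" by (rule beta_nonneg)
  show "mean_kernel 0 x y = of_bool (x = y)" for x y
   by (simp add: mean_kernel_def initial)
  fix u :: "int^'d => real" and t :: real and x
  assume u: "\<And>y. \<bar>u y\<bar> \<le> 1" and t: "0 \<le> t"
  define h where "h z = (u z + 1) / 2" for z
  have h: "0 \<le> h z" "h z \<le> 1" for z using u[of z] by (auto simp: h_def abs_le_iff)
  have act: "act mean_kernel s u y = 2 * moment h s y - moment (\<lambda>_. 1) s y" if "0 \<le> s" for s y
  proof -
   have "((\<lambda>z. 2 * (mean_kernel s y z * h z) + - mean_kernel s y z) has_sum 2 * moment h s y + - moment (\<lambda>_. 1) s y) UNIV"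
    by (intro has_sum_add has_sum_cmult_right mean_kernel_has_sum h that has_sum_uminus[THEN iffD2]) (simp add: one that)
   moreover have "2 * (mean_kernel s y z * h z) + - mean_kernel s y z = mean_kernel s y z * u z" for z
    by (simp add: h_def field_simps)
   ultimately show ?thesis by (simp add: act_def infsumI)
  qed
  have actf: "act mean_kernel t u = (\<lambda>y. 2 * moment h t y - moment (\<lambda>_. 1) t y)" using act[OF t] by blast
  have bh: "\<bar>moment h t y\<bar> \<le> exp (\<beta> * t)" and b1: "\<bar>moment (\<lambda>_. 1) t y\<bar> \<le> exp (\<beta> * t)" for y
   using moment_bounds[of h, OF h t, of y] moment_bounds[of "\<lambda>_. 1" t y] t by auto
  have b2: "\<bar>2 * moment h t y\<bar> \<le> 2 * exp (\<beta> * t)" for y using bh[of y] by simp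
  have "((\<lambda>s. 2 * moment h s x - moment (\<lambda>_. 1) s x) has_real_derivative
    2 * branch_gen a \<beta> (moment h t) x - branch_gen a \<beta> (moment (\<lambda>_. 1) t) x) (at t within {0..})"
   by (intro DERIV_diff DERIV_cmult moment_backward h t) auto
  moreover have "2 * branch_gen a \<beta> (moment h t) x - branch_gen a \<beta> (moment (\<lambda>_. 1) t) x
    = branch_gen a \<beta> (act mean_kernel t u) x"
   using H.gen_diff[where u="\<lambda>y. 2 * moment h t y" and v="moment (\<lambda>_. 1) t" and x=x, OF b2 b1] unfolding actf by (simp add: H.gen_scale)
  ultimately have "((\<lambda>s. 2 * moment h s x - moment (\<lambda>_. 1) s x) has_real_derivative
    branch_gen a \<beta> (act mean_kernel t u) x) (at t within {0..})" by simp
  then show "((\<lambda>s. act mean_kernel s u x) has_real_derivative branch_gen a \<beta> (act mean_kernel t u) x) (at t within {0..})"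
   by (rule has_field_derivative_transform_within[where d=1]) (use t act in auto)
 qed
qed

lemma mean_total: "0 \<le> t ==> act mean_kernel t (\<lambda>_. 1) x = exp (b 0 * t) * pmf_mean (P t {#x#}) (\<lambda>\<xi>. real (size \<xi>))"
proof -
 assume t: "0 \<le> t"
 have "real (size \<xi>) = add_functional (\<lambda>z. 1) \<xi>" for \<xi> :: "(int^'d) multiset"
  by (induction \<xi>) auto
 then have "moment (\<lambda>_. 1) t x = exp (b 0 * t) * pmf_mean (P t {#x#}) (\<lambda>\<xi>. real (size \<xi>))"
  by (simp add: moment_def)
 then show ?thesis using infsumI[OF mean_kernel_has_sum[of "\<lambda>_. 1" t x]] t by (simp add: act_def)
qed

end

section \<open>Potentials, eigenfunctions and renewal identities\<close>

lemma mono_bounded_tendsto_at_top: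
 fixes F :: "real => real"
 assumes mono: "\<And>s t. 0 \<le> s ==> s \<le> t ==> F s \<le> F t" and bdd: "\<And>t. 0 \<le> t ==> F t \<le> B"
 shows "\<exists>L. F \<leadsto> L \<and> (\<forall>t\<ge>0. F t \<le> L) \<and> L \<le> B"
proof -
 define L where "L = Sup (F ` {0..})"
 have bd: "bdd_above (F ` {0..})" using bdd by (auto simp: bdd_above_def)
 have up: "F t \<le> L" if "0 \<le> t" for t unfolding L_def using that by (intro cSup_upper bd) auto
 have "F \<leadsto> L"
 proof (rule increasing_tendsto)
  show "\<forall>\<^sub>F t in at_top. F t \<le> L" using eventually_ge_at_top[of 0] by eventually_elim (rule up)
  fix x assume "x < L"
  then obtain s where s: "0 \<le> s" "x < F s" unfolding L_def using less_cSup_iff[of "F ` {0..}" x] bd by auto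
  show "\<forall>\<^sub>F t in at_top. x < F t"
   using eventually_ge_at_top[of s] by eventually_elim (use s mono in \<open>fastforce intro: less_le_trans\<close>)
 qed
 moreover have "L \<le> B" unfolding L_def using bdd by (intro cSup_least) auto
 ultimately show ?thesis using up by blast
qed

lemma half_line_derivative:
 fixes f :: "real => real"
 assumes "continuous_on {0..} f" "0 \<le> t"
 shows "((\<lambda>T. integral {0..T} f) has_real_derivative f t) (at t within {0..})"
proof -
 have "continuous_on {0..t+1} f" by (rule continuous_on_subset[OF assms(1)]) auto
 from integral_has_real_derivative[OF this, of t] assms(2)
 have "((\<lambda>T. integral {0..T} f) has_real_derivative f t) (at t within {0..t+1})" by auto
 moreover have "at t within {0..t+1} = at t within {0..}"
  by (rule at_within_nhd[where S="{..<t+1}"]) (use assms in auto)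
 ultimately show ?thesis by simp
qed

lemma half_line_integrable:
 fixes f :: "real => real"
 shows "continuous_on {0..} f ==> f integrable_on {0..T}"
 by (rule integrable_continuous_real) (auto intro: continuous_on_subset)

lemma half_line_mono:
 fixes f :: "real => real"
 assumes "continuous_on {0..} f" "\<And>t. 0 \<le> t ==> 0 \<le> f t" "0 \<le> s" "s \<le> t"
 shows "integral {0..s} f \<le> integral {0..t} f"
 by (rule integral_subset_le) (use assms half_line_integrable in auto)

lemma restricted_measurable:
 fixes f :: "real => real"
 assumes "continuous_on {0..} f"
 shows "(\<lambda>s. ennreal (f s) * indicator {0..} s) \<in> borel_measurable borel"
proof -
 have "(\<lambda>s. ennreal (indicator {0..} s *\<^sub>R f s)) \<in> borel_measurable borel"
  using borel_measurable_continuous_on_indicator[OF _ assms] by simp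
 moreover have "(\<lambda>s. ennreal (indicator {0..} s *\<^sub>R f s)) = (\<lambda>s. ennreal (f s) * indicator {0..} s)"
  by (auto simp: indicator_def)
 ultimately show ?thesis by simp
qed

lemma restricted_interval_measurable:
 fixes f :: "real => real"
 assumes "continuous_on {0..} f"
 shows "(\<lambda>s. ennreal (f s) * indicator {0..b} s) \<in> borel_measurable borel"
proof -
 have "(\<lambda>s. (ennreal (f s) * indicator {0..} s) * indicator {..b} s) \<in> borel_measurable borel"
  using restricted_measurable[OF assms] by measurable
 moreover have "(\<lambda>s. (ennreal (f s) * indicator {0..} s) * indicator {..b} s) = (\<lambda>s. ennreal (f s) * indicator {0..b} s)"
  by (auto simp: indicator_def)
 ultimately show ?thesis by simp
qed

lemma nn_integral_interval:
 fixes f :: "real => real"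
 assumes c: "continuous_on {a..b} f" and f: "\<And>s. s \<in> {a..b} ==> 0 \<le> f s"
 shows "(\<integral>\<^sup>+ s. ennreal (f s) * indicator {a..b} s \<partial>lborel) = ennreal (integral {a..b} f)"
proof -
 have si: "set_integrable lborel {a..b} f" by (rule borel_integrable_atLeastAtMost'[OF c])
 have "(\<integral>\<^sup>+ s. ennreal (f s) * indicator {a..b} s \<partial>lborel) = (\<integral>\<^sup>+ s. ennreal (indicator {a..b} s *\<^sub>R f s) \<partial>lborel)"
  by (rule nn_integral_cong) (auto simp: indicator_def)
 also have "\<dots> = ennreal (LINT s:{a..b}|lborel. f s)" unfolding set_lebesgue_integral_def
  by (rule nn_integral_eq_integral) (use si f in \<open>auto simp: set_integrable_def indicator_def\<close>)
 finally show ?thesis using set_borel_integral_eq_integral(2)[OF si] by simp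
qed

lemma half_line_nn_integral:
 fixes f :: "real => real"
 assumes c: "continuous_on {0..} f" and f: "\<And>t. 0 \<le> t ==> 0 \<le> f t"
  and lim: "(\<lambda>T. integral {0..T} f) \<leadsto> L"
 shows "(\<integral>\<^sup>+t\<in>{0..}. ennreal (f t) \<partial>lborel) = ennreal L"
  and "set_integrable lborel {0..} f" and "(LINT t:{0..}|lborel. f t) = L"
proof -
 define F where "F n t = ennreal (f t) * indicator {0..real n} t" for n t
 have "(\<lambda>n. \<integral>\<^sup>+t. F n t \<partial>lborel) \<longlonglongrightarrow> (\<integral>\<^sup>+t\<in>{0..}. ennreal (f t) \<partial>lborel)"
 proof (rule nn_integral_LIMSEQ)
  show "incseq F" by (intro incseq_SucI le_funI) (auto simp: F_def indicator_def)
  show "F n \<in> borel_measurable lborel" for n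
   using restricted_interval_measurable[OF c] by (simp add: F_def[abs_def])
  show "(\<lambda>n. F n t) \<longlonglongrightarrow> ennreal (f t) * indicator {0..} t" for t
  proof (rule tendsto_eventually)
   obtain N :: nat where N: "t \<le> real N" using real_arch_simple by blast
   show "\<forall>\<^sub>F n in sequentially. F n t = ennreal (f t) * indicator {0..} t"
    using eventually_ge_at_top[of N] by eventually_elim (use N in \<open>auto simp: F_def indicator_def\<close>)
  qed
 qed
 moreover have "(\<integral>\<^sup>+t. F n t \<partial>lborel) = ennreal (integral {0..real n} f)" for n
  unfolding F_def by (rule nn_integral_interval[OF continuous_on_subset[OF c]]) (use f in auto)
 moreover have "(\<lambda>n. ennreal (integral {0..real n} f)) \<longlonglongrightarrow> ennreal L"
  by (intro tendsto_ennrealI filterlim_compose[OF lim] filterlim_real_sequentially)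
 ultimately show I: "(\<integral>\<^sup>+t\<in>{0..}. ennreal (f t) \<partial>lborel) = ennreal L" using LIMSEQ_unique by simp
 have L: "0 \<le> L"
  by (rule tendsto_lowerbound[OF lim], rule always_eventually, intro allI integral_nonneg half_line_integrable c)
   (simp_all add: f)
 have m: "(\<lambda>t. indicator {0..} t *\<^sub>R f t) \<in> borel_measurable lborel"
  using borel_measurable_continuous_on_indicator[OF _ c] by simp
 have e: "(\<integral>\<^sup>+t. ennreal (indicator {0..} t *\<^sub>R f t) \<partial>lborel) = ennreal L"
  unfolding I[symmetric] by (rule nn_integral_cong) (auto simp: indicator_def)
 show "set_integrable lborel {0..} f" unfolding set_integrable_def
  by (rule integrableI_nonneg[OF m]) (use f e in \<open>auto simp: indicator_def\<close>)
 show "(LINT t:{0..}|lborel. f t) = L" unfolding set_lebesgue_integral_def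
  by (subst integral_eq_nn_integral[OF m]) (use f e L in \<open>auto simp: indicator_def\<close>)
qed

lemma integral_le_exponential:
 fixes f :: "real => real"
 assumes f: "continuous_on {0..} f" "\<And>t. 0 \<le> t ==> f t \<le> c * exp (- l * t)" and c: "0 \<le> c" "0 < l" and T: "0 \<le> T"
 shows "integral {0..T} f \<le> c / l"
proof -
 have e: "((\<lambda>t. c * exp (- l * t)) has_integral (- (c * exp (- l * T) / l) - - (c * exp (- l * 0) / l))) {0..T}"
  by (rule integral_from_derivative[OF _ T]) (use c in \<open>auto intro!: derivative_eq_intros\<close>)
 have "integral {0..T} f \<le> integral {0..T} (\<lambda>t. c * exp (- l * t))"
  by (rule integral_le) (use f e half_line_integrable in \<open>auto simp: has_integral_integrable\<close>)
 also have "\<dots> = c / l - c * exp (- l * T) / l" unfolding integral_unique[OF e] by simp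
 also have "\<dots> \<le> c / l" using c by simp
 finally show ?thesis .
qed

lemma half_line_bounded:
 fixes f :: "real => real"
 assumes c: "continuous_on {0..} f" and f: "\<And>t. 0 \<le> t ==> 0 \<le> f t"
  and B: "\<And>T. 0 \<le> T ==> integral {0..T} f \<le> B"
 shows "\<exists>L. (\<lambda>T. integral {0..T} f) \<leadsto> L \<and> (\<forall>T\<ge>0. integral {0..T} f \<le> L) \<and> L \<le> B"
 by (rule mono_bounded_tendsto_at_top) (use half_line_mono[OF c f] B in auto)

lemma half_line_finite:
 fixes f :: "real => real"
 assumes c: "continuous_on {0..} f" and f: "\<And>t. 0 \<le> t ==> 0 \<le> f t"
  and I: "(\<integral>\<^sup>+t\<in>{0..}. ennreal (f t) \<partial>lborel) = ennreal L" and L: "0 \<le> L"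
 shows "(\<lambda>T. integral {0..T} f) \<leadsto> L"
proof -
 have "integral {0..T} f \<le> L" if T: "0 \<le> T" for T
 proof -
  have "ennreal (integral {0..T} f) = (\<integral>\<^sup>+t. ennreal (f t) * indicator {0..T} t \<partial>lborel)"
   by (rule nn_integral_interval[OF continuous_on_subset[OF c], symmetric]) (use f in auto)
  also have "\<dots> \<le> (\<integral>\<^sup>+t\<in>{0..}. ennreal (f t) \<partial>lborel)"
   by (rule nn_integral_mono) (auto simp: indicator_def)
  finally show ?thesis using I L by simp
 qed
 then obtain L' where L': "(\<lambda>T. integral {0..T} f) \<leadsto> L'" using half_line_bounded[OF c f] by blast
 have "0 \<le> L'"
  by (rule tendsto_lowerbound[OF L'], rule always_eventually, intro allI integral_nonneg half_line_integrable c)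
   (simp_all add: f)
 then have "L' = L" using half_line_nn_integral(1)[OF c f L'] I L by simp
 then show ?thesis using L' by simp
qed

text \<open>From here on only the two kernels matter: p of the walk and w of the means, generated by A and
 A + \<beta> \<delta>0 \<delta>0^T.\<close>

locale walk_and_branching = walk_intensity a
 for a :: "int ^ 'd => real" +
 fixes p :: "real => int ^ 'd => int ^ 'd => real" and \<beta> :: real and w :: "real => int ^ 'd => int ^ 'd => real"
 assumes p_semigroup: "kernel_semigroup (walk_rate a) mass p 0"
  and w_semigroup: "kernel_semigroup (branch_rate a \<beta>) (mass + \<beta>) w \<beta>"
  and beta_pos: "0 < \<beta>"
begin

sublocale Pk: kernel_semigroup "walk_rate a" mass p 0 by (rule p_semigroup)
sublocale Wk: kernel_semigroup "branch_rate a \<beta>" "mass + \<beta>" w \<beta> by (rule w_semigroup)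

lemma p_heat: "0 \<le> t ==> p t x y = heat a t (x - y)"
proof -
 assume t: "0 \<le> t"
 show ?thesis
 proof (rule heat_unique[where k="\<lambda>s x. p s x y" and B=1])
  show "\<bar>p s x y\<bar> \<le> 1" if "0 \<le> s" for s x using Pk.kernel_bound[OF that, of x y] by simp
  show "((\<lambda>s. p s x y) has_real_derivative walk_gen a (\<lambda>x. p s x y) x) (at s within {0..})" if "0 \<le> s" for s x
   by (rule Pk.kernel_backward[OF that])
  show "p 0 x y = of_bool (x = y)" for x by (rule Pk.k_initial)
 qed fact
qed

lemma p_le_diag: "0 \<le> t ==> p t x y \<le> p t 0 0"
 using heat_bound(1)[of t "x - y"] by (simp add: p_heat abs_le_iff)

lemma p_le_1: "0 \<le> t ==> p t x y \<le> 1"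
 using Pk.kernel_bound[of t x y] by simp

definition tilted :: "real => int ^ 'd => real => real" where
 "tilted lam x t = exp (- lam * t) * p t x 0"

lemma tilted_continuous: "continuous_on {0..} (tilted lam x)"
 unfolding tilted_def by (intro continuous_intros Pk.kernel_continuous)

lemma tilted_nonneg: "0 \<le> t ==> 0 \<le> tilted lam x t"
 using Pk.k_nonneg by (simp add: tilted_def)

lemma tilted_le_diag: "0 \<le> t ==> tilted lam x t \<le> tilted lam 0 t"
 using p_le_diag by (simp add: tilted_def mult_left_mono)

lemma tilted_le_exp: "0 \<le> t ==> tilted lam x t \<le> exp (- lam * t)"
 using p_le_1 by (simp add: tilted_def)

lemma tilted_antimono:
 assumes "0 \<le> lam" "0 \<le> s" "s \<le> t" shows "tilted lam 0 t \<le> tilted lam 0 s"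
 unfolding tilted_def
proof (rule Pk.tilted_diag_antimono[OF _ assms(2,3)])
 show "exp (- lam * t) * p t 0 0 \<le> 1" if "0 \<le> t" for t
 proof -
  have "exp (- lam * t) \<le> 1" using that assms(1) by simp
  then show ?thesis using tilted_le_exp[OF that, of lam 0] unfolding tilted_def by linarith
 qed
qed

text \<open>Integrating the backward equation of the tilted kernel up to T gives (A - \<lambda>) of the truncated
 potential as tilted(T) - \<delta>0. The boundary term vanishes in the limit: it is at most its diagonal
 value, and an integrable nonincreasing function is at most G / T.\<close>

lemma potential:
 assumes lam: "0 \<le> lam" and G: "(\<lambda>T. integral {0..T} (tilted lam 0)) \<leadsto> G"
 obtains \<psi> where "\<And>x. (\<lambda>T. integral {0..T} (tilted lam x)) \<leadsto> \<psi> x"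
  and "\<And>x. 0 \<le> \<psi> x" "\<And>x. \<psi> x \<le> G" "\<psi> 0 = G" "0 < G"
  and "\<And>x. walk_gen a \<psi> x = lam * \<psi> x - of_bool (x = 0)"
proof -
 have le0: "integral {0..T} (tilted lam x) \<le> integral {0..T} (tilted lam 0)" for x T
  by (rule integral_le) (auto intro!: half_line_integrable tilted_continuous tilted_le_diag)
 have nn: "0 \<le> integral {0..T} (tilted lam x)" for x T
  by (intro integral_nonneg half_line_integrable tilted_continuous) (simp add: tilted_nonneg)
 have G_up: "integral {0..T} (tilted lam 0) \<le> G" if "0 \<le> T" for T
 proof (rule tendsto_lowerbound[OF G])
  show "\<forall>\<^sub>F S in at_top. integral {0..T} (tilted lam 0) \<le> integral {0..S} (tilted lam 0)"
   using eventually_ge_at_top[of T]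
   by eventually_elim (use that half_line_mono[OF tilted_continuous tilted_nonneg] in auto)
 qed simp
 have "\<exists>L. (\<lambda>T. integral {0..T} (tilted lam x)) \<leadsto> L \<and> (\<forall>T\<ge>0. integral {0..T} (tilted lam x) \<le> L) \<and> L \<le> G" for x
  by (rule half_line_bounded[OF tilted_continuous tilted_nonneg]) (use le0[of _ x] G_up in \<open>auto intro: order_trans\<close>)
 then obtain \<psi> where \<psi>: "\<And>x. (\<lambda>T. integral {0..T} (tilted lam x)) \<leadsto> \<psi> x"
  "\<And>x T. 0 \<le> T ==> integral {0..T} (tilted lam x) \<le> \<psi> x" "\<And>x. \<psi> x \<le> G" by metis
 have \<psi>0: "0 \<le> \<psi> x" for x using \<psi>(2)[of 0 x] by simp
 have \<psi>G: "\<psi> 0 = G" using tendsto_unique[OF _ \<psi>(1)[of 0] G] by simp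
 have fin: "walk_gen a (\<lambda>y. integral {0..T} (tilted lam y)) x
   = tilted lam x T - of_bool (x = 0) + lam * integral {0..T} (tilted lam x)" if T: "0 \<le> T" for T x
 proof -
  have "walk_gen a (\<lambda>y. integral {0..T} (\<lambda>t. tilted lam y t)) x = integral {0..T} (\<lambda>t. walk_gen a (\<lambda>y. tilted lam y t) x)"
  proof (rule Pk.gen_integral)
   show "continuous_on {0..T} (\<lambda>t. tilted lam y t)" for y by (rule continuous_on_subset[OF tilted_continuous]) auto
   show "\<bar>tilted lam y t\<bar> \<le> 1" if "t \<in> {0..T}" for t y
   proof -
    have t: "0 \<le> t" using that by simp
    have "exp (- lam * t) \<le> 1" using t lam by simp
    then show ?thesis using tilted_nonneg[OF t, of lam y] tilted_le_exp[OF t, of lam y] by linarith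
   qed
  qed
  moreover have "((\<lambda>t. walk_gen a (\<lambda>y. tilted lam y t) x - lam * tilted lam x t) has_integral (tilted lam x T - tilted lam x 0)) {0..T}"
  proof (rule integral_from_derivative[OF _ T])
   fix t :: real assume t: "0 \<le> t"
   have g: "walk_gen a (\<lambda>y. tilted lam y t) x = exp (- lam * t) * walk_gen a (\<lambda>y. p t y 0) x"
    unfolding tilted_def by (rule Pk.gen_scale)
   have "((\<lambda>t. exp (- lam * t)) has_real_derivative - lam * exp (- lam * t)) (at t within {0..})"
    by (auto intro!: derivative_eq_intros)
   from DERIV_mult[OF this Pk.kernel_backward[OF t, of x 0]]
   show "(tilted lam x has_real_derivative walk_gen a (\<lambda>y. tilted lam y t) x - lam * tilted lam x t) (at t within {0..})"
    unfolding tilted_def[abs_def] g[unfolded tilted_def] by (rule DERIV_cong) (simp add: algebra_simps)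
  qed
  then have "((\<lambda>t. walk_gen a (\<lambda>y. tilted lam y t) x - lam * tilted lam x t + lam * tilted lam x t) has_integral
    (tilted lam x T - tilted lam x 0 + lam * integral {0..T} (tilted lam x))) {0..T}"
   by (intro has_integral_add has_integral_mult_right integrable_integral half_line_integrable tilted_continuous)
  then have "integral {0..T} (\<lambda>t. walk_gen a (\<lambda>y. tilted lam y t) x) = tilted lam x T - tilted lam x 0 + lam * integral {0..T} (tilted lam x)"
   by (simp add: integral_unique)
  moreover have "tilted lam x 0 = of_bool (x = 0)" by (simp add: tilted_def Pk.k_initial)
  ultimately show ?thesis by simp
 qed
 have "\<psi> 0 > 0"
 proof -
  have "0 < integral {0..1} (tilted lam 0)"
  proof (rule ccontr)
   assume "\<not> ?thesis"
   then have z: "integral {0..1} (tilted lam 0) = 0" using nn[of 1 0] by simp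
   have "\<forall>t\<in>{0..1}. tilted lam 0 t = 0"
    by (subst integral_eq_0_iff[symmetric]) (use z tilted_nonneg in \<open>auto intro: continuous_on_subset[OF tilted_continuous]\<close>)
   then have "tilted lam 0 0 = 0" by simp
   then show False by (simp add: tilted_def Pk.k_initial)
  qed
  then show ?thesis using \<psi>(2)[of 1 0] by simp
 qed
 then have Gp: "0 < G" using \<psi>G by simp
 have gen: "walk_gen a \<psi> x = lam * \<psi> x - of_bool (x = 0)" for x
 proof -
  have l1: "(\<lambda>T. walk_gen a (\<lambda>y. integral {0..T} (tilted lam y)) x) \<leadsto> walk_gen a \<psi> x"
  proof (rule Pk.gen_tendsto[where B=G])
   show "\<forall>\<^sub>F T in at_top. \<forall>y. \<bar>integral {0..T} (tilted lam y)\<bar> \<le> G"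
    using eventually_ge_at_top[of 0]
   proof eventually_elim
    fix T :: real assume "0 \<le> T"
    then show "\<forall>y. \<bar>integral {0..T} (tilted lam y)\<bar> \<le> G" using nn \<psi>(2,3) by (smt (verit))
   qed
  qed (rule \<psi>)
  have l2: "(\<lambda>T. tilted lam x T - of_bool (x = 0) + lam * integral {0..T} (tilted lam x)) \<leadsto> walk_gen a \<psi> x"
  proof (rule Lim_transform_eventually[OF l1])
   show "\<forall>\<^sub>F T in at_top. walk_gen a (\<lambda>y. integral {0..T} (tilted lam y)) x
     = tilted lam x T - of_bool (x = 0) + lam * integral {0..T} (tilted lam x)"
    using eventually_ge_at_top[of 0] by eventually_elim (rule fin)
  qed
  have "(\<lambda>T. (tilted lam x T - of_bool (x = 0) + lam * integral {0..T} (tilted lam x)) - lam * integral {0..T} (tilted lam x) + of_bool (x = 0))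
    \<leadsto> walk_gen a \<psi> x - lam * \<psi> x + of_bool (x = 0)"
   by (intro tendsto_intros l2 \<psi>(1))
  then have lim: "tilted lam x \<leadsto> walk_gen a \<psi> x - lam * \<psi> x + of_bool (x = 0)" by simp
  have z: "tilted lam x \<leadsto> 0"
  proof (rule tendsto_sandwich[OF _ _ tendsto_const])
   show "(\<lambda>t. G / t) \<leadsto> 0" by real_asymp
   show "\<forall>\<^sub>F t in at_top. 0 \<le> tilted lam x t" by (rule eventually_positive) (simp add: tilted_nonneg)
   show "\<forall>\<^sub>F t in at_top. tilted lam x t \<le> G / t"
   proof (rule eventually_positive)
    fix t :: real assume t: "0 < t"
    have "t * tilted lam 0 t = integral {0..t} (\<lambda>_. tilted lam 0 t)" using t by simp
    also have "\<dots> \<le> integral {0..t} (tilted lam 0)"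
     by (rule integral_le) (use lam tilted_antimono half_line_integrable[OF tilted_continuous] in auto)
    also have "\<dots> \<le> G" using G_up t by simp
    finally show "tilted lam x t \<le> G / t" using tilted_le_diag[of t lam x] t
     by (simp add: pos_le_divide_eq mult.commute order_trans[OF mult_left_mono])
   qed
  qed
  have "0 = walk_gen a \<psi> x - lam * \<psi> x + of_bool (x = 0)" by (rule tendsto_unique[OF _ z lim]) simp
  then show ?thesis by linarith
 qed
 show ?thesis by (rule that[of \<psi>]) (use \<psi> \<psi>0 \<psi>G Gp gen in auto)
qed

lemma duhamel_w:
 assumes "0 \<le> t"
 shows "((\<lambda>s. \<beta> * p (t - s) x 0 * w s 0 y) has_integral (w t x y - p t x y)) {0..t}"
proof -
 have r: "branch_rate a \<beta> x y = walk_rate a x y + \<beta> * of_bool (x = 0 \<and> y = 0)" for x y by (simp add: branch_rate_def)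
 show ?thesis
  using duhamel[OF p_semigroup w_semigroup r, of "\<lambda>z. of_bool (z = y)" 1 t x] assms
  by (simp add: Wk.act_delta Pk.act_delta)
qed

text \<open>Constants are harmonic for the walk, so H 1 = \<beta> \<delta>0.\<close>

lemma total_derivative:
 assumes "0 \<le> t"
 shows "((\<lambda>s. act w s (\<lambda>_. 1) x) has_real_derivative \<beta> * w t x 0) (at t within {0..})"
proof -
 have "branch_gen a \<beta> (\<lambda>_. 1) = (\<lambda>x. \<beta> * of_bool (x = 0))"
 proof
  fix x
  have "(\<Sum>\<^sub>\<infinity>v. a v * 1) = 0" using regular by (simp add: infsumI)
  then show "branch_gen a \<beta> (\<lambda>_. 1) x = \<beta> * of_bool (x = 0)"
   using branch_generator(2)[where u="\<lambda>_. 1" and B=1 and x=x, OF less_imp_le[OF beta_pos]] by (simp add: gen_walk)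
 qed
 then show ?thesis
  using Wk.act_forward[of "\<lambda>_. 1" 1 t x] assms by (simp add: Wk.act_scale Wk.act_delta)
qed

context
 fixes lam G :: real and \<psi> :: "int ^ 'd => real"
 assumes lam: "0 \<le> lam" and G: "0 < G" "\<psi> 0 = G" and \<psi>: "\<And>x. 0 \<le> \<psi> x" "\<And>x. \<psi> x \<le> G"
  and gen: "\<And>x. walk_gen a \<psi> x = lam * \<psi> x - of_bool (x = 0)"
begin

lemma psi_abs: "\<bar>\<psi> x\<bar> \<le> G" using \<psi>[of x] by simp

lemma gen_branch_psi: "branch_gen a \<beta> \<psi> x = lam * \<psi> x - (1 - \<beta> * G) * of_bool (x = 0)"
 using branch_generator(2)[where u=\<psi> and B=G and x=x, OF less_imp_le[OF beta_pos] psi_abs] gen[of x] G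
 by (cases "x = 0") (simp_all add: algebra_simps)

lemma branch_psi_integral:
 "0 \<le> t ==> ((\<lambda>s. - ((1 - \<beta> * G) * (exp (- lam * s) * w s x 0))) has_integral (exp (- lam * t) * act w t \<psi> x - \<psi> x)) {0..t}"
 by (rule Wk.act_perturbed_eigenfunction[OF psi_abs gen_branch_psi])

text \<open>For \<beta> G \<le> 1 the potential is a supersolution of H u = \<lambda> u.\<close>

lemma act_psi_le:
 assumes sub: "\<beta> * G \<le> 1" and t: "0 \<le> t"
 shows "exp (- lam * t) * act w t \<psi> x \<le> \<psi> x"
proof -
 have "exp (- lam * t) * act w t \<psi> x - \<psi> x \<le> 0"
  by (rule has_integral_le[OF branch_psi_integral[OF t] has_integral_0]) (use sub Wk.k_nonneg in auto)
 then show ?thesis by simp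
qed

text \<open>The potential dominates G \<delta>0, so w inherits the bound act_psi_le.\<close>

lemma w_le_psi:
 assumes sub: "\<beta> * G \<le> 1" and t: "0 \<le> t"
 shows "G * w t x 0 \<le> exp (lam * t) * \<psi> x"
proof -
 have "(\<Sum>y\<in>{0}. w t x y * \<psi> y) \<le> (\<Sum>\<^sub>\<infinity>y. w t x y * \<psi> y)"
  by (rule finite_sum_le_infsum[OF Wk.act_summable[OF t psi_abs]]) (use Wk.k_nonneg \<psi> t in auto)
 then have "G * w t x 0 \<le> act w t \<psi> x" using G by (simp add: act_def mult.commute)
 also have "\<dots> = exp (lam * t) * (exp (- lam * t) * act w t \<psi> x)" by (simp add: mult.assoc[symmetric] exp_add[symmetric])
 also have "\<dots> \<le> exp (lam * t) * \<psi> x" by (intro mult_left_mono act_psi_le assms) simp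
 finally show ?thesis .
qed

definition profile :: "real => real" where "profile t = exp (- lam * t) * w t 0 0"

lemma profile_nonneg: "0 \<le> t ==> 0 \<le> profile t"
 using Wk.k_nonneg by (simp add: profile_def)

lemma profile_le_1: "\<beta> * G \<le> 1 ==> 0 \<le> t ==> profile t \<le> 1"
proof -
 assume "\<beta> * G \<le> 1" "0 \<le> t"
 from w_le_psi[OF this, of 0] have "w t 0 0 \<le> exp (lam * t)" using G by simp
 then have "exp (- lam * t) * w t 0 0 \<le> exp (- lam * t) * exp (lam * t)" by (intro mult_left_mono) auto
 then show ?thesis by (simp add: profile_def exp_add[symmetric])
qed

lemma profile_continuous: "continuous_on {0..} profile"
 unfolding profile_def by (intro continuous_intros Wk.kernel_continuous)

lemma profile_antimono:
 assumes "\<beta> * G \<le> 1" "0 \<le> s" "s \<le> t" shows "profile t \<le> profile s"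
 unfolding profile_def
 by (rule Wk.tilted_diag_antimono[where B=1]) (use assms profile_le_1 in \<open>auto simp: profile_def\<close>)

text \<open>The defect 1 - \<beta> G is the strength of the source in branch_psi_integral: the mean occupation
 of the origin cannot exceed what \<psi> supplies.\<close>

lemma occupation_bound:
 assumes "lam = 0" "\<beta> * G < 1" "0 \<le> T"
 shows "integral {0..T} (\<lambda>s. w s x 0) \<le> \<psi> x / (1 - \<beta> * G)"
proof -
 from integral_unique[OF branch_psi_integral[OF assms(3), of x]]
 have "(1 - \<beta> * G) * integral {0..T} (\<lambda>s. w s x 0) = \<psi> x - act w T \<psi> x"
  using assms(1) by simp
 also have "\<dots> \<le> \<psi> x" using Wk.act_nonneg[OF assms(3), of \<psi> x] \<psi> by simp
 finally show ?thesis using assms(2) by (simp add: field_simps)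
qed

definition tail :: "real => real" where "tail t = G - integral {0..t} (tilted lam 0)"

text \<open>By the Markov property, \<psi> transported by the walk up to time t is what remains of the Green
 integral after t.\<close>

lemma act_p_psi: assumes t: "0 \<le> t" shows "act p t \<psi> 0 = exp (lam * t) * tail t"
proof -
 have "((\<lambda>s. - (1 * (exp (- lam * s) * p s 0 0))) has_integral (exp (- lam * t) * act p t \<psi> 0 - \<psi> 0)) {0..t}"
  by (rule Pk.act_perturbed_eigenfunction[where B=G]) (use psi_abs gen t in auto)
 from integral_unique[OF this] have "tail t = exp (- lam * t) * act p t \<psi> 0"
  by (simp add: tail_def tilted_def[abs_def] G)
 then show ?thesis by (simp add: mult.assoc[symmetric] exp_add[symmetric])
qed

lemma act_w_psi: assumes crit: "\<beta> * G = 1" and t: "0 \<le> t" shows "act w t \<psi> x = exp (lam * t) * \<psi> x"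
proof -
 have "exp (- lam * t) * act w t \<psi> x = \<psi> x" using integral_unique[OF branch_psi_integral[OF t, of x]] crit by simp
 then have "exp (lam * t) * (exp (- lam * t) * act w t \<psi> x) = exp (lam * t) * \<psi> x" by simp
 then show ?thesis by (simp add: mult.assoc[symmetric] exp_add[symmetric])
qed

text \<open>Duhamel's formula with w in the place of the unperturbed semigroup. On \<psi> both sides are
 explicit: w multiplies it by e^(\<lambda> t), and p turns it into the tail of the Green integral.\<close>

lemma renewal_identity:
 assumes crit: "\<beta> * G = 1" and t: "0 \<le> t"
 shows "((\<lambda>s. profile (t - s) * (\<beta> * tail s)) has_integral (G - tail t)) {0..t}"
proof -
 have r: "walk_rate a x y = branch_rate a \<beta> x y + (- \<beta>) * of_bool (x = 0 \<and> y = 0)" for x y by (simp add: branch_rate_def)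
 have "((\<lambda>s. - \<beta> * w (t - s) 0 0 * act p s \<psi> 0) has_integral (act p t \<psi> 0 - act w t \<psi> 0)) {0..t}"
  by (rule duhamel[OF w_semigroup p_semigroup r psi_abs t])
 from has_integral_mult_right[OF this, of "- exp (- lam * t)"]
 have "((\<lambda>s. exp (- lam * t) * (\<beta> * w (t - s) 0 0 * act p s \<psi> 0)) has_integral exp (- lam * t) * (act w t \<psi> 0 - act p t \<psi> 0)) {0..t}"
  by (simp add: algebra_simps)
 moreover have "exp (- lam * t) * (act w t \<psi> 0 - act p t \<psi> 0) = G - tail t"
  unfolding act_w_psi[OF crit t] act_p_psi[OF t] G by (simp add: exp_minus field_simps)
 moreover have "exp (- lam * t) * (\<beta> * w (t - s) 0 0 * act p s \<psi> 0) = profile (t - s) * (\<beta> * tail s)" if "s \<in> {0..t}" for s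
 proof -
  have "exp (- lam * t) * exp (lam * s) = exp (- lam * (t - s))" by (simp add: exp_add[symmetric] algebra_simps)
  then show ?thesis using act_p_psi[of s] that by (simp add: profile_def mult_ac)
 qed
 ultimately show ?thesis using has_integral_eq[of "{0..t}"] by (metis (no_types, lifting))
qed

end

definition branch_op :: "(int ^ 'd => real) => int ^ 'd => real" where
 "branch_op \<phi> x = walk_op a \<phi> x + \<beta> * delta_op \<phi> x"

lemma walk_op_gen: "walk_op a \<phi> x = walk_gen a \<phi> x"
proof -
 have "a (x - y) = walk_rate a x y" for y using symmetric[of "x - y"] by (simp add: walk_rate_def)
 then show ?thesis by (simp add: walk_op_def gen_op_def)
qed

lemma potential_summable:
 assumes lam: "0 < lam" and \<psi>: "\<And>x. (\<lambda>T. integral {0..T} (tilted lam x)) \<leadsto> \<psi> x" "\<And>x. 0 \<le> \<psi> x"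
 shows "\<psi> summable_on UNIV"
proof (rule nonneg_bdd_above_summable_on)
 have "sum \<psi> F \<le> 1 / lam" if F: "finite F" for F
 proof (rule tendsto_upperbound)
  show "(\<lambda>T. \<Sum>x\<in>F. integral {0..T} (tilted lam x)) \<leadsto> sum \<psi> F"
   by (intro tendsto_sum \<psi>)
  show "\<forall>\<^sub>F T in at_top. (\<Sum>x\<in>F. integral {0..T} (tilted lam x)) \<le> 1 / lam"
   using eventually_ge_at_top[of 0]
  proof eventually_elim
   fix T :: real assume T: "0 \<le> T"
   have "(\<Sum>x\<in>F. integral {0..T} (tilted lam x)) = integral {0..T} (\<lambda>t. \<Sum>x\<in>F. tilted lam x t)"
    by (subst integral_sum) (use F in \<open>auto intro!: half_line_integrable tilted_continuous\<close>)
   also have "\<dots> \<le> 1 / lam"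
   proof (rule integral_le_exponential[OF _ _ _ lam T])
    show "continuous_on {0..} (\<lambda>t. \<Sum>x\<in>F. tilted lam x t)" by (intro continuous_intros tilted_continuous)
    fix t :: real assume t: "0 \<le> t"
    have "(\<Sum>x\<in>F. p t 0 x) \<le> (\<Sum>\<^sub>\<infinity>x. p t 0 x)"
     by (rule finite_sum_le_infsum) (use F t Pk.k_summable Pk.k_nonneg in auto)
    also have "\<dots> \<le> 1" using Pk.k_mass[of t 0] t by simp
    finally have "(\<Sum>x\<in>F. p t x 0) \<le> 1" using Pk.kernel_sym[of t _ 0] t by simp
    then show "(\<Sum>x\<in>F. tilted lam x t) \<le> 1 * exp (- lam * t)"
     unfolding tilted_def sum_distrib_left[symmetric] using mult_left_mono[of _ 1 "exp (- lam * t)"] by simp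
   qed simp
   finally show "(\<Sum>x\<in>F. integral {0..T} (tilted lam x)) \<le> 1 / lam" .
  qed
 qed simp
 then show "bdd_above (sum \<psi> ` {F. F \<subseteq> UNIV \<and> finite F})" by (auto simp: bdd_above_def)
qed (rule \<psi>)

lemma eigenvalue_if_critical:
 assumes lam: "0 < lam" and G: "(\<lambda>T. integral {0..T} (tilted lam 0)) \<leadsto> G" and crit: "\<beta> * G = 1"
 shows "is_l2_eigenvalue branch_op lam"
proof -
 obtain \<psi> where \<psi>: "\<And>x. (\<lambda>T. integral {0..T} (tilted lam x)) \<leadsto> \<psi> x"
  and b: "\<And>x. 0 \<le> \<psi> x" "\<And>x. \<psi> x \<le> G" "\<psi> 0 = G" "0 < G"
  and gen: "\<And>x. walk_gen a \<psi> x = lam * \<psi> x - of_bool (x = 0)"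
  by (rule potential[OF less_imp_le[OF lam] G], rule that) blast+
 have "(\<lambda>x. \<psi> x * G) summable_on UNIV" by (intro summable_on_cmult_left potential_summable[OF lam \<psi> b(1)])
 then have "(\<lambda>x. (\<psi> x)\<^sup>2) summable_on UNIV"
  by (rule summable_on_comparison_test) (use b in \<open>auto simp: power2_eq_square intro: mult_left_mono\<close>)
 moreover have "\<psi> \<noteq> (\<lambda>x. 0)" using b by force
 moreover have "branch_op \<psi> x = lam * \<psi> x" for x
  using crit b gen[of x] by (cases "x = 0") (simp_all add: branch_op_def walk_op_gen delta_op_def)
 ultimately show ?thesis unfolding is_l2_eigenvalue_def by blast
qed

text \<open>The walk semigroup is a contraction in the supremum norm but multiplies u by e^(\<lambda> t).\<close>

lemma bounded_positive_eigenfunction_zero: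
 assumes B: "\<And>x. \<bar>u x\<bar> \<le> B" and e: "\<And>x. walk_gen a u x = lam * u x" and lam: "0 < lam"
 shows "u x = 0"
proof -
 have le: "\<bar>u x\<bar> \<le> exp (- lam * t) * B" if t: "0 \<le> t" for t
 proof -
  have "((\<lambda>s. - (0 * (exp (- lam * s) * p s x 0))) has_integral (exp (- lam * t) * act p t u x - u x)) {0..t}"
   by (rule Pk.act_perturbed_eigenfunction[where B=B]) (use B e t in auto)
  from integral_unique[OF this] have "u x = exp (- lam * t) * act p t u x" by simp
  then show ?thesis using Pk.act_bound[of t u B x, OF t B] by (simp add: abs_mult)
 qed
 have "(\<lambda>t. exp (- lam * t) * B) \<leadsto> 0" using lam by real_asymp
 then have "\<bar>u x\<bar> \<le> 0" by (rule tendsto_lowerbound) (rule eventually_positive, rule le, simp, simp)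
 then show ?thesis by simp
qed

text \<open>An eigenfunction \<phi> and \<beta> \<phi>(0) \<psi> solve the same equation (A - \<lambda>) u = - \<beta> \<phi>(0) \<delta>0 and are
 bounded, so they agree; at the origin this reads \<phi>(0) = \<beta> \<phi>(0) G.\<close>

lemma critical_if_eigenvalue:
 assumes lam: "0 < lam" and G: "(\<lambda>T. integral {0..T} (tilted lam 0)) \<leadsto> G"
  and ev: "is_l2_eigenvalue branch_op lam"
 shows "\<beta> * G = 1"
proof -
 obtain \<psi> where "\<And>x. (\<lambda>T. integral {0..T} (tilted lam x)) \<leadsto> \<psi> x"
  and b: "\<And>x. 0 \<le> \<psi> x" "\<And>x. \<psi> x \<le> G" "\<psi> 0 = G" "0 < G"
  and gen: "\<And>x. walk_gen a \<psi> x = lam * \<psi> x - of_bool (x = 0)"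
  by (rule potential[OF less_imp_le[OF lam] G], rule that) blast+
 obtain \<phi> where \<phi>: "(\<lambda>x. (\<phi> x)\<^sup>2) summable_on UNIV" "\<phi> \<noteq> (\<lambda>x. 0)" "\<And>x. branch_op \<phi> x = lam * \<phi> x"
  using ev unfolding is_l2_eigenvalue_def by blast
 define B where "B = sqrt (\<Sum>\<^sub>\<infinity>x. (\<phi> x)\<^sup>2)"
 have B: "\<bar>\<phi> x\<bar> \<le> B" for x
 proof -
  have "(\<Sum>y\<in>{x}. (\<phi> y)\<^sup>2) \<le> (\<Sum>\<^sub>\<infinity>x. (\<phi> x)\<^sup>2)"
   by (rule finite_sum_le_infsum) (use \<phi> in auto)
  then show ?thesis unfolding B_def by (intro real_le_rsqrt) simp
 qed
 have B2: "\<bar>\<beta> * \<phi> 0 * \<psi> x\<bar> \<le> \<bar>\<beta> * \<phi> 0\<bar> * G" for x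
  using b(1,2)[of x] by (simp add: abs_mult mult_left_mono)
 have z: "\<phi> x - \<beta> * \<phi> 0 * \<psi> x = 0" for x
 proof (rule bounded_positive_eigenfunction_zero[where u="\<lambda>x. \<phi> x - \<beta> * \<phi> 0 * \<psi> x" and B="B + \<bar>\<beta> * \<phi> 0\<bar> * G", OF _ _ lam])
  show "\<bar>\<phi> x - \<beta> * \<phi> 0 * \<psi> x\<bar> \<le> B + \<bar>\<beta> * \<phi> 0\<bar> * G" for x
   using B[of x] B2[of x] by linarith
  show "walk_gen a (\<lambda>x. \<phi> x - \<beta> * \<phi> 0 * \<psi> x) x = lam * (\<phi> x - \<beta> * \<phi> 0 * \<psi> x)" for x
  proof -
   have "walk_gen a (\<lambda>x. \<phi> x - \<beta> * \<phi> 0 * \<psi> x) x = walk_gen a \<phi> x - walk_gen a (\<lambda>x. \<beta> * \<phi> 0 * \<psi> x) x"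
    by (rule Pk.gen_diff[where u=\<phi> and v="\<lambda>x. \<beta> * \<phi> 0 * \<psi> x", OF B B2])
   moreover have "walk_gen a \<phi> x = lam * \<phi> x - \<beta> * delta_op \<phi> x"
    using \<phi>(3)[of x] by (simp add: branch_op_def walk_op_gen)
   ultimately show ?thesis
    by (cases "x = 0") (simp_all add: Pk.gen_scale gen delta_op_def algebra_simps)
  qed
 qed
 have eq: "\<phi> x = \<beta> * \<phi> 0 * \<psi> x" for x using z[of x] by linarith
 have "\<phi> 0 \<noteq> 0"
 proof
  assume "\<phi> 0 = 0"
  then have "\<phi> = (\<lambda>x. 0)" using eq by (intro ext) (metis mult_zero_left mult_zero_right)
  then show False using \<phi>(2) by simp
 qed
 moreover have "\<phi> 0 = \<beta> * \<phi> 0 * G" using eq[of 0] b(3) by simp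
 ultimately show ?thesis by simp
qed

lemma tilted_converges:
 assumes lam: "0 < lam"
 shows "\<exists>G. (\<lambda>T. integral {0..T} (tilted lam 0)) \<leadsto> G \<and> (\<forall>T\<ge>0. integral {0..T} (tilted lam 0) \<le> G) \<and> G \<le> 1 / lam"
proof (rule half_line_bounded[OF tilted_continuous tilted_nonneg])
 show "integral {0..T} (tilted lam 0) \<le> 1 / lam" if "0 \<le> T" for T
  by (rule integral_le_exponential[OF tilted_continuous _ _ lam that]) (use tilted_le_exp in auto)
qed auto

text \<open>As a function of \<lambda> > 0 the Green function at 0 is continuous and at most 1/\<lambda>, so the
 intermediate value theorem applies. The hypothesis on a finite time horizon covers an infinite
 Green function as well.\<close>

lemma critical_exists:
 assumes T: "0 \<le> T" and sup: "1 < \<beta> * integral {0..T} (tilted 0 0)"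
 shows "\<exists>lam G. 0 < lam \<and> (\<lambda>T. integral {0..T} (tilted lam 0)) \<leadsto> G \<and> \<beta> * G = 1"
proof -
 define g where "g lam = (LINT t:{0..}|lborel. tilted lam 0 t)" for lam
 have gl: "(\<lambda>T. integral {0..T} (tilted lam 0)) \<leadsto> g lam" "g lam \<le> 1 / lam"
   "\<And>T. 0 \<le> T ==> integral {0..T} (tilted lam 0) \<le> g lam" "set_integrable lborel {0..} (tilted lam 0)" if l: "0 < lam" for lam
 proof -
  obtain G where G: "(\<lambda>T. integral {0..T} (tilted lam 0)) \<leadsto> G" "\<forall>T\<ge>0. integral {0..T} (tilted lam 0) \<le> G" "G \<le> 1 / lam"
   using tilted_converges[OF l] by blast
  note h = half_line_nn_integral[OF tilted_continuous tilted_nonneg G(1)]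
  have "g lam = G" using h(3) by (simp add: g_def)
  then show "(\<lambda>T. integral {0..T} (tilted lam 0)) \<leadsto> g lam" "g lam \<le> 1 / lam"
   "\<And>T. 0 \<le> T ==> integral {0..T} (tilted lam 0) \<le> g lam" using G by auto
  show "set_integrable lborel {0..} (tilted lam 0)" by (rule h(2)) auto
 qed
 have cont: "continuous_on {m..} g" if m: "0 < m" for m
 proof (rule continuous_on_sequentiallyI)
  fix u :: "nat => real" and l assume u: "\<forall>n. u n \<in> {m..}" "l \<in> {m..}" "u \<longlonglongrightarrow> l"
  have meas: "(\<lambda>t. indicator {0..} t *\<^sub>R tilted lam 0 t) \<in> borel_measurable lborel" for lam
   using borel_measurable_continuous_on_indicator[OF _ tilted_continuous[of lam 0]] by simp
  show "(\<lambda>n. g (u n)) \<longlonglongrightarrow> g l"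
   unfolding g_def set_lebesgue_integral_def
  proof (rule integral_dominated_convergence[where w="\<lambda>t. indicator {0..} t *\<^sub>R tilted m 0 t"])
   show "integrable lborel (\<lambda>t. indicator {0..} t *\<^sub>R tilted m 0 t)" using gl(4)[OF m] by (simp add: set_integrable_def)
   show "AE t in lborel. (\<lambda>n. indicator {0..} t *\<^sub>R tilted (u n) 0 t) \<longlonglongrightarrow> indicator {0..} t *\<^sub>R tilted l 0 t"
    unfolding tilted_def by (intro AE_I2 tendsto_intros u)
   show "AE t in lborel. norm (indicator {0..} t *\<^sub>R tilted (u n) 0 t) \<le> indicator {0..} t *\<^sub>R tilted m 0 t" for n
   proof (rule AE_I2)
    fix t
    show "norm (indicator {0..} t *\<^sub>R tilted (u n) 0 t) \<le> indicator {0..} t *\<^sub>R tilted m 0 t"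
    proof (cases "0 \<le> t")
     case True
     have "exp (- u n * t) * p t 0 0 \<le> exp (- m * t) * p t 0 0"
      using True u(1) Pk.k_nonneg[of t 0 0] by (intro mult_right_mono) (auto intro: mult_right_mono)
     then show ?thesis using True tilted_nonneg[OF True, of "u n" 0] by (simp add: tilted_def)
    qed simp
   qed
  qed (use meas in auto)
 qed
 define I where "I = integral {0..T} (tilted 0 0)"
 have I: "1 < \<beta> * I" using sup by (simp add: I_def)
 have T0: "0 < T"
 proof (rule ccontr)
  assume "\<not> 0 < T" then have "T = 0" using T by simp
  then show False using sup by simp
 qed
 (* so small that e^(- m T) \<beta> I \<ge> 1; the other end of the search interval is 2 \<beta> *)
 define m where "m = min \<beta> (ln (\<beta> * I) / T)"
 have m: "0 < m" "m \<le> \<beta>" using beta_pos I T0 by (auto simp: m_def)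
 have "1 \<le> \<beta> * g m"
 proof -
  have "m * T \<le> ln (\<beta> * I)" using T0 by (simp add: m_def min_def field_simps)
  then have "exp (m * T) \<le> \<beta> * I" using I by (subst (asm) ln_ge_iff) auto
  then have "1 \<le> exp (- m * T) * (\<beta> * I)" by (simp add: exp_minus field_simps)
  also have "exp (- m * T) * (\<beta> * I) = \<beta> * integral {0..T} (\<lambda>t. exp (- m * T) * tilted 0 0 t)" by (simp add: I_def)
  also have "\<dots> \<le> \<beta> * integral {0..T} (tilted m 0)"
  proof (intro mult_left_mono integral_le)
   show "(\<lambda>t. exp (- m * T) * tilted 0 0 t) integrable_on {0..T}"
    by (intro half_line_integrable continuous_intros tilted_continuous)
   show "tilted m 0 integrable_on {0..T}" by (intro half_line_integrable tilted_continuous)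
   show "exp (- m * T) * tilted 0 0 t \<le> tilted m 0 t" if "t \<in> {0..T}" for t
    using that m Pk.k_nonneg[of t 0 0] by (auto simp: tilted_def intro!: mult_right_mono)
  qed (use beta_pos in auto)
  also have "\<dots> \<le> \<beta> * g m" using gl(3)[OF m(1) T] beta_pos by (intro mult_left_mono) auto
  finally show ?thesis .
 qed
 moreover have "\<beta> * g (2 * \<beta>) \<le> 1"
  using mult_left_mono[OF gl(2)[of "2 * \<beta>"], of \<beta>] beta_pos by simp
 ultimately have "\<exists>x\<ge>m. x \<le> 2 * \<beta> \<and> \<beta> * g x = 1"
  by (intro IVT2' continuous_intros continuous_on_subset[OF cont[OF m(1)]]) (use m beta_pos in auto)
 then obtain x where x: "m \<le> x" "\<beta> * g x = 1" by blast
 then show ?thesis using gl(1)[of x] m by (intro exI[of _ x] exI[of _ "g x"]) auto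
qed

end

section \<open>Renewal asymptotics\<close>

lemma half_line_derivative_at:
 fixes f :: "real => real"
 assumes "continuous_on {0..} f" "0 < t"
 shows "DERIV (\<lambda>T. integral {0..T} f) t :> f t"
proof -
 have "at t within {0..} = at t" by (rule at_within_interior) (use assms in \<open>simp add: interior_real_atLeast\<close>)
 with half_line_derivative[OF assms(1), of t] assms(2) show ?thesis by simp
qed

lemma integral_reflect_interval:
 fixes f :: "real => real"
 assumes "a \<le> b"
 shows "integral {a..b} (\<lambda>s. f (c - s)) = integral {c - b..c - a} f"
proof -
 have "integral {a..b} (\<lambda>s. f (c - s)) = integral {-b..-a} (\<lambda>s. f (c + s))"
  using Henstock_Kurzweil_Integration.integral_reflect_real[of "- a" "- b" "\<lambda>s. f (c + s)"] by simp
 also have "\<dots> = integral {c - b..c - a} f"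
  using integral_shift_Icc_real[of "- b" "- a" f c] by (simp add: o_def)
 finally show ?thesis .
qed

lemma convolution_split:
 fixes f g :: "real => real"
 assumes f: "continuous_on {0..} f" and g: "continuous_on {0..} g" and t: "0 \<le> t" and c: "0 \<le> c" "c \<le> 1"
 shows "integral {0..t} (\<lambda>s. f s * g (t - s)) =
  integral {0..c * t} (\<lambda>s. f s * g (t - s)) + integral {0..(1 - c) * t} (\<lambda>s. g s * f (t - s))"
proof -
 have ct: "0 \<le> c * t" "c * t \<le> t" using t c by (auto intro: mult_left_le_one_le)
 have "(\<lambda>s. f s * g (t - s)) integrable_on {0..t}"
  by (intro integrable_continuous_real continuous_intros continuous_on_subset[OF f]
    continuous_on_compose2[OF g]) auto
 from Henstock_Kurzweil_Integration.integral_combine[OF ct this]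
 have "integral {0..t} (\<lambda>s. f s * g (t - s)) = integral {0..c * t} (\<lambda>s. f s * g (t - s)) + integral {c * t..t} (\<lambda>s. f s * g (t - s))"
  by simp
 also have "integral {c * t..t} (\<lambda>s. f s * g (t - s)) = integral {0..(1 - c) * t} (\<lambda>s. g s * f (t - s))"
  using integral_reflect_interval[OF ct(2), of "\<lambda>s. g s * f (t - s)" t] by (simp add: algebra_simps)
 finally show ?thesis .
qed

lemma convolution_commute:
 fixes f g :: "real => real"
 assumes "0 \<le> t"
 shows "integral {0..t} (\<lambda>s. f s * g (t - s)) = integral {0..t} (\<lambda>s. g s * f (t - s))"
 using integral_reflect_interval[OF assms, of "\<lambda>s. g s * f (t - s)" t] by (simp add: mult.commute)

text \<open>The mass of f stays at bounded times s, where the weight at t - s and at t agree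
 asymptotically, while bd dominates the rest.\<close>

lemma partial_convolution_limit:
 fixes f g \<omega> :: "real => real"
 assumes f: "continuous_on {0..} f" "\<And>t. 0 \<le> t ==> 0 \<le> f t" "(\<lambda>T. integral {0..T} f) \<leadsto> I"
  and g: "continuous_on {0..} g" and c: "0 < c" "c \<le> 1"
  and lim: "(\<lambda>t. g t / \<omega> t) \<leadsto> b"
  and pos: "\<forall>\<^sub>F t in at_top. 0 < \<omega> t"
  and shift: "\<And>s. 0 \<le> s ==> (\<lambda>t. \<omega> (t - s) / \<omega> t) \<leadsto> 1"
  and bd: "\<forall>\<^sub>F t in at_top. \<forall>s\<in>{(1 - c) * t..t}. \<bar>g s\<bar> \<le> K * \<omega> t"
 shows "(\<lambda>t. integral {0..c * t} (\<lambda>s. f s * g (t - s)) / \<omega> t) \<leadsto> b * I"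
proof -
 define F where "F t s = indicator {0..c * t} s *\<^sub>R (f s * g (t - s) / \<omega> t)" for t s
 define h where "h s = indicator {0..} s *\<^sub>R f s" for s
 have hi: "integrable lborel h" and hI: "integral\<^sup>L lborel h = I"
  using half_line_nn_integral(2,3)[OF f] by (simp_all add: set_integrable_def set_lebesgue_integral_def h_def[abs_def])
 have cont: "continuous_on {0..c * t} (\<lambda>s. f s * g (t - s) / \<omega> t)" for t
 proof (cases "0 \<le> t")
  case True
  have "c * t \<le> t" using True c by (simp add: mult_left_le_one_le)
  then show ?thesis unfolding divide_inverse
   by (intro continuous_intros continuous_on_subset[OF f(1)] continuous_on_compose2[OF g]) auto
 next
  case False
  then have "c * t < 0" using c by (simp add: mult_pos_neg)
  then show ?thesis by simp
 qed
 have "(\<lambda>t. integral\<^sup>L lborel (F t)) \<leadsto> integral\<^sup>L lborel (\<lambda>s. b * h s)"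
 proof (rule integral_dominated_convergence_at_top[where w="\<lambda>s. K * h s"])
  show "(\<lambda>s. b * h s) \<in> borel_measurable lborel" "integrable lborel (\<lambda>s. K * h s)" using hi by auto
  show "F t \<in> borel_measurable lborel" for t
   using borel_measurable_continuous_on_indicator[OF _ cont[of t]] by (simp add: F_def[abs_def])
  show "AE s in lborel. (\<lambda>t. F t s) \<leadsto> b * h s"
  proof (rule AE_I2)
   fix s :: real
   show "(\<lambda>t. F t s) \<leadsto> b * h s"
   proof (cases "0 \<le> s")
    case False then show ?thesis by (simp add: F_def h_def)
   next
    case True
    have sh: "filterlim (\<lambda>t. t - s) at_top at_top"
     by real_asymp
    have "(\<lambda>t. f s * (g (t - s) / \<omega> (t - s) * (\<omega> (t - s) / \<omega> t))) \<leadsto> f s * (b * 1)"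
     by (intro tendsto_intros filterlim_compose[OF lim sh] shift True)
    then have "(\<lambda>t. F t s) \<leadsto> f s * (b * 1)"
    proof (rule Lim_transform_eventually)
     show "\<forall>\<^sub>F t in at_top. f s * (g (t - s) / \<omega> (t - s) * (\<omega> (t - s) / \<omega> t)) = F t s"
      using filterlim_iff[THEN iffD1, OF sh, rule_format, OF pos] eventually_ge_at_top[of "s / c"]
     proof eventually_elim
      case (elim t)
      then have "s \<le> c * t" using c by (simp add: pos_divide_le_eq mult.commute)
      then show ?case using elim(1) True by (simp add: F_def)
     qed
    qed
    then show ?thesis using True by (simp add: h_def mult.commute)
   qed
  qed
  show "\<forall>\<^sub>F t in at_top. AE s in lborel. norm (F t s) \<le> K * h s"
   using bd pos eventually_ge_at_top[of 0]
  proof eventually_elim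
   case (elim t)
   have "(1 - c) * t \<le> t" using elim(3) c by (simp add: algebra_simps)
   then have "0 \<le> K * \<omega> t" using elim(1) by (smt (verit) atLeastAtMost_iff)
   then have K: "0 \<le> K" using elim(2) by (simp add: zero_le_mult_iff)
   show ?case
   proof (rule AE_I2)
    fix s :: real
    show "norm (F t s) \<le> K * h s"
    proof (cases "s \<in> {0..c * t}")
     case False
     then show ?thesis using K f(2)[of s] by (simp add: F_def h_def indicator_def)
    next
     case True
     have "t - s \<in> {(1 - c) * t..t}" using True by (simp add: algebra_simps)
     then have "\<bar>g (t - s)\<bar> \<le> K * \<omega> t" using elim(1) by blast
     then have "\<bar>g (t - s)\<bar> / \<omega> t \<le> K" using elim(2) by (simp add: pos_divide_le_eq)
     then have "f s * (\<bar>g (t - s)\<bar> / \<omega> t) \<le> f s * K" using f(2)[of s] True by (intro mult_left_mono) auto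
     then show ?thesis using True f(2)[of s] elim(2) by (simp add: F_def h_def abs_mult mult.commute)
    qed
   qed
  qed
 qed
 moreover have "integral\<^sup>L lborel (\<lambda>s. b * h s) = b * I" unfolding hI[symmetric] by (rule integral_mult_right_zero)
 moreover have "integral\<^sup>L lborel (F t) = integral {0..c * t} (\<lambda>s. f s * g (t - s)) / \<omega> t" for t
 proof -
  have "integral\<^sup>L lborel (F t) = integral {0..c * t} (\<lambda>s. f s * g (t - s) / \<omega> t)"
   using set_borel_integral_eq_integral(2)[OF borel_integrable_atLeastAtMost'[OF cont]]
   by (simp add: set_lebesgue_integral_def F_def[abs_def])
  then show ?thesis by (simp add: divide_inverse)
 qed
 ultimately show ?thesis by (simp only:)
qed

text \<open>The scales below are powers of t, 1 / ln t and constants. What they share, and what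
 convolutions need, is insensitivity to bounded shifts and domination on [c t, t].\<close>

definition regular_weight :: "(real => real) => bool" where
 "regular_weight \<omega> \<longleftrightarrow> (\<forall>\<^sub>F t in at_top. 0 < \<omega> t) \<and> (\<forall>s\<ge>0. (\<lambda>t. \<omega> (t - s) / \<omega> t) \<leadsto> 1) \<and>
  (\<forall>c. 0 < c \<longrightarrow> c < 1 \<longrightarrow> (\<exists>K. \<forall>\<^sub>F t in at_top. \<forall>s\<in>{c * t..t}. \<omega> s \<le> K * \<omega> t))"

lemma regular_weight_powr: "regular_weight (\<lambda>t. t powr q)"
 unfolding regular_weight_def
proof (intro conjI allI impI)
 show "\<forall>\<^sub>F t::real in at_top. 0 < t powr q" using eventually_gt_at_top[of 0] by eventually_elim simp
 fix s :: real assume "0 \<le> s"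
 have "(\<lambda>t. (1 - s / t) powr q) \<leadsto> (1 - 0) powr q"
  by (intro tendsto_intros tendsto_divide_0[OF tendsto_const] filterlim_at_top_imp_at_infinity filterlim_ident) auto
 then have "(\<lambda>t. (1 - s / t) powr q) \<leadsto> 1" by simp
 then show "(\<lambda>t. (t - s) powr q / t powr q) \<leadsto> 1"
 proof (rule Lim_transform_eventually)
  show "\<forall>\<^sub>F t in at_top. (1 - s / t) powr q = (t - s) powr q / t powr q"
   using eventually_gt_at_top[of "s"] eventually_gt_at_top[of 0]
  proof eventually_elim
   case (elim t)
   have "1 - s / t = (t - s) / t" using elim by (simp add: field_simps)
   then show ?case using elim by (simp add: powr_divide)
  qed
 qed
next
 fix c :: real assume c: "0 < c" "c < 1"
 have "\<forall>\<^sub>F t in at_top. \<forall>s\<in>{c * t..t}. s powr q \<le> (1 + c powr q) * t powr q"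
  using eventually_gt_at_top[of 0]
 proof eventually_elim
  case (elim t)
  show ?case
  proof
   fix s assume s: "s \<in> {c * t..t}"
   have ct: "0 < c * t" using c elim by simp
   have "s powr q \<le> t powr q \<or> s powr q \<le> c powr q * t powr q"
   proof (cases "0 \<le> q")
    case True then show ?thesis using s ct by (intro disjI1 powr_mono2) auto
   next
    case False
    then have "s powr q \<le> (c * t) powr q" using s ct by (intro powr_mono2') auto
    then show ?thesis using c elim by (simp add: powr_mult)
   qed
   moreover have "0 \<le> t powr q" "0 \<le> c powr q * t powr q" by auto
   ultimately show "s powr q \<le> (1 + c powr q) * t powr q" unfolding distrib_right by linarith
  qed
 qed
 then show "\<exists>K. \<forall>\<^sub>F t in at_top. \<forall>s\<in>{c * t..t}. s powr q \<le> K * t powr q" by blast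
qed

lemma regular_weight_inverse_ln: "regular_weight (\<lambda>t. inverse (ln t))"
 unfolding regular_weight_def
proof (intro conjI allI impI)
 show "\<forall>\<^sub>F t::real in at_top. 0 < inverse (ln t)" using eventually_gt_at_top[of 1] by eventually_elim simp
 show "(\<lambda>t. inverse (ln (t - s)) / inverse (ln t)) \<leadsto> 1" for s :: real by real_asymp
next
 fix c :: real assume c: "0 < c" "c < 1"
 have "\<forall>\<^sub>F t in at_top. ln t / 2 \<le> ln (c * t)" using c by real_asymp
 then have "\<forall>\<^sub>F t in at_top. \<forall>s\<in>{c * t..t}. inverse (ln s) \<le> 2 * inverse (ln t)"
  using eventually_gt_at_top[of 1]
 proof eventually_elim
  case (elim t)
  show ?case
  proof
   fix s assume s: "s \<in> {c * t..t}"
   have "ln t / 2 \<le> ln s" using elim c s by (smt (verit) atLeastAtMost_iff ln_le_cancel_iff mult_pos_pos)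
   moreover have "0 < ln t / 2" using elim by simp
   ultimately have "inverse (ln s) \<le> inverse (ln t / 2)" by (rule le_imp_inverse_le)
   then show "inverse (ln s) \<le> 2 * inverse (ln t)" by (simp add: field_simps)
  qed
 qed
 then show "\<exists>K. \<forall>\<^sub>F t in at_top. \<forall>s\<in>{c * t..t}. inverse (ln s) \<le> K * inverse (ln t)" by blast
qed

lemma regular_weight_one: "regular_weight (\<lambda>t. 1)"
 unfolding regular_weight_def by (auto intro!: exI[of _ 1])

lemma regular_convolution_limit:
 fixes f g \<omega> :: "real => real"
 assumes f: "continuous_on {0..} f" "\<And>t. 0 \<le> t ==> 0 \<le> f t" "(\<lambda>T. integral {0..T} f) \<leadsto> I"
  and g: "continuous_on {0..} g" and c: "0 < c" "c < 1"
  and lim: "(\<lambda>t. g t / \<omega> t) \<leadsto> b" and \<omega>: "regular_weight \<omega>"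
 shows "(\<lambda>t. integral {0..c * t} (\<lambda>s. f s * g (t - s)) / \<omega> t) \<leadsto> b * I"
proof -
 have pos: "\<forall>\<^sub>F t in at_top. 0 < \<omega> t" using \<omega> by (simp add: regular_weight_def)
 obtain K where K: "\<forall>\<^sub>F t in at_top. \<forall>s\<in>{(1 - c) * t..t}. \<omega> s \<le> K * \<omega> t"
 proof -
  have "\<forall>c. 0 < c \<longrightarrow> c < 1 \<longrightarrow> (\<exists>K. \<forall>\<^sub>F t in at_top. \<forall>s\<in>{c * t..t}. \<omega> s \<le> K * \<omega> t)"
   using \<omega> by (simp add: regular_weight_def)
  from spec[OF this, of "1 - c"] show ?thesis using c that by auto
 qed
 have "\<forall>\<^sub>F t in at_top. \<bar>g t / \<omega> t - b\<bar> < 1" using tendstoD[OF lim, of 1] by (simp add: dist_real_def)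
 with pos have "\<forall>\<^sub>F t in at_top. 0 < \<omega> t \<and> \<bar>g t\<bar> \<le> (\<bar>b\<bar> + 1) * \<omega> t"
 proof eventually_elim
  case (elim t)
  have "\<bar>g t / \<omega> t\<bar> \<le> \<bar>b\<bar> + 1" using elim(2) by linarith
  then show ?case using elim(1) by (simp add: abs_divide pos_divide_le_eq)
 qed
 then obtain T where T: "\<And>t. T \<le> t ==> 0 < \<omega> t \<and> \<bar>g t\<bar> \<le> (\<bar>b\<bar> + 1) * \<omega> t"
  unfolding eventually_at_top_linorder by blast
 have "\<forall>\<^sub>F t in at_top. \<forall>s\<in>{(1 - c) * t..t}. \<bar>g s\<bar> \<le> ((\<bar>b\<bar> + 1) * K) * \<omega> t"
  using K eventually_ge_at_top[of "T / (1 - c)"]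
 proof eventually_elim
  case (elim t)
  show ?case
  proof
   fix s assume s: "s \<in> {(1 - c) * t..t}"
   have "T \<le> (1 - c) * t" using elim(2) c by (simp add: pos_divide_le_eq mult.commute)
   then have "\<bar>g s\<bar> \<le> (\<bar>b\<bar> + 1) * \<omega> s" using T[of s] s by auto
   also have "\<dots> \<le> (\<bar>b\<bar> + 1) * (K * \<omega> t)" using elim(1) s by (intro mult_left_mono) auto
   finally show "\<bar>g s\<bar> \<le> ((\<bar>b\<bar> + 1) * K) * \<omega> t" by (simp add: mult_ac)
  qed
 qed
 then show ?thesis
  using \<omega> c by (intro partial_convolution_limit[OF f g _ _ lim pos]) (auto simp: regular_weight_def)
qed

lemma nonpos_if_increasing_to_zero:
 fixes D :: "real => real"
 assumes "\<And>s. T \<le> s ==> DERIV D s :> D' s" "\<And>s. T \<le> s ==> 0 \<le> D' s" "D \<leadsto> 0"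
 shows "D T \<le> 0"
proof (rule tendsto_lowerbound[OF assms(3)])
 show "\<forall>\<^sub>F t in at_top. D T \<le> D t"
  using eventually_ge_at_top[of T]
 proof eventually_elim
  case (elim t)
  show ?case by (rule DERIV_nonneg_imp_nondecreasing[OF elim]) (use assms in blast)
 qed
qed simp

text \<open>Compares the tail with that of c t^(-r): their difference is eventually monotone and tends to
 0. The opposite inequality is the same statement for - f.\<close>

lemma integral_tail_eventually_less:
 fixes f :: "real => real"
 assumes f: "continuous_on {0..} f" and G: "(\<lambda>T. integral {0..T} f) \<leadsto> G"
  and r: "1 < r" and lim: "(\<lambda>t. f t * t powr r) \<leadsto> \<gamma>" and l: "\<gamma> / (r - 1) < l"
 shows "\<forall>\<^sub>F t in at_top. (G - integral {0..t} f) * t powr (r - 1) < l"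
proof -
 have "\<gamma> < l * (r - 1)" using l r by (simp add: pos_divide_less_eq)
 then obtain c where c: "\<gamma> < c" "c < l * (r - 1)" using dense by blast
 define D where "D t = (G - integral {0..t} f) - c * t powr (1 - r) / (r - 1)" for t
 have "(\<lambda>t::real. t powr (1 - r)) \<leadsto> 0" by (rule tendsto_neg_powr) (use r in \<open>auto intro: filterlim_ident\<close>)
 then have "D \<leadsto> (G - G) - c * 0 / (r - 1)" unfolding D_def by (intro tendsto_intros G) (use r in auto)
 then have D0: "D \<leadsto> 0" by simp
 have D': "DERIV D t :> - f t + c * t powr (- r)" if "0 < t" for t
 proof -
  have "((\<lambda>t. t powr (1 - r)) has_real_derivative (1 - r) * t powr (1 - r - 1)) (at t)"
   by (rule has_real_derivative_powr[OF that])
  then have "(D has_real_derivative (0 - f t) - c * ((1 - r) * t powr (1 - r - 1)) / (r - 1)) (at t)"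
   unfolding D_def by (intro DERIV_diff DERIV_const half_line_derivative_at[OF f that] DERIV_cdivide DERIV_cmult)
  moreover have "(0 - f t) - c * ((1 - r) * t powr (1 - r - 1)) / (r - 1) = - f t + c * t powr (- r)"
   using r by (simp add: field_simps)
  ultimately show ?thesis by (simp only:)
 qed
 from order_tendstoD(2)[OF lim c(1)] eventually_gt_at_top[of 0]
 have "\<forall>\<^sub>F t in at_top. 0 < t \<and> f t * t powr r < c" by eventually_elim simp
 then obtain T where T: "\<And>t. T \<le> t ==> 0 < t \<and> f t * t powr r < c" unfolding eventually_at_top_linorder by blast
 show ?thesis
  using eventually_ge_at_top[of T]
 proof eventually_elim
  case (elim t)
  have "D t \<le> 0"
  proof (rule nonpos_if_increasing_to_zero[OF _ _ D0])
   fix s assume "t \<le> s"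
   then have s: "0 < s" "f s * s powr r < c" using T[of s] elim by auto
   then show "DERIV D s :> - f s + c * s powr (- r)" by (intro D')
   have "f s = f s * s powr r * s powr (- r)" using s by (simp add: mult.assoc powr_add[symmetric])
   also have "\<dots> \<le> c * s powr (- r)" using s by (intro mult_right_mono) auto
   finally show "0 \<le> - f s + c * s powr (- r)" by simp
  qed
  then have "G - integral {0..t} f \<le> c * t powr (1 - r) / (r - 1)" by (simp add: D_def)
  then have "(G - integral {0..t} f) * t powr (r - 1) \<le> c * t powr (1 - r) / (r - 1) * t powr (r - 1)"
   by (intro mult_right_mono) auto
  moreover have "t powr (1 - r) * t powr (r - 1) = 1" using T[OF elim] by (simp add: powr_add[symmetric])
  then have "c * t powr (1 - r) / (r - 1) * t powr (r - 1) = c / (r - 1)" by simp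
  moreover have "c / (r - 1) < l" using c(2) r by (simp add: pos_divide_less_eq)
  ultimately show ?case by linarith
 qed
qed

lemma integral_tail_asymptotics:
 fixes f :: "real => real"
 assumes f: "continuous_on {0..} f" and G: "(\<lambda>T. integral {0..T} f) \<leadsto> G"
  and r: "1 < r" and lim: "(\<lambda>t. f t * t powr r) \<leadsto> \<gamma>"
 shows "(\<lambda>t. (G - integral {0..t} f) * t powr (r - 1)) \<leadsto> \<gamma> / (r - 1)"
proof (rule order_tendstoI)
 show "\<forall>\<^sub>F t in at_top. (G - integral {0..t} f) * t powr (r - 1) < l" if "\<gamma> / (r - 1) < l" for l
  by (rule integral_tail_eventually_less[OF f G r lim that])
 fix l assume "l < \<gamma> / (r - 1)"
 then have l: "- \<gamma> / (r - 1) < - l" by simp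
 have "\<forall>\<^sub>F t in at_top. (- G - integral {0..t} (\<lambda>s. - f s)) * t powr (r - 1) < - l"
  by (rule integral_tail_eventually_less[OF _ _ r _ l]) (use f tendsto_minus[OF G] tendsto_minus[OF lim] in \<open>auto intro: continuous_on_minus\<close>)
 then show "\<forall>\<^sub>F t in at_top. l < (G - integral {0..t} f) * t powr (r - 1)"
  by eventually_elim (simp add: left_diff_distrib)
qed

text \<open>A nonincreasing v has a limit, which the convolution with the integrable K multiplies by m.\<close>

lemma renewal_finite_mean:
 fixes v K :: "real => real"
 assumes v: "continuous_on {0..} v" "\<And>t. 0 \<le> t ==> 0 \<le> v t" "\<And>t. 0 \<le> t ==> v t \<le> 1"
   "\<And>s t. 0 \<le> s ==> s \<le> t ==> v t \<le> v s"
  and K: "continuous_on {0..} K" "\<And>t. 0 \<le> t ==> 0 \<le> K t" "(\<lambda>T. integral {0..T} K) \<leadsto> m"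
  and conv: "(\<lambda>t. integral {0..t} (\<lambda>s. K s * v (t - s))) \<leadsto> G" and G: "0 < G"
 shows "v \<leadsto> G / m \<and> 0 < m"
proof -
 obtain l where l: "(\<lambda>t. - v t) \<leadsto> l" "l \<le> 0"
  using mono_bounded_tendsto_at_top[of "\<lambda>t. - v t" 0] v(2,4) by auto
 have v_lim: "v \<leadsto> - l" using tendsto_minus[OF l(1)] by simp
 have "(\<lambda>t. integral {0..1 * t} (\<lambda>s. K s * v (t - s)) / 1) \<leadsto> - l * m"
 proof (rule partial_convolution_limit[OF K v(1), where K=1])
  show "\<forall>\<^sub>F t in at_top. \<forall>s\<in>{(1 - 1) * t..t}. \<bar>v s\<bar> \<le> 1 * 1"
   by (rule always_eventually) (use v(2,3) in auto)
 qed (use v_lim in auto)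
 then have "- l * m = G" using tendsto_unique[OF _ _ conv] by simp
 then have lm: "- l * m = G" "0 < - l * m" using G by auto
 then have "0 < - l \<and> 0 < m" using l(2) zero_less_mult_iff[of "- l" m] by linarith
 then have "0 < - l" "0 < m" by auto
 then have "- l = G / m" using lm(1) by (simp add: field_simps)
 then show ?thesis using v_lim \<open>0 < m\<close> by simp
qed

text \<open>Write S and V for the integrals of K and v, and R for the convolution. Monotonicity of v gives
 v(t) S(t) \<le> R(t), and that of K as well gives R(2t) - K(t) V(t) \<le> v(t) S(t). Here K(t) = O(1/t),
 V(t) = o(t) and S(t) ~ \<kappa> ln t.\<close>

lemma renewal_log_mean:
 fixes v K :: "real => real"
 assumes v: "continuous_on {0..} v" "\<And>t. 0 \<le> t ==> 0 \<le> v t" "\<And>t. 0 \<le> t ==> v t \<le> 1"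
   "\<And>s t. 0 \<le> s ==> s \<le> t ==> v t \<le> v s"
  and K: "continuous_on {0..} K" "\<And>t. 0 \<le> t ==> 0 \<le> K t" "\<And>s t. 0 \<le> s ==> s \<le> t ==> K t \<le> K s"
  and Klim: "(\<lambda>t. K t * t) \<leadsto> \<kappa>" and \<kappa>: "0 < \<kappa>"
  and conv: "(\<lambda>t. integral {0..t} (\<lambda>s. K s * v (t - s))) \<leadsto> G"
 shows "(\<lambda>t. v t / inverse (ln t)) \<leadsto> G / \<kappa>"
proof -
 define R where "R t = integral {0..t} (\<lambda>s. K s * v (t - s))" for t
 define S where "S t = integral {0..t} K" for t
 define V where "V t = integral {0..t} v" for t
 have R: "R \<leadsto> G" using conv by (simp add: R_def[abs_def])
 have prod_int: "(\<lambda>s. K s * v (t - s)) integrable_on {x..y}" if "0 \<le> x" "y \<le> t" for x y t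
  by (intro integrable_continuous_real continuous_intros continuous_on_subset[OF K(1)] continuous_on_compose2[OF v(1)])
   (use that in auto)
 have Sln: "(\<lambda>t. S t / ln t) \<leadsto> \<kappa>"
 proof (rule lhospital_at_top_at_top[where f'=K and g'="\<lambda>t. 1 / t"])
  show "\<forall>\<^sub>F t in at_top. DERIV S t :> K t"
   using eventually_gt_at_top[of 0] unfolding S_def by eventually_elim (rule half_line_derivative_at[OF K(1)])
  show "\<forall>\<^sub>F t::real in at_top. DERIV ln t :> 1 / t"
   by (rule eventually_positive) (auto intro!: derivative_eq_intros)
  show "\<forall>\<^sub>F t::real in at_top. 1 / t \<noteq> 0" using eventually_gt_at_top[of 0] by eventually_elim auto
 qed (use Klim ln_at_top in auto)
 have Sinf: "filterlim S at_top at_top"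
 proof -
  have "filterlim (\<lambda>t. S t / ln t * ln t) at_top at_top"
   by (rule filterlim_tendsto_pos_mult_at_top[OF Sln \<kappa> ln_at_top])
  moreover have "\<forall>\<^sub>F t in at_top. S t / ln t * ln t = S t" using eventually_gt_at_top[of 1] by eventually_elim auto
  ultimately show ?thesis using filterlim_cong[OF refl refl, of "\<lambda>t. S t / ln t * ln t" S] by blast
 qed
 have up: "v t * S t \<le> R t" if t: "0 \<le> t" for t
 proof -
  have "v t * S t = integral {0..t} (\<lambda>s. K s * v t)" by (simp add: S_def mult.commute)
  also have "\<dots> \<le> R t" unfolding R_def
   by (rule integral_le) (use t v K prod_int in \<open>auto intro!: mult_left_mono half_line_integrable continuous_intros\<close>)
  finally show ?thesis .
 qed
 have v0: "v \<leadsto> 0"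
 proof (rule tendsto_sandwich[OF _ _ tendsto_const])
  show "(\<lambda>t. R t / S t) \<leadsto> 0" by (rule real_tendsto_divide_at_top[OF R Sinf])
  show "\<forall>\<^sub>F t in at_top. 0 \<le> v t" using eventually_ge_at_top[of 0] by eventually_elim (rule v)
  show "\<forall>\<^sub>F t in at_top. v t \<le> R t / S t"
   using eventually_ge_at_top[of 0] filterlim_at_top_dense[THEN iffD1, OF Sinf, rule_format, of 0]
   by eventually_elim (use up in \<open>simp add: pos_le_divide_eq\<close>)
 qed
 have Vt: "(\<lambda>t. V t / t) \<leadsto> 0"
 proof (rule lhospital_at_top_at_top[where f'=v and g'="\<lambda>t. 1"])
  show "\<forall>\<^sub>F t in at_top. DERIV V t :> v t"
   using eventually_gt_at_top[of 0] unfolding V_def by eventually_elim (rule half_line_derivative_at[OF v(1)])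
 qed (use v0 in \<open>auto intro!: filterlim_ident derivative_eq_intros\<close>)
 (* on [0,t] the argument 2 t - s of v is at least t; on [t,2t] the argument of K is *)
 have low: "R (2 * t) - K t * V t \<le> v t * S t" if t: "0 \<le> t" for t
 proof -
  have "R (2 * t) = integral {0..t} (\<lambda>s. K s * v (2 * t - s)) + integral {t..2 * t} (\<lambda>s. K s * v (2 * t - s))"
   unfolding R_def by (rule Henstock_Kurzweil_Integration.integral_combine[symmetric]) (use t prod_int in auto)
  also have "integral {0..t} (\<lambda>s. K s * v (2 * t - s)) \<le> integral {0..t} (\<lambda>s. K s * v t)"
   by (rule integral_le) (use t v K prod_int in \<open>auto intro!: mult_left_mono half_line_integrable continuous_intros\<close>)
  also have "\<dots> = v t * S t" by (simp add: S_def mult.commute)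
  also have "integral {t..2 * t} (\<lambda>s. K s * v (2 * t - s)) \<le> integral {t..2 * t} (\<lambda>s. K t * v (2 * t - s))"
  proof (rule integral_le)
   show "(\<lambda>s. K t * v (2 * t - s)) integrable_on {t..2 * t}"
    by (intro integrable_continuous_real continuous_intros continuous_on_compose2[OF v(1)]) (use t in auto)
  qed (use t v K prod_int in \<open>auto intro!: mult_right_mono\<close>)
  also have "\<dots> = K t * V t" using integral_reflect_interval[of t "2 * t" v "2 * t"] t by (simp add: V_def)
  finally show ?thesis by simp
 qed
 have "(\<lambda>t. v t * S t) \<leadsto> G"
 proof (rule tendsto_sandwich[OF _ _ _ R])
  have "filterlim (\<lambda>t::real. 2 * t) at_top at_top" by real_asymp
  then have "(\<lambda>t. R (2 * t) - (K t * t) * (V t / t)) \<leadsto> G - \<kappa> * 0"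
   by (intro tendsto_intros Klim Vt filterlim_compose[OF R])
  then have l: "(\<lambda>t. R (2 * t) - (K t * t) * (V t / t)) \<leadsto> G" by simp
  show "(\<lambda>t. R (2 * t) - K t * V t) \<leadsto> G"
   by (rule Lim_transform_eventually[OF l]) (use eventually_gt_at_top[of 0] in eventually_elim, simp)
  show "\<forall>\<^sub>F t in at_top. R (2 * t) - K t * V t \<le> v t * S t" using eventually_ge_at_top[of 0] by eventually_elim (rule low)
  show "\<forall>\<^sub>F t in at_top. v t * S t \<le> R t" using eventually_ge_at_top[of 0] by eventually_elim (rule up)
 qed
 then have "(\<lambda>t. v t * S t / (S t / ln t)) \<leadsto> G / \<kappa>" using Sln \<kappa> by (intro tendsto_intros) auto
 then show ?thesis
 proof (rule Lim_transform_eventually)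
  show "\<forall>\<^sub>F t in at_top. v t * S t / (S t / ln t) = v t / inverse (ln t)"
   using filterlim_at_top_dense[THEN iffD1, OF Sinf, rule_format, of 0] by eventually_elim (simp add: field_simps)
 qed
qed

text \<open>C / (1 - \<theta>) is the fixed point of the recursion; the distance to it shrinks by \<theta> each time
 that t is replaced by q t, as long as q t stays beyond t0.\<close>

lemma contracting_recursion_bound:
 fixes f :: "real => real"
 assumes \<theta>: "0 \<le> \<theta>" "\<theta> < 1" and q: "0 < q" "q < 1" and t0: "0 < t0"
  and bd: "\<And>t. 0 \<le> t ==> t \<le> t0 ==> f t \<le> B"
  and rec: "\<And>t. t0 \<le> t ==> f t \<le> \<theta> * f (q * t) + C" and \<epsilon>: "0 < \<epsilon>"
 shows "\<forall>\<^sub>F t in at_top. f t \<le> C / (1 - \<theta>) + \<epsilon>"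
proof -
 define h where "h t = f t - C / (1 - \<theta>)" for t
 define B' where "B' = \<bar>B\<bar> + \<bar>C / (1 - \<theta>)\<bar>"
 have B': "0 \<le> B'" by (simp add: B'_def)
 have hrec: "h t \<le> \<theta> * h (q * t)" if "t0 \<le> t" for t
 proof -
  have "C / (1 - \<theta>) = \<theta> * (C / (1 - \<theta>)) + C" using \<theta> by (simp add: field_simps)
  then show ?thesis using rec[OF that] unfolding h_def right_diff_distrib by linarith
 qed
 have P: "\<forall>t\<ge>0. q ^ n * t \<le> t0 \<longrightarrow> h t \<le> B'" for n
 proof (induction n)
  case 0
  show ?case
  proof (intro allI impI)
   fix t assume "0 \<le> t" "q ^ 0 * t \<le> t0"
   then have "f t \<le> B" by (intro bd) auto
   then show "h t \<le> B'" unfolding h_def B'_def by linarith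
  qed
 next
  case (Suc n)
  show ?case
  proof (intro allI impI)
   fix t assume t: "0 \<le> t" "q ^ Suc n * t \<le> t0"
   show "h t \<le> B'"
   proof (cases "t \<le> t0")
    case True then have "f t \<le> B" using t by (intro bd) auto
    then show ?thesis unfolding h_def B'_def by linarith
   next
    case False
    have "h (q * t) \<le> B'" using Suc t q by (simp add: mult_ac)
    then have "\<theta> * h (q * t) \<le> \<theta> * B'" using \<theta> by (intro mult_left_mono) auto
    also have "\<dots> \<le> B'" using \<theta> B' by (simp add: mult_left_le_one_le)
    finally show ?thesis using hrec[of t] False by linarith
   qed
  qed
 qed
 have hB: "h t \<le> B'" if t: "0 \<le> t" for t
 proof -
  have "(\<lambda>n. q ^ n * t) \<longlonglongrightarrow> 0 * t" by (intro tendsto_intros LIMSEQ_power_zero) (use q in auto)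
  then have "\<forall>\<^sub>F n in sequentially. q ^ n * t < t0" using t0 by (intro order_tendstoD) auto
  then obtain n where "q ^ n * t < t0" by (auto simp: eventually_sequentially)
  then show ?thesis using P[of n] t by auto
 qed
 (* with the bound B' for all times, each of the n steps that stay beyond t0 gains a factor \<theta> *)
 have Q: "\<forall>t. t0 \<le> q ^ n * t \<and> 0 \<le> t \<longrightarrow> h t \<le> \<theta> ^ n * B'" for n
 proof (induction n)
  case 0 then show ?case using hB by auto
 next
  case (Suc n)
  show ?case
  proof (intro allI impI, elim conjE)
   fix t assume t: "t0 \<le> q ^ Suc n * t" "0 \<le> t"
   have "q ^ Suc n * t \<le> 1 * t" using q t(2) by (intro mult_right_mono power_le_one) auto
   then have "h t \<le> \<theta> * h (q * t)" using t by (intro hrec) auto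
   also have "\<dots> \<le> \<theta> * (\<theta> ^ n * B')" using Suc t q \<theta> by (intro mult_left_mono) (auto simp: mult_ac)
   finally show "h t \<le> \<theta> ^ Suc n * B'" by (simp add: mult_ac)
  qed
 qed
 have "(\<lambda>n. \<theta> ^ n * B') \<longlonglongrightarrow> 0 * B'" by (intro tendsto_intros LIMSEQ_power_zero) (use \<theta> in auto)
 then have "\<forall>\<^sub>F n in sequentially. \<theta> ^ n * B' < \<epsilon>" using \<epsilon> by (intro order_tendstoD) auto
 then obtain n where n: "\<theta> ^ n * B' < \<epsilon>" by (auto simp: eventually_sequentially)
 show ?thesis
  using eventually_ge_at_top[of "t0 / q ^ n"] eventually_ge_at_top[of 0]
 proof eventually_elim
  case (elim t)
  have "t0 \<le> q ^ n * t" using elim q by (simp add: pos_divide_le_eq mult.commute)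
  then have "h t \<le> \<theta> ^ n * B'" using Q[of n] elim by blast
  then show ?case using n by (simp add: h_def)
 qed
qed

text \<open>For f = v t^r split the convolution at (1 - q) t. The part with v at small times converges by
 regular_convolution_limit. In the other part v is evaluated on [q t, t], so by monotonicity it
 contributes at least the mass of p times \<beta> f(t), and at most \<beta> G q^(-r) f(q t), a contraction when
 q is close to 1. Letting q tend to 1 matches both bounds.\<close>

lemma defective_renewal:
 fixes p v :: "real => real"
 assumes p: "continuous_on {0..} p" "\<And>t. 0 \<le> t ==> 0 \<le> p t" "(\<lambda>T. integral {0..T} p) \<leadsto> G"
  and v: "continuous_on {0..} v" "\<And>t. 0 \<le> t ==> 0 \<le> v t" "\<And>t. 0 \<le> t ==> v t \<le> 1"
   "\<And>s t. 0 \<le> s ==> s \<le> t ==> v t \<le> v s" "(\<lambda>T. integral {0..T} v) \<leadsto> I"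
  and eq: "\<And>t. 0 \<le> t ==> v t = p t + \<beta> * integral {0..t} (\<lambda>s. p s * v (t - s))"
  and \<beta>: "0 < \<beta>" "\<beta> * G < 1" and r: "0 < r"
  and lim: "(\<lambda>t. p t / t powr (- r)) \<leadsto> \<gamma>"
 shows "(\<lambda>t. v t / t powr (- r)) \<leadsto> \<gamma> * (1 + \<beta> * I) / (1 - \<beta> * G)"
proof -
 define f where "f t = v t * t powr r" for t
 define c where "c q t = p t / t powr (- r) + \<beta> * (integral {0..q * t} (\<lambda>s. v s * p (t - s)) / t powr (- r))" for q t
 define D where "D = \<gamma> * (1 + \<beta> * I)"
 have c_lim: "c q \<leadsto> D" if "0 < q" "q < 1" for q
 proof -
  have "c q \<leadsto> \<gamma> + \<beta> * (\<gamma> * I)"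
   unfolding c_def by (intro tendsto_intros lim regular_convolution_limit v p that regular_weight_powr)
  then show ?thesis by (simp add: D_def algebra_simps)
 qed
 have p_le: "integral {0..T} p \<le> G" if "0 \<le> T" for T
 proof (rule tendsto_lowerbound[OF p(3)])
  show "\<forall>\<^sub>F S in at_top. integral {0..T} p \<le> integral {0..S} p"
   using eventually_ge_at_top[of T] by eventually_elim (use that half_line_mono[OF p(1,2)] in auto)
 qed simp
 have int1: "(\<lambda>s. p s * v (t - s)) integrable_on {0..y}" if "y \<le> t" for y t
  by (intro integrable_continuous_real continuous_intros continuous_on_subset[OF p(1)] continuous_on_compose2[OF v(1)])
   (use that in auto)
 have fc: "f t = c q t + \<beta> * (integral {0..(1 - q) * t} (\<lambda>s. p s * v (t - s)) * t powr r)"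
  if t: "0 < t" and q: "0 < q" "q < 1" for t q
 proof -
  have "integral {0..t} (\<lambda>s. p s * v (t - s)) =
    integral {0..(1 - q) * t} (\<lambda>s. p s * v (t - s)) + integral {0..q * t} (\<lambda>s. v s * p (t - s))"
   using convolution_split[OF p(1) v(1), of t "1 - q"] t q by simp
  then have "v t = p t + \<beta> * (integral {0..(1 - q) * t} (\<lambda>s. p s * v (t - s)) + integral {0..q * t} (\<lambda>s. v s * p (t - s)))"
   using eq[of t] t by simp
  then show ?thesis using t by (simp add: f_def c_def powr_minus_divide algebra_simps)
 qed
 have lower: "c (1/2) t / (1 - \<beta> * integral {0..1/2 * t} p) \<le> f t" if t: "0 < t" for t
 proof -
  have "v t * integral {0..1/2 * t} p = integral {0..1/2 * t} (\<lambda>s. p s * v t)" by (simp add: mult.commute)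
  also have "\<dots> \<le> integral {0..1/2 * t} (\<lambda>s. p s * v (t - s))"
   by (rule integral_le) (use t v p int1 in \<open>auto intro!: mult_left_mono half_line_integrable continuous_intros\<close>)
  finally have "\<beta> * (v t * integral {0..1/2 * t} p * t powr r) \<le> \<beta> * (integral {0..1/2 * t} (\<lambda>s. p s * v (t - s)) * t powr r)"
   using \<beta> by (intro mult_left_mono mult_right_mono) auto
  moreover have "f t = c (1/2) t + \<beta> * (integral {0..1/2 * t} (\<lambda>s. p s * v (t - s)) * t powr r)"
   using fc[OF t, of "1/2"] by simp
  moreover have "\<beta> * (v t * integral {0..1/2 * t} p * t powr r) = f t * (\<beta> * integral {0..1/2 * t} p)"
   by (simp add: f_def mult_ac)
  ultimately have "c (1/2) t + f t * (\<beta> * integral {0..1/2 * t} p) \<le> f t" by linarith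
  then have "c (1/2) t \<le> f t * (1 - \<beta> * integral {0..1/2 * t} p)" by (simp add: algebra_simps)
  moreover have "\<beta> * integral {0..1/2 * t} p \<le> \<beta> * G" using \<beta> t by (intro mult_left_mono p_le) auto
  then have "\<beta> * integral {0..1/2 * t} p < 1" using \<beta> by linarith
  ultimately show ?thesis by (simp add: pos_divide_le_eq)
 qed
 have upper: "f t \<le> \<beta> * G * q powr (- r) * f (q * t) + c q t" if t: "0 < t" and q: "0 < q" "q < 1" for t q
 proof -
  have "integral {0..(1 - q) * t} (\<lambda>s. p s * v (t - s)) \<le> integral {0..(1 - q) * t} (\<lambda>s. p s * v (q * t))"
  proof (rule integral_le)
   show "(\<lambda>s. p s * v (t - s)) integrable_on {0..(1 - q) * t}" using t q by (intro int1) (simp add: algebra_simps)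
   show "(\<lambda>s. p s * v (q * t)) integrable_on {0..(1 - q) * t}" by (intro half_line_integrable continuous_intros p)
   fix s assume s: "s \<in> {0..(1 - q) * t}"
   have "q * t \<le> t - s" using s by (simp add: algebra_simps)
   then show "p s * v (t - s) \<le> p s * v (q * t)" using s t q by (intro mult_left_mono v p) auto
  qed
  also have "\<dots> = integral {0..(1 - q) * t} p * v (q * t)" by simp
  also have "\<dots> \<le> G * v (q * t)" using t q by (intro mult_right_mono p_le v) auto
  finally have "\<beta> * (integral {0..(1 - q) * t} (\<lambda>s. p s * v (t - s)) * t powr r) \<le> \<beta> * (G * v (q * t) * t powr r)"
   using \<beta> by (intro mult_left_mono mult_right_mono) auto
  also have "\<dots> = \<beta> * G * q powr (- r) * f (q * t)" using t q by (simp add: f_def powr_mult powr_minus_divide)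
  finally show ?thesis using fc[OF t q] by simp
 qed
 have G0: "0 \<le> G" using p_le[of 0] by simp
 have "f \<leadsto> D / (1 - \<beta> * G)"
 proof (rule order_tendstoI)
  fix l assume l: "l < D / (1 - \<beta> * G)"
  have "filterlim (\<lambda>t::real. 1/2 * t) at_top at_top" by real_asymp
  then have "(\<lambda>t. c (1/2) t / (1 - \<beta> * integral {0..1/2 * t} p)) \<leadsto> D / (1 - \<beta> * G)"
   by (intro tendsto_intros c_lim filterlim_compose[OF p(3)]) (use \<beta> in auto)
  from order_tendstoD(1)[OF this l] eventually_gt_at_top[of 0]
  show "\<forall>\<^sub>F t in at_top. l < f t" by eventually_elim (use lower in \<open>force intro: less_le_trans\<close>)
 next
  fix l assume l: "D / (1 - \<beta> * G) < l"
  have "((\<lambda>\<eta>. (D + \<eta>) / (1 - \<beta> * G * (1 - \<eta>) powr (- r)) + \<eta>) \<longlongrightarrow> (D + 0) / (1 - \<beta> * G * (1 - 0) powr (- r)) + 0) (at_right 0)"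
   by (intro tendsto_intros) (use \<beta> in auto)
  then have 1: "\<forall>\<^sub>F \<eta> in at_right 0. (D + \<eta>) / (1 - \<beta> * G * (1 - \<eta>) powr (- r)) + \<eta> < l"
   using l by (intro order_tendstoD(2)) auto
  have "((\<lambda>\<eta>. \<beta> * G * (1 - \<eta>) powr (- r)) \<longlongrightarrow> \<beta> * G * (1 - 0) powr (- r)) (at_right 0)" by (intro tendsto_intros) auto
  then have 2: "\<forall>\<^sub>F \<eta> in at_right 0. \<beta> * G * (1 - \<eta>) powr (- r) < 1" using \<beta> by (intro order_tendstoD(2)) auto
  have 3: "\<forall>\<^sub>F \<eta> in at_right 0. \<eta> \<in> {0<..<1::real}" by (rule eventually_at_right_real) simp
  have "\<exists>\<eta>. (D + \<eta>) / (1 - \<beta> * G * (1 - \<eta>) powr (- r)) + \<eta> < l \<and> \<beta> * G * (1 - \<eta>) powr (- r) < 1 \<and> \<eta> < 1 \<and> 0 < \<eta>"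
   using eventually_happens'[OF _ eventually_conj[OF 1 eventually_conj[OF 2 3]]] by auto
  then obtain \<eta> where \<eta>: "(D + \<eta>) / (1 - \<beta> * G * (1 - \<eta>) powr (- r)) + \<eta> < l" "\<beta> * G * (1 - \<eta>) powr (- r) < 1" "\<eta> < 1" "0 < \<eta>" by blast
  define q where "q = 1 - \<eta>"
  have q: "0 < q" "q < 1" using \<eta> by (auto simp: q_def)
  have "\<forall>\<^sub>F t in at_top. c q t < D + \<eta>" using \<eta> by (intro order_tendstoD(2)[OF c_lim[OF q]]) auto
  then obtain t1 where t1: "\<And>t. t1 \<le> t ==> c q t < D + \<eta>" unfolding eventually_at_top_linorder by blast
  define t0 where "t0 = max t1 1"
  have "\<forall>\<^sub>F t in at_top. f t \<le> (D + \<eta>) / (1 - \<beta> * G * q powr (- r)) + \<eta>"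
  proof (rule contracting_recursion_bound[OF _ _ q, where ?t0.0=t0 and B="t0 powr r"])
   show "f t \<le> t0 powr r" if "0 \<le> t" "t \<le> t0" for t
   proof -
    have "v t * t powr r \<le> 1 * t0 powr r" using that r v by (intro mult_mono powr_mono2) auto
    then show ?thesis by (simp add: f_def)
   qed
   show "f t \<le> \<beta> * G * q powr (- r) * f (q * t) + (D + \<eta>)" if "t0 \<le> t" for t
    using upper[OF _ q, of t] t1[of t] that by (simp add: t0_def)
  qed (use \<eta> \<beta> G0 in \<open>auto simp: t0_def q_def\<close>)
  then show "\<forall>\<^sub>F t in at_top. f t < l" by eventually_elim (use \<eta>(1) in \<open>simp add: q_def\<close>)
 qed
 moreover have "f = (\<lambda>t. v t / t powr (- r))"
 proof
  fix t show "f t = v t / t powr (- r)" by (simp add: f_def powr_minus_divide)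
 qed
 ultimately show ?thesis by (simp only: D_def)
qed

section \<open>Regularly varying mean\<close>

definition power_density :: "real => real => ennreal" where
 "power_density \<rho> s = ennreal (s powr (\<rho> - 1)) * indicator {0<..} s"

lemma power_density_measurable [measurable]: "power_density \<rho> \<in> borel_measurable borel"
 unfolding power_density_def[abs_def] by measurable

text \<open>With values in the extended nonnegative reals, so that convolutions associate without
 integrability side conditions.\<close>

definition nn_conv :: "(real => ennreal) => (real => ennreal) => real => ennreal" where
 "nn_conv f g t = (\<integral>\<^sup>+ s. f (t - s) * g s \<partial>lborel)"

lemma nn_conv_commute:
 assumes [measurable]: "f \<in> borel_measurable borel" "g \<in> borel_measurable borel"
 shows "nn_conv f g t = nn_conv g f t"
 unfolding nn_conv_def using nn_integral_real_affine[of "\<lambda>s. f (t - s) * g s" "-1" t] by (simp add: mult.commute)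

lemma nn_conv_assoc:
 assumes [measurable]: "f \<in> borel_measurable borel" "g \<in> borel_measurable borel" "h \<in> borel_measurable borel"
 shows "nn_conv (nn_conv f g) h t = nn_conv f (nn_conv g h) t"
proof -
 have "nn_conv f (nn_conv g h) t = (\<integral>\<^sup>+ s. \<integral>\<^sup>+ u. f (t - s) * (g (s - u) * h u) \<partial>lborel \<partial>lborel)"
  unfolding nn_conv_def by (intro nn_integral_cong nn_integral_cmult[symmetric]) simp
 also have "\<dots> = (\<integral>\<^sup>+ u. \<integral>\<^sup>+ s. f (t - s) * (g (s - u) * h u) \<partial>lborel \<partial>lborel)"
  by (rule lborel_pair.Fubini') simp
 also have "\<dots> = (\<integral>\<^sup>+ u. nn_conv f g (t - u) * h u \<partial>lborel)"
 proof (rule nn_integral_cong)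
  fix u
  have "(\<integral>\<^sup>+ s. f (t - s) * (g (s - u) * h u) \<partial>lborel) = (\<integral>\<^sup>+ s. f (t - (u + s)) * (g s * h u) \<partial>lborel)"
   using nn_integral_real_affine[of "\<lambda>s. f (t - s) * (g (s - u) * h u)" 1 u] by simp
  also have "\<dots> = (\<integral>\<^sup>+ s. f (t - u - s) * g s * h u \<partial>lborel)" by (simp add: mult_ac diff_diff_eq)
  also have "\<dots> = nn_conv f g (t - u) * h u" unfolding nn_conv_def by (rule nn_integral_multc) simp
  finally show "(\<integral>\<^sup>+ s. f (t - s) * (g (s - u) * h u) \<partial>lborel) = nn_conv f g (t - u) * h u" .
 qed
 finally show ?thesis by (simp add: nn_conv_def)
qed

text \<open>As v is nonincreasing, it lies between the difference quotients of its integral to the right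
 and to the left, over [t, x t] and [x t, t]. These converge for fixed x, and their limits tend to A
 \<rho> as x tends to 1.\<close>

lemma monotone_density:
 fixes v :: "real => real"
 assumes v: "continuous_on {0..} v" "\<And>s t. 0 \<le> s ==> s \<le> t ==> v t \<le> v s"
  and lim: "(\<lambda>t. integral {0..t} v / t powr \<rho>) \<leadsto> A"
 shows "(\<lambda>t. v t / t powr (\<rho> - 1)) \<leadsto> A * \<rho>"
proof -
 define V where "V t = integral {0..t} v" for t
 (* the limiting slope over [t, x t], which tends to the derivative \<rho> of the power at 1 *)
 define S where "S x = (x powr \<rho> - 1) / (x - 1)" for x :: real
 have "((\<lambda>x. x powr \<rho>) has_real_derivative \<rho> * 1 powr (\<rho> - 1)) (at (1::real))"
  by (rule has_real_derivative_powr) simp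
 then have "(S \<longlongrightarrow> \<rho>) (at 1)" by (simp add: has_field_derivative_iff S_def[abs_def])
 then have S: "((\<lambda>x. A * S x) \<longlongrightarrow> A * \<rho>) (at 1)" by (intro tendsto_intros)
 have slope: "(\<lambda>t. (V (x * t) - V t) / ((x - 1) * t powr \<rho>)) \<leadsto> A * S x" if x: "0 < x" for x
 proof -
  have V: "(\<lambda>t. V t / t powr \<rho>) \<leadsto> A" using lim by (simp add: V_def)
  have "filterlim (\<lambda>t::real. x * t) at_top at_top" using x by real_asymp
  then have Vx: "(\<lambda>t. V (x * t) / (x * t) powr \<rho>) \<leadsto> A" by (rule filterlim_compose[OF V])
  have "(\<lambda>t. (x powr \<rho> * (V (x * t) / (x * t) powr \<rho>) - V t / t powr \<rho>) / (x - 1)) \<leadsto> (x powr \<rho> * A - A) / (x - 1)"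
  proof (cases "x = 1")
   case False
   then show ?thesis by (intro tendsto_divide tendsto_diff tendsto_mult tendsto_const Vx V) simp
  qed simp
  moreover have "(x powr \<rho> * A - A) / (x - 1) = A * S x" by (simp add: S_def algebra_simps)
  moreover have "\<forall>\<^sub>F t in at_top. (x powr \<rho> * (V (x * t) / (x * t) powr \<rho>) - V t / t powr \<rho>) / (x - 1) = (V (x * t) - V t) / ((x - 1) * t powr \<rho>)"
   using eventually_gt_at_top[of 0]
  proof eventually_elim
   case (elim t)
   have "x powr \<rho> * (V (x * t) / (x * t) powr \<rho>) = V (x * t) / t powr \<rho>" using x elim by (simp add: powr_mult)
   then show ?case by (simp add: diff_divide_distrib mult.commute)
  qed
  ultimately show ?thesis by (simp add: Lim_transform_eventually)
 qed
 have incr: "V y - V x \<le> (y - x) * v x" "(y - x) * v y \<le> V y - V x" if "0 \<le> x" "x \<le> y" for x y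
 proof -
  have int: "v integrable_on {0..y}" "v integrable_on {x..y}" by (intro integrable_continuous_real continuous_on_subset[OF v(1)]; use that in auto)+
  have "V y - V x = integral {x..y} v"
   using Henstock_Kurzweil_Integration.integral_combine[OF that int(1)] by (simp add: V_def)
  moreover have "integral {x..y} v \<le> integral {x..y} (\<lambda>_. v x)" "integral {x..y} (\<lambda>_. v y) \<le> integral {x..y} v"
   by (rule integral_le; use that v int in auto)+
  ultimately show "V y - V x \<le> (y - x) * v x" "(y - x) * v y \<le> V y - V x" using that by auto
 qed
 have eq: "v t / t powr (\<rho> - 1) = v t * t / t powr \<rho>" if "0 < t" for t using that by (simp add: powr_diff)
 show ?thesis
 proof (rule order_tendstoI)
  fix l assume "l < A * \<rho>"
  then have "\<forall>\<^sub>F x in at 1. l < A * S x" by (rule order_tendstoD(1)[OF S])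
  then have "\<forall>\<^sub>F x in at_right 1. l < A * S x" by (simp add: eventually_at_split)
  moreover have "\<forall>\<^sub>F x in at_right (1::real). 1 < x" by (rule eventually_at_right_less)
  ultimately obtain x where x: "l < A * S x" "1 < x" using eventually_happens'[OF _ eventually_conj] by (metis (mono_tags, lifting) trivial_limit_at_right_real)
  have "0 < x" using x by simp
  from order_tendstoD(1)[OF slope[OF this] x(1)] eventually_gt_at_top[of 0]
  show "\<forall>\<^sub>F t in at_top. l < v t / t powr (\<rho> - 1)"
  proof eventually_elim
   case (elim t)
   note l = elim(1) and t = elim(2)
   have "V (x * t) - V t \<le> (x * t - t) * v t" using incr(1)[of t "x * t"] t x by simp
   then have "(V (x * t) - V t) / ((x - 1) * t powr \<rho>) \<le> (x - 1) * (v t * t) / ((x - 1) * t powr \<rho>)"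
    using x t by (intro divide_right_mono) (auto simp: algebra_simps)
   also have "\<dots> = v t / t powr (\<rho> - 1)" unfolding eq[OF t] using x by simp
   finally show "l < v t / t powr (\<rho> - 1)" using l by simp
  qed
 next
  fix l assume "A * \<rho> < l"
  then have "\<forall>\<^sub>F x in at 1. A * S x < l" by (rule order_tendstoD(2)[OF S])
  then have 1: "\<forall>\<^sub>F x in at_left 1. A * S x < l" by (simp add: eventually_at_split)
  have 2: "\<forall>\<^sub>F x in at_left (1::real). x \<in> {0<..<1}" by (rule eventually_at_left_real) simp
  obtain x where x: "A * S x < l" "x < 1" "0 < x" using eventually_happens'[OF _ eventually_conj[OF 1 2]] by auto
  from order_tendstoD(2)[OF slope[OF x(3)] x(1)] eventually_gt_at_top[of 0]
  show "\<forall>\<^sub>F t in at_top. v t / t powr (\<rho> - 1) < l"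
  proof eventually_elim
   case (elim t)
   note l = elim(1) and t = elim(2)
   have "(t - x * t) * v t \<le> V t - V (x * t)" using incr(2)[of "x * t" t] t x by simp
   then have "(1 - x) * (v t * t) / ((1 - x) * t powr \<rho>) \<le> (V t - V (x * t)) / ((1 - x) * t powr \<rho>)"
    using x t by (intro divide_right_mono) (auto simp: algebra_simps)
   moreover have "(V t - V (x * t)) / ((1 - x) * t powr \<rho>) = (V (x * t) - V t) / ((x - 1) * t powr \<rho>)"
    using minus_divide_divide[of "V t - V (x * t)" "(1 - x) * t powr \<rho>"] by (simp add: algebra_simps)
   moreover have "(1 - x) * (v t * t) / ((1 - x) * t powr \<rho>) = v t / t powr (\<rho> - 1)" unfolding eq[OF t] using x by simp
   ultimately show "v t / t powr (\<rho> - 1) < l" using l by simp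
  qed
 qed
qed

text \<open>The exponents \<rho> - 1 and - \<rho> add up to -1, so after substituting s = t u all powers of t cancel
 and the Beta integral remains.\<close>

lemma kernel_convolution_limit:
 fixes K :: "real => real"
 assumes K: "continuous_on {0..} K" "\<And>t. 0 \<le> t ==> 0 \<le> K t" "\<And>t. 0 \<le> t ==> K t \<le> B"
  and \<rho>: "0 < \<rho>" "\<rho> < 1" and lim: "(\<lambda>t. K t * t powr \<rho>) \<leadsto> \<kappa>"
 shows "\<exists>j M. (\<forall>t>0. nn_conv (power_density \<rho>) (\<lambda>s. ennreal (K s) * indicator {0..} s) t = ennreal (j t)
   \<and> 0 \<le> j t \<and> j t \<le> M) \<and> j \<leadsto> \<kappa> * Beta (1 - \<rho>) \<rho>"
proof -
 define k where "k s = K s * s powr \<rho>" for s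
 define w where "w u = indicator {0<..<1} u * (u powr - \<rho> * (1 - u) powr (\<rho> - 1))" for u :: real
 have B0: "0 \<le> B" using K(2,3)[of 0] by linarith
 have "((\<lambda>t. t powr (1 - \<rho> - 1) * (1 - t) powr (\<rho> - 1)) has_integral Beta (1 - \<rho>) \<rho>) {0<..<1}"
  using has_integral_Beta_real[of "1 - \<rho>" \<rho>] \<rho> by (simp add: has_integral_Icc_iff_Ioo)
 then have hi: "(w has_integral Beta (1 - \<rho>) \<rho>) UNIV"
  unfolding w_def has_integral_restrict_UNIV[symmetric, of _ _ "{0<..<1}"]
  by (rule has_integral_eq[rotated]) (auto simp: indicator_def)
 have wm[measurable]: "w \<in> borel_measurable borel" unfolding w_def by simp
 have w0: "0 \<le> w u" for u by (simp add: w_def)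
 have nnw: "integral\<^sup>N lborel w = Beta (1 - \<rho>) \<rho>" by (rule nn_integral_has_integral_lborel[OF wm w0 hi])
 have wi: "integrable lborel w" by (rule integrableI_nonneg) (use w0 nnw in auto)
 have wI: "integral\<^sup>L lborel w = Beta (1 - \<rho>) \<rho>"
  using integral_unique[OF hi] integral_lborel[OF wi] by simp
 have kl: "k \<leadsto> \<kappa>" using lim by (simp add: k_def[abs_def])
 obtain M where M: "0 \<le> M" "\<And>s. 0 < s ==> k s \<le> M"
 proof -
  have "\<forall>\<^sub>F s in at_top. k s < \<kappa> + 1" using lim by (intro order_tendstoD(2)[of _ \<kappa>]) (auto simp: k_def)
  then obtain T where T: "\<And>s. T \<le> s ==> k s < \<kappa> + 1" unfolding eventually_at_top_linorder by blast
  show ?thesis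
  proof (rule that[of "\<bar>\<kappa> + 1\<bar> + B * \<bar>T\<bar> powr \<rho>"])
   show "0 \<le> \<bar>\<kappa> + 1\<bar> + B * \<bar>T\<bar> powr \<rho>" using B0 by simp
   fix s :: real assume s: "0 < s"
   show "k s \<le> \<bar>\<kappa> + 1\<bar> + B * \<bar>T\<bar> powr \<rho>"
   proof (cases "T \<le> s")
    case True
    have "0 \<le> B * \<bar>T\<bar> powr \<rho>" using B0 by simp
    then show ?thesis using T[OF True] by linarith
   next
    case False
    then have "k s \<le> B * \<bar>T\<bar> powr \<rho>" unfolding k_def using s K \<rho> B0 by (intro mult_mono powr_mono2) auto
    then show ?thesis by linarith
   qed
  qed
 qed
 have k0: "0 \<le> k s" if "0 < s" for s using K(2)[of s] that by (simp add: k_def)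
 define F where "F t u = w u * (indicator {0<..} u * k (t * u))" for t u
 define j where "j t = integral\<^sup>L lborel (F t)" for t
 have Km: "(\<lambda>s. indicator {0..} s * K s) \<in> borel_measurable borel"
  using borel_measurable_continuous_on_indicator[OF _ K(1)] by simp
 have Fm: "F t \<in> borel_measurable borel" if t: "0 < t" for t
 proof -
  have "(\<lambda>u. w u * (indicator {0<..} u * ((indicator {0..} (t * u) * K (t * u)) * (t * u) powr \<rho>))) \<in> borel_measurable borel"
   using measurable_compose[OF _ Km, of "\<lambda>u. t * u" borel] by simp
  moreover have "(\<lambda>u. w u * (indicator {0<..} u * ((indicator {0..} (t * u) * K (t * u)) * (t * u) powr \<rho>))) = F t"
   using t by (auto simp: F_def k_def indicator_def)
  ultimately show ?thesis by simp
 qed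
 have F0: "0 \<le> F t u" "F t u \<le> M * w u" if t: "0 < t" for t u
 proof -
  show "0 \<le> F t u" using w0[of u] k0[of "t * u"] t by (simp add: F_def indicator_def)
  have "w u * (indicator {0<..} u * k (t * u)) \<le> w u * M"
   using w0[of u] M(1) M(2)[of "t * u"] t by (intro mult_left_mono) (auto simp: indicator_def)
  then show "F t u \<le> M * w u" by (simp add: F_def mult.commute)
 qed
 have Fi: "integrable lborel (F t)" if t: "0 < t" for t
  by (rule Bochner_Integration.integrable_bound[of _ "\<lambda>u. M * w u"]) (use wi Fm[OF t] F0[OF t] w0 M in auto)
 have "j \<leadsto> integral\<^sup>L lborel (\<lambda>u. \<kappa> * w u)"
 proof -
  have "(\<lambda>t. integral\<^sup>L lborel (F (max 1 t))) \<leadsto> integral\<^sup>L lborel (\<lambda>u. \<kappa> * w u)"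
  proof (rule integral_dominated_convergence_at_top[where w="\<lambda>u. M * w u"])
   show "AE u in lborel. (\<lambda>t. F (max 1 t) u) \<leadsto> \<kappa> * w u"
   proof (rule AE_I2)
    fix u :: real
    show "(\<lambda>t. F (max 1 t) u) \<leadsto> \<kappa> * w u"
    proof (cases "0 < u")
     case True
     have "filterlim (\<lambda>t::real. max 1 t * u) at_top at_top" using True by real_asymp
     then have "(\<lambda>t. w u * k (max 1 t * u)) \<leadsto> w u * \<kappa>"
      by (intro tendsto_mult tendsto_const filterlim_compose[OF kl])
     then show ?thesis using True by (simp add: F_def mult.commute)
    qed (simp add: F_def w_def)
   qed
   show "\<forall>\<^sub>F t in at_top. AE u in lborel. norm (F (max 1 t) u) \<le> M * w u"
    by (intro always_eventually allI AE_I2) (use F0 in \<open>auto simp: abs_of_nonneg\<close>)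
  qed (use wi Fm in auto)
  then show ?thesis
  proof (rule Lim_transform_eventually)
   show "\<forall>\<^sub>F t in at_top. integral\<^sup>L lborel (F (max 1 t)) = j t"
    using eventually_ge_at_top[of 1] by eventually_elim (simp add: j_def max_def)
  qed
 qed
 then have jl: "j \<leadsto> \<kappa> * Beta (1 - \<rho>) \<rho>" using wI by simp
 have "nn_conv (power_density \<rho>) (\<lambda>s. ennreal (K s) * indicator {0..} s) t = ennreal (j t)
   \<and> 0 \<le> j t \<and> j t \<le> M * Beta (1 - \<rho>) \<rho>" if t: "0 < t" for t
 proof (intro conjI)
  have m': "(\<lambda>s. power_density \<rho> (t - s) * (ennreal (K s) * indicator {0..} s)) \<in> borel_measurable borel"
   using restricted_measurable[OF K(1)] by measurable
  have "nn_conv (power_density \<rho>) (\<lambda>s. ennreal (K s) * indicator {0..} s) t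
    = ennreal t * (\<integral>\<^sup>+ u. power_density \<rho> (t - t * u) * (ennreal (K (t * u)) * indicator {0..} (t * u)) \<partial>lborel)"
   unfolding nn_conv_def using nn_integral_real_affine[OF m', of t 0] t by simp
  also have "\<dots> = (\<integral>\<^sup>+ u. ennreal t * (power_density \<rho> (t - t * u) * (ennreal (K (t * u)) * indicator {0..} (t * u))) \<partial>lborel)"
   by (rule nn_integral_cmult[symmetric]) (use measurable_compose[OF _ m', of "\<lambda>u. t * u" borel] in simp)
  also have "\<dots> = (\<integral>\<^sup>+ u. ennreal (F t u) \<partial>lborel)"
  proof (rule nn_integral_cong_AE, rule AE_mp[OF AE_lborel_singleton[of 0]], rule AE_I2, rule impI)
   fix u :: real assume u: "u \<noteq> 0"
   show "ennreal t * (power_density \<rho> (t - t * u) * (ennreal (K (t * u)) * indicator {0..} (t * u))) = ennreal (F t u)"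
   proof (cases "0 < u \<and> u < 1")
    case True
    have 1: "(t - t * u) powr (\<rho> - 1) = t powr (\<rho> - 1) * (1 - u) powr (\<rho> - 1)"
     using True t by (subst powr_mult[symmetric]) (auto simp: algebra_simps)
    have 2: "t * t powr (\<rho> - 1) = t powr \<rho>" using t by (simp add: powr_diff)
    have 3: "t powr \<rho> = (t * u) powr \<rho> * u powr - \<rho>" using True t by (simp add: powr_mult powr_minus_divide)
    have "t * (t powr (\<rho> - 1) * (1 - u) powr (\<rho> - 1) * K (t * u)) = F t u"
     using True unfolding F_def k_def w_def mult.assoc[symmetric] 2 unfolding 3 by (simp add: mult_ac)
    moreover have "ennreal t * (ennreal ((t - t * u) powr (\<rho> - 1)) * ennreal (K (t * u))) = ennreal (t * (t powr (\<rho> - 1) * (1 - u) powr (\<rho> - 1) * K (t * u)))"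
     using t True K(2)[of "t * u"] by (simp add: 1 ennreal_mult')
    ultimately show ?thesis using True t by (simp add: power_density_def indicator_def)
   next
    case False
    then consider "u < 0" | "1 \<le> u" using u by linarith
    then show ?thesis
    proof cases
     case 1 then have "t * u < 0" using t by (simp add: mult_pos_neg)
     then show ?thesis using 1 by (simp add: F_def power_density_def)
    next
     case 2 then have "t - t * u \<le> 0" using t by simp
     then show ?thesis using 2 by (simp add: F_def power_density_def w_def indicator_def)
    qed
   qed
  qed
  also have "\<dots> = ennreal (j t)" unfolding j_def
   by (rule nn_integral_eq_integral[OF Fi[OF t]]) (use F0 t in auto)
  finally show "nn_conv (power_density \<rho>) (\<lambda>s. ennreal (K s) * indicator {0..} s) t = ennreal (j t)" .
  show "0 \<le> j t" unfolding j_def by (rule integral_nonneg_AE) (use F0 t in auto)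
  have "j t \<le> integral\<^sup>L lborel (\<lambda>u. M * w u)" unfolding j_def
   by (rule integral_mono[OF Fi[OF t]]) (use F0 t wi in auto)
  then show "j t \<le> M * Beta (1 - \<rho>) \<rho>" using wI by simp
 qed
 then show ?thesis using jl by blast
qed

lemma nn_integral_reflected_power:
 assumes \<rho>: "0 < \<rho>" and a: "a \<le> t"
 shows "(\<integral>\<^sup>+ s. power_density \<rho> (t - s) * indicator {a..} s \<partial>lborel) = ennreal ((t - a) powr \<rho> / \<rho>)"
proof -
 have "(\<integral>\<^sup>+ s. power_density \<rho> (t - s) * indicator {a..} s \<partial>lborel)
   = (\<integral>\<^sup>+ s. power_density \<rho> s * indicator {a..} (t - s) \<partial>lborel)"
  using nn_integral_real_affine[of "\<lambda>s. power_density \<rho> (t - s) * indicator {a..} s" "-1" t] by simp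
 also have "\<dots> = (\<integral>\<^sup>+ s. ennreal (if s \<in> {0..t - a} then s powr (\<rho> - 1) else 0) \<partial>lborel)"
  by (rule nn_integral_cong) (auto simp: power_density_def indicator_def)
 also have "\<dots> = ennreal ((t - a) powr \<rho> / \<rho>)"
 proof (rule nn_integral_has_integral_lborel)
  show "((\<lambda>s. if s \<in> {0..t - a} then s powr (\<rho> - 1) else 0) has_integral (t - a) powr \<rho> / \<rho>) UNIV"
   unfolding has_integral_restrict_UNIV using has_integral_powr_from_0[of "\<rho> - 1" "t - a"] \<rho> a by simp
 qed auto
 finally show ?thesis .
qed

text \<open>Convolving K * v, which tends to G, with t^(\<rho>-1) gives G t^\<rho> / \<rho>. By associativity this is
 also the convolution of v with a function tending to J (kernel_convolution_limit), hence about J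
 times the integral of v. The four bounds R_up, R_low, J_up, J_low make this precise.\<close>

lemma renewal_regularly_varying_mean:
 fixes v K :: "real => real"
 assumes v: "continuous_on {0..} v" "\<And>t. 0 \<le> t ==> 0 \<le> v t" "\<And>t. 0 \<le> t ==> v t \<le> 1"
   "\<And>s t. 0 \<le> s ==> s \<le> t ==> v t \<le> v s"
  and K: "continuous_on {0..} K" "\<And>t. 0 \<le> t ==> 0 \<le> K t" "\<And>t. 0 \<le> t ==> K t \<le> B"
  and \<rho>: "0 < \<rho>" "\<rho> < 1" and lim: "(\<lambda>t. K t * t powr \<rho>) \<leadsto> \<kappa>" and \<kappa>: "0 < \<kappa>"
  and conv: "(\<lambda>t. integral {0..t} (\<lambda>s. K s * v (t - s))) \<leadsto> G" and G: "0 < G"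
  and conv_le: "\<And>t. 0 \<le> t ==> integral {0..t} (\<lambda>s. K s * v (t - s)) \<le> G"
 shows "(\<lambda>t. integral {0..t} v / t powr \<rho>) \<leadsto> G / (\<rho> * (\<kappa> * Beta (1 - \<rho>) \<rho>))"
proof -
 define q where "q = power_density \<rho>"
 define Kx where "Kx s = ennreal (K s) * indicator {0..} s" for s
 define vx where "vx s = ennreal (v s) * indicator {0..} s" for s
 define R where "R t = integral {0..t} (\<lambda>s. K s * v (t - s))" for t
 define V where "V t = integral {0..t} v" for t
 define J where "J = \<kappa> * Beta (1 - \<rho>) \<rho>"
 have J0: "0 < J" unfolding J_def Beta_def using \<rho> \<kappa> by (auto intro!: mult_pos_pos divide_pos_pos Gamma_real_pos)
 have qm[measurable]: "q \<in> borel_measurable borel" unfolding q_def by measurable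
 have Km[measurable]: "Kx \<in> borel_measurable borel" unfolding Kx_def by (rule restricted_measurable[OF K(1)])
 have vm[measurable]: "vx \<in> borel_measurable borel" unfolding vx_def by (rule restricted_measurable[OF v(1)])
 have vm': "(\<lambda>s. ennreal (v s) * indicator {0..t} s) \<in> borel_measurable lborel" for t
  using restricted_interval_measurable[OF v(1)] by simp
 obtain j M where j: "\<And>t. 0 < t ==> nn_conv q Kx t = ennreal (j t)" "\<And>t. 0 < t ==> 0 \<le> j t" "\<And>t. 0 < t ==> j t \<le> M"
  and jl: "j \<leadsto> J"
  using kernel_convolution_limit[OF K \<rho> lim] unfolding q_def[symmetric] Kx_def[abs_def, symmetric] J_def by blast
 have M: "0 \<le> M" using j(2,3)[of 1] by simp
 have j0: "nn_conv q Kx t = 0" if "t \<le> 0" for t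
 proof -
  have "(\<lambda>s. q (t - s) * Kx s) = (\<lambda>s. 0)"
  proof
   fix s show "q (t - s) * Kx s = 0" using that by (cases "s < 0") (auto simp: q_def power_density_def Kx_def)
  qed
  then show ?thesis by (simp only: nn_conv_def) simp
 qed
 have Rconv: "nn_conv Kx vx t = ennreal (R t) * indicator {0..} t" for t
 proof (cases "0 \<le> t")
  case True
  have "nn_conv Kx vx t = nn_conv vx Kx t" by (rule nn_conv_commute) measurable
  also have "\<dots> = (\<integral>\<^sup>+ s. ennreal (K s * v (t - s)) * indicator {0..t} s \<partial>lborel)"
   unfolding nn_conv_def
   by (rule nn_integral_cong) (use K(2) v(2) in \<open>auto simp: Kx_def vx_def indicator_def ennreal_mult mult.commute\<close>)
  also have "\<dots> = ennreal (R t)" unfolding R_def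
   by (rule nn_integral_interval)
    (use K v in \<open>auto intro!: continuous_intros continuous_on_subset[OF K(1)] continuous_on_compose2[OF v(1)]\<close>)
  finally show ?thesis using True by simp
 next
  case False
  have "(\<lambda>s. Kx (t - s) * vx s) = (\<lambda>s. 0)"
  proof
   fix s show "Kx (t - s) * vx s = 0" using False by (cases "s < 0") (auto simp: vx_def Kx_def)
  qed
  then show ?thesis using False by (simp only: nn_conv_def) simp
 qed
 have main: "nn_conv (nn_conv q Kx) vx t = nn_conv q (\<lambda>s. ennreal (R s) * indicator {0..} s) t" for t
 proof -
  have "nn_conv Kx vx = (\<lambda>s. ennreal (R s) * indicator {0..} s)" by (rule ext) (rule Rconv)
  with nn_conv_assoc[OF qm Km vm, of t] show ?thesis by simp
 qed
 have R_up: "nn_conv q (\<lambda>s. ennreal (R s) * indicator {0..} s) t \<le> ennreal (G * (t powr \<rho> / \<rho>))" if t: "0 \<le> t" for t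
 proof -
  have "nn_conv q (\<lambda>s. ennreal (R s) * indicator {0..} s) t \<le> (\<integral>\<^sup>+ s. ennreal G * (q (t - s) * indicator {0..} s) \<partial>lborel)"
   unfolding nn_conv_def
  proof (rule nn_integral_mono)
   fix s :: real
   have "ennreal (R s) * indicator {0..} s \<le> ennreal G * indicator {0..} s"
    using conv_le[of s] by (auto simp: R_def indicator_def intro!: ennreal_leI)
   then have "q (t - s) * (ennreal (R s) * indicator {0..} s) \<le> q (t - s) * (ennreal G * indicator {0..} s)" by (rule mult_left_mono) simp
   then show "q (t - s) * (ennreal (R s) * indicator {0..} s) \<le> ennreal G * (q (t - s) * indicator {0..} s)" by (simp add: mult_ac)
  qed
  also have "\<dots> = ennreal G * (\<integral>\<^sup>+ s. q (t - s) * indicator {0..} s \<partial>lborel)" by (rule nn_integral_cmult) measurable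
  also have "\<dots> = ennreal G * ennreal (t powr \<rho> / \<rho>)"
   using nn_integral_reflected_power[OF \<rho>(1) t] by (simp add: q_def)
  also have "\<dots> = ennreal (G * (t powr \<rho> / \<rho>))" by (rule ennreal_mult'[symmetric]) (use G in simp)
  finally show ?thesis .
 qed
 have R_low: "ennreal (c * ((t - T) powr \<rho> / \<rho>)) \<le> nn_conv q (\<lambda>s. ennreal (R s) * indicator {0..} s) t"
  if t: "0 \<le> T" "T \<le> t" and c: "0 \<le> c" "\<And>s. T \<le> s ==> c \<le> R s" for t T c
 proof -
  have "ennreal (c * ((t - T) powr \<rho> / \<rho>)) = ennreal c * ennreal ((t - T) powr \<rho> / \<rho>)" by (rule ennreal_mult'[OF c(1)])
  also have "\<dots> = ennreal c * (\<integral>\<^sup>+ s. q (t - s) * indicator {T..} s \<partial>lborel)"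
   using nn_integral_reflected_power[OF \<rho>(1) t(2)] by (simp add: q_def)
  also have "\<dots> = (\<integral>\<^sup>+ s. ennreal c * (q (t - s) * indicator {T..} s) \<partial>lborel)" by (rule nn_integral_cmult[symmetric]) measurable
  also have "\<dots> \<le> nn_conv q (\<lambda>s. ennreal (R s) * indicator {0..} s) t" unfolding nn_conv_def
  proof (rule nn_integral_mono)
   fix s :: real
   have "ennreal c * indicator {T..} s \<le> ennreal (R s) * indicator {0..} s"
    using c(2)[of s] t by (auto simp: indicator_def intro!: ennreal_leI)
   then have "q (t - s) * (ennreal c * indicator {T..} s) \<le> q (t - s) * (ennreal (R s) * indicator {0..} s)" by (rule mult_left_mono) simp
   then show "ennreal c * (q (t - s) * indicator {T..} s) \<le> q (t - s) * (ennreal (R s) * indicator {0..} s)" by (simp add: mult_ac)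
  qed
  finally show ?thesis .
 qed
 have V_nn: "0 \<le> V t" for t unfolding V_def
  by (rule integral_nonneg) (use v half_line_integrable in auto)
 have V_int: "(\<integral>\<^sup>+ s. ennreal (v s) * indicator {0..t} s \<partial>lborel) = ennreal (V t)" for t
  unfolding V_def by (rule nn_integral_interval) (use v in \<open>auto intro: continuous_on_subset[OF v(1)]\<close>)
 have J_up: "nn_conv (nn_conv q Kx) vx t \<le> ennreal (c * V t + M * T)"
  if T: "0 < T" and c: "0 \<le> c" "\<And>s. T \<le> s ==> j s \<le> c" for t T c
 proof -
  have "nn_conv (nn_conv q Kx) vx t \<le> (\<integral>\<^sup>+ s. ennreal c * (ennreal (v s) * indicator {0..t} s) + ennreal M * indicator {t - T..t} s \<partial>lborel)"
   unfolding nn_conv_def[of "nn_conv q Kx"]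
  proof (rule nn_integral_mono)
   fix s :: real
   consider "s < 0" | "t \<le> s" | "0 \<le> s" "s < t" "T \<le> t - s" | "0 \<le> s" "s < t" "t - s < T" by linarith
   then show "nn_conv q Kx (t - s) * vx s \<le> ennreal c * (ennreal (v s) * indicator {0..t} s) + ennreal M * indicator {t - T..t} s"
   proof cases
    case 1 then show ?thesis by (simp add: vx_def)
   next
    case 2 then show ?thesis using j0[of "t - s"] by simp
   next
    case 3
    have "nn_conv q Kx (t - s) * vx s \<le> ennreal c * ennreal (v s)"
     using 3 j(1)[of "t - s"] c(2)[of "t - s"] by (auto simp: vx_def intro!: mult_right_mono ennreal_leI)
    also have "\<dots> \<le> ennreal c * (ennreal (v s) * indicator {0..t} s) + ennreal M * indicator {t - T..t} s"
     using 3 by simp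
    finally show ?thesis .
   next
    case 4
    have "ennreal (j (t - s)) * ennreal (v s) \<le> ennreal M * 1"
     using 4 j(3)[of "t - s"] v(3)[of s] by (intro mult_mono ennreal_leI) auto
    then have "nn_conv q Kx (t - s) * vx s \<le> ennreal M" using 4 j(1)[of "t - s"] by (simp add: vx_def)
    also have "\<dots> \<le> ennreal c * (ennreal (v s) * indicator {0..t} s) + ennreal M * indicator {t - T..t} s"
     using 4 by simp
    finally show ?thesis .
   qed
  qed
  also have "\<dots> = (\<integral>\<^sup>+ s. ennreal c * (ennreal (v s) * indicator {0..t} s) \<partial>lborel) + (\<integral>\<^sup>+ s. ennreal M * indicator {t - T..t} s \<partial>lborel)"
   by (rule nn_integral_add) (use vm' in measurable)
  also have "(\<integral>\<^sup>+ s. ennreal c * (ennreal (v s) * indicator {0..t} s) \<partial>lborel) = ennreal (c * V t)"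
   using nn_integral_cmult[OF vm', of "ennreal c" t] c V_int[of t] by (simp add: ennreal_mult')
  also have "(\<integral>\<^sup>+ s. ennreal M * indicator {t - T..t} s \<partial>lborel) = ennreal (M * T)"
   using T M by (subst nn_integral_cmult_indicator) (auto simp: ennreal_mult')
  finally show ?thesis using c M T V_nn[of t] by (simp add: ennreal_plus[symmetric] del: ennreal_plus)
 qed
 have J_low: "ennreal (c * V (t - T)) \<le> nn_conv (nn_conv q Kx) vx t"
  if T: "0 < T" and c: "0 \<le> c" "\<And>s. T \<le> s ==> c \<le> j s" for t T c
 proof -
  have "ennreal (c * V (t - T)) = (\<integral>\<^sup>+ s. ennreal c * (ennreal (v s) * indicator {0..t - T} s) \<partial>lborel)"
   using nn_integral_cmult[OF vm', of "ennreal c" "t - T"] c V_int[of "t - T"] by (simp add: ennreal_mult')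
  also have "\<dots> \<le> nn_conv (nn_conv q Kx) vx t" unfolding nn_conv_def[of "nn_conv q Kx"]
  proof (rule nn_integral_mono)
   fix s :: real
   show "ennreal c * (ennreal (v s) * indicator {0..t - T} s) \<le> nn_conv q Kx (t - s) * vx s"
   proof (cases "s \<in> {0..t - T}")
    case True
    then have "ennreal c * ennreal (v s) \<le> ennreal (j (t - s)) * ennreal (v s)"
     using c(2)[of "t - s"] by (intro mult_right_mono ennreal_leI) auto
    then show ?thesis using True j(1)[of "t - s"] T by (simp add: vx_def)
   qed simp
  qed
  finally show ?thesis .
 qed
 have V_shift: "V t - T \<le> V (t - T)" if "0 < T" "T \<le> t" for t T
 proof -
  have int: "v integrable_on {0..t}" "v integrable_on {t - T..t}"
   by (intro integrable_continuous_real continuous_on_subset[OF v(1)]; use that in auto)+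
  have "V t = V (t - T) + integral {t - T..t} v"
   using Henstock_Kurzweil_Integration.integral_combine[OF _ _ int(1), of "t - T"] that by (simp add: V_def)
  moreover have "integral {t - T..t} v \<le> integral {t - T..t} (\<lambda>_. 1)"
   by (rule integral_le) (use that v int in auto)
  ultimately show ?thesis using that by simp
 qed
 define A where "A = G / (\<rho> * J)"
 have small: "\<forall>\<^sub>F \<eta> in at_right 0. \<eta> \<in> {0<..<min G J}" by (rule eventually_at_right_real) (use G J0 in simp)
 have Rl: "R \<leadsto> G" using conv by (simp add: R_def[abs_def])
 have powT: "(\<lambda>t. x / t powr \<rho>) \<leadsto> 0" for x :: real using \<rho> by real_asymp
 have powS: "(\<lambda>t. (t - T) powr \<rho> / t powr \<rho>) \<leadsto> 1" for T :: real using \<rho> by real_asymp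
 have "(\<lambda>t. V t / t powr \<rho>) \<leadsto> A"
 proof (rule order_tendstoI)
  fix l assume l: "A < l"
  have "((\<lambda>\<eta>. G / (\<rho> * (J - \<eta>))) \<longlongrightarrow> G / (\<rho> * (J - 0))) (at_right 0)" using \<rho> J0 by (intro tendsto_intros) auto
  then have "\<forall>\<^sub>F \<eta> in at_right 0. G / (\<rho> * (J - \<eta>)) < l" using l by (intro order_tendstoD(2)) (auto simp: A_def)
  then obtain \<eta> where \<eta>: "G / (\<rho> * (J - \<eta>)) < l" "0 < \<eta>" "\<eta> < J"
   using eventually_happens'[OF _ eventually_conj[OF _ small]] by fastforce
  have "\<forall>\<^sub>F t in at_top. J - \<eta> < j t" using \<eta> by (intro order_tendstoD(1)[OF jl]) auto
  then obtain T' where T': "\<And>s. T' \<le> s ==> J - \<eta> < j s" unfolding eventually_at_top_linorder by blast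
  define T where "T = max 1 T'"
  have T: "0 < T" "\<And>s. T \<le> s ==> J - \<eta> \<le> j s" using T' by (auto simp: T_def less_imp_le)
  have bd: "V t / t powr \<rho> \<le> G / (\<rho> * (J - \<eta>)) + T / t powr \<rho>" if t: "T \<le> t" for t
  proof -
   have "ennreal ((J - \<eta>) * V (t - T)) \<le> ennreal (G * (t powr \<rho> / \<rho>))"
    using J_low[OF T(1) _ T(2), of t] R_up[of t] main[of t] \<eta> T t by (auto intro: order_trans)
   then have "(J - \<eta>) * V (t - T) \<le> G * (t powr \<rho> / \<rho>)" using G \<rho> by (subst (asm) ennreal_le_iff) auto
   then have "V (t - T) \<le> G / (\<rho> * (J - \<eta>)) * t powr \<rho>" using \<eta> \<rho> by (simp add: field_simps)
   then have "V t \<le> G / (\<rho> * (J - \<eta>)) * t powr \<rho> + T" using V_shift[OF T(1) t] by linarith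
   then have "V t / t powr \<rho> \<le> (G / (\<rho> * (J - \<eta>)) * t powr \<rho> + T) / t powr \<rho>" by (intro divide_right_mono) auto
   also have "\<dots> = G / (\<rho> * (J - \<eta>)) + T / t powr \<rho>" using t T(1) by (simp add: add_divide_distrib)
   finally show ?thesis .
  qed
  have "(\<lambda>t. G / (\<rho> * (J - \<eta>)) + T / t powr \<rho>) \<leadsto> G / (\<rho> * (J - \<eta>)) + 0" by (intro tendsto_add tendsto_const powT)
  from order_tendstoD(2)[OF this, of l] \<eta>(1) have "\<forall>\<^sub>F t in at_top. G / (\<rho> * (J - \<eta>)) + T / t powr \<rho> < l" by simp
  then show "\<forall>\<^sub>F t in at_top. V t / t powr \<rho> < l"
   using eventually_ge_at_top[of T] by eventually_elim (use bd in \<open>force intro: le_less_trans\<close>)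
 next
  fix l assume l: "l < A"
  have "((\<lambda>\<eta>. (G - \<eta>) / (\<rho> * (J + \<eta>))) \<longlongrightarrow> (G - 0) / (\<rho> * (J + 0))) (at_right 0)" using \<rho> J0 by (intro tendsto_intros) auto
  then have "\<forall>\<^sub>F \<eta> in at_right 0. l < (G - \<eta>) / (\<rho> * (J + \<eta>))" using l by (intro order_tendstoD(1)) (auto simp: A_def)
  then obtain \<eta> where \<eta>: "l < (G - \<eta>) / (\<rho> * (J + \<eta>))" "0 < \<eta>" "\<eta> < G"
   using eventually_happens'[OF _ eventually_conj[OF _ small]] by fastforce
  have "\<forall>\<^sub>F t in at_top. j t < J + \<eta> \<and> G - \<eta> < R t"
   using \<eta> by (intro eventually_conj order_tendstoD(2)[OF jl] order_tendstoD(1)[OF Rl]) auto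
  then obtain T' where T': "\<And>s. T' \<le> s ==> j s < J + \<eta> \<and> G - \<eta> < R s" unfolding eventually_at_top_linorder by blast
  define T where "T = max 1 T'"
  have T: "0 < T" "\<And>s. T \<le> s ==> j s \<le> J + \<eta>" "\<And>s. T \<le> s ==> G - \<eta> \<le> R s" using T' by (auto simp: T_def less_imp_le)
  have bd: "(G - \<eta>) / (\<rho> * (J + \<eta>)) * ((t - T) powr \<rho> / t powr \<rho>) - M * T / (J + \<eta>) / t powr \<rho> \<le> V t / t powr \<rho>" if t: "T \<le> t" for t
  proof -
   define g where "g = G - \<eta>"
   have "ennreal ((G - \<eta>) * ((t - T) powr \<rho> / \<rho>)) \<le> ennreal ((J + \<eta>) * V t + M * T)"
    using R_low[OF less_imp_le[OF T(1)] t _ T(3)] J_up[OF T(1) _ T(2), of t] main[of t] \<eta> J0 by (auto intro: order_trans)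
   then have "(G - \<eta>) * ((t - T) powr \<rho> / \<rho>) \<le> (J + \<eta>) * V t + M * T"
    using J0 \<eta> M T V_nn[of t] by (subst (asm) ennreal_le_iff) auto
   then have "((G - \<eta>) * ((t - T) powr \<rho> / \<rho>) - M * T) / (J + \<eta>) \<le> V t"
    using J0 \<eta> by (subst pos_divide_le_eq) (auto simp: mult.commute)
   then have "((G - \<eta>) * ((t - T) powr \<rho> / \<rho>) - M * T) / (J + \<eta>) / t powr \<rho> \<le> V t / t powr \<rho>" by (intro divide_right_mono) auto
   then show ?thesis unfolding g_def[symmetric] by (simp add: diff_divide_distrib)
  qed
  have "(\<lambda>t. (G - \<eta>) / (\<rho> * (J + \<eta>)) * ((t - T) powr \<rho> / t powr \<rho>) - M * T / (J + \<eta>) / t powr \<rho>) \<leadsto> (G - \<eta>) / (\<rho> * (J + \<eta>)) * 1 - 0"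
   by (intro tendsto_diff tendsto_mult tendsto_const powT powS)
  from order_tendstoD(1)[OF this, of l] \<eta>(1)
  have "\<forall>\<^sub>F t in at_top. l < (G - \<eta>) / (\<rho> * (J + \<eta>)) * ((t - T) powr \<rho> / t powr \<rho>) - M * T / (J + \<eta>) / t powr \<rho>" by simp
  then show "\<forall>\<^sub>F t in at_top. l < V t / t powr \<rho>"
   using eventually_ge_at_top[of T] by eventually_elim (use bd in \<open>force intro: less_le_trans\<close>)
 qed
 then show ?thesis by (simp add: A_def V_def J_def)
qed

section \<open>Asymptotics of the tilted mean kernel\<close>

locale branching_potential = walk_and_branching a p \<beta> w
 for a :: "int ^ 'd => real" and p :: "real => int ^ 'd => int ^ 'd => real" and \<beta> :: real
  and w :: "real => int ^ 'd => int ^ 'd => real" +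
 fixes lam G r \<gamma> :: real and \<psi> :: "int ^ 'd => real"
 assumes lam_nonneg: "0 \<le> lam" and G_pos: "0 < G" and psi_0: "\<psi> 0 = G" and psi_nonneg: "\<And>x. 0 \<le> \<psi> x"
  and psi_le: "\<And>x. \<psi> x \<le> G" and gen_psi: "\<And>x. walk_gen a \<psi> x = lam * \<psi> x - of_bool (x = 0)"
  and sub: "\<beta> * G \<le> 1"
  and psi_lim: "\<And>x. (\<lambda>T. integral {0..T} (tilted lam x)) \<leadsto> \<psi> x"
  and r_pos: "0 < r" and gamma_pos: "0 < \<gamma>"
  and p_lim: "\<And>x y. (\<lambda>t. p t x y * t powr r) \<leadsto> \<gamma>"
begin

lemmas potential_facts = lam_nonneg G_pos psi_0 psi_nonneg psi_le gen_psi

lemmas prof_nonneg = profile_nonneg[OF potential_facts]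
lemmas prof_le_1 = profile_le_1[OF potential_facts sub]
lemmas prof_continuous = profile_continuous[OF potential_facts]
lemmas prof_antimono = profile_antimono[OF potential_facts sub]

text \<open>For any pair of points what profile is for the origin.\<close>

definition tilted_mean :: "int ^ 'd => int ^ 'd => real => real" where
 "tilted_mean x y t = exp (- lam * t) * w t x y"

lemma tilted_mean_continuous: "continuous_on {0..} (tilted_mean x y)"
 unfolding tilted_mean_def by (intro continuous_intros Wk.kernel_continuous)

lemma tilted_mean_nonneg: "0 \<le> t ==> 0 \<le> tilted_mean x y t"
 by (simp add: tilted_mean_def Wk.k_nonneg)

lemma tilted_mean_sym: "0 \<le> t ==> tilted_mean x y t = tilted_mean y x t"
 using Wk.kernel_sym[of t x y] by (simp add: tilted_mean_def)

lemma tilted_mean_origin: "tilted_mean 0 0 = profile lam"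
 by (rule ext) (simp add: tilted_mean_def profile_def[OF potential_facts])

lemma tilted_renewal:
 assumes t: "0 \<le> t"
 shows "tilted_mean x y t = exp (- lam * t) * p t x y + \<beta> * integral {0..t} (\<lambda>s. tilted lam x s * tilted_mean 0 y (t - s))"
proof -
 have "((\<lambda>s. exp (- lam * t) * (\<beta> * p (t - s) x 0 * w s 0 y)) has_integral exp (- lam * t) * (w t x y - p t x y)) {0..t}"
  by (rule has_integral_mult_right[OF duhamel_w[OF t]])
 moreover have "exp (- lam * t) * (\<beta> * p (t - s) x 0 * w s 0 y) = \<beta> * (tilted_mean 0 y s * tilted lam x (t - s))" for s
 proof -
  have "exp (- lam * t) = exp (- lam * s) * exp (- lam * (t - s))" by (simp add: exp_add[symmetric] algebra_simps)
  then show ?thesis by (simp add: tilted_mean_def tilted_def mult_ac)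
 qed
 ultimately have "((\<lambda>s. \<beta> * (tilted_mean 0 y s * tilted lam x (t - s))) has_integral exp (- lam * t) * (w t x y - p t x y)) {0..t}"
  by (simp only:)
 from integral_unique[OF this]
 have "\<beta> * integral {0..t} (\<lambda>s. tilted_mean 0 y s * tilted lam x (t - s)) = exp (- lam * t) * (w t x y - p t x y)" by simp
 then show ?thesis using convolution_commute[OF t, of "tilted lam x" "tilted_mean 0 y"]
  by (simp add: tilted_mean_def algebra_simps)
qed

lemma p_le_w: assumes t: "0 \<le> t" shows "p t x y \<le> w t x y"
proof -
 have "0 \<le> w t x y - p t x y"
  by (rule has_integral_nonneg[OF duhamel_w[OF t]]) (use beta_pos Pk.k_nonneg Wk.k_nonneg in auto)
 then show ?thesis by simp
qed

lemma p_eventually_pos: "\<exists>T\<ge>0. \<forall>t\<ge>T. 0 < p t x y"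
proof -
 have "\<forall>\<^sub>F t in at_top. 0 < p t x y * t powr r" by (rule order_tendstoD(1)[OF p_lim gamma_pos])
 then obtain T where T: "\<And>t. T \<le> t ==> 0 < p t x y * t powr r" unfolding eventually_at_top_linorder by blast
 have "0 < p t x y" if "max 0 T \<le> t" for t
  using T[of t] that by (auto simp: zero_less_mult_iff)
 then show ?thesis by (intro exI[of _ "max 0 T"]) auto
qed

text \<open>By the local limit theorem p t x 0 is positive for all large t.\<close>

lemma psi_pos: "0 < \<psi> x"
proof -
 obtain T where T: "0 \<le> T" "\<And>t. T \<le> t ==> 0 < p t x 0" using p_eventually_pos by blast
 have le: "integral {0..S} (tilted lam x) \<le> \<psi> x" if "0 \<le> S" for S
 proof (rule tendsto_lowerbound[OF psi_lim])
  show "\<forall>\<^sub>F U in at_top. integral {0..S} (tilted lam x) \<le> integral {0..U} (tilted lam x)"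
   using eventually_ge_at_top[of S]
   by eventually_elim (use that half_line_mono[OF tilted_continuous tilted_nonneg] in auto)
 qed simp
 have c: "continuous_on {T..T + 1} (tilted lam x)" by (rule continuous_on_subset[OF tilted_continuous]) (use T in auto)
 have nn: "0 \<le> integral {T..T + 1} (tilted lam x)"
  by (rule integral_nonneg[OF integrable_continuous_real[OF c]]) (use T tilted_nonneg in auto)
 have "integral {T..T + 1} (tilted lam x) \<noteq> 0"
 proof
  assume "integral {T..T + 1} (tilted lam x) = 0"
  then have "\<forall>t\<in>{T..T + 1}. tilted lam x t = 0"
   by (subst integral_eq_0_iff[symmetric]) (use c T tilted_nonneg in auto)
  then have "tilted lam x T = 0" by simp
  then show False using T(2)[of T] by (simp add: tilted_def)
 qed
 moreover have "integral {T..T + 1} (tilted lam x) \<le> integral {0..T + 1} (tilted lam x)"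
  by (rule integral_subset_le) (use T tilted_nonneg c half_line_integrable[OF tilted_continuous] in \<open>auto intro: integrable_continuous_real\<close>)
 ultimately show ?thesis using nn le[of "T + 1"] T(1) by linarith
qed

text \<open>w(t,0,y) w(T,y,0) \<le> w(t+T,0,0) with a fixed T for which w(T,y,0) > 0, and the profile is
 nonincreasing.\<close>

lemma tilted_mean_dominated: "\<exists>C\<ge>0. \<forall>t\<ge>0. tilted_mean 0 y t \<le> C * profile lam t"
proof -
 obtain T where T: "0 \<le> T" "\<And>t. T \<le> t ==> 0 < p t y 0" using p_eventually_pos by blast
 have wT: "0 < w T y 0" using T(2)[of T] p_le_w[OF T(1), of y 0] by simp
 define c where "c = exp (- lam * T) * w T y 0"
 have c: "0 < c" using wT by (simp add: c_def)
 have "tilted_mean 0 y t \<le> (1 / c) * profile lam t" if t: "0 \<le> t" for t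
 proof -
  have sm: "(\<lambda>z. w t 0 z * w T z 0) summable_on UNIV"
   by (rule Wk.act_summable[where B="exp (\<beta> * T)", OF t]) (use Wk.kernel_bound[OF T(1)] in auto)
  have "(\<Sum>z\<in>{y}. w t 0 z * w T z 0) \<le> (\<Sum>\<^sub>\<infinity>z. w t 0 z * w T z 0)"
   by (rule finite_sum_le_infsum[OF sm]) (use Wk.k_nonneg t T in auto)
  also have "\<dots> = w (t + T) 0 0"
   using Wk.act_semigroup[of "\<lambda>z. of_bool (z = 0)" 1 t T 0] t T by (simp add: Wk.act_delta_fun Wk.act_delta act_def)
  finally have "w t 0 y * w T y 0 \<le> w (t + T) 0 0" by simp
  then have "exp (- lam * (t + T)) * (w t 0 y * w T y 0) \<le> exp (- lam * (t + T)) * w (t + T) 0 0" by (intro mult_left_mono) auto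
  also have "\<dots> = profile lam (t + T)" by (simp add: profile_def[OF potential_facts])
  also have "\<dots> \<le> profile lam t" by (rule prof_antimono) (use t T in auto)
  also have "exp (- lam * (t + T)) * (w t 0 y * w T y 0) = tilted_mean 0 y t * c"
  proof -
   have "exp (- lam * (t + T)) = exp (- lam * t) * exp (- lam * T)" by (simp add: exp_add[symmetric] algebra_simps)
   then show ?thesis unfolding tilted_mean_def c_def by (simp only: mult_ac)
  qed
  finally show ?thesis using c by (simp add: pos_le_divide_eq)
 qed
 then show ?thesis using c by (intro exI[of _ "1 / c"]) auto
qed

text \<open>Duhamel's formula gives w(t,x,y) from w(s,0,y), s \<le> t. Starting from y = 0, it provides
 w(t,y,0), which is w(t,0,y) by symmetry, and a second application provides w(t,x,y). In either step
 the convolution is cut in the middle: near s = t the known asymptotics and the integrable tilted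
 kernel give b \<psi>(x), and the half with s small is left to the hypothesis H.\<close>

lemma local_limits:
 assumes \<omega>: "regular_weight \<omega>"
  and L: "(\<lambda>t. profile lam t / \<omega> t) \<leadsto> L" "0 < L"
  and P: "\<And>x y. (\<lambda>t. exp (- lam * t) * p t x y / \<omega> t) \<leadsto> e0" "0 \<le> e0"
  and H: "\<And>g C x. continuous_on {0..} g ==> (\<And>t. 0 \<le> t ==> 0 \<le> g t \<and> g t \<le> C * profile lam t) ==>
   \<exists>e\<ge>0. (\<lambda>t. integral {0..1/2 * t} (\<lambda>s. g s * tilted lam x (t - s)) / \<omega> t) \<leadsto> e"
 shows "\<exists>C. \<forall>x y. 0 < C x y \<and> (\<lambda>t. tilted_mean x y t / \<omega> t) \<leadsto> C x y"
proof -
 have step: "\<exists>c>0. (\<lambda>t. tilted_mean x y t / \<omega> t) \<leadsto> c"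
  if b: "(\<lambda>t. tilted_mean 0 y t / \<omega> t) \<leadsto> b" "0 < b" for x y b
 proof -
  obtain C where C: "\<And>t. 0 \<le> t ==> tilted_mean 0 y t \<le> C * profile lam t" using tilted_mean_dominated by blast
  obtain e where e: "0 \<le> e" "(\<lambda>t. integral {0..1/2 * t} (\<lambda>s. tilted_mean 0 y s * tilted lam x (t - s)) / \<omega> t) \<leadsto> e"
   using H[of "tilted_mean 0 y" C x] tilted_mean_continuous tilted_mean_nonneg C by blast
  have first: "(\<lambda>t. integral {0..1/2 * t} (\<lambda>s. tilted lam x s * tilted_mean 0 y (t - s)) / \<omega> t) \<leadsto> b * \<psi> x"
   by (rule regular_convolution_limit[OF tilted_continuous tilted_nonneg psi_lim tilted_mean_continuous _ _ b(1) \<omega>]) auto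
  have "(\<lambda>t. exp (- lam * t) * p t x y / \<omega> t + \<beta> * (integral {0..1/2 * t} (\<lambda>s. tilted lam x s * tilted_mean 0 y (t - s)) / \<omega> t
    + integral {0..1/2 * t} (\<lambda>s. tilted_mean 0 y s * tilted lam x (t - s)) / \<omega> t)) \<leadsto> e0 + \<beta> * (b * \<psi> x + e)"
   by (intro tendsto_add tendsto_mult tendsto_const P first e)
  then have "(\<lambda>t. tilted_mean x y t / \<omega> t) \<leadsto> e0 + \<beta> * (b * \<psi> x + e)"
  proof (rule Lim_transform_eventually)
   show "\<forall>\<^sub>F t in at_top. exp (- lam * t) * p t x y / \<omega> t + \<beta> * (integral {0..1/2 * t} (\<lambda>s. tilted lam x s * tilted_mean 0 y (t - s)) / \<omega> t
     + integral {0..1/2 * t} (\<lambda>s. tilted_mean 0 y s * tilted lam x (t - s)) / \<omega> t) = tilted_mean x y t / \<omega> t"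
    using eventually_ge_at_top[of 0]
   proof eventually_elim
    case (elim t)
    have s: "integral {0..t} (\<lambda>s. tilted lam x s * tilted_mean 0 y (t - s)) =
      integral {0..1/2 * t} (\<lambda>s. tilted lam x s * tilted_mean 0 y (t - s)) + integral {0..1/2 * t} (\<lambda>s. tilted_mean 0 y s * tilted lam x (t - s))"
     using convolution_split[OF tilted_continuous tilted_mean_continuous elim, of "1/2"] by simp
    show ?case unfolding tilted_renewal[OF elim, of x y] s by (simp add: add_divide_distrib distrib_left)
   qed
  qed
  moreover have "0 < e0 + \<beta> * (b * \<psi> x + e)"
   using P(2) beta_pos b(2) psi_pos[of x] e(1) by (intro add_nonneg_pos mult_pos_pos add_pos_nonneg) auto
  ultimately show ?thesis by blast
 qed
 have origin: "\<exists>b>0. (\<lambda>t. tilted_mean 0 y t / \<omega> t) \<leadsto> b" for y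
 proof -
  obtain b where b: "0 < b" "(\<lambda>t. tilted_mean y 0 t / \<omega> t) \<leadsto> b"
   using step[of 0 L y] L by (auto simp: tilted_mean_origin)
  have "(\<lambda>t. tilted_mean 0 y t / \<omega> t) \<leadsto> b"
  by (rule limit_cong_positive[OF b(2)]) (simp add: tilted_mean_sym)
  then show ?thesis using b(1) by blast
 qed
 have "\<exists>c. 0 < c \<and> (\<lambda>t. tilted_mean x y t / \<omega> t) \<leadsto> c" for x y
  using origin[of y] step[of y] by blast
 then show ?thesis by metis
qed

text \<open>Under Z the walk term and the half of the convolution with w at small times are negligible:
 both are bounded by multiples of the tilted p(t/2,0,0) times the integrated profile.\<close>

lemma local_limits_critical:
 assumes \<omega>: "regular_weight \<omega>"
  and L: "(\<lambda>t. profile lam t / \<omega> t) \<leadsto> L" "0 < L"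
  and Z: "(\<lambda>t. tilted lam 0 (1/2 * t) * integral {0..t} (profile lam) / \<omega> t) \<leadsto> 0"
 shows "\<exists>C. \<forall>x y. 0 < C x y \<and> (\<lambda>t. tilted_mean x y t / \<omega> t) \<leadsto> C x y"
proof (rule local_limits[OF \<omega> L, where ?e0.0=0])
 define V where "V t = integral {0..t} (profile lam)" for t
 have pos: "\<forall>\<^sub>F t in at_top. 0 < \<omega> t" using \<omega> by (simp add: regular_weight_def)
 have Vmono: "V s \<le> V t" if "0 \<le> s" "s \<le> t" for s t
  unfolding V_def using that by (intro half_line_mono prof_continuous prof_nonneg)
 have V1: "0 < V 1"
 proof -
  have "\<forall>\<^sub>F t in at_top. 0 < profile lam t / \<omega> t" by (rule order_tendstoD(1)[OF L])
  from eventually_conj[OF this eventually_conj[OF pos eventually_ge_at_top[of 1]]]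
  obtain t where t: "0 < profile lam t / \<omega> t" "0 < \<omega> t" "1 \<le> t" using eventually_happens by fastforce
  then have "0 < profile lam t" by (simp add: zero_less_divide_iff)
  also have "\<dots> \<le> profile lam 1" using t by (intro prof_antimono) auto
  also have "\<dots> = integral {0..1::real} (\<lambda>_. profile lam 1)" by simp
  also have "\<dots> \<le> V 1" unfolding V_def
   by (rule integral_le) (use prof_antimono half_line_integrable[OF prof_continuous] in auto)
  finally show ?thesis .
 qed
 show "(\<lambda>t. exp (- lam * t) * p t x y / \<omega> t) \<leadsto> 0" for x y
 proof (rule tendsto_sandwich[OF _ _ tendsto_const])
  have "(\<lambda>t. 1 / V 1 * (tilted lam 0 (1/2 * t) * V t / \<omega> t)) \<leadsto> 1 / V 1 * 0"
   using Z by (intro tendsto_mult tendsto_const) (simp add: V_def)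
  then show "(\<lambda>t. 1 / V 1 * (tilted lam 0 (1/2 * t) * V t / \<omega> t)) \<leadsto> 0" by simp
  show "\<forall>\<^sub>F t in at_top. 0 \<le> exp (- lam * t) * p t x y / \<omega> t"
   using pos eventually_ge_at_top[of 0] by eventually_elim (simp add: Pk.k_nonneg)
  show "\<forall>\<^sub>F t in at_top. exp (- lam * t) * p t x y / \<omega> t \<le> 1 / V 1 * (tilted lam 0 (1/2 * t) * V t / \<omega> t)"
   using pos eventually_ge_at_top[of 1]
  proof eventually_elim
   case (elim t)
   have "exp (- lam * t) * p t x y \<le> tilted lam 0 t" using p_le_diag[of t x y] elim by (simp add: tilted_def)
   also have "\<dots> \<le> tilted lam 0 (1/2 * t)" using elim by (intro tilted_antimono[OF lam_nonneg]) auto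
   also have "\<dots> = 1 / V 1 * (tilted lam 0 (1/2 * t) * V 1)" using V1 by simp
   also have "\<dots> \<le> 1 / V 1 * (tilted lam 0 (1/2 * t) * V t)"
    using V1 elim by (intro mult_left_mono Vmono tilted_nonneg) auto
   finally have "exp (- lam * t) * p t x y / \<omega> t \<le> 1 / V 1 * (tilted lam 0 (1/2 * t) * V t) / \<omega> t"
    using elim by (intro divide_right_mono) auto
   then show ?case by simp
  qed
 qed
 fix g C x assume g: "continuous_on {0..} g" "\<And>t. 0 \<le> t ==> 0 \<le> g t \<and> g t \<le> C * profile lam t"
 have "(\<lambda>t. integral {0..1/2 * t} (\<lambda>s. g s * tilted lam x (t - s)) / \<omega> t) \<leadsto> 0"
 proof (rule tendsto_sandwich[OF _ _ tendsto_const])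
  have "(\<lambda>t. \<bar>C\<bar> * (tilted lam 0 (1/2 * t) * V t / \<omega> t)) \<leadsto> \<bar>C\<bar> * 0"
   using Z by (intro tendsto_mult tendsto_const) (simp add: V_def)
  then show "(\<lambda>t. \<bar>C\<bar> * (tilted lam 0 (1/2 * t) * V t / \<omega> t)) \<leadsto> 0" by simp
  have int: "(\<lambda>s. g s * tilted lam x (t - s)) integrable_on {0..1/2 * t}" if "0 \<le> t" for t
   by (intro integrable_continuous_real continuous_intros continuous_on_subset[OF g(1)] continuous_on_compose2[OF tilted_continuous])
    (use that in auto)
  show "\<forall>\<^sub>F t in at_top. 0 \<le> integral {0..1/2 * t} (\<lambda>s. g s * tilted lam x (t - s)) / \<omega> t"
   using pos eventually_ge_at_top[of 0]
  proof eventually_elim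
   case (elim t)
   show ?case
    by (intro divide_nonneg_pos integral_nonneg int mult_nonneg_nonneg tilted_nonneg) (use g elim in auto)
  qed
  show "\<forall>\<^sub>F t in at_top. integral {0..1/2 * t} (\<lambda>s. g s * tilted lam x (t - s)) / \<omega> t \<le> \<bar>C\<bar> * (tilted lam 0 (1/2 * t) * V t / \<omega> t)"
   using pos eventually_ge_at_top[of 0]
  proof eventually_elim
   case (elim t)
   have "integral {0..1/2 * t} (\<lambda>s. g s * tilted lam x (t - s)) \<le> integral {0..1/2 * t} (\<lambda>s. \<bar>C\<bar> * tilted lam 0 (1/2 * t) * profile lam s)"
   proof (rule integral_le[OF int])
    show "(\<lambda>s. \<bar>C\<bar> * tilted lam 0 (1/2 * t) * profile lam s) integrable_on {0..1/2 * t}"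
     by (intro half_line_integrable continuous_intros prof_continuous)
    fix s assume s: "s \<in> {0..1/2 * t}"
    have "g s \<le> \<bar>C\<bar> * profile lam s"
     using g(2)[of s] s mult_right_mono[OF abs_ge_self prof_nonneg[of s], of C] by auto
    moreover have "tilted lam x (t - s) \<le> tilted lam 0 (1/2 * t)"
     using tilted_le_diag[of "t - s" lam x] tilted_antimono[OF lam_nonneg, of "1/2 * t" "t - s"] s elim by auto
    ultimately have "g s * tilted lam x (t - s) \<le> (\<bar>C\<bar> * profile lam s) * tilted lam 0 (1/2 * t)"
     using s elim g(2)[of s] by (intro mult_mono tilted_nonneg mult_nonneg_nonneg prof_nonneg) auto
    then show "g s * tilted lam x (t - s) \<le> \<bar>C\<bar> * tilted lam 0 (1/2 * t) * profile lam s" by (simp add: mult_ac)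
   qed (use elim in auto)
   also have "\<dots> = \<bar>C\<bar> * tilted lam 0 (1/2 * t) * V (1/2 * t)" by (simp add: V_def)
   also have "\<dots> \<le> \<bar>C\<bar> * tilted lam 0 (1/2 * t) * V t"
    using elim by (intro mult_left_mono Vmono mult_nonneg_nonneg tilted_nonneg) auto
   finally have "integral {0..1/2 * t} (\<lambda>s. g s * tilted lam x (t - s)) / \<omega> t \<le> \<bar>C\<bar> * tilted lam 0 (1/2 * t) * V t / \<omega> t"
    using elim by (intro divide_right_mono) auto
   then show ?case by (simp add: mult_ac)
  qed
 qed
 then show "\<exists>e\<ge>0. (\<lambda>t. integral {0..1/2 * t} (\<lambda>s. g s * tilted lam x (t - s)) / \<omega> t) \<leadsto> e" by blast
qed simp

text \<open>When \<beta> G = 1, \<beta> e^(-\<lambda> t) p(t,0,0) is a probability density, that of the waiting time in the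
 renewal equation for w; this is its tail.\<close>

definition waiting_tail :: "real => real" where
 "waiting_tail t = \<beta> * (G - integral {0..t} (tilted lam 0))"

lemma green_upto: "0 \<le> t ==> integral {0..t} (tilted lam 0) \<le> G"
proof (rule tendsto_lowerbound[OF psi_lim[of 0, unfolded psi_0]])
 assume "0 \<le> t"
 then show "\<forall>\<^sub>F U in at_top. integral {0..t} (tilted lam 0) \<le> integral {0..U} (tilted lam 0)"
  using eventually_ge_at_top[of t]
  by (intro eventually_mono[OF eventually_ge_at_top[of t]] half_line_mono[OF tilted_continuous tilted_nonneg])
qed simp

lemma waiting_tail_nonneg: "0 \<le> t ==> 0 \<le> waiting_tail t"
 using green_upto[of t] beta_pos by (simp add: waiting_tail_def)

lemma waiting_tail_antimono: "0 \<le> s ==> s \<le> t ==> waiting_tail t \<le> waiting_tail s"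
 using half_line_mono[OF tilted_continuous tilted_nonneg, of s t] beta_pos by (simp add: waiting_tail_def)

lemma waiting_tail_continuous: "continuous_on {0..} waiting_tail"
proof -
 have "continuous_on {0..} (\<lambda>t. integral {0..t} (tilted lam 0))"
  by (rule DERIV_continuous_on[OF half_line_derivative[OF tilted_continuous]]) auto
 then show ?thesis unfolding waiting_tail_def by (intro continuous_intros)
qed

lemma waiting_tail_le: "0 \<le> t ==> waiting_tail t \<le> 1"
 using waiting_tail_antimono[of 0 t] sub by (simp add: waiting_tail_def)

lemma profile_renewal:
 assumes crit: "\<beta> * G = 1" and t: "0 \<le> t"
 shows "integral {0..t} (\<lambda>s. waiting_tail s * profile lam (t - s)) = integral {0..t} (tilted lam 0)"
 using integral_unique[OF renewal_identity[OF potential_facts crit t]]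
 by (simp add: tail_def[OF potential_facts] waiting_tail_def mult.commute)

lemma profile_renewal_limit:
 assumes crit: "\<beta> * G = 1"
 shows "(\<lambda>t. integral {0..t} (\<lambda>s. waiting_tail s * profile lam (t - s))) \<leadsto> G"
proof (rule Lim_transform_eventually[OF psi_lim[of 0, unfolded psi_0]])
 show "\<forall>\<^sub>F t in at_top. integral {0..t} (tilted lam 0) = integral {0..t} (\<lambda>s. waiting_tail s * profile lam (t - s))"
  by (rule eventually_positive) (simp add: profile_renewal[OF crit])
qed

lemma occupation_le: "0 \<le> t ==> integral {0..t} (profile lam) \<le> t"
proof -
 assume t: "0 \<le> t"
 have "integral {0..t} (profile lam) \<le> integral {0..t} (\<lambda>_. 1)"
  by (rule integral_le) (use prof_le_1 half_line_integrable[OF prof_continuous] in auto)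
 then show ?thesis using t by simp
qed

lemma occupation_nonneg: "0 \<le> t ==> 0 \<le> integral {0..t} (profile lam)"
 by (rule integral_nonneg[OF half_line_integrable[OF prof_continuous]]) (use prof_nonneg in auto)

text \<open>As p \<le> 1, the waiting time has an exponential tail and hence a finite mean.\<close>

lemma supercritical_limits:
 assumes lam: "0 < lam" and crit: "\<beta> * G = 1"
 shows "\<exists>C. \<forall>x y. 0 < C x y \<and> tilted_mean x y \<leadsto> C x y"
proof -
 have Kexp: "waiting_tail t \<le> (\<beta> / lam + 1) * exp (- lam * t)" if t: "0 \<le> t" for t
 proof (cases "t = 0")
  case True
  then show ?thesis using crit beta_pos lam by (simp add: waiting_tail_def)
 next
  case False
  then have t0: "0 < t" using t by simp
  have "(G - integral {0..t} (tilted lam 0)) - exp (- lam * t) / lam \<le> 0"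
  proof (rule nonpos_if_increasing_to_zero[where D="\<lambda>t. (G - integral {0..t} (tilted lam 0)) - exp (- lam * t) / lam"
     and D'="\<lambda>s. - tilted lam 0 s + exp (- lam * s)"])
   fix s assume "t \<le> s"
   then have s: "0 < s" using t0 by simp
   have "((\<lambda>t. exp (- lam * t) / lam) has_real_derivative - exp (- lam * s)) (at s)"
    using lam by (auto intro!: derivative_eq_intros)
   from DERIV_diff[OF DERIV_diff[OF DERIV_const half_line_derivative_at[OF tilted_continuous s]] this]
   show "DERIV (\<lambda>t. (G - integral {0..t} (tilted lam 0)) - exp (- lam * t) / lam) s :> - tilted lam 0 s + exp (- lam * s)" by simp
   show "0 \<le> - tilted lam 0 s + exp (- lam * s)"
    using p_le_1[of s 0 0] s by (simp add: tilted_def)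
  next
   have "(\<lambda>t. exp (- lam * t) / lam) \<leadsto> 0" using lam by real_asymp
   from tendsto_diff[OF tendsto_diff[OF tendsto_const[of G] psi_lim[of 0, unfolded psi_0]] this]
   show "(\<lambda>t. (G - integral {0..t} (tilted lam 0)) - exp (- lam * t) / lam) \<leadsto> 0" by simp
  qed
  then have "waiting_tail t \<le> \<beta> * (exp (- lam * t) / lam)"
   unfolding waiting_tail_def using beta_pos by (intro mult_left_mono) auto
  also have "\<dots> \<le> (\<beta> / lam + 1) * exp (- lam * t)" by (simp add: distrib_right)
  finally show ?thesis .
 qed
 define c where "c = \<beta> / lam + 1"
 have c: "0 \<le> c" using beta_pos lam by (simp add: c_def)
 obtain m where m: "(\<lambda>T. integral {0..T} waiting_tail) \<leadsto> m"
 proof -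
  have "integral {0..T} waiting_tail \<le> c / lam" if T: "0 \<le> T" for T
   by (rule integral_le_exponential[OF waiting_tail_continuous _ c lam T]) (use Kexp in \<open>simp add: c_def\<close>)
  then show ?thesis
   using half_line_bounded[OF waiting_tail_continuous waiting_tail_nonneg] that by blast
 qed
 have vl: "profile lam \<leadsto> G / m \<and> 0 < m"
  by (rule renewal_finite_mean[OF prof_continuous prof_nonneg prof_le_1 prof_antimono waiting_tail_continuous waiting_tail_nonneg m
     profile_renewal_limit[OF crit] G_pos])
 have "\<exists>C. \<forall>x y. 0 < C x y \<and> (\<lambda>t. tilted_mean x y t / 1) \<leadsto> C x y"
 proof (rule local_limits_critical[OF regular_weight_one])
  show "(\<lambda>t. profile lam t / 1) \<leadsto> G / m" "0 < G / m" using vl G_pos by auto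
  show "(\<lambda>t. tilted lam 0 (1/2 * t) * integral {0..t} (profile lam) / 1) \<leadsto> 0"
  proof (rule tendsto_sandwich[OF _ _ tendsto_const])
   show "(\<lambda>t. exp (- lam * (1/2 * t)) * t) \<leadsto> 0" using lam by real_asymp
   show "\<forall>\<^sub>F t in at_top. 0 \<le> tilted lam 0 (1/2 * t) * integral {0..t} (profile lam) / 1"
    by (rule eventually_positive) (simp add: tilted_nonneg occupation_nonneg)
   show "\<forall>\<^sub>F t in at_top. tilted lam 0 (1/2 * t) * integral {0..t} (profile lam) / 1 \<le> exp (- lam * (1/2 * t)) * t"
    using eventually_ge_at_top[of 0]
   proof eventually_elim
    case (elim t)
    have "tilted lam 0 (1/2 * t) \<le> exp (- lam * (1/2 * t))" using p_le_1[of "1/2 * t" 0 0] elim by (simp add: tilted_def)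
    then show ?case using elim by (simp add: mult_mono occupation_le occupation_nonneg)
   qed
  qed
 qed
 then show ?thesis by simp
qed

context
 assumes lam0: "lam = 0"
begin

lemma tilted_diag_lim: "(\<lambda>t. tilted lam 0 t * t powr r) \<leadsto> \<gamma>"
 using p_lim[of 0 0] by (simp add: tilted_def lam0)

lemma tilted_half_lim: "(\<lambda>t. tilted lam 0 (1/2 * t) * t powr r) \<leadsto> 2 powr r * \<gamma>"
proof -
 have "filterlim (\<lambda>t::real. 1/2 * t) at_top at_top" by real_asymp
 from tendsto_mult[OF tendsto_const filterlim_compose[OF tilted_diag_lim this]]
 have "(\<lambda>t. 2 powr r * (tilted lam 0 (1/2 * t) * (1/2 * t) powr r)) \<leadsto> 2 powr r * \<gamma>" .
 then show ?thesis
 proof (rule Lim_transform_eventually)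
  show "\<forall>\<^sub>F t in at_top. 2 powr r * (tilted lam 0 (1/2 * t) * (1/2 * t) powr r) = tilted lam 0 (1/2 * t) * t powr r"
   using eventually_gt_at_top[of 0]
  proof eventually_elim
   case (elim t)
   have "2 powr r * (1/2 * t) powr r = t powr r" using elim by (subst powr_mult[symmetric]) auto
   then show ?case by (simp add: mult_ac)
  qed
 qed
qed

lemma waiting_tail_lim:
 assumes "1 < r"
 shows "(\<lambda>t. waiting_tail t * t powr (r - 1)) \<leadsto> \<beta> * (\<gamma> / (r - 1))"
 using tendsto_mult[OF tendsto_const[of \<beta>] integral_tail_asymptotics[OF tilted_continuous psi_lim[of 0, unfolded psi_0] assms tilted_diag_lim]]
 by (simp add: waiting_tail_def mult.assoc)

text \<open>By the local limit theorem the condition of local_limits_critical reduces to a growth bound on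
 the integrated profile.\<close>

lemma vanishing_product:
 assumes "(\<lambda>t. U t * t powr - r) \<leadsto> 0" "\<forall>\<^sub>F t in at_top. 0 < \<omega> t \<and> integral {0..t} (profile lam) / \<omega> t \<le> U t"
 shows "(\<lambda>t. tilted lam 0 (1/2 * t) * integral {0..t} (profile lam) / \<omega> t) \<leadsto> 0"
proof (rule tendsto_sandwich[OF _ _ tendsto_const])
 have "(\<lambda>t. (tilted lam 0 (1/2 * t) * t powr r) * (U t * t powr - r)) \<leadsto> (2 powr r * \<gamma>) * 0"
  by (intro tendsto_mult tilted_half_lim assms)
 then show "(\<lambda>t. (tilted lam 0 (1/2 * t) * t powr r) * (U t * t powr - r)) \<leadsto> 0" by simp
 show "\<forall>\<^sub>F t in at_top. 0 \<le> tilted lam 0 (1/2 * t) * integral {0..t} (profile lam) / \<omega> t"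
  using assms(2) eventually_ge_at_top[of 0] by eventually_elim (simp add: tilted_nonneg occupation_nonneg)
 show "\<forall>\<^sub>F t in at_top. tilted lam 0 (1/2 * t) * integral {0..t} (profile lam) / \<omega> t \<le> (tilted lam 0 (1/2 * t) * t powr r) * (U t * t powr - r)"
  using assms(2) eventually_gt_at_top[of 0]
 proof eventually_elim
  case (elim t)
  have "tilted lam 0 (1/2 * t) * (integral {0..t} (profile lam) / \<omega> t) \<le> tilted lam 0 (1/2 * t) * U t"
   using elim by (intro mult_left_mono tilted_nonneg) auto
  also have "\<dots> = (tilted lam 0 (1/2 * t) * t powr r) * (U t * t powr - r)"
   using elim by (simp add: powr_minus_divide)
  finally show ?case by simp
 qed
qed

text \<open>The waiting time has tail O(t^(1-r)), which is integrable for r > 2.\<close>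

lemma critical_limits_high:
 assumes crit: "\<beta> * G = 1" and r: "2 < r"
 shows "\<exists>C. \<forall>x y. 0 < C x y \<and> (\<lambda>t. tilted_mean x y t / 1) \<leadsto> C x y"
proof -
 define c where "c = \<beta> * (\<gamma> / (r - 1)) + 1"
 have c0: "0 < c" using beta_pos gamma_pos r by (auto simp: c_def intro!: add_pos_pos mult_pos_pos divide_pos_pos)
 have "1 < r" using r by simp
 have "\<forall>\<^sub>F t in at_top. waiting_tail t * t powr (r - 1) < c"
  by (rule order_tendstoD(2)[OF waiting_tail_lim[OF \<open>1 < r\<close>]]) (simp add: c_def)
 then obtain T' where T': "\<And>t. T' \<le> t ==> waiting_tail t * t powr (r - 1) < c" unfolding eventually_at_top_linorder by blast
 define T where "T = max 1 T'"
 have Kc: "waiting_tail t \<le> c * t powr (1 - r)" if "T \<le> t" for t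
 proof -
  have "waiting_tail t * t powr (r - 1) * t powr (1 - r) \<le> c * t powr (1 - r)"
   using T'[of t] that by (intro mult_right_mono) (auto simp: T_def)
  moreover have "t powr (r - 1) * t powr (1 - r) = 1" using that by (simp add: powr_add[symmetric] T_def)
  ultimately show ?thesis by (simp add: mult.assoc)
 qed
 define D where "D t = integral {0..t} waiting_tail + c * t powr (2 - r) / (r - 2)" for t
 have D: "D t \<le> D T" if t: "T \<le> t" for t
 proof (rule DERIV_nonpos_imp_nonincreasing[OF t])
  fix s assume s: "T \<le> s" "s \<le> t"
  then have s0: "0 < s" by (simp add: T_def)
  have "((\<lambda>t. t powr (2 - r)) has_real_derivative (2 - r) * s powr (2 - r - 1)) (at s)" by (rule has_real_derivative_powr[OF s0])
  from DERIV_add[OF half_line_derivative_at[OF waiting_tail_continuous s0] DERIV_cdivide[OF DERIV_cmult[OF this, of c], of "r - 2"]]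
  have "DERIV D s :> waiting_tail s + c * ((2 - r) * s powr (2 - r - 1)) / (r - 2)" unfolding D_def .
  moreover have "waiting_tail s + c * ((2 - r) * s powr (2 - r - 1)) / (r - 2) \<le> 0"
  proof -
   have "c * ((2 - r) * s powr (2 - r - 1)) / (r - 2) = - (c * s powr (1 - r))" using r by (simp add: field_simps)
   then show ?thesis using Kc[OF s(1)] by simp
  qed
  ultimately show "\<exists>y. DERIV D s :> y \<and> y \<le> 0" by blast
 qed
 have "integral {0..t} waiting_tail \<le> D T" if t: "0 \<le> t" for t
 proof -
  have "integral {0..t} waiting_tail \<le> integral {0..max t T} waiting_tail"
   using t by (intro half_line_mono[OF waiting_tail_continuous waiting_tail_nonneg]) auto
  also have "\<dots> \<le> D (max t T)" unfolding D_def using c0 r by simp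
  also have "\<dots> \<le> D T" by (rule D) simp
  finally show ?thesis .
 qed
 then obtain m where m: "(\<lambda>T. integral {0..T} waiting_tail) \<leadsto> m"
  using half_line_bounded[OF waiting_tail_continuous waiting_tail_nonneg] by blast
 have vl: "profile lam \<leadsto> G / m \<and> 0 < m"
  by (rule renewal_finite_mean[OF prof_continuous prof_nonneg prof_le_1 prof_antimono waiting_tail_continuous waiting_tail_nonneg m
     profile_renewal_limit[OF crit] G_pos])
 show ?thesis
 proof (rule local_limits_critical[OF regular_weight_one])
  show "(\<lambda>t. profile lam t / 1) \<leadsto> G / m" "0 < G / m" using vl G_pos by auto
  show "(\<lambda>t. tilted lam 0 (1/2 * t) * integral {0..t} (profile lam) / 1) \<leadsto> 0"
  proof (rule vanishing_product)
   show "(\<lambda>t::real. t * t powr - r) \<leadsto> 0" using r by real_asymp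
   show "\<forall>\<^sub>F t in at_top. 0 < (1::real) \<and> integral {0..t} (profile lam) / 1 \<le> t"
    by (rule eventually_positive) (simp add: occupation_le)
  qed
 qed
qed

lemma critical_limits_log:
 assumes crit: "\<beta> * G = 1" and r: "r = 2"
 shows "\<exists>C. \<forall>x y. 0 < C x y \<and> (\<lambda>t. tilted_mean x y t / inverse (ln t)) \<leadsto> C x y"
proof -
 have "(\<lambda>t. waiting_tail t * t powr 1) \<leadsto> \<beta> * \<gamma>" using waiting_tail_lim r by simp
 then have K: "(\<lambda>t. waiting_tail t * t) \<leadsto> \<beta> * \<gamma>"
 proof (rule Lim_transform_eventually)
  show "\<forall>\<^sub>F t in at_top. waiting_tail t * t powr 1 = waiting_tail t * t"
   using eventually_ge_at_top[of 0] by eventually_elim simp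
 qed
 have bg: "0 < \<beta> * \<gamma>" using beta_pos gamma_pos by simp
 show ?thesis
 proof (rule local_limits_critical[OF regular_weight_inverse_ln])
  show "(\<lambda>t. profile lam t / inverse (ln t)) \<leadsto> G / (\<beta> * \<gamma>)"
   by (rule renewal_log_mean[OF prof_continuous prof_nonneg prof_le_1 prof_antimono waiting_tail_continuous waiting_tail_nonneg
      waiting_tail_antimono K bg profile_renewal_limit[OF crit]])
  show "0 < G / (\<beta> * \<gamma>)" using bg G_pos by simp
  show "(\<lambda>t. tilted lam 0 (1/2 * t) * integral {0..t} (profile lam) / inverse (ln t)) \<leadsto> 0"
  proof (rule vanishing_product)
   show "(\<lambda>t::real. (t * ln t) * t powr - r) \<leadsto> 0" unfolding r by real_asymp
   show "\<forall>\<^sub>F t in at_top. 0 < inverse (ln t) \<and> integral {0..t} (profile lam) / inverse (ln t) \<le> t * ln t"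
    using eventually_gt_at_top[of 1]
    by eventually_elim (simp add: divide_inverse occupation_le mult_right_mono)
  qed
 qed
qed

lemma critical_limits_low:
 assumes crit: "\<beta> * G = 1" and r: "1 < r" "r < 2"
 shows "\<exists>C. \<forall>x y. 0 < C x y \<and> (\<lambda>t. tilted_mean x y t / t powr (r - 2)) \<leadsto> C x y"
proof -
 define \<kappa> where "\<kappa> = \<beta> * (\<gamma> / (r - 1))"
 have \<kappa>: "0 < \<kappa>" using beta_pos gamma_pos r by (simp add: \<kappa>_def)
 define A where "A = G / ((r - 1) * (\<kappa> * Beta (1 - (r - 1)) (r - 1)))"
 have A0: "0 < A" unfolding A_def Beta_def using r \<kappa> G_pos by (auto intro!: mult_pos_pos divide_pos_pos Gamma_real_pos)
 have \<rho>: "0 < r - 1" "r - 1 < 1" using r by auto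
 have conv_le: "integral {0..t} (\<lambda>s. waiting_tail s * profile lam (t - s)) \<le> G" if "0 \<le> t" for t
  using profile_renewal[OF crit that] green_upto[OF that] by simp
 have V: "(\<lambda>t. integral {0..t} (profile lam) / t powr (r - 1)) \<leadsto> A"
  unfolding A_def
  by (rule renewal_regularly_varying_mean[OF prof_continuous prof_nonneg prof_le_1 prof_antimono waiting_tail_continuous waiting_tail_nonneg
     waiting_tail_le \<rho> waiting_tail_lim[OF r(1), folded \<kappa>_def] \<kappa> profile_renewal_limit[OF crit] G_pos conv_le])
 show ?thesis
 proof (rule local_limits_critical[OF regular_weight_powr])
  show "(\<lambda>t. profile lam t / t powr (r - 2)) \<leadsto> A * (r - 1)"
   using monotone_density[OF prof_continuous prof_antimono V] by simp
  show "0 < A * (r - 1)" using A0 r by simp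
  show "(\<lambda>t. tilted lam 0 (1/2 * t) * integral {0..t} (profile lam) / t powr (r - 2)) \<leadsto> 0"
  proof (rule vanishing_product)
   show "(\<lambda>t::real. ((A + 1) * t) * t powr - r) \<leadsto> 0" using r A0 by real_asymp
   have "\<forall>\<^sub>F t in at_top. integral {0..t} (profile lam) / t powr (r - 1) < A + 1" by (rule order_tendstoD(2)[OF V]) simp
   then show "\<forall>\<^sub>F t in at_top. 0 < t powr (r - 2) \<and> integral {0..t} (profile lam) / t powr (r - 2) \<le> (A + 1) * t"
    using eventually_gt_at_top[of 0]
   proof eventually_elim
    case (elim t)
    have "t powr (r - 1) = t powr (r - 2) * t"
     using elim(2) powr_add[of t "r - 2" 1] by simp
    then have "integral {0..t} (profile lam) / t powr (r - 2) / t \<le> A + 1" using elim by simp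
    then show ?case using elim(2) by (simp add: pos_divide_le_eq mult_ac)
   qed
  qed
 qed
qed

text \<open>Here w is of the same order as p, so both the walk term and the half with w at small times
 contribute; the latter converges since the profile is integrable.\<close>

lemma subcritical_limits:
 assumes sub': "\<beta> * G < 1" and r: "1 < r"
 shows "\<exists>C. \<forall>x y. 0 < C x y \<and> (\<lambda>t. tilted_mean x y t / t powr - r) \<leadsto> C x y"
proof -
 have prof_w: "profile lam = (\<lambda>s. w s 0 0)" unfolding profile_def[OF potential_facts] by (simp add: lam0)
 obtain I where I: "(\<lambda>T. integral {0..T} (profile lam)) \<leadsto> I"
  using half_line_bounded[OF prof_continuous prof_nonneg] occupation_bound[OF potential_facts lam0 sub', of _ 0]
  unfolding prof_w by blast
 have I0: "0 \<le> I"
 proof (rule tendsto_lowerbound[OF I])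
  show "\<forall>\<^sub>F T in at_top. 0 \<le> integral {0..T} (profile lam)"
   using eventually_ge_at_top[of 0] by eventually_elim (rule occupation_nonneg)
 qed simp
 have pl: "(\<lambda>t. p t x y / t powr - r) \<leadsto> \<gamma>" for x y
  using p_lim[of x y] by (simp add: powr_minus_divide)
 have tl: "(\<lambda>t. tilted lam x t / t powr - r) \<leadsto> \<gamma>" for x
  using pl[of x 0] by (simp add: tilted_def lam0)
 have eq: "profile lam t = tilted lam 0 t + \<beta> * integral {0..t} (\<lambda>s. tilted lam 0 s * profile lam (t - s))" if "0 \<le> t" for t
  using tilted_renewal[OF that, of 0 0] by (simp add: tilted_mean_origin tilted_def)
 have v: "(\<lambda>t. profile lam t / t powr - r) \<leadsto> \<gamma> * (1 + \<beta> * I) / (1 - \<beta> * G)"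
  by (rule defective_renewal[OF tilted_continuous tilted_nonneg psi_lim[of 0, unfolded psi_0] prof_continuous prof_nonneg prof_le_1
     prof_antimono I eq beta_pos sub' r_pos tl])
 show ?thesis
 proof (rule local_limits[OF regular_weight_powr v, where ?e0.0=\<gamma>])
  show "0 < \<gamma> * (1 + \<beta> * I) / (1 - \<beta> * G)"
   using gamma_pos I0 beta_pos sub' by (intro divide_pos_pos mult_pos_pos add_pos_nonneg) auto
  show "(\<lambda>t. exp (- lam * t) * p t x y / t powr - r) \<leadsto> \<gamma>" for x y
   using pl[of x y] by (simp add: lam0)
  show "0 \<le> \<gamma>" using gamma_pos by simp
  fix g C x assume g: "continuous_on {0..} g" "\<And>t. 0 \<le> t ==> 0 \<le> g t \<and> g t \<le> C * profile lam t"
  have "integral {0..T} g \<le> \<bar>C\<bar> * (1 / (1 - \<beta> * G) * G)" if T: "0 \<le> T" for T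
  proof -
   have "integral {0..T} g \<le> integral {0..T} (\<lambda>t. \<bar>C\<bar> * profile lam t)"
   proof (rule integral_le)
    show "g integrable_on {0..T}" by (rule half_line_integrable[OF g(1)])
    show "(\<lambda>t. \<bar>C\<bar> * profile lam t) integrable_on {0..T}" by (intro half_line_integrable continuous_intros prof_continuous)
    fix t assume t: "t \<in> {0..T}"
    then show "g t \<le> \<bar>C\<bar> * profile lam t"
     using g(2)[of t] mult_right_mono[OF abs_ge_self prof_nonneg[of t], of C] by auto
   qed
   also have "\<dots> = \<bar>C\<bar> * integral {0..T} (profile lam)" by simp
   also have "\<dots> \<le> \<bar>C\<bar> * (1 / (1 - \<beta> * G) * G)"
    using occupation_bound[OF potential_facts lam0 sub' T, of 0] psi_0 by (intro mult_left_mono) (auto simp: prof_w)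
   finally show ?thesis .
  qed
  then obtain I' where I': "(\<lambda>T. integral {0..T} g) \<leadsto> I'" "\<forall>T\<ge>0. integral {0..T} g \<le> I'"
   using half_line_bounded[of g, OF g(1)] g(2) by blast
  have "0 \<le> I'" using I'(2)[rule_format, of 0] by simp
  moreover have "(\<lambda>t. integral {0..1/2 * t} (\<lambda>s. g s * tilted lam x (t - s)) / t powr - r) \<leadsto> \<gamma> * I'"
   by (rule regular_convolution_limit[OF g(1) _ I'(1) tilted_continuous _ _ tl regular_weight_powr]) (use g(2) in auto)
  ultimately show "\<exists>e\<ge>0. (\<lambda>t. integral {0..1/2 * t} (\<lambda>s. g s * tilted lam x (t - s)) / t powr - r) \<leadsto> e"
   using gamma_pos by (intro exI[of _ "\<gamma> * I'"]) auto
 qed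
qed

text \<open>The total mean is 1 plus \<beta> times the mean occupation of the origin, which stays finite.\<close>

lemma subcritical_total:
 assumes sub': "\<beta> * G < 1"
 shows "\<exists>c>0. (\<lambda>t. act w t (\<lambda>_. 1) x) \<leadsto> c"
proof -
 have W: "act w t (\<lambda>_. 1) x = 1 + \<beta> * integral {0..t} (\<lambda>s. w s x 0)" if t: "0 \<le> t" for t
  using integral_unique[OF integral_from_derivative[OF total_derivative[of _ x] t]] by (simp add: Wk.act_initial)
 have "\<exists>L. (\<lambda>t. integral {0..t} (\<lambda>s. w s x 0)) \<leadsto> L \<and> (\<forall>t\<ge>0. integral {0..t} (\<lambda>s. w s x 0) \<le> L) \<and> L \<le> \<psi> x / (1 - \<beta> * G)"
  by (rule half_line_bounded[OF Wk.kernel_continuous Wk.k_nonneg occupation_bound[OF potential_facts lam0 sub']])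
 then obtain L where L: "(\<lambda>t. integral {0..t} (\<lambda>s. w s x 0)) \<leadsto> L" "\<forall>t\<ge>0. integral {0..t} (\<lambda>s. w s x 0) \<le> L" by blast
 have "0 \<le> L" using L(2)[rule_format, of 0] by simp
 then have "0 < 1 + \<beta> * L" using beta_pos by (intro add_pos_nonneg) auto
 moreover have "(\<lambda>t. act w t (\<lambda>_. 1) x) \<leadsto> 1 + \<beta> * L"
 proof (rule Lim_transform_eventually)
  show "(\<lambda>t. 1 + \<beta> * integral {0..t} (\<lambda>s. w s x 0)) \<leadsto> 1 + \<beta> * L" by (intro tendsto_intros L)
  show "\<forall>\<^sub>F t in at_top. 1 + \<beta> * integral {0..t} (\<lambda>s. w s x 0) = act w t (\<lambda>_. 1) x"
   by (rule eventually_positive) (simp add: W)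
 qed
 ultimately show ?thesis by blast
qed

end

end

section \<open>The walk, the population and the theorem\<close>

lemma pmf_expectation_shift:
 fixes u :: "'a => real"
 assumes "\<And>y. \<bar>u y\<bar> \<le> B"
 shows "pmf_mean q (\<lambda>y. u y + c) = pmf_mean q u + c"
proof -
 have "integrable (measure_pmf q) u"
  by (rule measure_pmf.integrable_const_bound[where B=B]) (use assms in auto)
 then show ?thesis by simp
qed

lemma pmf_expectation_bounded:
 fixes u :: "'a => real"
 assumes "\<And>y. \<bar>u y\<bar> \<le> 1"
 shows "\<bar>pmf_mean q u\<bar> \<le> 1"
proof -
 have i: "integrable (measure_pmf q) u"
  by (rule measure_pmf.integrable_const_bound[where B=1]) (use assms in auto)
 have u: "-1 \<le> u y" "u y \<le> 1" for y using assms[of y] by auto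
 have "pmf_mean q u \<le> 1"
  by (rule measure_pmf.integral_le_const[OF i]) (use u in auto)
 moreover have "-1 \<le> pmf_mean q u"
  by (rule measure_pmf.integral_ge_const[OF i]) (use u in auto)
 ultimately show ?thesis by simp
qed

text \<open>An instance of the backward equation. Its Markov property is an iterated expectation, taken of
 the nonnegative function u + 1.\<close>

lemma (in walk_transition) walk_kernel_semigroup:
 "kernel_semigroup (walk_rate a) mass (\<lambda>t x y. pmf (p t x) y) 0"
proof -
 interpret H: generator "walk_rate a" mass by (rule generator_walk_rate)
 show ?thesis
 proof
  show "pmf (p t x) summable_on UNIV" for t x using pmf_has_sum by (rule has_sum_imp_summable)
  show "(\<Sum>\<^sub>\<infinity>y. pmf (p t x) y) \<le> exp (0 * t)" for t x using infsumI[OF pmf_has_sum[of "p t x"]] by simp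
  show "pmf (p 0 x) y = of_bool (x = y)" for x y by (simp add: initial indicator_def)
  fix u :: "int ^ 'd => real" and t :: real and x
  assume u: "\<And>y. \<bar>u y\<bar> \<le> 1" and t: "0 \<le> t"
  define \<Phi> where "\<Phi> t y = pmf_mean (p t y) u" for t y
  have act: "act (\<lambda>t x y. pmf (p t x) y) s u y = \<Phi> s y" for s y
   using pmf_expectation_infsum[OF u, of "p s y"] by (simp add: act_def \<Phi>_def)
  have bound: "\<bar>\<Phi> s y\<bar> \<le> 1" for s y unfolding \<Phi>_def by (rule pmf_expectation_bounded[OF u])
  have q_nonneg: "0 \<le> walk_rate a x \<xi>" if "\<xi> \<noteq> x" for x \<xi> using that by (intro H.offdiag) auto
  have q_sum: "(walk_rate a x has_sum 0) UNIV" for x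
  proof -
   have "((\<lambda>y. a (y - x)) has_sum 0) UNIV = ((\<lambda>v. a (x + v - x)) has_sum 0) UNIV"
    by (rule has_sum_reindex_bij_betw[OF shift_bij, symmetric])
   then show ?thesis using regular by (simp add: walk_rate_def[abs_def])
  qed
  have rate: "(\<lambda>h. pmf (p h x) \<xi> - (of_bool (\<xi> = x) + walk_rate a x \<xi> * h)) \<in> o[at_right 0](\<lambda>h. h)" for x \<xi>
   using stay[of x] jump[of x \<xi>] by (cases "\<xi> = x") (auto simp: walk_rate_def)
  have markov: "\<Phi> (s + h) x = pmf_mean (p h x) (\<Phi> s)" if "0 \<le> s" "0 \<le> h" for s h x
  proof -
   have u1: "0 \<le> u y + 1" "u y + 1 \<le> 2" for y using u[of y] by (auto simp: abs_le_iff)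
   have "p (s + h) x = bind_pmf (p h x) (p s)" using semigroup[of h s x] that by (simp add: add.commute)
   then have "\<Phi> (s + h) x + 1 = pmf_mean (bind_pmf (p h x) (p s)) (\<lambda>y. u y + 1)"
    by (simp only: \<Phi>_def pmf_expectation_shift[OF u])
   also have "\<dots> = pmf_mean (p h x) (\<lambda>z. pmf_mean (p s z) (\<lambda>y. u y + 1))"
    by (rule expectation_bind_pmf[where B=2]) (use u1 in auto)
   also have "\<dots> = pmf_mean (p h x) (\<lambda>z. \<Phi> s z + 1)"
    by (simp only: \<Phi>_def pmf_expectation_shift[OF u])
   also have "\<dots> = pmf_mean (p h x) (\<Phi> s) + 1" by (rule pmf_expectation_shift[OF bound])
   finally show ?thesis by simp
  qed
  have cont: "continuous_on {0..} (\<lambda>t. \<Phi> t y)" for y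
   by (rule backward_equation(1)[where q="walk_rate a y" and Q="\<lambda>h. p h y"]) (use q_nonneg q_sum rate bound markov in auto)
  have "((\<lambda>t. \<Phi> t x) has_real_derivative (\<Sum>\<^sub>\<infinity>\<xi>. walk_rate a x \<xi> * \<Phi> t \<xi>)) (at t within {0..})"
   by (rule backward_equation(2)[where Q="\<lambda>h. p h x"]) (use q_nonneg q_sum rate bound markov cont t in auto)
  then show "((\<lambda>s. act (\<lambda>t x y. pmf (p t x) y) s u x) has_real_derivative
    walk_gen a (act (\<lambda>t x y. pmf (p t x) y) t u) x) (at t within {0..})"
   by (simp add: act gen_op_def)
 qed auto
qed

context branching_random_walk
begin

text \<open>The Markov property at time 0 gives the point probabilities. They sum to 1 over the countable
 support of P t, which excludes mass outside it.\<close>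

lemma distr_population:
 assumes t: "0 \<le> t"
 shows "distr (M x) (count_space UNIV) (X t) = measure_pmf (P t {#x#})"
proof -
 interpret Mx: prob_space "M x" by (rule prob_space)
 have mt: "X t \<in> M x \<rightarrow>\<^sub>M count_space UNIV" by (rule measurable[OF t])
 have pt: "emeasure (distr (M x) (count_space UNIV) (X t)) {\<zeta>} = emeasure (measure_pmf (P t {#x#})) {\<zeta>}" for \<zeta>
 proof -
  have "space (M x) \<in> sigma_sets (space (M x)) {X r -` B \<inter> space (M x) | r B. 0 \<le> r \<and> r \<le> 0}" by (rule sigma_sets_top)
  from markov[OF order_refl t this, of \<zeta>]
  have "measure (M x) {\<omega> \<in> space (M x). X t \<omega> = \<zeta>} = (LINT \<omega>:space (M x)|M x. pmf (P t (X 0 \<omega>)) \<zeta>)" by simp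
  also have "\<dots> = (LINT \<omega>|M x. pmf (P t {#x#}) \<zeta>)" unfolding set_lebesgue_integral_def
  proof (rule integral_cong_AE)
   have "(\<lambda>\<omega>. pmf (P t (X 0 \<omega>)) \<zeta>) \<in> borel_measurable (M x)"
    by (rule measurable_compose[OF measurable[OF order_refl]]) simp
   then show "(\<lambda>\<omega>. indicator (space (M x)) \<omega> *\<^sub>R pmf (P t (X 0 \<omega>)) \<zeta>) \<in> borel_measurable (M x)" by simp
   show "AE \<omega> in M x. indicator (space (M x)) \<omega> *\<^sub>R pmf (P t (X 0 \<omega>)) \<zeta> = pmf (P t {#x#}) \<zeta>"
    using start[of x] AE_space by eventually_elim simp
  qed simp
  also have "\<dots> = pmf (P t {#x#}) \<zeta>" by (simp add: Mx.prob_space)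
  finally have "measure (M x) (X t -` {\<zeta>} \<inter> space (M x)) = pmf (P t {#x#}) \<zeta>"
   by (simp add: vimage_def Int_def conj_commute)
  then show ?thesis using mt
   by (simp add: emeasure_distr Mx.emeasure_eq_measure emeasure_pmf_single)
 qed
 interpret D: prob_space "distr (M x) (count_space UNIV) (X t)" by (rule Mx.prob_space_distr[OF mt])
 define \<Omega> where "\<Omega> = set_pmf (P t {#x#})"
 have "emeasure (distr (M x) (count_space UNIV) (X t)) \<Omega> = emeasure (measure_pmf (P t {#x#})) \<Omega>"
  by (subst (1 2) emeasure_countable_singleton) (auto simp: \<Omega>_def pt)
 also have "\<dots> = 1" by (simp add: \<Omega>_def emeasure_pmf)
 finally have "D.prob \<Omega> = 1" by (simp add: D.emeasure_eq_measure)
 then have AE: "AE \<xi> in distr (M x) (count_space UNIV) (X t). \<xi> \<in> \<Omega>"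
  by (intro D.AE_prob_1) auto
 show ?thesis
  by (rule measure_eqI_countable_AE[where \<Omega>=\<Omega>]) (use pt AE in \<open>auto simp: \<Omega>_def AE_measure_pmf\<close>)
qed

lemma moment_from_mean_kernel:
 assumes t: "0 \<le> t"
 shows "local_moment M X 1 t x y = exp (- b 0 * t) * mean_kernel t x y"
  and "total_moment M X 1 t x = exp (- b 0 * t) * act mean_kernel t (\<lambda>_. 1) x"
proof -
 have E: "(LINT \<omega>|M x. g (X t \<omega>)) = pmf_mean (P t {#x#}) g" for g :: "(int ^ 'd) multiset => real"
  unfolding distr_population[OF t, symmetric] by (rule integral_distr[symmetric]) (use measurable[OF t] in auto)
 have e: "exp (- b 0 * t) * (exp (b 0 * t) * z) = z" for z :: real by (simp add: exp_minus)
 show "local_moment M X 1 t x y = exp (- b 0 * t) * mean_kernel t x y"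
  unfolding local_moment_def mean_kernel_def e using E[of "\<lambda>\<xi>. real (count \<xi> y)"] by simp
 show "total_moment M X 1 t x = exp (- b 0 * t) * act mean_kernel t (\<lambda>_. 1) x"
  unfolding total_moment_def mean_total[OF t] e using E[of "\<lambda>\<xi>. real (size \<xi>)"] by simp
qed

lemma first_moments_from_limits:
 assumes loc: "\<And>x y. 0 < C x y" "\<And>x y. (\<lambda>t. mean_kernel t x y / \<omega> t) \<leadsto> C x y"
  and tot: "\<And>x. 0 < c x" "\<And>x. (\<lambda>t. act mean_kernel t (\<lambda>_. 1) x / \<Omega> t) \<leadsto> c x"
  and u: "\<And>t. u t = \<omega> t * exp (- b 0 * t)" and v: "\<And>t. v t = \<Omega> t * exp (- b 0 * t)"
 shows "first_moments_asymp M X C c u v"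
 unfolding first_moments_asymp_def
proof (intro conjI allI)
 fix x y
 have "(\<lambda>t. mean_kernel t x y / \<omega> t / C x y) \<leadsto> C x y / C x y"
  by (intro tendsto_divide loc tendsto_const) (use loc(1)[of x y] in auto)
 then have l: "(\<lambda>t. mean_kernel t x y / \<omega> t / C x y) \<leadsto> 1" using loc(1)[of x y] by simp
 show "(\<lambda>t. local_moment M X 1 t x y) \<sim>[at_top] (\<lambda>t. C x y * u t)"
 by (rule asymp_equivI', rule limit_cong_positive[OF l]) (simp add: moment_from_mean_kernel[unfolded One_nat_def] u mult_ac)
next
 fix x
 have "(\<lambda>t. act mean_kernel t (\<lambda>_. 1) x / \<Omega> t / c x) \<leadsto> c x / c x"
  by (intro tendsto_divide tot tendsto_const) (use tot(1)[of x] in auto)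
 then have l: "(\<lambda>t. act mean_kernel t (\<lambda>_. 1) x / \<Omega> t / c x) \<leadsto> 1" using tot(1)[of x] by simp
 show "(\<lambda>t. total_moment M X 1 t x) \<sim>[at_top] (\<lambda>t. c x * v t)"
 by (rule asymp_equivI', rule limit_cong_positive[OF l]) (simp add: moment_from_mean_kernel[unfolded One_nat_def] v mult_ac)
qed

end

text \<open>By l'Hospital's rule, as the total mean has derivative \<beta> w(t,x,0).\<close>

lemma (in walk_and_branching) total_limit:
 assumes lim: "(\<lambda>t. w t x 0 / \<omega> t) \<leadsto> c" and pos: "\<forall>\<^sub>F t in at_top. 0 < \<omega> t"
  and \<Omega>: "\<forall>\<^sub>F t::real in at_top. DERIV \<Omega> t :> \<Omega>' t" "(\<lambda>t. \<Omega>' t / \<omega> t) \<leadsto> k" "0 < k" "filterlim \<Omega> at_top at_top"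
 shows "(\<lambda>t. act w t (\<lambda>_. 1) x / \<Omega> t) \<leadsto> \<beta> * c / k"
proof (rule lhospital_at_top_at_top[where f'="\<lambda>t. \<beta> * w t x 0" and g'=\<Omega>'])
 have "\<forall>\<^sub>F t in at_top. 0 < \<Omega>' t / \<omega> t" by (rule order_tendstoD(1)[OF \<Omega>(2,3)])
 then show nz: "\<forall>\<^sub>F t in at_top. \<Omega>' t \<noteq> 0" by eventually_elim auto
 show "\<forall>\<^sub>F t::real in at_top. DERIV (\<lambda>t. act w t (\<lambda>_. 1) x) t :> \<beta> * w t x 0"
  using eventually_gt_at_top[of 0]
 proof eventually_elim
  case (elim t)
  have "at t within {0..} = at t" by (rule at_within_interior) (use elim in \<open>simp add: interior_real_atLeast\<close>)
  then show ?case using total_derivative[of t x] elim by simp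
 qed
 have "(\<lambda>t. \<beta> * (w t x 0 / \<omega> t) / (\<Omega>' t / \<omega> t)) \<leadsto> \<beta> * c / k"
  using \<Omega>(3) by (intro tendsto_divide tendsto_mult tendsto_const lim \<Omega>(2)) simp
 then show "(\<lambda>t. \<beta> * w t x 0 / \<Omega>' t) \<leadsto> \<beta> * c / k"
  by (rule Lim_transform_eventually) (use pos in eventually_elim, simp)
qed (use \<Omega> in auto)

lemma exponential_rate_unique:
 fixes f :: "real => real"
 assumes "(\<lambda>t. exp (- l * t) * f t) \<leadsto> A" "0 < A"
  and "(\<lambda>t. exp (- m * t) * f t) \<leadsto> B" "0 < B"
 shows "l = m"
proof -
 have not_less: False
  if "(\<lambda>t. exp (- l * t) * f t) \<leadsto> A" "0 < A" "(\<lambda>t. exp (- m * t) * f t) \<leadsto> B" "l < m"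
   "0 < B" for l m A B
 proof -
  have "(\<lambda>t. exp (- (m - l) * t)) \<leadsto> 0" using that(4) by real_asymp
  from tendsto_mult[OF this that(1)]
  have "(\<lambda>t. exp (- (m - l) * t) * (exp (- l * t) * f t)) \<leadsto> 0" by simp
  moreover have "exp (- (m - l) * t) * (exp (- l * t) * f t) = exp (- m * t) * f t" for t
   by (simp add: mult.assoc[symmetric] exp_add[symmetric] algebra_simps)
  ultimately have "(\<lambda>t. exp (- m * t) * f t) \<leadsto> 0" by (simp only:)
  then have "B = 0" using tendsto_unique[OF _ that(3)] by simp
  then show False using that(5) by simp
 qed
 show ?thesis using not_less[OF assms(1,2,3) _ assms(4)] not_less[OF assms(3,4,1) _ assms(2)] by (cases l m rule: linorder_cases) auto
qed

locale heavy_tailed_branching = W: walk_transition a p + B: branching_random_walk a b P M X + HT: heavy_tailed_walk a \<alpha> H\<^sub>0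
 for a :: "int ^ 'd => real" and p :: "real => int ^ 'd => (int ^ 'd) pmf" and b :: "nat => real"
  and P :: "real => (int ^ 'd) multiset => (int ^ 'd) multiset pmf"
  and M :: "int ^ 'd => 'w measure" and X :: "real => 'w => (int ^ 'd) multiset" and \<alpha> H\<^sub>0 :: real +
 fixes r :: real
 assumes beta_star_pos: "0 < beta_star b" and r: "r = real CARD('d) / \<alpha>"
begin

sublocale WB: walk_and_branching a "\<lambda>t x y. pmf (p t x) y" "beta_star b" "B.mean_kernel"
 by (intro walk_and_branching.intro walk_and_branching_axioms.intro W.walk_intensity_axioms
   W.walk_kernel_semigroup B.mean_kernel_semigroup beta_star_pos)

abbreviation occupation :: "real => real" where "occupation T \<equiv> integral {0..T} (WB.tilted 0 0)"

abbreviation potential_at :: "real => real => (int ^ 'd => real) => bool" where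
 "potential_at lam G \<equiv> branching_potential a (\<lambda>t x y. pmf (p t x) y) (beta_star b) B.mean_kernel lam G r HT.stable_density"

lemma potential_exists:
 assumes lam: "0 \<le> lam" and G: "(\<lambda>T. integral {0..T} (WB.tilted lam 0)) \<leadsto> G" and sub: "beta_star b * G \<le> 1"
 shows "\<exists>\<psi>. potential_at lam G \<psi>"
proof -
 obtain \<psi> where \<psi>: "\<And>x. (\<lambda>T. integral {0..T} (WB.tilted lam x)) \<leadsto> \<psi> x"
  "\<And>x. 0 \<le> \<psi> x" "\<And>x. \<psi> x \<le> G" "\<psi> 0 = G" "0 < G"
  "\<And>x. walk_gen a \<psi> x = lam * \<psi> x - of_bool (x = 0)"
  by (rule WB.potential[OF lam G], rule that) blast+
 have "potential_at lam G \<psi>"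
 proof unfold_locales
  show "0 < r" using HT.alpha by (simp add: r)
  show "0 < HT.stable_density" by (rule HT.stable_density_pos)
  show "(\<lambda>t. pmf (p t x) y * t powr r) \<leadsto> HT.stable_density" for x y
  by (rule limit_cong_positive[OF HT.heat_asymptotics[of "x - y", folded r]]) (simp add: WB.p_heat)
 qed (use lam sub \<psi> in auto)
 then show ?thesis by blast
qed

lemma green_eq: "green p 0 0 0 = (\<integral>\<^sup>+ t\<in>{0..}. ennreal (WB.tilted 0 0 t) \<partial>lborel)"
 by (simp add: green_def WB.tilted_def)

lemma beta_crit_finite:
 assumes "(\<lambda>T. occupation T) \<leadsto> G" "0 < G"
 shows "beta_crit p = 1 / G"
 using half_line_nn_integral(1)[OF WB.tilted_continuous WB.tilted_nonneg assms(1)] assms(2)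
 by (simp add: beta_crit_def green_eq)

text \<open>Covers the recurrent case too, where the critical value is 0.\<close>

lemma beta_crit_less:
 assumes T: "0 \<le> T" and sup: "1 < beta_star b * occupation T"
 shows "beta_crit p < beta_star b"
proof (cases "green p 0 0 0 = \<infinity>")
 case True
 then show ?thesis using beta_star_pos by (simp add: beta_crit_def)
next
 case False
 define G where "G = enn2real (green p 0 0 0)"
 have eq: "(\<integral>\<^sup>+ t\<in>{0..}. ennreal (WB.tilted 0 0 t) \<partial>lborel) = ennreal G"
  using False by (simp add: G_def green_eq[symmetric] top.not_eq_extremum)
 have G0: "0 \<le> G" by (simp add: G_def)
 have lim: "(\<lambda>T. occupation T) \<leadsto> G"
  by (rule half_line_finite[OF WB.tilted_continuous WB.tilted_nonneg eq G0])
 have "occupation T \<le> G"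
 proof (rule tendsto_lowerbound[OF lim])
  show "\<forall>\<^sub>F U in at_top. occupation T \<le> occupation U"
   using eventually_ge_at_top[of T]
   by eventually_elim (use T half_line_mono[OF WB.tilted_continuous WB.tilted_nonneg] in auto)
 qed simp
 then have "1 < beta_star b * G" using sup beta_star_pos mult_left_mono[of "occupation T" G "beta_star b"] by linarith
 moreover have "0 < G"
 proof (rule ccontr)
  assume "\<not> 0 < G"
  then have "beta_star b * G \<le> 0" using beta_star_pos by (simp add: mult_nonneg_nonpos)
  then show False using \<open>1 < beta_star b * G\<close> by simp
 qed
 ultimately have "1 / G < beta_star b" by (simp add: pos_divide_less_eq)
 then show ?thesis using beta_crit_finite[OF lim \<open>0 < G\<close>] by simp
qed

text \<open>Phrased with finite time horizons, so that a recurrent walk falls under the first case.\<close>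

lemma occupation_dichotomy:
 obtains (super) T where "0 \<le> T" "1 < beta_star b * occupation T"
 | (sub) G where "(\<lambda>T. occupation T) \<leadsto> G" "beta_star b * G \<le> 1" "0 < G" "beta_crit p = 1 / G"
proof (cases "\<exists>T\<ge>0. 1 < beta_star b * occupation T")
 case True
 then show ?thesis using super by blast
next
 case False
 then have "occupation T \<le> 1 / beta_star b" if "0 \<le> T" for T
  using that beta_star_pos by (force simp: pos_le_divide_eq mult.commute)
 then obtain G where G: "(\<lambda>T. occupation T) \<leadsto> G" "G \<le> 1 / beta_star b"
  using half_line_bounded[OF WB.tilted_continuous WB.tilted_nonneg] by blast
 have le: "beta_star b * G \<le> 1" using G(2) beta_star_pos by (simp add: pos_le_divide_eq mult.commute)
 obtain \<psi> where "potential_at 0 G \<psi>"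
  using potential_exists[OF order_refl G(1) le] by blast
 then have "0 < G" by (rule branching_potential.G_pos)
 then show ?thesis using sub[OF G(1) le] beta_crit_finite[OF G(1)] by blast
qed

lemma branch_op_eq: "(\<lambda>\<phi> x. walk_op a \<phi> x + beta_star b * delta_op \<phi> x) = WB.branch_op"
 by (intro ext) (simp add: WB.branch_op_def)

lemma supercritical_kernel:
 assumes lam: "0 < lam" and G: "(\<lambda>T. integral {0..T} (WB.tilted lam 0)) \<leadsto> G" and crit: "beta_star b * G = 1"
 shows "\<exists>C. \<forall>x y. 0 < C x y \<and> (\<lambda>t. exp (- lam * t) * B.mean_kernel t x y) \<leadsto> C x y"
proof -
 obtain \<psi> where "potential_at lam G \<psi>"
  using potential_exists[OF less_imp_le[OF lam] G] crit by auto
 then interpret BP: branching_potential a "\<lambda>t x y. pmf (p t x) y" "beta_star b" B.mean_kernel lam G r HT.stable_density \<psi> .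
 show ?thesis using BP.supercritical_limits[OF lam crit] unfolding BP.tilted_mean_def[abs_def] .
qed

text \<open>Every positive eigenvalue is the exponential growth rate of the same function w(t,0,0), so
 there is only one.\<close>

lemma lambda_zero_eq:
 assumes lam: "0 < lam" and G: "(\<lambda>T. integral {0..T} (WB.tilted lam 0)) \<leadsto> G" and crit: "beta_star b * G = 1"
 shows "lambda_zero a b = lam"
 unfolding lambda_zero_def branch_op_eq
proof (rule the_equality)
 show "0 < lam \<and> is_l2_eigenvalue WB.branch_op lam" using lam WB.eigenvalue_if_critical[OF lam G crit] by blast
 fix m assume m: "0 < m \<and> is_l2_eigenvalue WB.branch_op m"
 obtain G' where G': "(\<lambda>T. integral {0..T} (WB.tilted m 0)) \<leadsto> G'" using WB.tilted_converges m by blast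
 have crit': "beta_star b * G' = 1" using WB.critical_if_eigenvalue[OF _ G'] m by blast
 obtain C C' where C: "0 < C (0::int^'d) (0::int^'d)" "(\<lambda>t. exp (- lam * t) * B.mean_kernel t 0 0) \<leadsto> C 0 0"
  and C': "0 < C' (0::int^'d) (0::int^'d)" "(\<lambda>t. exp (- m * t) * B.mean_kernel t 0 0) \<leadsto> C' 0 0"
  using supercritical_kernel[OF lam G crit] supercritical_kernel[OF _ G' crit'] m by blast
 show "m = lam" using exponential_rate_unique[OF C'(2,1) C(2,1)] .
qed

lemma supercritical_moments:
 assumes T: "0 \<le> T" and sup: "1 < beta_star b * occupation T"
 shows "\<exists>C c. (\<forall>x y. 0 < C x y) \<and> (\<forall>x. 0 < c x) \<and>
  first_moments_asymp M X C c (\<lambda>t. exp (lambda_E a b * t)) (\<lambda>t. exp (lambda_E a b * t))"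
proof -
 obtain lam G where lam: "0 < lam" and G: "(\<lambda>T. integral {0..T} (WB.tilted lam 0)) \<leadsto> G" and crit: "beta_star b * G = 1"
  using WB.critical_exists[OF T sup] by blast
 have lE: "lambda_E a b = lam - b 0" using lambda_zero_eq[OF lam G crit] by (simp add: lambda_E_def)
 obtain C where C: "\<And>x y. 0 < C x y" "\<And>x y. (\<lambda>t. exp (- lam * t) * B.mean_kernel t x y) \<leadsto> C x y"
  using supercritical_kernel[OF lam G crit] by blast
 have C': "(\<lambda>t. B.mean_kernel t x y / exp (lam * t)) \<leadsto> C x y" for x y
  using C(2)[of x y] by (simp add: exp_minus field_simps)
 have W: "(\<lambda>t. act B.mean_kernel t (\<lambda>_. 1) x / exp (lam * t)) \<leadsto> beta_star b * C x 0 / lam" for x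
 proof (rule WB.total_limit[OF C'])
  show "\<forall>\<^sub>F t::real in at_top. DERIV (\<lambda>t. exp (lam * t)) t :> lam * exp (lam * t)"
   by (rule always_eventually) (auto intro!: derivative_eq_intros)
  show "filterlim (\<lambda>t. exp (lam * t)) at_top at_top" using lam by real_asymp
 qed (use lam in auto)
 have "first_moments_asymp M X C (\<lambda>x. beta_star b * C x 0 / lam) (\<lambda>t. exp (lambda_E a b * t)) (\<lambda>t. exp (lambda_E a b * t))"
  by (rule B.first_moments_from_limits[OF C(1) C' _ W])
   (use C lam beta_star_pos in \<open>auto simp: lE exp_add[symmetric] algebra_simps\<close>)
 then show ?thesis using C(1) lam beta_star_pos by (intro exI[of _ C] exI[of _ "\<lambda>x. beta_star b * C x 0 / lam"]) auto
qed

lemma critical_moments: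
 assumes G: "(\<lambda>T. occupation T) \<leadsto> G" and crit: "beta_star b * G = 1"
 shows "\<exists>C c. (\<forall>x y. 0 < C x y) \<and> (\<forall>x. 0 < c x) \<and>
   (1 < r \<and> r < 2 \<longrightarrow> first_moments_asymp M X C c (\<lambda>t. t powr (r - 2) * exp (- b 0 * t)) (\<lambda>t. t powr (r - 1) * exp (- b 0 * t))) \<and>
   (r = 2 \<longrightarrow> first_moments_asymp M X C c (\<lambda>t. inverse (ln t) * exp (- b 0 * t)) (\<lambda>t. t * inverse (ln t) * exp (- b 0 * t))) \<and>
   (r > 2 \<longrightarrow> first_moments_asymp M X C c (\<lambda>t. exp (- b 0 * t)) (\<lambda>t. t * exp (- b 0 * t)))"
proof -
 obtain \<psi> where "potential_at 0 G \<psi>"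
  using potential_exists[OF order_refl G] crit by auto
 then interpret BP: branching_potential a "\<lambda>t x y. pmf (p t x) y" "beta_star b" B.mean_kernel 0 G r HT.stable_density \<psi> .
 have tm: "BP.tilted_mean x y t = B.mean_kernel t x y" for x y t by (simp add: BP.tilted_mean_def)
 consider "r \<le> 1" | "1 < r" "r < 2" | "r = 2" | "2 < r" by linarith
 then show ?thesis
 proof cases
  (* no assertion concerns this range, so any positive functions do *)
  case 1
  then show ?thesis by (intro exI[of _ "\<lambda>x y. 1"] exI[of _ "\<lambda>x. 1"]) auto
 next
  case 2
  obtain C where C: "\<And>x y. 0 < C x y" "\<And>x y. (\<lambda>t. B.mean_kernel t x y / t powr (r - 2)) \<leadsto> C x y"
   using BP.critical_limits_low[OF refl crit 2] unfolding tm by blast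
  have W: "(\<lambda>t. act B.mean_kernel t (\<lambda>_. 1) x / t powr (r - 1)) \<leadsto> beta_star b * C x 0 / (r - 1)" for x
  proof (rule WB.total_limit[OF C(2)])
   show "\<forall>\<^sub>F t::real in at_top. 0 < t powr (r - 2)" using eventually_gt_at_top[of 0] by eventually_elim simp
   show "\<forall>\<^sub>F t::real in at_top. DERIV (\<lambda>t. t powr (r - 1)) t :> (r - 1) * t powr (r - 2)"
    using eventually_gt_at_top[of 0]
   proof eventually_elim
    case (elim t)
    show ?case using has_real_derivative_powr[OF elim, of "r - 1"] by (simp add: diff_diff_eq)
   qed
   show "(\<lambda>t. (r - 1) * t powr (r - 2) / t powr (r - 2)) \<leadsto> r - 1"
    by (rule Lim_transform_eventually[OF tendsto_const]) (use eventually_gt_at_top[of 0] in eventually_elim, simp)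
   show "filterlim (\<lambda>t. t powr (r - 1)) at_top at_top" using 2 by real_asymp
  qed (use 2 in auto)
  have "first_moments_asymp M X C (\<lambda>x. beta_star b * C x 0 / (r - 1)) (\<lambda>t. t powr (r - 2) * exp (- b 0 * t)) (\<lambda>t. t powr (r - 1) * exp (- b 0 * t))"
   by (rule B.first_moments_from_limits[OF C _ W]) (use C 2 beta_star_pos in auto)
  then show ?thesis using C(1) 2 beta_star_pos
   by (intro exI[of _ C] exI[of _ "\<lambda>x. beta_star b * C x 0 / (r - 1)"]) auto
 next
  case 3
  obtain C where C: "\<And>x y. 0 < C x y" "\<And>x y. (\<lambda>t. B.mean_kernel t x y / inverse (ln t)) \<leadsto> C x y"
   using BP.critical_limits_log[OF refl crit 3] unfolding tm by blast
  have W: "(\<lambda>t. act B.mean_kernel t (\<lambda>_. 1) x / (t * inverse (ln t))) \<leadsto> beta_star b * C x 0 / 1" for x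
  proof (rule WB.total_limit[OF C(2)])
   show "\<forall>\<^sub>F t::real in at_top. 0 < inverse (ln t)" using eventually_gt_at_top[of 1] by eventually_elim simp
   show "\<forall>\<^sub>F t::real in at_top. DERIV (\<lambda>t. t * inverse (ln t)) t :> inverse (ln t) - inverse (ln t ^ 2)"
    using eventually_gt_at_top[of 1]
    by eventually_elim (auto intro!: derivative_eq_intros simp: power2_eq_square field_simps)
   show "(\<lambda>t::real. (inverse (ln t) - inverse (ln t ^ 2)) / inverse (ln t)) \<leadsto> 1" by real_asymp
   show "filterlim (\<lambda>t::real. t * inverse (ln t)) at_top at_top" by real_asymp
  qed auto
  have "first_moments_asymp M X C (\<lambda>x. beta_star b * C x 0 / 1) (\<lambda>t. inverse (ln t) * exp (- b 0 * t)) (\<lambda>t. t * inverse (ln t) * exp (- b 0 * t))"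
   by (rule B.first_moments_from_limits[OF C _ W]) (use C beta_star_pos in auto)
  then show ?thesis using C(1) 3 beta_star_pos
   by (intro exI[of _ C] exI[of _ "\<lambda>x. beta_star b * C x 0 / 1"]) auto
 next
  case 4
  obtain C where C: "\<And>x y. 0 < C x y" "\<And>x y. (\<lambda>t. B.mean_kernel t x y / 1) \<leadsto> C x y"
   using BP.critical_limits_high[OF refl crit 4] unfolding tm by blast
  have W: "(\<lambda>t. act B.mean_kernel t (\<lambda>_. 1) x / t) \<leadsto> beta_star b * C x 0 / 1" for x
  proof (rule WB.total_limit[OF C(2), where \<Omega>'="\<lambda>_. 1"])
   show "filterlim (\<lambda>t::real. t) at_top at_top" by (rule filterlim_ident)
  qed (auto intro!: always_eventually)
  have "first_moments_asymp M X C (\<lambda>x. beta_star b * C x 0 / 1) (\<lambda>t. exp (- b 0 * t)) (\<lambda>t. t * exp (- b 0 * t))"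
   by (rule B.first_moments_from_limits[OF C _ W]) (use C beta_star_pos in auto)
  then show ?thesis using C(1) 4 beta_star_pos
   by (intro exI[of _ C] exI[of _ "\<lambda>x. beta_star b * C x 0 / 1"]) auto
 qed
qed

lemma subcritical_moments:
 assumes G: "(\<lambda>T. occupation T) \<leadsto> G" and sub: "beta_star b * G < 1" and r1: "1 < r"
 shows "\<exists>C c. (\<forall>x y. 0 < C x y) \<and> (\<forall>x. 0 < c x) \<and>
  first_moments_asymp M X C c (\<lambda>t. t powr (- r) * exp (- b 0 * t)) (\<lambda>t. exp (- b 0 * t))"
proof -
 obtain \<psi> where "potential_at 0 G \<psi>"
  using potential_exists[OF order_refl G] sub by auto
 then interpret BP: branching_potential a "\<lambda>t x y. pmf (p t x) y" "beta_star b" B.mean_kernel 0 G r HT.stable_density \<psi> .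
 have tm: "BP.tilted_mean x y t = B.mean_kernel t x y" for x y t by (simp add: BP.tilted_mean_def)
 obtain C where C: "\<And>x y. 0 < C x y" "\<And>x y. (\<lambda>t. B.mean_kernel t x y / t powr - r) \<leadsto> C x y"
  using BP.subcritical_limits[OF refl sub r1] unfolding tm by blast
 have "\<forall>x. \<exists>c. 0 < c \<and> (\<lambda>t. act B.mean_kernel t (\<lambda>_. 1) x / 1) \<leadsto> c"
  using BP.subcritical_total[OF refl sub] by simp
 then obtain c where c: "\<And>x. 0 < c x" "\<And>x. (\<lambda>t. act B.mean_kernel t (\<lambda>_. 1) x / 1) \<leadsto> c x" by metis
 have "first_moments_asymp M X C c (\<lambda>t. t powr (- r) * exp (- b 0 * t)) (\<lambda>t. exp (- b 0 * t))"
  by (rule B.first_moments_from_limits[OF C c]) auto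
 then show ?thesis using C(1) c(1) by blast
qed

end

theorem theorem4p2:
  fixes a :: "int ^ 'd \<Rightarrow> real" and b :: "nat \<Rightarrow> real"
    and p :: "real \<Rightarrow> int ^ 'd \<Rightarrow> (int ^ 'd) pmf"
    and P :: "real \<Rightarrow> (int ^ 'd) multiset \<Rightarrow> (int ^ 'd) multiset pmf"
    and M :: "int ^ 'd \<Rightarrow> 'w measure" and X :: "real \<Rightarrow> 'w \<Rightarrow> (int ^ 'd) multiset"
    and \<alpha> H\<^sub>0 r :: real
  assumes walk: "walk_transition a p"
    and brw: "branching_random_walk a b P M X"
    and beta_pos: "beta_star b > 0"
    and alpha: "0 < \<alpha>" "\<alpha> < 2"
    and H: "H\<^sub>0 > 0"
    and heavy_tail: "a \<sim>[at_lattice_infinity]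
      (\<lambda>z. H\<^sub>0 / lattice_norm z powr (real CARD('d) + \<alpha>))"
    and r: "r = real CARD('d) / \<alpha>"
  shows "\<exists>C c. (\<forall>x y. C x y > 0) \<and> (\<forall>x. c x > 0) \<and>
    (beta_star b > beta_crit p \<longrightarrow>
      first_moments_asymp M X C c (\<lambda>t. exp (lambda_E a b * t)) (\<lambda>t. exp (lambda_E a b * t))) \<and>
    (beta_star b = beta_crit p \<longrightarrow>
      (1 < r \<and> r < 2 \<longrightarrow>
        first_moments_asymp M X C c (\<lambda>t. t powr (r - 2) * exp (- b 0 * t))
          (\<lambda>t. t powr (r - 1) * exp (- b 0 * t))) \<and>
      (r = 2 \<longrightarrow>
        first_moments_asymp M X C c (\<lambda>t. inverse (ln t) * exp (- b 0 * t))
          (\<lambda>t. t * inverse (ln t) * exp (- b 0 * t))) \<and>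
      (r > 2 \<longrightarrow>
        first_moments_asymp M X C c (\<lambda>t. exp (- b 0 * t)) (\<lambda>t. t * exp (- b 0 * t)))) \<and>
    (beta_star b < beta_crit p \<and> r > 1 \<longrightarrow>
      first_moments_asymp M X C c (\<lambda>t. t powr (- r) * exp (- b 0 * t)) (\<lambda>t. exp (- b 0 * t)))"
proof -
  interpret W: walk_transition a p by (rule walk)
  interpret heavy_tailed_branching a p b P M X \<alpha> H\<^sub>0 r
    by (intro heavy_tailed_branching.intro heavy_tailed_branching_axioms.intro heavy_tailed_walk.intro
        heavy_tailed_walk_axioms.intro walk brw beta_pos alpha H heavy_tail r W.walk_intensity_axioms)
  show ?thesis
  proof (rule occupation_dichotomy)
    fix T :: real assume T: "0 \<le> T" "1 < beta_star b * occupation T"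
    have "beta_crit p < beta_star b" by (rule beta_crit_less[OF T])
    then have not: "\<not> beta_star b < beta_crit p" "beta_star b \<noteq> beta_crit p" by auto
    show ?thesis using supercritical_moments[OF T] not by simp
  next
    fix G assume G: "(\<lambda>T. occupation T) \<leadsto> G" "beta_star b * G \<le> 1" "0 < G" "beta_crit p = 1 / G"
    show ?thesis
    proof (cases "beta_star b * G = 1")
      case True
      have "beta_star b = beta_crit p" unfolding G(4) using True G(3) by (simp add: field_simps)
      then show ?thesis using critical_moments[OF G(1) True] by simp
    next
      case False
      then have sub: "beta_star b * G < 1" using G(2) by simp
      have "beta_star b < beta_crit p" using sub G(3,4) by (simp add: pos_less_divide_eq)
      then have not: "\<not> beta_crit p < beta_star b" "beta_star b \<noteq> beta_crit p" by auto
      show ?thesis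
      proof (cases "1 < r")
        case True
        then show ?thesis using subcritical_moments[OF G(1) sub True] not by simp
      next
        case False
        (* for r \<le> 1 nothing is asserted below the critical value *)
        then show ?thesis using not by (intro exI[of _ "\<lambda>x y. 1"] exI[of _ "\<lambda>x. 1"]) auto
      qed
    qed
  qed
qed

end
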